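(* Let $A$ and $f$ satisfy the standing assumptions listed in the context. Assume in addition that for every $x\in\mathbb{R}^n$ the function $s\mapsto f(x,s)/s$ is decreasing in $s>0$; that there is a constant $M>0$ with $f(x,s)\le 0$ for all $x\in\mathbb{R}^n$ and $s\ge M$; that $\mu_1>0$; and that $\bar\mu_1<0$. Let $c\ge c^*$, let $w(x,x_1+ct)$ be a spatially periodic traveling wavefront with speed $c$, and let $\lambda\in[\lambda_1(c),\lambda_2(c)]$. Then there is $\bar\varepsilon_0>0$ such that the following holds for every $\bar\varepsilon\in(0,\bar\varepsilon_0)$ and every $\xi_0\in\mathbb{R}$ with $|w(x,\xi)-p(x)|<\bar\varepsilon$ for all $\xi\ge\xi_0$ and $x\in\mathbb{R}^n$. Let $W$ be the weight function $$W(\xi)=e^{-\lambda(\xi-\xi_0)}\ \ (\xi\le\xi_0),\qquad W(\xi)=1\ \ (\xi>\xi_0).$$ Let $u_0:\mathbb{R}^n\to\mathbb{R}$ have at most finitely many points of discontinuity and satisfy $0\le u_0(x)\le p(x)$ for all $x\in\mathbb{R}^n$ and $$W(x_1)\,\bigl(u_0(x)-w(x,x_1)\bigr)\in L^1(\mathbb{R}^n),$$ and let $u(t,x)$ be the solution of $u_t-\nabla\cdot(A(x)\nabla u)=f(x,u)$ with $u(0,x)=u_0(x)$. Then: (1) If $c>c^*$ and $\lambda\in(\lambda_1(c),\lambda_2(c))$, the wavefront is exponentially stable: there are constants $C>0$ and $\mu_3>0$ such that for all $t\ge0$ $$\sup_{x\in\mathbb{R}^n}|u(t,x)-w(x,x_1+ct)|\le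 Ce^{-\mu_3t}.$$ (2) If $c=c^*$, or if $c>c^*$ and $\lambda=\lambda_1(c)$, the wavefront is algebraically stable: there is a constant $C>0$ such that for all $t\ge0$ $$\sup_{x\in\mathbb{R}^n}|u(t,x)-w(x,x_1+ct)|\le C(1+t)^{-\frac n2}.$$
   Context: Setting. $n\ge1$, $x=(x_1,\dots,x_n)\in\mathbb{R}^n$, $\mathbf e_i$ is the $i$-th standard basis vector, $\mathbf e=\mathbf e_1=(1,0,\dots,0)$, and $L_1,\dots,L_n>0$ are fixed. A function $h$ of $x$ is called $L$-periodic if $h(x+L_i\mathbf e_i)=h(x)$ for all $x$ and $1\le i\le n$. The equation is $$u_t-\nabla\cdot(A(x)\nabla u)=f(x,u),\qquad x\in\mathbb{R}^n.\qquad( * )$$ Standing assumptions. $A(x)=(a_{i,j}(x))$ is a bounded symmetric matrix field, $L$-periodic in $x$, of class $C^{1,\alpha}(\mathbb{R}^n)$ for some $\alpha\in(0,1)$, and uniformly elliptic: $\sum_{i,j}a_{i,j}(x)\xi_i\xi_j\ge\alpha_0|\xi|^2$ for all $x,\xi\in\mathbb{R}^n$, with some $\alpha_0>0$. The function $f(x,u)$ is $L$-periodic in $x$, continuous, of class $C^{0,\alpha}$ in $x$ locally uniformly in $u\in\mathbb{R}$; the derivative $f_u=\partial f/\partial u$ exists and is continuous in $u\in\mathbb{R}$ uniformly for $x\in\mathbb{R}^n$; and $f(x,0)=0$ for all $x$. Eigenvalues. A principal eigenvalue (among $L$-periodic functions) is the one having a positive $L$-periodic eigenfunction. $\mu_1$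 is the principal eigenvalue of $\phi\mapsto\nabla\cdot(A(x)\nabla\phi)+f_u(x,0)\phi$, i.e. $\nabla\cdot(A\nabla\phi)+f_u(x,0)\phi=\mu_1\phi$. When $\mu_1>0$ and $f$ satisfies the conditions of the statement, it is known that there is a unique positive $L$-periodic steady state $p(x)$ of class $C^{2,\alpha}$, i.e. $\nabla\cdot(A\nabla p)+f(x,p)=0$. $\bar\mu_1$ is the principal eigenvalue of $\phi\mapsto\nabla\cdot(A(x)\nabla\phi)+f_u(x,p(x))\phi$. For $c\in\mathbb{R}$ and $\lambda\in\mathbb{R}$, $\mu_c(\lambda)$ is the principal eigenvalue of the operator $-L_{c,\lambda}$ on $L$-periodic functions, i.e. $-L_{c,\lambda}\psi=\mu_c(\lambda)\psi$ with $\psi>0$ $L$-periodic, where $$-L_{c,\lambda}\psi=-\nabla\cdot(A\nabla\psi)-2\lambda\,\mathbf e\cdot(A\nabla\psi)-\bigl[\lambda\nabla\cdot(A\mathbf e)+\lambda^2\,\mathbf e\cdot(A\mathbf e)-\lambda c+f_u(x,0)\bigr]\psi .$$ The minimal speed is $c^*=\min\{c:\ \exists\,\lambda>0\text{ such that }\mu_c(\lambda)=0\}$. It is known that for $c>c^*$ there are $0<\lambda_1(c)<\lambda_2(c)$ with $\mu_c(\lambda_1(c))=\mu_c(\lambda_2(c))=0$ and $\mu_c(\lambda)>0$ for $\lambda\in(\lambda_1(c),\lambda_2(c))$; for $c=c^*$ one has $\mu_{c^*}(\lambda)\le0$, with $\mu_{c^*}(\lambda^* )=0$ for $\lambda^*=\lambda_1(c^*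 )=\lambda_2(c^* )$. Traveling wavefront. A (spatially periodic) traveling wavefront with speed $c$ is a nonnegative function $w(x,\xi)$, $(x,\xi)\in\mathbb{R}^n\times\mathbb{R}$, $L$-periodic in $x$, such that $u(t,x)=w(x,x_1+ct)$ solves $( * )$ and $\lim_{\xi\to-\infty}w(x,\xi)=0$, $\lim_{\xi\to\infty}w(x,\xi)=p(x)$ uniformly in $x\in\mathbb{R}^n$. Solutions of the initial value problem for $( * )$ are understood as bounded solutions. *)

theory Defs
  imports "HOL-Analysis.Analysis"
begin

subsection \<open>Differential calculus on \<open>real ^ 'n\<close>\<close>

definition pd :: "'n::finite \<Rightarrow> (real ^ 'n \<Rightarrow> real) \<Rightarrow> real ^ 'n \<Rightarrow> real" where
  "pd i h x = deriv (\<lambda>s. h (x + s *\<^sub>R axis i 1)) 0"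

definition grad :: "(real ^ 'n::finite \<Rightarrow> real) \<Rightarrow> real ^ 'n \<Rightarrow> real ^ 'n" where
  "grad h x = (\<chi> i. pd i h x)"

definition div_field :: "(real ^ 'n::finite \<Rightarrow> real ^ 'n) \<Rightarrow> real ^ 'n \<Rightarrow> real" where
  "div_field F x = (\<Sum>i\<in>UNIV. pd i (\<lambda>y. F y $ i) x)"

definition C1 :: "(real ^ 'n::finite \<Rightarrow> real) \<Rightarrow> bool" where
  "C1 h \<longleftrightarrow> (\<forall>i x. (\<lambda>s. h (x + s *\<^sub>R axis i 1)) field_differentiable (at 0)) \<and>
            (\<forall>i. continuous_on UNIV (pd i h))"

definition C2 :: "(real ^ 'n::finite \<Rightarrow> real) \<Rightarrow> bool" where
  "C2 h \<longleftrightarrow> C1 h \<and> (\<forall>i. C1 (pd i h))"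

definition holder :: "real \<Rightarrow> (real ^ 'n::finite \<Rightarrow> real) \<Rightarrow> bool" where
  "holder \<alpha> g \<longleftrightarrow> (\<exists>K. \<forall>x y. \<bar>g x - g y\<bar> \<le> K * dist x y powr \<alpha>)"

definition C1_holder :: "real \<Rightarrow> (real ^ 'n::finite \<Rightarrow> real) \<Rightarrow> bool" where
  "C1_holder \<alpha> h \<longleftrightarrow> C1 h \<and> (\<forall>i. holder \<alpha> (pd i h))"

definition C2_holder :: "real \<Rightarrow> (real ^ 'n::finite \<Rightarrow> real) \<Rightarrow> bool" where
  "C2_holder \<alpha> h \<longleftrightarrow> C2 h \<and> (\<forall>i j. holder \<alpha> (pd i (pd j h)))"

definition periodic :: "real ^ 'n::finite \<Rightarrow> (real ^ 'n \<Rightarrow> 'b) \<Rightarrow> bool" where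
  "periodic L h \<longleftrightarrow> (\<forall>x i. h (x + (L $ i) *\<^sub>R axis i 1) = h x)"


subsection \<open>Standing assumptions on the coefficients\<close>

definition admissible_diffusion ::
    "real ^ 'n::finite \<Rightarrow> real \<Rightarrow> (real ^ 'n \<Rightarrow> real ^ 'n ^ 'n) \<Rightarrow> bool" where
  "admissible_diffusion L \<alpha> A \<longleftrightarrow>
     bounded (range A) \<and>
     (\<forall>x. transpose (A x) = A x) \<and>
     periodic L A \<and>
     (\<forall>i j. C1_holder \<alpha> (\<lambda>x. A x $ i $ j)) \<and>
     (\<exists>\<alpha>0>0. \<forall>x \<xi>. \<xi> \<bullet> (A x *v \<xi>) \<ge> \<alpha>0 * (norm \<xi>)\<^sup>2)"

definition f_u :: "(real ^ 'n::finite \<Rightarrow> real \<Rightarrow> real) \<Rightarrow> real ^ 'n \<Rightarrow> real \<Rightarrow> real" where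
  "f_u f x s = deriv (f x) s"

definition admissible_reaction ::
    "real ^ 'n::finite \<Rightarrow> real \<Rightarrow> (real ^ 'n \<Rightarrow> real \<Rightarrow> real) \<Rightarrow> bool" where
  "admissible_reaction L \<alpha> f \<longleftrightarrow>
     (\<forall>s. periodic L (\<lambda>x. f x s)) \<and>
     continuous_on UNIV (\<lambda>(x, s). f x s) \<and>
     (\<forall>R. \<exists>K. \<forall>s. \<bar>s\<bar> \<le> R \<longrightarrow> (\<forall>x y. \<bar>f x s - f y s\<bar> \<le> K * dist x y powr \<alpha>)) \<and>
     (\<forall>x s. f x field_differentiable (at s)) \<and>
     (\<forall>s. \<forall>\<epsilon>>0. \<exists>\<delta>>0. \<forall>r. \<bar>r - s\<bar> < \<delta> \<longrightarrow> (\<forall>x. \<bar>f_u f x r - f_u f x s\<bar> < \<epsilon>)) \<and>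
     (\<forall>x. f x 0 = 0)"


subsection \<open>Principal eigenvalues\<close>

text \<open>
  The standing assumptions make \<open>x \<mapsto> f_u f x 0\<close> continuous but not necessarily Hoelder
  continuous, so eigenfunctions are in general of class \<open>W\<^sup>2\<^sup>,\<^sup>p\<close> for all finite \<open>p\<close> (hence
  \<open>C\<^sup>1\<close>) but need not be \<open>C\<^sup>2\<close>. In the eigenvalue equation, the divergence of the
  continuous field \<open>A \<nabla>\<phi>\<close> is therefore the distributional one, which is the classical
  divergence whenever the field is \<open>C\<^sup>1\<close>.
\<close>

definition has_weak_divergence ::
    "(real ^ 'n::finite \<Rightarrow> real ^ 'n) \<Rightarrow> (real ^ 'n \<Rightarrow> real) \<Rightarrow> bool" where
  "has_weak_divergence F g \<longleftrightarrow>
     continuous_on UNIV F \<and> continuous_on UNIV g \<and>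
     (\<forall>\<eta>. C1 \<eta> \<and> (\<exists>R. \<forall>x. norm x > R \<longrightarrow> \<eta> x = 0) \<longrightarrow>
        (LINT x|lborel. F x \<bullet> grad \<eta> x) = - (LINT x|lborel. g x * \<eta> x))"

text \<open>\<open>m\<close> is the principal eigenvalue, among \<open>L\<close>-periodic functions, of the operator
  \<open>\<phi> \<mapsto> \<nabla>\<cdot>(A \<nabla>\<phi>) + N \<phi>\<close> with lower-order part \<open>N\<close>.\<close>

definition principal_eigenvalue ::
    "real ^ 'n::finite \<Rightarrow> (real ^ 'n \<Rightarrow> real ^ 'n ^ 'n) \<Rightarrow>
     ((real ^ 'n \<Rightarrow> real) \<Rightarrow> real ^ 'n \<Rightarrow> real) \<Rightarrow> real \<Rightarrow> bool" where
  "principal_eigenvalue L A N m \<longleftrightarrow>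
     (\<exists>\<phi>. C1 \<phi> \<and> periodic L \<phi> \<and> (\<forall>x. 0 < \<phi> x) \<and>
          has_weak_divergence (\<lambda>x. A x *v grad \<phi> x) (\<lambda>x. m * \<phi> x - N \<phi> x))"

text \<open>Lower-order part of
  \<open>L\<^sub>c\<^sub>,\<^sub>\<lambda> = \<nabla>\<cdot>(A \<nabla>\<psi>) + 2\<lambda> e\<cdot>(A \<nabla>\<psi>) + [\<lambda> \<nabla>\<cdot>(A e) + \<lambda>\<^sup>2 e\<cdot>(A e) - \<lambda>c + f_u(x,0)] \<psi>\<close>,
  where \<open>e\<close> is the unit vector of the coordinate \<open>k\<close>, the direction of propagation.\<close>

definition speed_lower_order ::
    "'n::finite \<Rightarrow> (real ^ 'n \<Rightarrow> real ^ 'n ^ 'n) \<Rightarrow> (real ^ 'n \<Rightarrow> real \<Rightarrow> real) \<Rightarrow>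
     real \<Rightarrow> real \<Rightarrow> (real ^ 'n \<Rightarrow> real) \<Rightarrow> real ^ 'n \<Rightarrow> real" where
  "speed_lower_order k A f c lam \<psi> x =
     2 * lam * (axis k 1 \<bullet> (A x *v grad \<psi> x)) +
     (lam * div_field (\<lambda>y. A y *v axis k 1) x + lam\<^sup>2 * (axis k 1 \<bullet> (A x *v axis k 1))
        - lam * c + f_u f x 0) * \<psi> x"

text \<open>\<open>\<mu>\<^sub>c(\<lambda>) = m\<close>; it is an eigenvalue of \<open>- L\<^sub>c\<^sub>,\<^sub>\<lambda>\<close>, hence the sign.\<close>

definition mu_speed ::
    "real ^ 'n::finite \<Rightarrow> 'n \<Rightarrow> (real ^ 'n \<Rightarrow> real ^ 'n ^ 'n) \<Rightarrow>
     (real ^ 'n \<Rightarrow> real \<Rightarrow> real) \<Rightarrow> real \<Rightarrow> real \<Rightarrow> real \<Rightarrow> bool" where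
  "mu_speed L k A f c lam m \<longleftrightarrow>
     principal_eigenvalue L A (speed_lower_order k A f c lam) (- m)"

definition minimal_speed ::
    "real ^ 'n::finite \<Rightarrow> 'n \<Rightarrow> (real ^ 'n \<Rightarrow> real ^ 'n ^ 'n) \<Rightarrow>
     (real ^ 'n \<Rightarrow> real \<Rightarrow> real) \<Rightarrow> real \<Rightarrow> bool" where
  "minimal_speed L k A f cs \<longleftrightarrow>
     (\<exists>lam>0. mu_speed L k A f cs lam 0) \<and>
     (\<forall>c. (\<exists>lam>0. mu_speed L k A f c lam 0) \<longrightarrow> cs \<le> c)"

text \<open>\<open>l1 = \<lambda>\<^sub>1(c)\<close> and \<open>l2 = \<lambda>\<^sub>2(c)\<close> for a speed \<open>c \<ge> cs\<close>; the two zeros coincide exactly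
  at the minimal speed \<open>cs\<close>.\<close>

definition decay_rates ::
    "real ^ 'n::finite \<Rightarrow> 'n \<Rightarrow> (real ^ 'n \<Rightarrow> real ^ 'n ^ 'n) \<Rightarrow>
     (real ^ 'n \<Rightarrow> real \<Rightarrow> real) \<Rightarrow> real \<Rightarrow> real \<Rightarrow> real \<Rightarrow> real \<Rightarrow> bool" where
  "decay_rates L k A f cs c l1 l2 \<longleftrightarrow>
     0 < l1 \<and> mu_speed L k A f c l1 0 \<and> mu_speed L k A f c l2 0 \<and>
     (c > cs \<longrightarrow> l1 < l2 \<and> (\<forall>lam\<in>{l1<..<l2}. \<exists>m>0. mu_speed L k A f c lam m)) \<and>
     (c = cs \<longrightarrow> l1 = l2)"


subsection \<open>Solutions, steady states and wavefronts\<close>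

definition steady_state ::
    "(real ^ 'n::finite \<Rightarrow> real ^ 'n ^ 'n) \<Rightarrow> (real ^ 'n \<Rightarrow> real \<Rightarrow> real) \<Rightarrow>
     (real ^ 'n \<Rightarrow> real) \<Rightarrow> bool" where
  "steady_state A f p \<longleftrightarrow>
     C2 p \<and> (\<forall>x. div_field (\<lambda>y. A y *v grad p y) x + f x (p x) = 0)"

definition classical_solution ::
    "(real ^ 'n::finite \<Rightarrow> real ^ 'n ^ 'n) \<Rightarrow> (real ^ 'n \<Rightarrow> real \<Rightarrow> real) \<Rightarrow>
     real set \<Rightarrow> (real \<Rightarrow> real ^ 'n \<Rightarrow> real) \<Rightarrow> bool" where
  "classical_solution A f T u \<longleftrightarrow>
     (\<forall>t\<in>T. \<forall>x. (\<lambda>s. u s x) field_differentiable (at t)) \<and>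
     (\<forall>t\<in>T. C2 (u t)) \<and>
     continuous_on (T \<times> UNIV) (\<lambda>(t, x). u t x) \<and>
     continuous_on (T \<times> UNIV) (\<lambda>(t, x). deriv (\<lambda>s. u s x) t) \<and>
     (\<forall>i. continuous_on (T \<times> UNIV) (\<lambda>(t, x). pd i (u t) x)) \<and>
     (\<forall>i j. continuous_on (T \<times> UNIV) (\<lambda>(t, x). pd i (pd j (u t)) x)) \<and>
     (\<forall>t\<in>T. \<forall>x. deriv (\<lambda>s. u s x) t - div_field (\<lambda>y. A y *v grad (u t) y) x = f x (u t x))"

text \<open>The bounded solution with initial value \<open>u0\<close>. As \<open>u0\<close> may be discontinuous, the initial
  value is attained continuously at the points of continuity of \<open>u0\<close>.\<close>

definition solves_ivp ::
    "(real ^ 'n::finite \<Rightarrow> real ^ 'n ^ 'n) \<Rightarrow> (real ^ 'n \<Rightarrow> real \<Rightarrow> real) \<Rightarrow>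
     (real ^ 'n \<Rightarrow> real) \<Rightarrow> (real \<Rightarrow> real ^ 'n \<Rightarrow> real) \<Rightarrow> bool" where
  "solves_ivp A f u0 u \<longleftrightarrow>
     classical_solution A f {0<..} u \<and>
     (\<exists>B. \<forall>t\<ge>0. \<forall>x. \<bar>u t x\<bar> \<le> B) \<and>
     (\<forall>x. u 0 x = u0 x) \<and>
     (\<forall>x. isCont u0 x \<longrightarrow> continuous (at (0, x) within {0..} \<times> UNIV) (\<lambda>(t, y). u t y))"

definition wavefront ::
    "real ^ 'n::finite \<Rightarrow> 'n \<Rightarrow> (real ^ 'n \<Rightarrow> real ^ 'n ^ 'n) \<Rightarrow>
     (real ^ 'n \<Rightarrow> real \<Rightarrow> real) \<Rightarrow> (real ^ 'n \<Rightarrow> real) \<Rightarrow> real \<Rightarrow>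
     (real ^ 'n \<Rightarrow> real \<Rightarrow> real) \<Rightarrow> bool" where
  "wavefront L k A f p c w \<longleftrightarrow>
     (\<forall>x \<xi>. 0 \<le> w x \<xi>) \<and>
     (\<forall>\<xi>. periodic L (\<lambda>x. w x \<xi>)) \<and>
     classical_solution A f UNIV (\<lambda>t x. w x (x $ k + c * t)) \<and>
     uniform_limit UNIV (\<lambda>\<xi> x. w x \<xi>) (\<lambda>x. 0) at_bot \<and>
     uniform_limit UNIV (\<lambda>\<xi> x. w x \<xi>) p at_top"

definition weight :: "real \<Rightarrow> real \<Rightarrow> real \<Rightarrow> real" where
  "weight lam \<xi>0 \<xi> = (if \<xi> \<le> \<xi>0 then exp (- lam * (\<xi> - \<xi>0)) else 1)"

end

theory Submission
 imports Defs
begin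

text \<open>
  All comparison arguments reduce to one estimate: a subsolution of
  \<open>v\<^sub>t \<le> \<nabla>\<cdot>(A\<nabla>v) + a v\<close> divided by a positive supersolution \<open>\<Phi>\<close> solves a
  drift-diffusion inequality whose operator has an invariant functional comparable with
  Lebesgue measure (Hahn-Banach and explicit radial barriers). Nash's inequality, iterated over
  the powers \<open>2\<^sup>k\<close>, then bounds \<open>v\<close> by \<open>t\<^sup>-\<^sup>n\<^sup>/\<^sup>2 \<Phi>\<close> times the weighted
  \<open>L\<^sup>1\<close> norm of the initial value. With \<open>\<Phi> = e\<^sup>\<lambda>\<^sup>x\<psi>\<close> this controls \<open>u - w\<close> in
  \<open>{\<xi> \<le> const}\<close>; with \<open>\<Phi> = p\<close>, cut off at a level of \<open>\<xi>\<close>, it shows that \<open>u\<close> is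
  eventually close to \<open>p\<close> to the right of that level, where \<open>\<mu>bar1 < 0\<close> yields a barrier
  that decays at the same rate. Eigenfunctions, which are only weak solutions, are mollified.
\<close>

subsection \<open>Gradients and divergences\<close>

text \<open>The drift 2 A grad(Phi) / Phi left by the division is not divergence free, so Lebesgue
  measure is not invariant and an energy estimate would pick up a term growing in time; in the
  algebraic case no growth can be afforded. Testing with a functional that annihilates the operator
  removes the drift, and Nash's inequality then asks only that it be comparable with Lebesgue
  measure. Hence a functional without a density is enough, and the barriers, modelled on the
  fundamental solution with frozen coefficients, give the comparison.

  The two eigenvalue conditions act at opposite ends of the front. As f(x,s)/s decreases, f(x,b) -
  f(x,a) <= f_u(x,0) (b - a) for 0 <= a <= b, so u - w and w - u, where positive, are subsolutions
  of the linearization at 0 in all of space. To the right the exponential weight makes the resulting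
  bound useless; there the linearization at p takes over, but only once u is known to be close to p,
  and this closeness is proved with no smallness of the initial difference.\<close>

lemma grad_nth [simp]: "grad h x $ i = pd i h x"
 by (simp add: grad_def)

lemma C1_line_deriv:
 assumes "C1 h"
 shows "((%s. h (y + s *\<^sub>R axis i 1)) has_real_derivative pd i h (y + s0 *\<^sub>R axis i 1)) (at s0)"
proof -
 have "((%s. h ((y + s0 *\<^sub>R axis i 1) + s *\<^sub>R axis i 1)) has_real_derivative pd i h (y + s0 *\<^sub>R axis i 1)) (at 0)"
  using assms by (simp add: C1_def pd_def field_differentiable_derivI)
 then have "((%s. h (y + (s + s0) *\<^sub>R axis i 1)) has_real_derivative pd i h (y + s0 *\<^sub>R axis i 1)) (at 0)"
  by (simp add: algebra_simps)
 then show ?thesis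
  using DERIV_shift[of "%s. h (y + s *\<^sub>R axis i 1)" _ 0 s0] by simp
qed

text \<open>The definition of \<open>C1\<close> speaks of partial derivatives only. Changing the
  coordinates one at a time, the mean value estimate bounds each change by the oscillation of one
  partial derivative, which gives a total derivative and with it the chain rule.\<close>

lemma C1_GDERIV:
 fixes h :: "real ^ 'n::finite => real"
 assumes h: "C1 h"
 shows "GDERIV h x :> grad h x"
proof -
 \<comment> \<open>\<open>part S d\<close> moves only the coordinates in \<open>S\<close>, so that
   induction on \<open>S\<close> passes from \<open>x\<close> to \<open>x + d\<close> one coordinate
   at a time.\<close>
 define part where "part S d = (\<chi> i. if i \<in> S then d $ i else 0)" for S and d :: "real ^ 'n"
 have main: "\<exists>dt>0. ALL d. norm d < dt --> \<bar>h (x + d) - h x - inner d (grad h x)\<bar> <= e * norm d"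
  if e: "e > 0" for e
 proof -
  \<comment> \<open>The sum of the \<open>\<bar>d $ i\<bar>\<close> is at most
    \<open>CARD('n)\<close> times \<open>norm d\<close>.\<close>
  define e' where "e' = e / real CARD('n)"
  have e': "e' > 0" using e by (simp add: e'_def)
  have "ALL i. \<exists>dt>0. ALL y. dist y x < dt --> \<bar>pd i h y - pd i h x\<bar> < e'"
   using h e' unfolding C1_def continuous_on_iff by (metis UNIV_I dist_real_def)
  then obtain dl where dl: "!!i. dl i > 0" "!!i y. dist y x < dl i ==> \<bar>pd i h y - pd i h x\<bar> < e'"
   by metis
  define dt where "dt = Min (range dl)"
  have dt: "dt > 0" "!!i. dt <= dl i" using dl(1) by (auto simp: dt_def)
  have step: "\<bar>h (x + part S d) - h x - (\<Sum>i\<in>S. d $ i * pd i h x)\<bar> <= (\<Sum>i\<in>S. \<bar>d $ i\<bar>) * e'"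
   if "finite S" "norm d < dt" for S d
   using that
  proof (induction S rule: finite_induct)
   case empty
   then show ?case by (simp add: part_def zero_vec_def[symmetric])
  next
   case (insert j S)
   define y where "y = x + part S d"
   have eq: "x + part (insert j S) d = y + d $ j *\<^sub>R axis j 1"
   using insert.hyps by (auto simp: y_def part_def vec_eq_iff axis_def)
   have bnd: "\<bar>(h (y + d $ j *\<^sub>R axis j 1) - d $ j * pd j h x) - (h (y + 0 *\<^sub>R axis j 1) - 0 * pd j h x)\<bar> <= e' * \<bar>d $ j - 0\<bar>"
   proof (rule field_differentiable_bound[where S="closed_segment 0 (d $ j)" and f="%s. h (y + s *\<^sub>R axis j 1) - s * pd j h x", unfolded real_norm_def])
   fix s assume s: "s \<in> closed_segment 0 (d $ j)"
   show "((%s. h (y + s *\<^sub>R axis j 1) - s * pd j h x) has_field_derivative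
   pd j h (y + s *\<^sub>R axis j 1) - pd j h x) (at s within closed_segment 0 (d $ j))"
   by (rule has_field_derivative_at_within) (auto intro!: derivative_eq_intros C1_line_deriv[OF h])
   have "\<bar>s\<bar> <= \<bar>d $ j\<bar>" using s by (auto simp: closed_segment_eq_real_ivl split: if_splits)
   then have "norm (part S d + s *\<^sub>R axis j 1) <= norm d"
   using insert.hyps by (intro norm_le_componentwise_cart) (auto simp: part_def axis_def)
   then have "dist (y + s *\<^sub>R axis j 1) x < dl j"
   using insert.prems dt(2)[of j] by (simp add: dist_norm y_def add.assoc)
   then show "\<bar>pd j h (y + s *\<^sub>R axis j 1) - pd j h x\<bar> <= e'"
   using dl(2)[of _ j] by fastforce
   qed auto
   have "h (x + part (insert j S) d) - h x - (\<Sum>i\<in>insert j S. d $ i * pd i h x)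
   = (h y - h x - (\<Sum>i\<in>S. d $ i * pd i h x)) + (h (y + d $ j *\<^sub>R axis j 1) - d $ j * pd j h x - h y)"
   using insert.hyps by (simp add: eq)
   also have "\<bar>...\<bar> <= (\<Sum>i\<in>S. \<bar>d $ i\<bar>) * e' + e' * \<bar>d $ j\<bar>"
   using insert.IH insert.prems bnd unfolding y_def
   by (smt (verit) add_0_right diff_0_right mult_zero_left scaleR_zero_left)
   finally show ?case using insert.hyps by (simp add: algebra_simps)
  qed
  have "\<bar>h (x + d) - h x - inner d (grad h x)\<bar> <= e * norm d" if "norm d < dt" for d
  proof -
   have "part UNIV d = d" by (simp add: part_def vec_eq_iff)
   then have "\<bar>h (x + d) - h x - inner d (grad h x)\<bar> <= (\<Sum>i\<in>UNIV. \<bar>d $ i\<bar>) * e'"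
   using step[of UNIV d] that by (simp add: inner_vec_def)
   also have "... <= (real CARD('n) * norm d) * e'"
   using e' by (intro mult_right_mono sum_bounded_above[where K="norm d", simplified] component_le_norm_cart) auto
   also have "... = e * norm d" by (simp add: e'_def)
   finally show ?thesis .
  qed
  with dt(1) show ?thesis by blast
 qed
 show ?thesis
  unfolding gderiv_def has_derivative_at_alt
 proof (intro conjI allI impI)
  show "bounded_linear (%d. inner d (grad h x))" by (rule bounded_linear_inner_left)
  fix e :: real assume "e > 0"
  from main[OF this] obtain dt where d: "dt > 0"
   "!!d. norm d < dt ==> \<bar>h (x + d) - h x - inner d (grad h x)\<bar> <= e * norm d" by blast
  show "\<exists>dt>0. ALL y. norm (y - x) < dt --> norm (h y - h x - inner (y - x) (grad h x)) <= e * norm (y - x)"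
  proof (intro exI[of _ dt] conjI allI impI d(1))
   fix y assume "norm (y - x) < dt"
   from d(2)[OF this] show "norm (h y - h x - inner (y - x) (grad h x)) <= e * norm (y - x)"
   by (simp only: add_diff_cancel_left' add_diff_cancel real_norm_def) (simp add: algebra_simps)
  qed
 qed
qed

lemma GDERIV_pd:
 assumes "GDERIV h x :> D"
 shows "((%s. h (x + s *\<^sub>R axis i 1)) has_real_derivative D $ i) (at 0)" "pd i h x = D $ i"
proof -
 have "((%s. h (x + s *\<^sub>R axis i 1)) has_derivative (%s. inner (s *\<^sub>R axis i 1) D)) (at 0)"
 proof (rule has_derivative_compose[of "%s. x + s *\<^sub>R axis i 1" "%s. s *\<^sub>R axis i 1" 0 UNIV h "%v. inner v D"])
  show "((%s. x + s *\<^sub>R axis i 1) has_derivative (%s. s *\<^sub>R axis i 1)) (at 0)"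
   by (auto intro!: derivative_eq_intros)
  show "(h has_derivative (%v. inner v D)) (at (x + 0 *\<^sub>R axis i 1))"
   using assms by (simp add: gderiv_def)
 qed
 then show *: "((%s. h (x + s *\<^sub>R axis i 1)) has_real_derivative D $ i) (at 0)"
  by (simp add: has_field_derivative_def inner_axis' mult_commute_abs)
 show "pd i h x = D $ i" unfolding pd_def by (rule DERIV_imp_deriv[OF *])
qed

lemma GDERIV_grad: "GDERIV h x :> D ==> grad h x = D"
 by (simp add: vec_eq_iff GDERIV_pd(2))

lemma C1_iff: "C1 h \<longleftrightarrow> (ALL x. GDERIV h x :> grad h x) & continuous_on UNIV (grad h)"
proof
 assume "C1 h"
 then show "(ALL x. GDERIV h x :> grad h x) & continuous_on UNIV (grad h)"
  using C1_GDERIV by (auto simp: C1_def grad_def[abs_def] intro!: continuous_on_vec_lambda)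
next
 assume *: "(ALL x. GDERIV h x :> grad h x) & continuous_on UNIV (grad h)"
 then have "continuous_on UNIV (%x. grad h x $ i)" for i
  by (intro continuous_on_component) auto
 then show "C1 h" using * unfolding C1_def
  by (auto intro: GDERIV_pd(1) simp: field_differentiable_def)
qed

lemma C1I:
 assumes "!!x. GDERIV h x :> F x" "continuous_on UNIV F"
 shows "C1 h"
 using assms GDERIV_grad[OF assms(1)] unfolding C1_iff
 by (metis (no_types, lifting) ext)

lemma C1_grad_cont: "C1 h ==> continuous_on S (grad h)"
 by (meson C1_iff continuous_on_subset subset_UNIV)

lemma C1_pd_cont: "C1 h ==> continuous_on S (pd i h)"
 by (meson C1_def continuous_on_subset subset_UNIV)

lemma C1_cont: "C1 h ==> continuous_on S h"
 using C1_GDERIV unfolding gderiv_def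
 by (metis continuous_at_imp_continuous_on has_derivative_continuous)

lemma C1_const [simp]: "C1 (%x. c)"
 by (rule C1I[OF GDERIV_const]) (rule continuous_on_const)

lemma GDERIV_nth: "GDERIV (%x. x $ k) x :> axis k 1"
 unfolding gderiv_def
 by (rule has_derivative_eq_rhs, rule bounded_linear_imp_has_derivative[OF bounded_linear_vec_nth])
   (simp add: inner_axis)

lemma C1_nth [simp]: "C1 (%x. x $ k)"
 by (rule C1I[OF GDERIV_nth]) simp

lemma grad_component: "grad (%x. x $ k) x = axis k 1"
 by (rule GDERIV_grad[OF GDERIV_nth])

lemma C1_add: "C1 g ==> C1 h ==> C1 (%x. g x + h x)"
 by (rule C1I[OF GDERIV_add]) (auto intro!: C1_GDERIV continuous_intros C1_grad_cont)
lemma grad_add: "C1 g ==> C1 h ==> grad (%x. g x + h x) x = grad g x + grad h x"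
 by (rule GDERIV_grad[OF GDERIV_add]) (auto intro!: C1_GDERIV)
lemma C1_diff: "C1 g ==> C1 h ==> C1 (%x. g x - h x)"
 by (rule C1I[OF GDERIV_diff]) (auto intro!: C1_GDERIV continuous_intros C1_grad_cont)
lemma grad_diff: "C1 g ==> C1 h ==> grad (%x. g x - h x) x = grad g x - grad h x"
 by (rule GDERIV_grad[OF GDERIV_diff]) (auto intro!: C1_GDERIV)
lemma C1_mult: "C1 g ==> C1 h ==> C1 (%x. g x * h x)"
 by (rule C1I[OF GDERIV_mult]) (auto intro!: C1_GDERIV continuous_intros C1_grad_cont C1_cont)
lemma grad_mult: "C1 g ==> C1 h ==> grad (%x. g x * h x) x = g x *\<^sub>R grad h x + h x *\<^sub>R grad g x"
 by (rule GDERIV_grad[OF GDERIV_mult]) (auto intro!: C1_GDERIV)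
lemma C1_cmult: "C1 h ==> C1 (%x. c * h x)"
 by (intro C1_mult) auto
lemma grad_const [simp]: "grad (%x. c) x = 0"
 by (rule GDERIV_grad[OF GDERIV_const])
lemma pd_const [simp]: "pd i (%x. c) x = 0"
 using grad_const[of c x] by (metis grad_nth zero_index)
lemma grad_cmult: "C1 h ==> grad (%x. c * h x) x = c *\<^sub>R grad h x"
 by (simp add: grad_mult)
lemma C1_sum: "(!!i. i \<in> S ==> C1 (h i)) ==> C1 (%x. \<Sum>i\<in>S. h i x)"
 by (induction S rule: infinite_finite_induct) (auto intro: C1_add)
lemma grad_sum: "(!!i. i \<in> S ==> C1 (h i)) ==> grad (%x. \<Sum>i\<in>S. h i x) x = (\<Sum>i\<in>S. grad (h i) x)"
 by (induction S rule: infinite_finite_induct) (auto simp: grad_add C1_sum)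

lemma C1_compose:
 assumes "C1 h" "!!x. (F has_real_derivative F' (h x)) (at (h x))" "continuous_on UNIV (%x. F' (h x))"
 shows "C1 (%x. F (h x))"
 by (rule C1I[OF GDERIV_DERIV_compose[OF C1_GDERIV[OF assms(1)] assms(2)]])
   (auto intro!: continuous_intros C1_grad_cont assms)
lemma grad_compose:
 assumes "C1 h" "(F has_real_derivative F' (h x)) (at (h x))"
 shows "grad (%x. F (h x)) x = F' (h x) *\<^sub>R grad h x"
 by (rule GDERIV_grad[OF GDERIV_DERIV_compose[OF C1_GDERIV[OF assms(1)] assms(2)]])

lemma C1_translate: "C1 h ==> C1 (%x. h (x + a))" and pd_translate: "pd i (%x. h (x + a)) x = pd i h (x + a)"
proof -
 have eq: "(%s. h (y + s *\<^sub>R axis i 1 + a)) = (%s. h (y + a + s *\<^sub>R axis i 1))" for y i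
  by (simp add: algebra_simps)
 show *: "pd i (%x. h (x + a)) x = pd i h (x + a)" for i x by (simp add: pd_def eq)
 assume "C1 h"
 moreover have "continuous_on UNIV (%x. pd i h (x + a))" if "continuous_on UNIV (pd i h)" for i
  by (rule continuous_on_compose2[OF that]) (auto intro!: continuous_intros)
 ultimately show "C1 (%x. h (x + a))" unfolding C1_def * [abs_def] eq by auto
qed

lemma C2_C1: "C2 h ==> C1 h" by (simp add: C2_def)
lemma C2_pd: "C2 h ==> C1 (pd i h)" by (simp add: C2_def)
lemma C2_cont: "C2 h ==> continuous_on S h" by (simp add: C2_def C1_cont)
lemma C2I: "C1 h ==> (!!x. grad h x = F x) ==> (!!i. C1 (%x. F x $ i)) ==> C2 h"
 unfolding C2_def by (metis (no_types, lifting) ext grad_nth)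

lemma C2_const [simp]: "C2 (%x. c)" by (rule C2I[where F="%_. 0"]) auto
lemma C2_nth [simp]: "C2 (%x. x $ k)" by (rule C2I[OF _ grad_component]) auto
lemma C2_add: "C2 g ==> C2 h ==> C2 (%x. g x + h x)"
 by (rule C2I[OF _ grad_add]) (auto intro: C1_add simp: C2_def)
lemma C2_diff: "C2 g ==> C2 h ==> C2 (%x. g x - h x)"
 by (rule C2I[OF _ grad_diff]) (auto intro: C1_diff simp: C2_def)
lemma C2_mult: "C2 g ==> C2 h ==> C2 (%x. g x * h x)"
 by (rule C2I[OF _ grad_mult]) (auto intro!: C1_mult C1_add simp: C2_def)
lemma C2_cmult: "C2 h ==> C2 (%x. c * h x)" by (intro C2_mult) auto
lemma C2_sum: "(!!i. i \<in> S ==> C2 (h i)) ==> C2 (%x. \<Sum>i\<in>S. h i x)"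
 by (induction S rule: infinite_finite_induct) (auto intro: C2_add)
lemma C2_compose:
 assumes "C2 h" "!!x. (F has_real_derivative F' (h x)) (at (h x))"
  "!!x. (F' has_real_derivative F'' (h x)) (at (h x))" "continuous_on UNIV (%x. F'' (h x))"
 shows "C2 (%x. F (h x))"
proof (rule C2I)
 have 1: "C1 (%x. F' (h x))" by (rule C1_compose[where F'=F'']) (use assms C2_C1 in auto)
 show "C1 (%x. F (h x))"
  by (rule C1_compose[where F'=F']) (use assms C2_C1 C1_cont[OF 1] in auto)
 show "grad (%x. F (h x)) x = F' (h x) *\<^sub>R grad h x" for x
  by (rule grad_compose) (use assms C2_C1 in auto)
 show "C1 (%x. (F' (h x) *\<^sub>R grad h x) $ i)" for i
  using assms 1 by (auto intro!: C1_mult simp: C2_def)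
qed
lemma C2_translate: "C2 h ==> C2 (%x. h (x + a))"
proof -
 have "pd i (%x. h (x + a)) = (%x. pd i h (x + a))" for i by (auto simp: pd_translate)
 then show "C2 h ==> C2 (%x. h (x + a))" by (auto simp: C2_def C1_translate)
qed

lemma div_field_scale:
 assumes "C1 g" "!!i. C1 (%x. F x $ i)"
 shows "div_field (%x. g x *\<^sub>R F x) x = g x * div_field F x + inner (grad g x) (F x)"
proof -
 have "pd i (%y. g y * F y $ i) x = g x * pd i (%y. F y $ i) x + pd i g x * F x $ i" for i
  using arg_cong[OF grad_mult[OF assms(1) assms(2)[of i], of x], of "%v. v $ i"] by simp
 then show ?thesis by (simp add: div_field_def inner_vec_def sum.distrib sum_distrib_left)
qed

lemma div_field_add:
 assumes "!!i. C1 (%x. F x $ i)" "!!i. C1 (%x. G x $ i)"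
 shows "div_field (%x. F x + G x) x = div_field F x + div_field G x"
proof -
 have "pd i (%y. F y $ i + G y $ i) x = pd i (%y. F y $ i) x + pd i (%y. G y $ i) x" for i
  using arg_cong[OF grad_add[OF assms(1)[of i] assms(2)[of i], of x], of "%v. v $ i"] by simp
 then show ?thesis by (simp add: div_field_def sum.distrib)
qed

section \<open>The divergence-form operator \<open>D\<close>\<close>

locale diffusion_field =
 fixes A :: "real ^ 'n::finite => real ^ 'n ^ 'n"
 assumes A_C1: "C1 (%x. A x $ i $ j)" and A_sym: "transpose (A x) = A x"
begin

definition D :: "(real ^ 'n => real) => real ^ 'n => real" where
 "D h x = div_field (%y. A y *v grad h y) x"

lemma A_swap: "A x $ i $ j = A x $ j $ i"
 using A_sym[of x] by (metis transpose_def vec_lambda_beta)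

lemma A_inner_sym: "inner u (A x *v v) = inner v (A x *v u)"
 by (metis A_sym dot_lmul_matrix inner_commute transpose_matrix_vector)

lemma A_field_C1: assumes "!!i. C1 (%x. F x $ i)" shows "C1 (%x. (A x *v F x) $ i)"
 unfolding matrix_vector_mult_def by (auto intro!: C1_sum C1_mult A_C1 assms)

lemma flux_C1: "C2 h ==> C1 (%x. (A x *v grad h x) $ i)"
 by (rule A_field_C1) (simp add: C2_def)

lemma D_add: assumes "C2 g" "C2 h" shows "D (%x. g x + h x) x = D g x + D h x"
proof -
 have "(%y. A y *v grad (%x. g x + h x) y) = (%y. A y *v grad g y + A y *v grad h y)"
  using assms by (auto simp: grad_add C2_C1 matrix_vector_right_distrib)
 then show ?thesis unfolding D_def by (simp add: div_field_add flux_C1 assms)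
qed

lemma D_compose:
 assumes "C2 h" "!!x. (F has_real_derivative F' (h x)) (at (h x))"
  "!!x. (F' has_real_derivative F'' (h x)) (at (h x))" "continuous_on UNIV (%x. F'' (h x))"
 shows "D (%x. F (h x)) x = F' (h x) * D h x + F'' (h x) * inner (grad h x) (A x *v grad h x)"
proof -
 have 1: "C1 (%x. F' (h x))" by (rule C1_compose[where F'=F'']) (use assms C2_C1 in auto)
 have "(%y. A y *v grad (%x. F (h x)) y) = (%y. F' (h y) *\<^sub>R (A y *v grad h y))"
  using assms by (auto simp: grad_compose[where F'=F'] C2_C1 matrix_vector_mult_scaleR)
 moreover have "grad (%x. F' (h x)) x = F'' (h x) *\<^sub>R grad h x"
  by (rule grad_compose) (use assms C2_C1 in auto)
 ultimately show ?thesis unfolding D_def by (simp add: div_field_scale 1 flux_C1 assms)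
qed

lemma D_mult:
 assumes "C2 g" "C2 h"
 shows "D (%x. g x * h x) x = g x * D h x + h x * D g x + 2 * inner (grad g x) (A x *v grad h x)"
proof -
 have "(%y. A y *v grad (%x. g x * h x) y) = (%y. g y *\<^sub>R (A y *v grad h y) + h y *\<^sub>R (A y *v grad g y))"
  using assms by (auto simp: grad_mult C2_C1 matrix_vector_right_distrib matrix_vector_mult_scaleR)
 then show ?thesis unfolding D_def
  using assms flux_C1 A_inner_sym[of "grad h x" x "grad g x"]
  by (simp add: div_field_add div_field_scale C1_mult C2_C1)
qed

lemma D_const [simp]: "D (%x. c) x = 0"
 by (simp add: D_def div_field_def)

lemma D_cmult: "C2 h ==> D (%x. c * h x) x = c * D h x"
 by (simp add: D_mult)

lemma D_diff: assumes "C2 g" "C2 h" shows "D (%x. g x - h x) x = D g x - D h x"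
 using D_add[OF assms(1) C2_cmult[OF assms(2), of "-1"]] D_cmult[OF assms(2), of "-1"] by simp

lemma D_sum: "(!!i. i \<in> S ==> C2 (h i)) ==> D (%x. \<Sum>i\<in>S. h i x) x = (\<Sum>i\<in>S. D (h i) x)"
 by (induction S rule: infinite_finite_induct) (auto simp: D_add C2_sum)

lemma D_explicit:
 assumes "C2 h"
 shows "D h x = (\<Sum>i\<in>UNIV. \<Sum>j\<in>UNIV. pd i (%y. A y $ i $ j) x * pd j h x + A x $ i $ j * pd i (pd j h) x)"
proof -
 have "pd i (%y. (A y *v grad h y) $ i) x = (\<Sum>j\<in>UNIV. pd i (%y. A y $ i $ j) x * pd j h x + A x $ i $ j * pd i (pd j h) x)" for i
 proof -
  have "grad (%y. (A y *v grad h y) $ i) x = (\<Sum>j\<in>UNIV. A x $ i $ j *\<^sub>R grad (pd j h) x + pd j h x *\<^sub>R grad (%y. A y $ i $ j) x)"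
   unfolding matrix_vector_mult_def using assms A_C1
   by (simp add: grad_sum grad_mult C1_mult C2_pd)
  from arg_cong[OF this, of "%v. v $ i"] show ?thesis by (simp add: algebra_simps)
 qed
 then show ?thesis by (simp add: D_def div_field_def)
qed

lemma D_continuous: assumes "C2 h" shows "continuous_on S (D h)"
proof -
 have "D h = (%x. \<Sum>i\<in>UNIV. \<Sum>j\<in>UNIV. pd i (%y. A y $ i $ j) x * pd j h x + A x $ i $ j * pd i (pd j h) x)"
  using D_explicit[OF assms] by auto
 then show ?thesis
  by (simp only:) (intro continuous_intros C1_pd_cont C1_cont[OF A_C1] C1_cont C2_C1 C2_pd A_C1 assms)
qed

end

subsection \<open>Periodic functions\<close>

definition lat :: "real ^ 'n::finite => ('n => int) => real ^ 'n" where
 "lat L z = (\<chi> i. L $ i * of_int (z i))"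

lemma lat_nth [simp]: "lat L z $ i = L $ i * of_int (z i)" by (simp add: lat_def)

lemma lat_add: "lat L (%i. z i + w i) = lat L z + lat L w"
 by (simp add: vec_eq_iff algebra_simps)

lemma periodic_lat:
 assumes h: "periodic L h"
 shows "h (x + lat L z) = h x"
proof -
 have one: "h (x + (L $ i * of_int m) *\<^sub>R axis i 1) = h x" for x i m
 proof (induction m rule: int_induct[where k=0])
  case base then show ?case by simp
 next
  case (step1 m)
  have "h (x + (L $ i * of_int (m + 1)) *\<^sub>R axis i 1) = h ((x + (L $ i * of_int m) *\<^sub>R axis i 1) + (L $ i) *\<^sub>R axis i 1)"
   by (simp add: algebra_simps)
  with step1 h show ?case by (simp add: periodic_def)
 next
  case (step2 m)
  have "h (x + (L $ i * of_int m) *\<^sub>R axis i 1) = h ((x + (L $ i * of_int (m - 1)) *\<^sub>R axis i 1) + (L $ i) *\<^sub>R axis i 1)"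
   by (simp add: algebra_simps)
  with step2 h show ?case by (simp add: periodic_def)
 qed
 have "h (x + (\<Sum>i\<in>S. (L $ i * of_int (z i)) *\<^sub>R axis i 1)) = h x" if "finite S" for S
  using that
 proof (induction S rule: finite_induct)
  case (insert j S)
  have "h (x + (\<Sum>i\<in>insert j S. (L $ i * of_int (z i)) *\<^sub>R axis i 1))
   = h ((x + (\<Sum>i\<in>S. (L $ i * of_int (z i)) *\<^sub>R axis i 1)) + (L $ j * of_int (z j)) *\<^sub>R axis j 1)"
   using insert.hyps by (simp add: algebra_simps)
  with one insert.IH show ?case by simp
 qed simp
 from this[of UNIV] have "h (x + (\<Sum>i\<in>UNIV. (L $ i * of_int (z i)) *\<^sub>R axis i 1)) = h x" by simp
 moreover have "(\<Sum>i\<in>UNIV. (L $ i * of_int (z i)) *\<^sub>R axis i 1) = lat L z"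
  by (auto simp: vec_eq_iff axis_def if_distrib cong: if_cong)
 ultimately show ?thesis by simp
qed

lemma periodicI_lat: "(!!x z. h (x + lat L z) = h x) ==> periodic L h"
proof -
 assume *: "!!x z. h (x + lat L z) = h x"
 have "(L $ i) *\<^sub>R axis i 1 = lat L (%j. if j = i then 1 else 0)" for i
  by (auto simp: vec_eq_iff axis_def)
 then show ?thesis unfolding periodic_def using * by metis
qed

text \<open>Taking integer parts of \<open>x $ i / L $ i\<close> moves every point into a compact
  cell; this turns periodicity plus continuity into boundedness, attained minima and uniform
  continuity.\<close>

lemma cell_cover:
 fixes L :: "real ^ 'n::finite"
 assumes L: "!!i. 0 < L $ i"
 obtains y z where "x = y + lat L z" "y \<in> cbox 0 L"
proof
 define z where "z = (%i. \<lfloor>x $ i / L $ i\<rfloor>)"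
 show "x = (x - lat L z) + lat L z" by simp
 have "0 <= x $ i - L $ i * of_int (z i) & x $ i - L $ i * of_int (z i) <= L $ i" for i
 proof -
  have "of_int (z i) <= x $ i / L $ i" "x $ i / L $ i <= of_int (z i) + 1"
   unfolding z_def by linarith+
  then show ?thesis using L[of i] by (simp add: field_simps)
 qed
 then show "x - lat L z \<in> cbox 0 L" by (auto simp: mem_box_cart)
qed

lemma cell_nonempty: "(!!i. 0 < L $ i) ==> cbox 0 L \<noteq> {}" for L :: "real ^ 'n::finite"
 by (metis cell_cover empty_iff)

lemma periodic_attains_min:
 fixes h :: "real ^ 'n::finite => real"
 assumes L: "!!i. 0 < L $ i" and h: "periodic L h" and c: "continuous_on UNIV h"
 obtains x0 where "!!x. h x0 <= h x"
proof -
 have "\<exists>x0\<in>cbox 0 L. \<forall>x\<in>cbox 0 L. h x0 <= h x"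
  by (rule continuous_attains_inf) (use cell_nonempty[OF L] c continuous_on_subset in auto)
 then obtain x0 where x0: "!!x. x \<in> cbox 0 L ==> h x0 <= h x" by blast
 have "h x0 <= h x" for x
  by (rule cell_cover[OF L, of x]) (use x0 periodic_lat[OF h] in auto)
 then show ?thesis by (rule that)
qed

lemma periodic_bounded:
 fixes h :: "real ^ 'n::finite => 'a::real_normed_vector"
 assumes L: "!!i. 0 < L $ i" and h: "periodic L h" and c: "continuous_on UNIV h"
 obtains K where "K > 0" "!!x. norm (h x) <= K"
proof -
 have "periodic L (%x. - norm (h x))" using h by (simp add: periodic_def)
 then obtain x0 where "!!x. - norm (h x0) <= - norm (h x)"
  by (rule periodic_attains_min[OF L]) (auto intro!: continuous_intros c)
 then have "norm (h x) <= norm (h x0) + 1" for x by (smt (verit))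
 then show ?thesis by (intro that[of "norm (h x0) + 1"]) (auto intro: add_nonneg_pos)
qed

lemma periodic_unif:
 fixes h :: "real ^ 'n::finite => 'a::real_normed_vector"
 assumes L: "!!i. 0 < L $ i" and h: "periodic L h" and c: "continuous_on UNIV h" and e: "e > 0"
 obtains d where "d > 0" "!!x y. dist x y < d ==> dist (h x) (h y) < e"
proof -
 \<comment> \<open>The cell enlarged by 1, so that a point of the cell and its close neighbours lie
   in one compact set.\<close>
 define K where "K = {x + y | x y. x \<in> cbox 0 L & y \<in> cball 0 1}"
 have "compact K" unfolding K_def by (rule compact_sums) auto
 then have "uniformly_continuous_on K h"
  using c by (intro compact_uniformly_continuous) (auto intro: continuous_on_subset)
 then obtain d where d: "d > 0" "!!x y. x \<in> K ==> y \<in> K ==> dist y x < d ==> dist (h y) (h x) < e"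
  using e unfolding uniformly_continuous_on_def by metis
 show ?thesis
 proof
  show "min d 1 > 0" using d by simp
  fix x y :: "real ^ 'n" assume xy: "dist x y < min d 1"
  obtain x' z where x: "x = x' + lat L z" "x' \<in> cbox 0 L" by (rule cell_cover[OF L])
  define y' where "y' = y - lat L z"
  have y: "y = y' + lat L z" by (simp add: y'_def)
  have dd: "dist x' y' = dist x y" by (simp add: x y)
  have "x' = x' + 0" "y' = x' + (y' - x')" "y' - x' \<in> cball 0 1"
   using xy dd by (auto simp: dist_norm norm_minus_commute)
  moreover have "0 \<in> cball (0 :: real ^ 'n) 1" by simp
  ultimately have "x' \<in> K" "y' \<in> K" unfolding K_def using x(2) by blast+
  then have "dist (h x') (h y') < e" using d(2)[of y' x'] xy dd by auto
  then show "dist (h x) (h y) < e" using periodic_lat[OF h] x y by metis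
 qed
qed

lemma periodic_pd: "periodic L h ==> periodic L (pd i h)"
 unfolding periodic_def by (metis (no_types, lifting) ext pd_translate)

lemma periodic_grad: "periodic L h ==> periodic L (grad h)"
 using periodic_pd[of L h] by (auto simp: periodic_def vec_eq_iff)

subsection \<open>The second derivative test\<close>

lemma C1_line:
 assumes "C1 h"
 shows "((%s. h (x + s *\<^sub>R v)) has_real_derivative inner v (grad h (x + s0 *\<^sub>R v))) (at s0)"
proof -
 have 1: "((%s. x + s *\<^sub>R v) has_derivative (%s. s *\<^sub>R v)) (at s0)"
  by (auto intro!: derivative_eq_intros)
 have "((%s. h (x + s *\<^sub>R v)) has_derivative (%s. inner (s *\<^sub>R v) (grad h (x + s0 *\<^sub>R v)))) (at s0)"
  by (rule has_derivative_compose[OF 1]) (use C1_GDERIV[OF assms] in "simp add: gderiv_def")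
 then show ?thesis by (simp add: has_field_derivative_def mult_commute_abs)
qed

text \<open>One-variable arguments along lines. The gradient vanishes by choosing the gradient
  itself as direction; if the second derivative along \<open>v\<close> were negative, the slope,
  zero at the minimum, would turn negative and the function would drop below its minimum.\<close>

lemma local_min_second_order:
 fixes h :: "real ^ 'n::finite => real"
 assumes h: "C2 h" and r: "r > 0" and m: "!!x. dist x x0 < r ==> h x0 <= h x"
 shows "grad h x0 = 0" "(\<Sum>i\<in>UNIV. \<Sum>j\<in>UNIV. v $ i * v $ j * pd i (pd j h) x0) >= 0"
proof -
 have ball: "dist (x0 + s *\<^sub>R v) x0 < r" if "\<bar>s\<bar> * norm v < r" for s v
  using that by (simp add: dist_norm)
 show g: "grad h x0 = 0"
 proof -
  define v where "v = grad h x0"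
  have *: "((%s. h (x0 + s *\<^sub>R v)) has_real_derivative inner v v) (at 0)"
   using C1_line[OF C2_C1[OF h], of x0 v 0] by (simp add: v_def)
  have "inner v v = 0"
  proof (rule DERIV_local_min[OF *])
   show "0 < r / (norm v + 1)" using r by (simp add: add_nonneg_pos)
   show "ALL y. \<bar>0 - y\<bar> < r / (norm v + 1) --> h (x0 + 0 *\<^sub>R v) <= h (x0 + y *\<^sub>R v)"
   proof (intro allI impI)
   fix y :: real assume "\<bar>0 - y\<bar> < r / (norm v + 1)"
   then have "\<bar>y\<bar> * (norm v + 1) < r"
   using pos_less_divide_eq[of "norm v + 1" "\<bar>y\<bar>" r] by (simp add: add_nonneg_pos)
   then have "\<bar>y\<bar> * norm v < r" by (smt (verit) mult_left_mono abs_ge_zero distrib_left mult.right_neutral)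
   then show "h (x0 + 0 *\<^sub>R v) <= h (x0 + y *\<^sub>R v)" using m ball by simp
   qed
  qed
  then show ?thesis by (simp add: v_def)
 qed
 define ps where "ps s = inner v (grad h (x0 + s *\<^sub>R v))" for s
 have "((%s. \<Sum>j\<in>UNIV. v $ j * pd j h (x0 + s *\<^sub>R v)) has_real_derivative
   (\<Sum>j\<in>UNIV. v $ j * inner v (grad (pd j h) (x0 + 0 *\<^sub>R v)))) (at 0)"
  by (intro DERIV_sum DERIV_cmult C1_line C2_pd h)
 moreover have "(\<Sum>j\<in>UNIV. v $ j * inner v (grad (pd j h) (x0 + 0 *\<^sub>R v))) = (\<Sum>i\<in>UNIV. \<Sum>j\<in>UNIV. v $ i * v $ j * pd i (pd j h) x0)"
  unfolding inner_vec_def sum_distrib_left by (subst sum.swap) (simp add: algebra_simps)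
 ultimately have d2: "(ps has_real_derivative (\<Sum>i\<in>UNIV. \<Sum>j\<in>UNIV. v $ i * v $ j * pd i (pd j h) x0)) (at 0)"
  by (simp add: ps_def[abs_def] inner_vec_def)
 show "(\<Sum>i\<in>UNIV. \<Sum>j\<in>UNIV. v $ i * v $ j * pd i (pd j h) x0) >= 0"
 proof (rule ccontr)
  assume "\<not> ?thesis"
  then obtain e where e: "e > 0" "!!s. 0 < s ==> s < e ==> ps (0 + s) < ps 0"
   using DERIV_neg_dec_right[OF d2] by auto
  have psi0: "ps 0 = 0" by (simp add: ps_def g)
  define s1 where "s1 = min e (r / (norm v + 1)) / 2"
  have "0 < r / (norm v + 1)" using r by (simp add: add_nonneg_pos)
  then have s1: "0 < s1" "s1 < e" "s1 < r / (norm v + 1)" using e(1) by (smt (verit) s1_def field_sum_of_halves)+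
  have "\<exists>\<xi>>0. \<xi> < s1 & h (x0 + s1 *\<^sub>R v) - h (x0 + 0 *\<^sub>R v) = (s1 - 0) * ps \<xi>"
   using s1 by (intro MVT2[where f="%s. h (x0 + s *\<^sub>R v)"]) (auto simp: ps_def intro!: C1_line C2_C1 h)
  then obtain \<xi> where "0 < \<xi>" "\<xi> < s1" "h (x0 + s1 *\<^sub>R v) - h x0 = s1 * ps \<xi>" by auto
  moreover have "ps \<xi> < 0" using e(2)[of \<xi>] psi0 \<open>0 < \<xi>\<close> \<open>\<xi> < s1\<close> s1 by simp
  moreover have "h x0 <= h (x0 + s1 *\<^sub>R v)"
  proof (rule m[OF ball])
   have "\<bar>s1\<bar> * (norm v + 1) < r"
   using s1 pos_less_divide_eq[of "norm v + 1" "\<bar>s1\<bar>" r] by (simp add: add_nonneg_pos)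
   then show "\<bar>s1\<bar> * norm v < r" by (smt (verit) mult_left_mono abs_ge_zero distrib_left mult.right_neutral)
  qed
  ultimately show False using s1(1) by (smt (verit) mult_pos_neg)
 qed
qed

text \<open>Induction on the number of nonzero diagonal entries: subtracting the square of one
  normalised column (a Schur complement) keeps the form positive semidefinite and clears that entry.
  The decomposition lets the trace of \<open>A\<close> times a Hessian be read as a sum of second
  directional derivatives.\<close>

lemma psd_sum_of_squares:
 fixes a :: "'n::finite => 'n => real"
 assumes "!!i j. a i j = a j i" "!!x. (\<Sum>i\<in>UNIV. \<Sum>j\<in>UNIV. x i * x j * a i j) >= 0"
 shows "EX xs. ALL i j. a i j = (\<Sum>si\<leftarrow>xs. si i * si j)"
 using assms
proof (induction "card {i. a i i \<noteq> 0}" arbitrary: a rule: less_induct)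
 case less
 note sym = less.prems(1) and psd = less.prems(2)
 \<comment> \<open>The form at \<open>s\<close> times the i-th unit vector plus the j-th unit
   vector.\<close>
 have two: "s * s * a i i + 2 * s * a i j + a j j >= 0" if "i \<noteq> j" for i j s
 proof -
  define x where "x = (%k. if k = i then s else if k = j then 1 else (0::real))"
  have "(\<Sum>l\<in>UNIV. x k * x l * a k l) = x k * (s * a k i + a k j)" for k
  proof -
   have "(\<Sum>l\<in>UNIV. x k * x l * a k l) = (\<Sum>l\<in>{i,j}. x k * x l * a k l)"
   by (rule sum.mono_neutral_right) (auto simp: x_def)
   then show ?thesis using that by (simp add: x_def algebra_simps)
  qed
  then have "(\<Sum>k\<in>UNIV. \<Sum>l\<in>UNIV. x k * x l * a k l) = (\<Sum>k\<in>UNIV. x k * (s * a k i + a k j))" by simp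
  also have "... = (\<Sum>k\<in>{i,j}. x k * (s * a k i + a k j))"
   by (rule sum.mono_neutral_right) (auto simp: x_def)
  also have "... = s * s * a i i + 2 * s * a i j + a j j"
   using that sym[of i j] by (simp add: x_def algebra_simps)
  finally show ?thesis using psd[of x] by simp
 qed
 have diag: "a i i >= 0" for i
 proof -
  define x where "x = (%k. if k = i then 1 else (0::real))"
  have "(\<Sum>k\<in>UNIV. \<Sum>l\<in>UNIV. x k * x l * a k l) = (\<Sum>k\<in>{i}. \<Sum>l\<in>{i}. x k * x l * a k l)"
   by (rule sum.mono_neutral_cong_right; (intro ballI sum.mono_neutral_right)?) (auto simp: x_def)
  then show ?thesis using psd[of x] by (simp add: x_def)
 qed
 have zero: "a i j = 0" if "a i i = 0" for i j
 proof (cases "i = j")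
  case False
  show ?thesis
  proof (rule ccontr)
   assume "a i j \<noteq> 0"
   \<comment> \<open>With this value of \<open>s\<close> the form would equal -1.\<close>
   then have "2 * (- (a j j + 1) / (2 * a i j)) * a i j = - (a j j + 1)" by (simp add: field_simps)
   with two[OF False, of "- (a j j + 1) / (2 * a i j)"] that show False by simp
  qed
 qed (use that in simp)
 show ?case
 proof (cases "EX k. a k k \<noteq> 0")
  case False
  then have "a i j = 0" for i j using zero by blast
  then show ?thesis by (intro exI[of _ "[]"]) auto
 next
  case True
  then obtain k where k: "a k k \<noteq> 0" by blast
  then have kp: "a k k > 0" using diag[of k] by simp
  define b where "b = (%i j. a i j - a i k * a j k / a k k)"
  have bs: "b i j = b j i" for i j using sym by (simp add: b_def mult.commute)
  have bp: "(\<Sum>i\<in>UNIV. \<Sum>j\<in>UNIV. x i * x j * b i j) >= 0" for x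
  proof -
   define q where "q = (\<Sum>i\<in>UNIV. x i * a i k)"
   \<comment> \<open>The increment of the k-th coordinate that minimises the form; the minimum value
     is the form of \<open>b\<close>.\<close>
   define s where "s = - q / a k k"
   define e where "e = (%j. if j = k then s else (0::real))"
   have e1: "(\<Sum>j\<in>UNIV. e j * f j) = s * f k" for f
   by (simp add: e_def if_distrib[of "%t. t * _"] sum.delta cong: if_cong)
   have "0 <= (\<Sum>i\<in>UNIV. \<Sum>j\<in>UNIV. (x i + e i) * (x j + e j) * a i j)" by (rule psd)
   also have "... = (\<Sum>i\<in>UNIV. \<Sum>j\<in>UNIV. x i * x j * a i j) + (\<Sum>i\<in>UNIV. x i * (\<Sum>j\<in>UNIV. e j * a i j))
   + (\<Sum>i\<in>UNIV. e i * (\<Sum>j\<in>UNIV. x j * a i j)) + (\<Sum>i\<in>UNIV. e i * (\<Sum>j\<in>UNIV. e j * a i j))"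
   by (simp add: sum.distrib[symmetric] sum_distrib_left algebra_simps)
   also have "... = (\<Sum>i\<in>UNIV. \<Sum>j\<in>UNIV. x i * x j * a i j) + 2 * s * q + s * s * a k k"
   unfolding e1 using sym by (simp add: q_def sum_distrib_left algebra_simps)
   also have "... = (\<Sum>i\<in>UNIV. \<Sum>j\<in>UNIV. x i * x j * a i j) - q * q / a k k"
   using kp by (simp add: s_def field_simps)
   also have "... = (\<Sum>i\<in>UNIV. \<Sum>j\<in>UNIV. x i * x j * b i j)"
   proof -
   have "(\<Sum>i\<in>UNIV. \<Sum>j\<in>UNIV. x i * x j * (a i k * a j k / a k k)) = q * q / a k k"
   unfolding q_def sum_product sum_divide_distrib by (intro sum.cong refl) simp
   then show ?thesis unfolding b_def by (simp add: right_diff_distrib sum_subtractf)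
   qed
   finally show ?thesis .
  qed
  have "{i. b i i \<noteq> 0} \<subset> {i. a i i \<noteq> 0}"
  proof
   show "{i. b i i \<noteq> 0} \<subseteq> {i. a i i \<noteq> 0}" using zero by (auto simp: b_def)
   have "k \<in> {i. a i i \<noteq> 0}" "k \<notin> {i. b i i \<noteq> 0}" using k by (auto simp: b_def)
   then show "{i. b i i \<noteq> 0} \<noteq> {i. a i i \<noteq> 0}" by blast
  qed
  then have "card {i. b i i \<noteq> 0} < card {i. a i i \<noteq> 0}" by (intro psubset_card_mono) auto
  from less.hyps[OF this bs bp] obtain xs where xs: "!!i j. b i j = (\<Sum>si\<leftarrow>xs. si i * si j)" by blast
  have "a i j = (\<Sum>si\<leftarrow>((%i. a i k / sqrt (a k k)) # xs). si i * si j)" for i j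
   using kp by (simp add: xs[symmetric] b_def)
  then show ?thesis by blast
 qed
qed

locale periodic_diffusion = diffusion_field A for A :: "real ^ 'n::finite => real ^ 'n ^ 'n" +
 fixes L :: "real ^ 'n" and \<alpha>0 :: real
 assumes L_pos: "!!i. 0 < L $ i" and A_per: "periodic L A" and \<alpha>0: "\<alpha>0 > 0"
  and elliptic: "!!x \<xi>. \<alpha>0 * (norm \<xi>)\<^sup>2 <= inner \<xi> (A x *v \<xi>)"
begin

text \<open>At a minimum the first-order terms vanish, and writing \<open>A x0\<close> as a sum of
  squares leaves second directional derivatives, all nonnegative.\<close>

lemma local_min_D:
 assumes h: "C2 h" and r: "r > 0" and m: "!!x. dist x x0 < r ==> h x0 <= h x"
 shows "D h x0 >= 0"
proof -
 have "(\<Sum>i\<in>UNIV. \<Sum>j\<in>UNIV. v i * v j * A x0 $ i $ j) >= 0" for v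
 proof -
  have "(\<Sum>i\<in>UNIV. \<Sum>j\<in>UNIV. v i * v j * A x0 $ i $ j) = inner (\<chi> i. v i) (A x0 *v (\<chi> i. v i))"
   by (simp add: inner_vec_def matrix_vector_mult_def sum_distrib_left algebra_simps)
  also have "... >= 0" using elliptic[of "\<chi> i. v i" x0] \<alpha>0 by (smt (verit) mult_nonneg_nonneg zero_le_power2)
  finally show ?thesis .
 qed
 from psd_sum_of_squares[OF A_swap this]
 obtain xs where xs: "!!i j. A x0 $ i $ j = (\<Sum>si\<leftarrow>xs. si i * si j)" by auto
 have "pd j h x0 = 0" for j using local_min_second_order(1)[OF h r m] by (metis grad_nth zero_index)
 then have "D h x0 = (\<Sum>i\<in>UNIV. \<Sum>j\<in>UNIV. (\<Sum>si\<leftarrow>xs. si i * si j) * pd i (pd j h) x0)"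
  by (simp add: D_explicit[OF h] xs)
 also have "... = (\<Sum>si\<leftarrow>xs. \<Sum>i\<in>UNIV. \<Sum>j\<in>UNIV. si i * si j * pd i (pd j h) x0)"
  by (induction xs) (auto simp: sum.distrib distrib_right)
 also have "... >= 0"
 proof (rule sum_list_nonneg)
  fix y assume "y \<in> set (map (%si. \<Sum>i\<in>UNIV. \<Sum>j\<in>UNIV. si i * si j * pd i (pd j h) x0) xs)"
  then obtain si where "y = (\<Sum>i\<in>UNIV. \<Sum>j\<in>UNIV. si i * si j * pd i (pd j h) x0)" by auto
  then show "0 <= y" using local_min_second_order(2)[OF h r m, of "\<chi> i. si i"] by simp
 qed
 finally show ?thesis .
qed

end

subsection \<open>Linear functionals below a sublinear one\<close>

text \<open>Homogeneity is asked as an inequality for positive scalars, the form that the infima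
  below satisfy directly; scaling back by the inverse gives equality.\<close>

definition sublinear :: "('a::real_vector => real) => bool" where
 "sublinear q \<longleftrightarrow> (ALL x y. q (x + y) <= q x + q y) & (\<forall>c>0. ALL x. q (c *\<^sub>R x) <= c * q x)"

lemma sublinear_zero: "sublinear q ==> q 0 = 0"
proof -
 assume q: "sublinear q"
 have "q ((1/2) *\<^sub>R 0) <= 1/2 * q 0" "q (2 *\<^sub>R 0) <= 2 * q 0"
  using q unfolding sublinear_def by (metis zero_less_divide_1_iff zero_less_numeral)+
 then show ?thesis by simp
qed

lemma sublinear_lower: assumes "sublinear q" shows "- q (- x) <= q x"
proof -
 have "q (x + - x) <= q x + q (- x)" using assms unfolding sublinear_def by blast
 then show ?thesis using sublinear_zero[OF assms] by simp
qed

text \<open>A form of the Hahn-Banach theorem without subspaces: Zorn's lemma gives a minimal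
  sublinear functional below \<open>p\<close>, and a minimal one is linear.\<close>

lemma sublinear_dominates_linear:
 fixes p :: "'a::real_vector => real"
 assumes p: "sublinear p"
 shows "EX f. linear f & (ALL x. f x <= p x)"
proof -
 \<comment> \<open>Epigraphs turn the pointwise order into reversed inclusion, so a maximal set is a
   minimal functional.\<close>
 define E where "E q = {(x, r). q x <= r}" for q :: "'a => real"
 have E: "E q1 \<subseteq> E q2 \<longleftrightarrow> (ALL x. q2 x <= q1 x)" for q1 q2
  unfolding E_def by (auto intro: order_trans)
 define A where "A = {E q | q. sublinear q & (ALL x. q x <= p x)}"
 have "\<forall>C\<in>chains A. \<exists>U\<in>A. \<forall>X\<in>C. X \<subseteq> U"
 proof
  fix C assume C: "C \<in> chains A"
  show "\<exists>U\<in>A. \<forall>X\<in>C. X \<subseteq> U"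
  proof (cases "C = {}")
   case True
   then show ?thesis using p by (intro bexI[of _ "E p"]) (auto simp: A_def)
  next
   case False
   define Q where "Q = {q. sublinear q & (ALL x. q x <= p x) & E q \<in> C}"
   have CA: "C \<subseteq> A" and lin: "!!X Y. X \<in> C ==> Y \<in> C ==> X \<subseteq> Y | Y \<subseteq> X"
   using C by (auto simp: chains_def chain_subset_def)
   have Qne: "Q \<noteq> {}" using False CA by (auto simp: Q_def A_def)
   \<comment> \<open>The infimum over a chain stays sublinear because any two members have a member
     below both; \<open>- p (- x)\<close> bounds it from below.\<close>
   define q0 where "q0 x = (INF q\<in>Q. q x)" for x
   have bdd: "bdd_below ((%q. q x) ` Q)" for x
   proof (rule bdd_belowI2)
   fix q assume "q \<in> Q"
   then have "- q (- x) <= q x" "q (- x) <= p (- x)" by (auto simp: Q_def sublinear_lower)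
   then show "- p (- x) <= q x" by linarith
   qed
   have lower: "q0 x <= q x" if "q \<in> Q" for q x
   unfolding q0_def by (rule cINF_lower[OF bdd that])
   have great: "r <= q0 x" if "!!q. q \<in> Q ==> r <= q x" for r x
   unfolding q0_def by (rule cINF_greatest[OF Qne that])
   have "sublinear q0" unfolding sublinear_def
   proof (intro conjI allI impI)
   fix x y
   have "q0 (x + y) - q0 y <= q1 x" if q1: "q1 \<in> Q" for q1
   proof -
   have "q0 (x + y) - q1 x <= q2 y" if q2: "q2 \<in> Q" for q2
   proof -
   obtain q where q: "q \<in> Q" "!!x. q x <= q1 x" "!!x. q x <= q2 x"
   using lin[of "E q1" "E q2"] q1 q2 unfolding E by (auto simp: Q_def)
   have "q0 (x + y) <= q (x + y)" by (rule lower[OF q(1)])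
   also have "... <= q x + q y" using q(1) by (auto simp: Q_def sublinear_def)
   finally show ?thesis using q(2)[of x] q(3)[of y] by linarith
   qed
   then have "q0 (x + y) - q1 x <= q0 y" by (rule great)
   then show ?thesis by linarith
   qed
   then have "q0 (x + y) - q0 y <= q0 x" by (rule great)
   then show "q0 (x + y) <= q0 x + q0 y" by linarith
   next
   fix c :: real and x assume c: "c > 0"
   have "q0 (c *\<^sub>R x) / c <= q x" if q: "q \<in> Q" for q
   proof -
   have "q0 (c *\<^sub>R x) <= q (c *\<^sub>R x)" by (rule lower[OF q])
   also have "... <= c * q x" using q c by (auto simp: Q_def sublinear_def)
   finally show ?thesis using c by (simp add: field_simps)
   qed
   then have "q0 (c *\<^sub>R x) / c <= q0 x" by (rule great)
   then show "q0 (c *\<^sub>R x) <= c * q0 x" using c by (simp add: field_simps)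
   qed
   moreover have "q0 x <= p x" for x
   proof -
   obtain q where qQ: "q \<in> Q" using Qne by blast
   then have "q x <= p x" by (simp add: Q_def)
   with lower[OF qQ, of x] show ?thesis by linarith
   qed
   ultimately have "E q0 \<in> A" by (auto simp: A_def)
   moreover have "X \<subseteq> E q0" if "X \<in> C" for X
   proof -
   have "X \<in> A" using that CA by blast
   then obtain q where q: "X = E q" "sublinear q" "ALL x. q x <= p x" unfolding A_def by blast
   then have "q \<in> Q" using that by (simp add: Q_def)
   then show ?thesis using lower q(1) E by simp
   qed
   ultimately show ?thesis by blast
  qed
 qed
 from Zorn_Lemma2[OF this] obtain M where M: "M \<in> A" "!!X. X \<in> A ==> M \<subseteq> X ==> X = M"
  by auto
 from M(1) obtain q where Mq: "M = E q" and q: "sublinear q" "!!x. q x <= p x"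
  unfolding A_def by auto
 have min: "E q' = E q" if "sublinear q'" "ALL x. q' x <= p x" "E q \<subseteq> E q'" for q'
  using M(2)[of "E q'"] that by (auto simp: A_def Mq)
 have minq: "q x <= q' x" if "sublinear q'" "!!x. q' x <= q x" for q' x
 proof -
  have "E q' = E q" using min[of q'] that q(2) E by (meson order_trans)
  then show ?thesis using E by (metis order_refl)
 qed
 have add: "q (x + a) = q x + q a" for x a
 proof -
  \<comment> \<open>Sublinear and below \<open>q\<close> (take \<open>t = 0\<close>), so minimality
    gives \<open>q x <= qa x\<close>; \<open>t = 1\<close> then yields the reverse of subadditivity,
    \<open>q x + q a <= q (x + a)\<close>.\<close>
  define qa where "qa x = (INF t\<in>{0..}. q (x + t *\<^sub>R a) - t * q a)" for x
  have bdd: "bdd_below ((%t. q (x + t *\<^sub>R a) - t * q a) ` {0..})" for x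
  proof (rule bdd_belowI2)
   fix t :: real assume t: "t \<in> {0..}"
   have "q a * t <= q (t *\<^sub>R a)"
   proof (cases "t = 0")
   case False
   then have "q ((1/t) *\<^sub>R (t *\<^sub>R a)) <= (1/t) * q (t *\<^sub>R a)"
   using q(1) t unfolding sublinear_def by (metis atLeast_iff less_eq_real_def zero_less_divide_1_iff)
   then show ?thesis using False t by (simp add: field_simps)
   qed (use sublinear_zero[OF q(1)] in simp)
   also have "q ((x + t *\<^sub>R a) + (- x)) <= q (x + t *\<^sub>R a) + q (- x)"
   using q(1) unfolding sublinear_def by blast
   then have "q (t *\<^sub>R a) <= q (x + t *\<^sub>R a) + q (- x)" by simp
   finally show "- q (- x) <= q (x + t *\<^sub>R a) - t * q a" by (simp add: mult.commute)
  qed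
  have lower: "qa x <= q (x + t *\<^sub>R a) - t * q a" if "t >= 0" for t x
   unfolding qa_def using that by (intro cINF_lower[OF bdd]) auto
  have great: "r <= qa x" if "!!t. t >= 0 ==> r <= q (x + t *\<^sub>R a) - t * q a" for r x
   unfolding qa_def using that by (intro cINF_greatest) auto
  have "sublinear qa" unfolding sublinear_def
  proof (intro conjI allI impI)
   fix x y
   have "qa (x + y) - qa y <= q (x + s *\<^sub>R a) - s * q a" if s: "s >= 0" for s
   proof -
   have "qa (x + y) - (q (x + s *\<^sub>R a) - s * q a) <= q (y + t *\<^sub>R a) - t * q a" if t: "t >= 0" for t
   proof -
   have "qa (x + y) <= q ((x + y) + (s + t) *\<^sub>R a) - (s + t) * q a" using s t by (intro lower) auto
   also have "(x + y) + (s + t) *\<^sub>R a = (x + s *\<^sub>R a) + (y + t *\<^sub>R a)" by (simp add: algebra_simps)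
   also have "q ... <= q (x + s *\<^sub>R a) + q (y + t *\<^sub>R a)" using q(1) by (simp add: sublinear_def)
   finally show ?thesis by (simp add: algebra_simps)
   qed
   then have "qa (x + y) - (q (x + s *\<^sub>R a) - s * q a) <= qa y" by (rule great)
   then show ?thesis by linarith
   qed
   then have "qa (x + y) - qa y <= qa x" by (rule great)
   then show "qa (x + y) <= qa x + qa y" by linarith
  next
   fix c :: real and x assume c: "c > 0"
   have "qa (c *\<^sub>R x) / c <= q (x + t *\<^sub>R a) - t * q a" if t: "t >= 0" for t
   proof -
   have "qa (c *\<^sub>R x) <= q (c *\<^sub>R x + (c * t) *\<^sub>R a) - (c * t) * q a" using c t by (intro lower) auto
   also have "c *\<^sub>R x + (c * t) *\<^sub>R a = c *\<^sub>R (x + t *\<^sub>R a)" by (simp add: algebra_simps)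
   also have "q ... <= c * q (x + t *\<^sub>R a)" using q(1) c by (simp add: sublinear_def)
   finally show ?thesis using c by (simp add: field_simps)
   qed
   then have "qa (c *\<^sub>R x) / c <= qa x" by (rule great)
   then show "qa (c *\<^sub>R x) <= c * qa x" using c by (simp add: field_simps)
  qed
  moreover have "qa x <= q x" for x using lower[of 0 x] by simp
  ultimately have "q x <= qa x" by (rule minq)
  also have "qa x <= q (x + 1 *\<^sub>R a) - 1 * q a" by (rule lower) simp
  finally have "q x + q a <= q (x + a)" by simp
  with q(1) show ?thesis by (auto simp: sublinear_def intro: antisym)
 qed
 have neg: "q (- x) = - q x" for x using add[of x "- x"] sublinear_zero[OF q(1)] by simp
 have pos: "q (c *\<^sub>R x) = c * q x" if "c > 0" for c x
 proof -
  have "q (c *\<^sub>R x) <= c * q x" "q (c *\<^sub>R (- x)) <= c * q (- x)"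
   using q(1) that unfolding sublinear_def by blast+
  then show ?thesis using neg by simp
 qed
 have "linear q"
 proof (rule linearI[OF add])
  fix c x show "q (c *\<^sub>R x) = c *\<^sub>R q x"
  proof (cases c "0::real" rule: linorder_cases)
   case less
   then show ?thesis using pos[of "- c" "x"] neg[of "c *\<^sub>R x"] by simp
  qed (use pos sublinear_zero[OF q(1)] in auto)
 qed
 with q(2) show ?thesis by blast
qed

subsection \<open>Locality\<close>

lemma GDERIV_local:
 assumes "r > 0" "!!y. dist y x < r ==> g y = h y" "GDERIV h x :> D"
 shows "GDERIV g x :> D"
 unfolding gderiv_def
proof (rule has_derivative_transform_within_open)
 show "(h has_derivative (%d. inner d D)) (at x)" using assms(3) by (simp add: gderiv_def)
 show "open (ball x r)" "x \<in> ball x r" using assms(1) by auto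
 show "!!y. y \<in> ball x r ==> h y = g y" using assms(2) by (simp add: dist_commute)
qed

lemma pd_local:
 assumes "r > 0" "!!y. dist y x < r ==> g y = h y"
 shows "pd i g x = pd i h x"
proof -
 have "\<forall>\<^sub>F s in nhds 0. g (x + s *\<^sub>R axis i 1) = h (x + s *\<^sub>R axis i 1)"
  unfolding eventually_nhds_metric using assms
  by (intro exI[of _ r]) (auto simp: dist_norm)
 then show ?thesis unfolding pd_def by (rule deriv_cong_ev) simp
qed

lemma pd_local2:
 assumes "r > 0" "!!y. dist y x < r ==> g y = h y" "dist y x < r"
 shows "pd i g y = pd i h y"
proof (rule pd_local)
 show "r - dist y x > 0" using assms by simp
 fix z assume "dist z y < r - dist y x"
 then show "g z = h z" using dist_triangle[of z x y] by (intro assms(2)) simp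
qed

lemma C1_local:
 assumes "!!x. EX h r. r > 0 & C1 h & (ALL y. dist y x < r --> g y = h y)"
 shows "C1 g"
proof -
 have 1: "GDERIV g x :> grad g x" and 2: "isCont (grad g) x" for x
 proof -
  obtain h r where h: "r > 0" "C1 h" "!!y. dist y x < r ==> g y = h y" using assms by blast
  have "GDERIV g x :> grad h x" by (rule GDERIV_local[OF h(1,3) C1_GDERIV[OF h(2)]])
  then show "GDERIV g x :> grad g x" using GDERIV_grad by metis
  have "grad g y = grad h y" if "dist y x < r" for y
   using pd_local2[OF h(1,3) that] by (simp add: vec_eq_iff)
  then have "\<forall>\<^sub>F y in nhds x. grad g y = grad h y"
   unfolding eventually_nhds_metric using h(1) by blast
  then show "isCont (grad g) x"
   using C1_grad_cont[OF h(2), of UNIV] isCont_cong continuous_on_eq_continuous_at open_UNIV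
   by (metis UNIV_I)
 qed
 then show ?thesis unfolding C1_iff by (simp add: continuous_at_imp_continuous_on)
qed

lemma C2_local:
 assumes "!!x. EX h r. r > 0 & C2 h & (ALL y. dist y x < r --> g y = h y)"
 shows "C2 g"
 unfolding C2_def
proof (intro conjI allI)
 show "C1 g" by (rule C1_local) (use assms C2_C1 in blast)
 show "C1 (pd i g)" for i
 proof (rule C1_local)
  fix x
  obtain h r where h: "r > 0" "C2 h" "!!y. dist y x < r ==> g y = h y" using assms by blast
  then show "EX h r. r > 0 & C1 h & (ALL y. dist y x < r --> pd i g y = h y)"
   using pd_local2[OF h(1,3)] C2_pd[OF h(2)] by (intro exI[of _ "pd i h"] exI[of _ r]) auto
 qed
qed

lemma (in diffusion_field) D_local:
 assumes "r > 0" "!!y. dist y x < r ==> g y = h y"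
 shows "D g x = D h x"
proof -
 have "(A y *v grad g y) $ i = (A y *v grad h y) $ i" if "dist y x < r" for y i
  using pd_local2[OF assms that] by (simp add: matrix_vector_mult_def)
 then show ?thesis unfolding D_def div_field_def by (intro sum.cong refl pd_local[OF assms(1)])
qed

subsection \<open>Periodization\<close>

definition Cc :: "(real ^ 'n::finite => real) => bool" where
 "Cc g \<longleftrightarrow> continuous_on UNIV g & (EX R. ALL x. norm x > R --> g x = 0)"

text \<open>The index set consists of the translates that contribute. It is finite when
  \<open>g\<close> has compact support, which keeps the periodization an ordinary finite
  sum.\<close>

definition Per :: "real ^ 'n::finite => (real ^ 'n => real) => real ^ 'n => real" where
 "Per L g x = (\<Sum>z | g (x + lat L z) \<noteq> 0. g (x + lat L z))"

lemma lat_diff: "lat L (%i. z i - w i) = lat L z - lat L w"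
 by (simp add: vec_eq_iff algebra_simps)

lemma finite_lat:
 fixes L :: "real ^ 'n::finite"
 assumes L: "!!i. 0 < L $ i"
 shows "finite {z. norm (lat L z) <= rh}"
proof (rule finite_subset)
 show "finite (PiE UNIV (%i. {- \<lceil>rh / L $ i\<rceil> .. \<lceil>rh / L $ i\<rceil>}))" by (intro finite_PiE) auto
 show "{z. norm (lat L z) <= rh} \<subseteq> PiE UNIV (%i. {- \<lceil>rh / L $ i\<rceil> .. \<lceil>rh / L $ i\<rceil>})"
 proof
  fix z assume "z \<in> {z. norm (lat L z) <= rh}"
  then have nz: "norm (lat L z) <= rh" by simp
  have "z i \<in> {- \<lceil>rh / L $ i\<rceil> .. \<lceil>rh / L $ i\<rceil>}" for i
  proof -
   have "\<bar>L $ i * of_int (z i)\<bar> <= rh" using component_le_norm_cart[of "lat L z" i] nz by simp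
   moreover have "\<bar>L $ i * of_int (z i)\<bar> = L $ i * \<bar>of_int (z i)\<bar>" using L[of i] by (simp add: abs_mult)
   ultimately have "L $ i * \<bar>of_int (z i)\<bar> <= rh" by linarith
   then have "\<bar>real_of_int (z i)\<bar> <= rh / L $ i" using L[of i] by (simp add: field_simps)
   then have "real_of_int \<bar>z i\<bar> <= real_of_int \<lceil>rh / L $ i\<rceil>" by linarith
   then show ?thesis by (simp only: of_int_le_iff) auto
  qed
  then show "z \<in> PiE UNIV (%i. {- \<lceil>rh / L $ i\<rceil> .. \<lceil>rh / L $ i\<rceil>})" by auto
 qed
qed

text \<open>One finite index set serves a whole ball, so \<open>Per L g\<close> is locally a finite
  sum of translates and inherits their regularity.\<close>

lemma Per_local:
 assumes L: "!!i. 0 < L $ i" and g: "!!x. norm x > R ==> g x = 0" and x: "norm x <= rh"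
 shows "Per L g x = (\<Sum>z\<in>{z. norm (lat L z) <= R + rh}. g (x + lat L z))"
 unfolding Per_def
proof (rule sum.mono_neutral_left[OF finite_lat[OF L]])
 show "{z. g (x + lat L z) \<noteq> 0} \<subseteq> {z. norm (lat L z) <= R + rh}"
 proof (rule subsetI, rule CollectI, rule ccontr)
  fix z assume "z \<in> {z. g (x + lat L z) \<noteq> 0}" "\<not> norm (lat L z) <= R + rh"
  moreover have "norm (lat L z) <= norm (x + lat L z) + norm x"
   using norm_triangle_ineq4[of "x + lat L z" x] by simp
  ultimately show False using g[of "x + lat L z"] x by auto
 qed
qed auto

lemma Per_periodic: "periodic L (Per L g)"
proof (rule periodicI_lat)
 fix x z
 have b: "bij_betw (%w i. z i + w i) {w. g (x + lat L z + lat L w) \<noteq> 0} {w. g (x + lat L w) \<noteq> 0}"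
  by (rule bij_betw_byWitness[where f'="%w i. w i - z i"])
   (auto simp: lat_add lat_diff algebra_simps)
 show "Per L g (x + lat L z) = Per L g x"
  unfolding Per_def by (subst sum.reindex_bij_betw[OF b, symmetric]) (simp add: lat_add add.assoc)
qed

lemma Per_C2:
 assumes L: "!!i. 0 < L $ i" and g: "C2 g" "!!x. norm x > R ==> g x = 0"
 shows "C2 (Per L g)"
proof (rule C2_local)
 fix x
 have "Per L g y = (\<Sum>z\<in>{z. norm (lat L z) <= R + (norm x + 1)}. g (y + lat L z))" if "dist y x < 1" for y
  using that norm_triangle_ineq2[of y x] by (intro Per_local[OF L g(2)]) (auto simp: dist_norm)
 moreover have "C2 (%y. \<Sum>z\<in>{z. norm (lat L z) <= R + (norm x + 1)}. g (y + lat L z))"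
  by (intro C2_sum C2_translate g)
 ultimately show "EX h r. r > 0 & C2 h & (ALL y. dist y x < r --> Per L g y = h y)"
  by (intro exI[of _ "%y. \<Sum>z\<in>{z. norm (lat L z) <= R + (norm x + 1)}. g (y + lat L z)"] exI[of _ 1]) auto
qed

lemma Per_cont:
 assumes L: "!!i. 0 < L $ i" and g: "Cc g"
 shows "continuous_on UNIV (Per L g)"
proof (rule continuous_at_imp_continuous_on, rule ballI)
 fix x
 obtain R where R: "!!x. norm x > R ==> g x = 0" using g by (auto simp: Cc_def)
 have c: "continuous_on UNIV g" using g by (simp add: Cc_def)
 have "Per L g y = (\<Sum>z\<in>{z. norm (lat L z) <= R + (norm x + 1)}. g (y + lat L z))" if "dist y x < 1" for y
  using that norm_triangle_ineq2[of y x] by (intro Per_local[OF L R]) (auto simp: dist_norm)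
 then have ev: "\<forall>\<^sub>F y in nhds x. Per L g y = (\<Sum>z\<in>{z. norm (lat L z) <= R + (norm x + 1)}. g (y + lat L z))"
  unfolding eventually_nhds_metric by (intro exI[of _ 1]) auto
 have "continuous_on UNIV (%y. \<Sum>z\<in>{z. norm (lat L z) <= R + (norm x + 1)}. g (y + lat L z))"
  by (intro continuous_intros continuous_on_compose2[OF c]) auto
 then show "isCont (Per L g) x"
  using isCont_cong[OF ev] by (simp add: continuous_on_eq_continuous_at)
qed

lemma Cc_add: "Cc g ==> Cc h ==> Cc (%x. g x + h x)"
 unfolding Cc_def
proof (elim conjE exE, intro conjI)
 fix R S assume "ALL x. norm x > R --> g x = 0" "ALL x. norm x > S --> h x = 0"
 then show "EX R. ALL x. norm x > R --> g x + h x = 0" by (intro exI[of _ "max R S"]) auto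
qed (auto intro: continuous_intros)

lemma Cc_mult: "Cc g ==> continuous_on UNIV h ==> Cc (%x. h x * g x)"
 unfolding Cc_def by (auto intro: continuous_intros)

lemma Cc_cmult: "Cc g ==> Cc (%x. c * g x)"
 by (rule Cc_mult) auto

lemma Per_add:
 assumes L: "!!i. 0 < L $ i" and "Cc g" "Cc h"
 shows "Per L (%x. g x + h x) x = Per L g x + Per L h x"
proof -
 obtain R S where "!!x. norm x > R ==> g x = 0" "!!x. norm x > S ==> h x = 0"
  using assms by (auto simp: Cc_def)
 then have g: "g x = 0" and h: "h x = 0" if "norm x > max R S" for x
  using that by auto
 then have gh: "g x + h x = 0" if "norm x > max R S" for x using that by simp
 show ?thesis
  by (simp only: Per_local[where R="max R S", OF L g order_refl] Per_local[where R="max R S", OF L h order_refl]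
   Per_local[where R="max R S" and g="%x. g x + h x", OF L gh order_refl] sum.distrib)
qed

lemma Per_cmult: "Per L (%x. c * g x) x = c * Per L g x"
 by (cases "c = 0") (simp_all add: Per_def sum_distrib_left)

section \<open>Invariant functional of a periodic drift-diffusion operator\<close>

context periodic_diffusion
begin

definition Lop :: "(real ^ 'n => real ^ 'n) => (real ^ 'n => real) => real ^ 'n => real" where
 "Lop b h x = D h x + inner (b x) (grad h x)"

lemma Lop_translate:
 assumes "periodic L b" "C2 h"
 shows "Lop b (%y. h (y + lat L z)) x = Lop b h (x + lat L z)"
proof -
 have g: "grad (%y. h (y + lat L z)) y = grad h (y + lat L z)" for y
  by (simp add: vec_eq_iff pd_translate)
 have "(%y. (A y *v grad h (y + lat L z)) $ i) = (%y. (A (y + lat L z) *v grad h (y + lat L z)) $ i)" for i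
  using periodic_lat[OF A_per] by simp
 then have "D (%y. h (y + lat L z)) x = D h (x + lat L z)"
  unfolding D_def div_field_def g pd_translate[symmetric] by simp
 then show ?thesis using periodic_lat[OF assms(1)] by (simp add: Lop_def g)
qed

lemma Lop_sum: "(!!i. i \<in> S ==> C2 (h i)) ==> Lop b (%x. \<Sum>i\<in>S. h i x) x = (\<Sum>i\<in>S. Lop b (h i) x)"
 by (simp add: Lop_def D_sum grad_sum C2_C1 inner_sum_right sum.distrib)

lemma Lop_add: "C2 g ==> C2 h ==> Lop b (%x. g x + h x) x = Lop b g x + Lop b h x"
 by (simp add: Lop_def D_add grad_add C2_C1 inner_add_right)

lemma Lop_cmult: "C2 h ==> Lop b (%x. c * h x) x = c * Lop b h x"
 by (simp add: Lop_def D_cmult grad_cmult C2_C1 algebra_simps)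

lemma Lop_cont: "continuous_on UNIV b ==> C2 h ==> continuous_on S (Lop b h)"
 unfolding Lop_def[abs_def]
 by (intro continuous_intros D_continuous C1_grad_cont C2_C1) (auto intro: continuous_on_subset)

lemma Lop_zero: assumes "!!y. dist y x < 1 ==> h y = 0" shows "Lop b h x = 0"
proof -
 have "D h x = D (%_. 0) x" by (rule D_local[of 1]) (use assms in auto)
 moreover have "grad h x = 0" using pd_local[of 1 x h "%_. 0"] assms by (simp add: vec_eq_iff)
 ultimately show ?thesis by (simp add: Lop_def)
qed

lemma Lop_support:
 assumes "!!x. norm x > R ==> h x = 0" "norm x > R + 1"
 shows "Lop b h x = 0"
proof (rule Lop_zero)
 fix y assume "dist y x < 1"
 then have "norm y > R" using assms(2) norm_triangle_ineq2[of x y] by (auto simp: dist_norm norm_minus_commute)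
 then show "h y = 0" by (rule assms(1))
qed

lemma Lop_Cc: "continuous_on UNIV b ==> C2 h ==> Cc h ==> Cc (Lop b h)"
 unfolding Cc_def using Lop_support Lop_cont by blast

lemma Lop_Per:
 assumes "periodic L b" "C2 h" "!!x. norm x > R ==> h x = 0"
 shows "Lop b (Per L h) x = Per L (Lop b h) x"
proof -
 define S where "S = {z. norm (lat L z) <= (R + 1) + (norm x + 1)}"
 have "Per L h y = (\<Sum>z\<in>S. h (y + lat L z))" if "dist y x < 1" for y
  unfolding S_def using that norm_triangle_ineq2[of y x]
  by (intro Per_local[OF L_pos]) (auto simp: dist_norm assms)
 then have eq: "D (Per L h) x = D (%y. \<Sum>z\<in>S. h (y + lat L z)) x"
  "!!i. pd i (Per L h) x = pd i (%y. \<Sum>z\<in>S. h (y + lat L z)) x"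
  by (intro D_local[of 1] pd_local[of 1]; simp)+
 then have "Lop b (Per L h) x = Lop b (%y. \<Sum>z\<in>S. h (y + lat L z)) x"
  by (simp add: Lop_def grad_def)
 also have "... = (\<Sum>z\<in>S. Lop b h (x + lat L z))"
  by (subst Lop_sum) (auto simp: C2_translate Lop_translate assms)
 also have "... = Per L (Lop b h) x"
  unfolding S_def by (rule Per_local[OF L_pos, symmetric]) (auto intro: Lop_support assms)
 finally show ?thesis .
qed

text \<open>In substance an invariant measure on the period cell, kept as a mere linear functional.
  \<open>p G\<close>, the infimum over periodic \<open>h\<close> of the supremum of
  \<open>G + Lop b h\<close>, is sublinear; a linear \<open>m\<close> below it annihilates the range
  of the operator and is at most the supremum of its argument. Periodization carries
  \<open>m\<close> over to functions of compact support.\<close>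

theorem invariant_functional:
 assumes bc: "continuous_on UNIV b" and bp: "periodic L b"
 obtains I :: "(real ^ 'n => real) => real" where
  "!!g h. Cc g ==> Cc h ==> I (%x. g x + h x) = I g + I h"
  "!!g c. Cc g ==> I (%x. c * g x) = c * I g"
  "!!g r. Cc g ==> (!!x. Per L g x <= r) ==> I g <= r"
  "!!h. C2 h ==> Cc h ==> I (Lop b h) = 0"
proof -
 define T where "T = {h. C2 h & periodic L h}"
 define S where "S G = {r. \<exists>h\<in>T. ALL x. apply_bcontfun G x + Lop b h x <= r}" for G :: "(real ^ 'n) \<Rightarrow>\<^sub>C real"
 define p where "p G = Inf (S G)" for G
 \<comment> \<open>At a minimum point of \<open>h\<close> the second derivative test gives
   \<open>Lop b h x0 >= 0\<close>, so no choice of \<open>h\<close> can push the supremum below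
   \<open>- norm G\<close>.\<close>
 have low: "- norm G <= r" if r: "r \<in> S G" for r G
 proof -
  obtain h where h: "C2 h" "periodic L h" "!!x. apply_bcontfun G x + Lop b h x <= r"
   using r by (auto simp: S_def T_def)
  obtain x0 where x0: "!!x. h x0 <= h x"
   using periodic_attains_min[OF L_pos h(2) C2_cont[OF h(1)]] by blast
  have "D h x0 >= 0" "grad h x0 = 0"
   using local_min_D[OF h(1), of 1 x0] local_min_second_order(1)[OF h(1), of 1 x0] x0 by auto
  then have "apply_bcontfun G x0 <= r" using h(3)[of x0] by (simp add: Lop_def)
  moreover have "\<bar>apply_bcontfun G x0\<bar> <= norm G" using norm_bounded[of G x0] by simp
  ultimately show ?thesis by linarith
 qed
 have bdd: "bdd_below (S G)" for G using low by (rule bdd_belowI)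
 have upper: "p G <= r" if "h \<in> T" "!!x. apply_bcontfun G x + Lop b h x <= r" for G h r
  unfolding p_def by (rule cInf_lower[OF _ bdd]) (use that in "auto simp: S_def")
 have ne: "norm G \<in> S G" for G
 proof -
  have "(%_. 0) \<in> T" by (auto simp: T_def periodic_def)
  moreover have "apply_bcontfun G x + Lop b (%_. 0) x <= norm G" for x
   using norm_bounded[of G x] by (simp add: Lop_def)
  ultimately show ?thesis by (auto simp: S_def)
 qed
 have great: "r <= p G" if "!!s. s \<in> S G ==> r <= s" for r G
  unfolding p_def by (rule cInf_greatest) (use ne that in auto)
 have "sublinear p" unfolding sublinear_def
 proof (intro conjI allI impI)
  fix G H
  have "p (G + H) - p H <= s" if s: "s \<in> S G" for s
  proof -
   have "p (G + H) - s <= t" if t: "t \<in> S H" for t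
   proof -
   obtain g h where g: "g \<in> T" "!!x. apply_bcontfun G x + Lop b g x <= s"
   and h: "h \<in> T" "!!x. apply_bcontfun H x + Lop b h x <= t"
   using s t by (auto simp: S_def)
   have "p (G + H) <= s + t"
   proof (rule upper)
   show "(%x. g x + h x) \<in> T" using g h by (auto simp: T_def C2_add periodic_def)
   show "apply_bcontfun (G + H) x + Lop b (%x. g x + h x) x <= s + t" for x
   using g(1) h(1) g(2)[of x] h(2)[of x] by (simp add: Lop_add T_def plus_bcontfun.rep_eq)
   qed
   then show ?thesis by linarith
   qed
   then have "p (G + H) - s <= p H" by (rule great)
   then show ?thesis by linarith
  qed
  then have "p (G + H) - p H <= p G" by (rule great)
  then show "p (G + H) <= p G + p H" by linarith
 next
  fix c :: real and G assume c: "c > 0"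
  have "p (c *\<^sub>R G) / c <= s" if s: "s \<in> S G" for s
  proof -
   obtain g where g: "g \<in> T" "!!x. apply_bcontfun G x + Lop b g x <= s"
   using s by (auto simp: S_def)
   have "p (c *\<^sub>R G) <= c * s"
   proof (rule upper)
   show "(%x. c * g x) \<in> T" using g by (auto simp: T_def C2_cmult periodic_def)
   show "apply_bcontfun (c *\<^sub>R G) x + Lop b (%x. c * g x) x <= c * s" for x
   using g(1) mult_left_mono[OF g(2)[of x], of c] c by (simp add: Lop_cmult T_def scaleR_bcontfun.rep_eq algebra_simps)
   qed
   then show ?thesis using c by (simp add: field_simps)
  qed
  then have "p (c *\<^sub>R G) / c <= p G" by (rule great)
  then show "p (c *\<^sub>R G) <= c * p G" using c by (simp add: field_simps)
 qed
 from sublinear_dominates_linear[OF this] obtain m where m: "linear m" "!!G. m G <= p G" by blast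
 have rep: "apply_bcontfun (Bcontfun g) = g" if "continuous_on UNIV g" "periodic L g" for g :: "real ^ 'n => real"
 proof (rule Bcontfun_inverse)
  note gc = that
  obtain K where "!!x. norm (g x) <= K" using periodic_bounded[OF L_pos gc(2,1)] by metis
  then show "g \<in> bcontfun" using gc(1) by (auto simp: bcontfun_def bounded_iff)
 qed
 have repP: "apply_bcontfun (Bcontfun (Per L g)) = Per L g" if "Cc g" for g
  using rep[OF Per_cont[OF L_pos that] Per_periodic] .
 define I where "I g = m (Bcontfun (Per L g))" for g
 show ?thesis
 proof (rule that[of I])
  fix g h :: "real ^ 'n => real" assume gh: "Cc g" "Cc h"
  have "Bcontfun (Per L (%x. g x + h x)) = Bcontfun (Per L g) + Bcontfun (Per L h)"
   by (rule bcontfun_eqI) (simp add: repP gh Cc_add plus_bcontfun.rep_eq Per_add[OF L_pos])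
  then show "I (%x. g x + h x) = I g + I h" by (simp add: I_def linear_add[OF m(1)])
 next
  fix g :: "real ^ 'n => real" and c assume g: "Cc g"
  have "Bcontfun (Per L (%x. c * g x)) = c *\<^sub>R Bcontfun (Per L g)"
   by (rule bcontfun_eqI) (simp add: repP g Cc_cmult scaleR_bcontfun.rep_eq Per_cmult)
  then show "I (%x. c * g x) = c * I g" by (simp add: I_def linear_cmul[OF m(1)])
 next
  fix g :: "real ^ 'n => real" and r assume g: "Cc g" "!!x. Per L g x <= r"
  have "m (Bcontfun (Per L g)) <= p (Bcontfun (Per L g))" by (rule m(2))
  also have "... <= r"
   by (rule upper[of "%_. 0"]) (auto simp: T_def periodic_def repP[OF g(1)] g(2) Lop_def)
  finally show "I g <= r" by (simp add: I_def)
 next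
  fix h :: "real ^ 'n => real" assume h: "C2 h" "Cc h"
  then obtain R where R: "!!x. norm x > R ==> h x = 0" by (auto simp: Cc_def)
  define G where "G = Bcontfun (Per L (Lop b h))"
  have G: "apply_bcontfun G x = Lop b (Per L h) x" for x
   unfolding G_def repP[OF Lop_Cc[OF bc h]] using Lop_Per[OF bp h(1) R] by simp
  have P: "C2 (Per L h)" "periodic L (Per L h)" by (rule Per_C2[OF L_pos h(1) R], simp) (rule Per_periodic)
  \<comment> \<open>Minus the periodization of \<open>h\<close>, and for \<open>- G\<close> the
    periodization itself, cancels \<open>G\<close> exactly; hence both \<open>m G\<close> and
    \<open>- m G\<close> are at most 0.\<close>
  have "p G <= 0"
   using P by (intro upper[of "%x. - 1 * Per L h x"])
   (auto simp: T_def G Lop_cmult[OF P(1), of b "- 1", simplified] periodic_def intro: C2_cmult[of _ "- 1", simplified])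
  moreover have "p (- G) <= 0"
   using P by (intro upper[of "Per L h"]) (auto simp: T_def G uminus_bcontfun.rep_eq)
  moreover have "m (- G) = - m G" by (rule linear_neg[OF m(1)])
  ultimately show "I (Lop b h) = 0" using m(2)[of G] m(2)[of "- G"] by (simp add: I_def G_def)
 qed
qed

end

subsection \<open>Radial barrier profiles\<close>

text \<open>Continues a profile that is singular at 0 by its tangent line at \<open>a\<close>, which
  keeps it differentiable with a continuous derivative.\<close>

lemma C1_extend_linear:
 fixes f f' :: "real => real"
 assumes f: "!!s. s >= a ==> (f has_real_derivative f' s) (at s)"
 shows "((%s. if s >= a then f s else f a + f' a * (s - a)) has_real_derivative f' (max s a)) (at s)"
proof (cases s a rule: linorder_cases)
 case less
 have "((%s. f a + f' a * (s - a)) has_real_derivative f' a) (at s)"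
  by (auto intro!: derivative_eq_intros)
 then have "((%s. if s >= a then f s else f a + f' a * (s - a)) has_real_derivative f' a) (at s)"
  by (rule has_field_derivative_transform_within_open[where S="{..<a}"]) (use less in auto)
 with less show ?thesis by (simp add: max_def)
next
 case greater
 have "((%s. if s >= a then f s else f a + f' a * (s - a)) has_real_derivative f' s) (at s)"
  by (rule has_field_derivative_transform_within_open[OF f, where S="{a<..}"]) (use greater in auto)
 with greater show ?thesis by (simp add: max_def)
next
 case equal
 let ?F = "%s. if s >= a then f s else f a + f' a * (s - a)"
 have "((%y. (?F y - ?F a) / (y - a)) \<longlongrightarrow> f' a) (at_left a)"
 proof (rule Lim_transform_eventually[OF tendsto_const])
  show "\<forall>\<^sub>F y in at_left a. f' a = (?F y - ?F a) / (y - a)"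
   by (auto simp: eventually_at_left_field intro!: exI[of _ "a - 1"])
 qed
 moreover have "((%y. (?F y - ?F a) / (y - a)) \<longlongrightarrow> f' a) (at_right a)"
 proof (rule Lim_transform_eventually)
  show "((%y. (f y - f a) / (y - a)) \<longlongrightarrow> f' a) (at_right a)"
   using f[of a] by (auto simp: has_field_derivative_iff intro: filterlim_mono at_le)
  show "\<forall>\<^sub>F y in at_right a. (f y - f a) / (y - a) = (?F y - ?F a) / (y - a)"
   by (auto simp: eventually_at_right_field intro!: exI[of _ "a + 1"])
 qed
 ultimately have "((%y. (?F y - ?F a) / (y - a)) \<longlongrightarrow> f' a) (at a)"
  by (rule filterlim_split_at)
 with equal show ?thesis by (simp add: has_field_derivative_iff)
qed

lemma DERIV_pos_part_power:
 "((%s::real. (max 0 s) ^ (Suc (Suc k))) has_real_derivative real (Suc (Suc k)) * (max 0 s) ^ Suc k) (at s)"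
proof (cases s "0::real" rule: linorder_cases)
 case less
 have "((%s::real. (max 0 s) ^ (Suc (Suc k))) has_real_derivative 0) (at s)"
  by (rule has_field_derivative_transform_within_open[OF DERIV_const[of 0], where S="{..<0}"]) (use less in "auto simp: max_def")
 with less show ?thesis by (simp add: max_def)
next
 case greater
 have "((%s::real. s ^ (Suc (Suc k))) has_real_derivative real (Suc (Suc k)) * s ^ Suc k) (at s)"
  using DERIV_pow[of "Suc (Suc k)" s] by (simp del: power_Suc of_nat_Suc)
 then have "((%s::real. (max 0 s) ^ (Suc (Suc k))) has_real_derivative real (Suc (Suc k)) * s ^ Suc k) (at s)"
  by (rule has_field_derivative_transform_within_open[where S="{0<..}"]) (use greater in "auto simp: max_def")
 with greater show ?thesis by (simp add: max_def)
next
 case equal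
 have "((%y. ((max 0 y) ^ (Suc (Suc k)) - 0) / (y - 0)) \<longlongrightarrow> 0) (at (0::real))"
 proof (rule Lim_null_comparison)
  have "norm (((max 0 y) ^ (Suc (Suc k)) - 0) / (y - 0)) <= \<bar>y\<bar> ^ Suc k" for y :: real
  proof (cases "y > 0")
   case False
   then have "(max 0 y) ^ (Suc (Suc k)) = 0" by simp
   then show ?thesis by (simp del: power_Suc)
  qed (simp add: max_def abs_mult)
  then show "\<forall>\<^sub>F y in at (0::real). norm (((max 0 y) ^ (Suc (Suc k)) - 0) / (y - 0)) <= \<bar>y\<bar> ^ Suc k"
   by (intro always_eventually) auto
  show "((%y::real. \<bar>y\<bar> ^ Suc k) \<longlongrightarrow> 0) (at 0)"
   by (auto intro!: tendsto_eq_intros)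
 qed
 with equal show ?thesis by (simp add: has_field_derivative_iff)
qed

lemma powr_exp_derivative_eq:
 "(- n / 2) * (P / s) * X + P * (X * (- k * (inverse q / 2))) = - (n / (2 * s) + k / (2 * q)) * (P * X)" for n :: real
 by (cases "s = 0"; cases "q = 0") (simp_all add: field_simps)

lemma square_powr_half: "r > 0 ==> (r\<^sup>2) powr (- n / 2) = r powr (- n)" for r :: real
proof -
 assume "r > 0"
 then have "r\<^sup>2 = r powr 2" by simp
 then show ?thesis by (simp only: powr_powr) simp
qed

lemma barrier_lower:
 fixes n C th S :: real
 assumes n: "n >= 1" and C: "C > 0" and th: "0 < th" and S: "S >= 1"
 obtains c C' where "c > 0" "C' > 0"
  "!!r. 0 < r ==> r <= 1 ==> EX G G'. (ALL s. (G has_real_derivative G' s) (at s)) & continuous_on UNIV G' \<and>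
   (\<forall>s\<ge>S + 1. G s = 0) \<and>
   (ALL s a \<tau>. 0 <= s --> \<bar>\<tau> - 2 * n\<bar> <= C * sqrt s --> \<bar>a - s\<bar> <= C * s * sqrt s --> th * s <= a --> a <= s / th -->
   c * (if s <= S then 1 else 0) - C' * r powr (- n) * (if s <= r\<^sup>2 then 1 else 0) <= - 4 * a * G' s - \<tau> * G s)"
proof -
 \<comment> \<open>The first bound is for \<open>C * q <= 1/2\<close> with
   \<open>q = sqrt s\<close>, where \<open>a / s >= 1 - C * q\<close> is useful. The second is for
   larger \<open>q\<close>, where only \<open>a / s >= th\<close> is available but
   \<open>2 * n <= 4 * n * (C * q)\<close>.\<close>
 define ka where "ka = max (2*n*C + C + 1) ((4*n*C + C + 1) / (2 * th))"
 have ka1: "ka >= 2*n*C + C + 1" and ka2: "2 * th * ka >= 4*n*C + C + 1"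
  using th by (auto simp: ka_def max_def field_simps)
 have ka0: "ka > 0" using ka1 n C by (smt (verit) mult_pos_pos)
 define g where "g s = s powr (- n / 2) * exp (- ka * sqrt s)" for s :: real
 define g' where "g' s = - (n / (2 * s) + ka / (2 * sqrt s)) * g s" for s
 have gd: "(g has_real_derivative g' s) (at s)" if "s > 0" for s
 proof -
  have "(g has_real_derivative (- n / 2) * s powr (- n / 2 - 1) * exp (- ka * sqrt s) + s powr (- n / 2) * (exp (- ka * sqrt s) * (- ka * (inverse (sqrt s) / 2)))) (at s)"
   unfolding g_def[abs_def] using that by (auto intro!: derivative_eq_intros)
  moreover have e: "s powr (- n / 2 - 1) = s powr (- n / 2) / s"
   using that by (simp add: powr_diff)
  have "(- n / 2) * s powr (- n / 2 - 1) * exp (- ka * sqrt s) + s powr (- n / 2) * (exp (- ka * sqrt s) * (- ka * (inverse (sqrt s) / 2))) = g' s"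
   unfolding e g'_def g_def by (rule powr_exp_derivative_eq)
  ultimately show ?thesis by simp
 qed
 have gp: "g s > 0" if "s > 0" for s using that by (simp add: g_def)
 \<comment> \<open>The cut-off is nonincreasing, so above \<open>r\<^sup>2\<close> its derivative
   enters with a favourable sign.\<close>
 define w where "w s = (max 0 (S + 1 - s))\<^sup>2" for s
 define w' where "w' s = - 2 * max 0 (S + 1 - s)" for s
 have wd: "(w has_real_derivative w' s) (at s)" for s
 proof -
  have "((%s. S + 1 - s) has_real_derivative - 1) (at s)" by (auto intro!: derivative_eq_intros)
  from DERIV_chain2[where f="%s. max 0 s ^ Suc (Suc 0)", OF DERIV_pos_part_power[of 0] this]
  show ?thesis by (simp add: w_def[abs_def] w'_def power2_eq_square)
 qed
 \<comment> \<open>A lower bound for \<open>g s * sqrt s\<close> on \<open>s <= S\<close>, where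
   \<open>w s >= 1\<close>; the power \<open>s powr ((1 - n) / 2)\<close> is smallest at
   \<open>S\<close>.\<close>
 define c where "c = S powr (- n / 2) * exp (- ka * sqrt S)"
 have cp: "c > 0" using S by (simp add: c_def)
 define W where "W = (S + 1)\<^sup>2"
 \<comment> \<open>The three summands bound the contributions of \<open>g'\<close>, of
   \<open>w'\<close> and of \<open>\<tau>\<close> below \<open>r\<^sup>2\<close>; the final
   \<open>c\<close> absorbs the indicator of \<open>s <= S\<close>, which is 1 there too.\<close>
 define C0 where "C0 = (4 / th * (n + ka) * W + 4 / th * (1 + n + ka) * (2 * (S + 1)) + (2 * n + C) * (1 + n + ka) * W) + c"
 have C0p: "C0 > 0" using n C th S ka0 cp unfolding C0_def W_def by (intro add_nonneg_pos add_nonneg_nonneg mult_nonneg_nonneg divide_nonneg_nonneg) auto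
 show ?thesis
 proof (rule that[OF cp C0p])
  fix r :: real assume r: "0 < r" "r <= 1"
  define a0 where "a0 = r\<^sup>2"
  have a0: "0 < a0" "a0 <= 1" "sqrt a0 = r" using r by (auto simp: a0_def power_le_one)
  define gx where "gx s = (if s >= a0 then g s else g a0 + g' a0 * (s - a0))" for s
  have gxd: "(gx has_real_derivative g' (max s a0)) (at s)" for s
   unfolding gx_def[abs_def] by (rule C1_extend_linear) (use gd a0 in auto)
  define G where "G s = gx s * w s" for s
  define G' where "G' s = g' (max s a0) * w s + gx s * w' s" for s
  have Gd: "(G has_real_derivative G' s) (at s)" for s
   unfolding G_def[abs_def] G'_def by (rule derivative_eq_intros gxd wd refl)+ (simp add: mult.commute)
  have cont: "continuous_on UNIV G'"
  proof -
   have "continuous_on UNIV gx" by (rule DERIV_continuous_on, rule gxd)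
   moreover have "continuous_on UNIV w" by (rule DERIV_continuous_on, rule wd)
   moreover have "continuous_on UNIV (%s. g' (max s a0))"
   unfolding g'_def g_def using a0 by (intro continuous_intros) auto
   moreover have "continuous_on UNIV w'" unfolding w'_def[abs_def] by (intro continuous_intros)
   ultimately show ?thesis unfolding G'_def[abs_def] by (intro continuous_intros)
  qed
  have supp: "G s = 0" if "s >= S + 1" for s using that by (simp add: G_def w_def max_def)
  have main: "c * (if s <= S then 1 else 0) - C0 * r powr (- n) * (if s <= r\<^sup>2 then 1 else 0) <= - 4 * a * G' s - \<tau> * G s"
   if s0: "0 <= s" and t1: "\<bar>\<tau> - 2 * n\<bar> <= C * sqrt s" and t2: "\<bar>a - s\<bar> <= C * s * sqrt s"
   and t3: "th * s <= a" and t4: "a <= s / th" for s a \<tau>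
  proof -
   have ann: "a >= 0" using t3 s0 th by (smt (verit) mult_nonneg_nonneg)
   have wnn: "w s >= 0" "w' s <= 0" by (auto simp: w_def w'_def)
   have rn: "r powr (- n) >= 1" using r n by (simp add: powr_minus one_le_inverse_iff powr_le1)
   show ?thesis
   proof (cases "s > a0")
   case True
   then have sp: "s > 0" using a0 by linarith
   define q where "q = sqrt s"
   have q: "q > 0" "q * q = s" using sp by (auto simp: q_def)
   have gxs: "gx s = g s" "g' (max s a0) = g' s"
   unfolding gx_def max_absorb1[OF less_imp_le[OF True]] using less_imp_le[OF True] by auto
   have br: "4 * a * (n / (2 * s) + ka / (2 * q)) - \<tau> >= q"
   proof -
   have e1: "4 * a * (n / (2 * s)) = 2 * n * (a / s)" "4 * a * (ka / (2 * q)) = 2 * ka * q * (a / s)"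
   unfolding q(2)[symmetric] using q(1) by simp_all
   have as1: "a / s >= 1 - C * q" and as2: "a / s >= th"
   using t2 t3 sp by (auto simp: field_simps q_def)
   have tt: "\<tau> <= 2 * n + C * q" using t1 by (simp add: q_def)
   show ?thesis
   proof (cases "C * q <= 1/2")
   case True
   have "2 * n * (a / s) >= 2 * n * (1 - C * q)" using as1 n by (intro mult_left_mono) auto
   moreover have "a / s >= 1/2" using as1 True by linarith
   then have "2 * ka * q * (a / s) >= 2 * ka * q * (1/2)"
   using ka0 q(1) by (intro mult_left_mono) simp_all
   moreover have "ka * q >= (2*n*C + C + 1) * q" using ka1 q(1) by (intro mult_right_mono) simp_all
   ultimately have "2 * n * (a / s) + 2 * ka * q * (a / s) - \<tau> >= 2 * n * (1 - C * q) + (2*n*C + C + 1) * q - (2 * n + C * q)"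
   using tt by linarith
   also have "2 * n * (1 - C * q) + (2*n*C + C + 1) * q - (2 * n + C * q) = q" by (simp add: algebra_simps)
   finally show ?thesis unfolding distrib_left e1 .
   next
   case False
   have "2 * n * (a / s) >= 0" using ann n sp by auto
   moreover have "2 * ka * q * (a / s) >= 2 * ka * q * th"
   using as2 ka0 q(1) by (intro mult_left_mono) simp_all
   moreover have "2 * ka * q * th >= (4*n*C + C + 1) * q" using mult_right_mono[OF ka2, of q] q(1) by (simp add: mult_ac)
   moreover have "4 * n * (C * q) >= 4 * n * (1/2)" using False n by (intro mult_left_mono) auto
   ultimately have "2 * n * (a / s) + 2 * ka * q * (a / s) - \<tau> >= q"
   using tt by (simp add: algebra_simps)
   then show ?thesis unfolding distrib_left e1 .
   qed
   qed
   have "- 4 * a * G' s - \<tau> * G s = g s * w s * (4 * a * (n / (2 * s) + ka / (2 * q)) - \<tau>) + 4 * a * g s * (- w' s)"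
   proof -
   have e: "G' s = g' s * w s + g s * w' s" by (simp only: G'_def gxs)
   show ?thesis unfolding e G_def gxs(1) g'_def q_def by (simp add: algebra_simps)
   qed
   moreover have "4 * a * g s * (- w' s) >= 0" using ann gp[OF sp] wnn by (intro mult_nonneg_nonneg) auto
   moreover have "g s * w s * (4 * a * (n / (2 * s) + ka / (2 * q)) - \<tau>) >= g s * w s * q"
   using br gp[OF sp] wnn by (intro mult_left_mono mult_nonneg_nonneg) simp_all
   ultimately have ge: "- 4 * a * G' s - \<tau> * G s >= g s * w s * q" by linarith
   note q = q(1)
   have "c * (if s <= S then 1 else 0) <= g s * w s * q"
   proof (cases "s <= S")
   case True
   have "w s >= 1" using True by (simp add: w_def max_def one_le_power)
   have "s powr (- n / 2) * q = s powr ((1 - n) / 2)"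
   using sp by (simp add: q_def powr_half_sqrt[symmetric] powr_add[symmetric] diff_divide_distrib)
   moreover have "s powr ((1 - n) / 2) >= S powr ((1 - n) / 2)"
   using n sp True by (intro powr_mono2') auto
   moreover have "S powr ((1 - n) / 2) >= S powr (- n / 2)" using S by (intro powr_mono) auto
   ultimately have "s powr (- n / 2) * q >= S powr (- n / 2)" by linarith
   moreover have "exp (- ka * sqrt s) >= exp (- ka * sqrt S)" using ka0 True by auto
   ultimately have "c <= (s powr (- n / 2) * q) * exp (- ka * sqrt s)"
   unfolding c_def by (intro mult_mono) (use q in auto)
   also have "... = g s * 1 * q" by (simp add: g_def)
   also have "... <= g s * w s * q" using \<open>w s >= 1\<close> gp[OF sp] q by (intro mult_right_mono mult_left_mono) auto
   finally show ?thesis using True by simp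
   next
   case False
   then show ?thesis using gp[OF sp] wnn q by simp
   qed
   with ge show ?thesis using True by (simp add: a0_def)
   next
   case False
   then have sa: "s <= a0" by simp
   define N where "N = r powr (- n)"
   have N: "N >= 1" using rn by (simp add: N_def)
   have ga: "g a0 <= N"
   proof -
   have "a0 powr (- n / 2) = N" unfolding a0_def N_def by (rule square_powr_half[OF r(1)])
   moreover have "exp (- ka * sqrt a0) <= 1" using ka0 a0 by auto
   ultimately show ?thesis unfolding g_def using N by (simp add: mult_left_le)
   qed
   have gap: "g a0 > 0" using gp a0 by auto
   have q1: "a0 * (n / (2 * a0) + ka / (2 * r)) = n / 2 + ka * r / 2"
   using a0 r by (simp add: a0_def field_simps power2_eq_square)
   have "n / 2 + ka * r / 2 <= n + ka"
   proof -
   have "ka * r <= ka * 1" using r ka0 by (intro mult_left_mono) auto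
   then show ?thesis using n ka0 by linarith
   qed
   then have q2: "a0 * (n / (2 * a0) + ka / (2 * r)) <= n + ka" using q1 by simp
   have q3: "n / (2 * a0) + ka / (2 * r) > 0" using n a0 r ka0 by (simp add: add_pos_pos)
   define P where "P = a0 * \<bar>g' a0\<bar>"
   have "\<bar>g' a0\<bar> = (n / (2 * a0) + ka / (2 * r)) * g a0"
   using q3 gap a0 by (simp add: g'_def abs_mult)
   then have "P = a0 * (n / (2 * a0) + ka / (2 * r)) * g a0" by (simp add: P_def)
   also have "... <= (n + ka) * N" using q2 ga gap n ka0 by (intro mult_mono) auto
   finally have g'a: "a0 * \<bar>g' a0\<bar> <= (n + ka) * N" by (simp add: P_def)
   have gxs: "\<bar>gx s\<bar> <= (1 + n + ka) * N"
   proof -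
   have "gx s = g a0 + g' a0 * (s - a0)" using sa by (auto simp: gx_def)
   then have "\<bar>gx s\<bar> <= g a0 + \<bar>g' a0\<bar> * \<bar>s - a0\<bar>"
   using gap abs_triangle_ineq[of "g a0" "g' a0 * (s - a0)"] unfolding abs_mult by simp
   also have "\<bar>g' a0\<bar> * \<bar>s - a0\<bar> <= \<bar>g' a0\<bar> * a0" using sa s0 by (intro mult_left_mono) auto
   finally show ?thesis using ga g'a by (simp add: algebra_simps)
   qed
   have m: "max s a0 = a0" using sa by simp
   have aa: "a <= a0 / th" using t4 sa th by (meson divide_right_mono less_imp_le order_trans)
   have wb: "\<bar>w s\<bar> <= W" "\<bar>w' s\<bar> <= 2 * (S + 1)"
   using s0 S by (auto simp: w_def W_def w'_def max_def intro!: power_mono)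
   have W0: "W >= 0" by (simp add: W_def)
   have A1: "\<bar>4 * a * (g' a0 * w s)\<bar> <= 4 / th * (n + ka) * W * N"
   proof -
   have "\<bar>4 * a * (g' a0 * w s)\<bar> = 4 * (a * \<bar>g' a0\<bar>) * \<bar>w s\<bar>" using ann by (simp add: abs_mult)
   also have "... <= 4 * ((n + ka) * N / th) * W"
   proof (rule mult_mono[OF mult_left_mono wb(1)])
   have "a * \<bar>g' a0\<bar> <= a0 / th * \<bar>g' a0\<bar>" using aa by (intro mult_right_mono) auto
   also have "... <= (n + ka) * N / th" using g'a th by (simp add: field_simps)
   finally show "a * \<bar>g' a0\<bar> <= (n + ka) * N / th" .
   qed (use n ka0 N th in simp_all)
   finally show ?thesis by (simp add: field_simps)
   qed
   have A2: "\<bar>4 * a * (gx s * w' s)\<bar> <= 4 / th * (1 + n + ka) * (2 * (S + 1)) * N"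
   proof -
   have "a <= 1 / th" using aa a0 th by (meson divide_right_mono less_imp_le order_trans)
   have "\<bar>4 * a * (gx s * w' s)\<bar> = 4 * a * (\<bar>gx s\<bar> * \<bar>w' s\<bar>)" using ann by (simp add: abs_mult)
   also have "... <= 4 * (1 / th) * (((1 + n + ka) * N) * (2 * (S + 1)))"
   using \<open>a <= 1 / th\<close> ann gxs wb n ka0 N S th by (intro mult_mono mult_nonneg_nonneg) auto
   finally show ?thesis by (simp add: field_simps)
   qed
   have A3: "\<bar>\<tau> * (gx s * w s)\<bar> <= (2 * n + C) * (1 + n + ka) * W * N"
   proof -
   have "sqrt s <= 1" using sa a0 s0 by (simp add: order_trans)
   then have "C * sqrt s <= C" using C by (simp add: mult_left_le)
   then have "\<bar>\<tau>\<bar> <= 2 * n + C" using t1 n by linarith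
   have "\<bar>\<tau> * (gx s * w s)\<bar> = \<bar>\<tau>\<bar> * (\<bar>gx s\<bar> * \<bar>w s\<bar>)" by (simp add: abs_mult)
   also have "... <= (2 * n + C) * (((1 + n + ka) * N) * W)"
   using \<open>\<bar>\<tau>\<bar> <= 2 * n + C\<close> gxs wb n ka0 N C by (intro mult_mono mult_nonneg_nonneg) auto
   finally show ?thesis by (simp add: field_simps)
   qed
   have "- 4 * a * G' s - \<tau> * G s = - (4 * a * (g' a0 * w s)) - 4 * a * (gx s * w' s) - \<tau> * (gx s * w s)"
   unfolding G_def G'_def m by (simp add: algebra_simps)
   then have "- 4 * a * G' s - \<tau> * G s >= - (4 / th * (n + ka) * W * N + 4 / th * (1 + n + ka) * (2 * (S + 1)) * N + (2 * n + C) * (1 + n + ka) * W * N)"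
   using A1 A2 A3 by linarith
   also have "(4 / th * (n + ka) * W * N + 4 / th * (1 + n + ka) * (2 * (S + 1)) * N + (2 * n + C) * (1 + n + ka) * W * N) = C0 * N - c * N"
   unfolding C0_def by (simp add: algebra_simps)
   finally have "c * N - C0 * N <= - 4 * a * G' s - \<tau> * G s" by simp
   moreover have "c <= c * N" using cp N by simp
   ultimately show ?thesis using sa a0 S by (simp add: a0_def N_def)
   qed
  qed
  show "EX G G'. (ALL s. (G has_real_derivative G' s) (at s)) & continuous_on UNIV G' \<and>
   (\<forall>s\<ge>S + 1. G s = 0) \<and>
   (ALL s a \<tau>. 0 <= s --> \<bar>\<tau> - 2 * n\<bar> <= C * sqrt s --> \<bar>a - s\<bar> <= C * s * sqrt s --> th * s <= a --> a <= s / th -->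
   c * (if s <= S then 1 else 0) - C0 * r powr (- n) * (if s <= r\<^sup>2 then 1 else 0) <= - 4 * a * G' s - \<tau> * G s)"
   using Gd cont supp main by (intro exI[of _ G] exI[of _ G']) auto
 qed
qed

text \<open>The reverse estimate. The exponential has the opposite sign, and the profile is shifted
  to \<open>s + r\<^sup>2\<close> rather than linearised below \<open>r\<^sup>2\<close>, because the
  shift produces a strictly negative source of size \<open>r powr (- n)\<close> on
  \<open>s <= r\<^sup>2\<close>. The cut-off now acts in the wrong direction and costs the bounded
  term \<open>C'\<close>, supported in \<open>s <= S\<close>.\<close>

lemma barrier_upper:
 fixes n C th :: real
 assumes n: "n >= 1" and C: "C > 0" and th: "0 < th"
 obtains c C' S r0 where "c > 0" "C' > 0" "S > 0" "r0 > 0"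
  "!!r. 0 < r ==> r <= r0 ==> EX G G'. (ALL s. (G has_real_derivative G' s) (at s)) & continuous_on UNIV G' \<and>
   (\<forall>s\<ge>S. G s = 0) \<and>
   (ALL s a \<tau>. 0 <= s --> \<bar>\<tau> - 2 * n\<bar> <= C * sqrt s --> \<bar>a - s\<bar> <= C * s * sqrt s --> th * s <= a --> a <= s / th -->
   - 4 * a * G' s - \<tau> * G s <= C' * (if s <= S then 1 else 0) - c * r powr (- n) * (if s <= r\<^sup>2 then 1 else 0))"
proof -
 \<comment> \<open>Makes \<open>C * sqrt s <= 1/2\<close> on the support of the barrier.\<close>
 define S where "S = (1 / (2 * C))\<^sup>2"
 have S: "S > 0" "sqrt S = 1 / (2 * C)" using C by (simp_all add: S_def del: power_divide)
 \<comment> \<open>The coefficient of \<open>sqrt s\<close> in all errors;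
   \<open>32 / sqrt S\<close> is the cut-off term \<open>16 / sqrt S\<close> divided by
   \<open>v >= 1/2\<close>. The next line doubles it because \<open>s / sqrt t >= sqrt s / 2\<close>
   once \<open>s > r\<^sup>2\<close>.\<close>
 define d where "d = 2*n*C + C + 32 / sqrt S"
 define ka where "ka = 2 * d"
 have d0: "d > 0" using n C S(1) unfolding d_def by (intro add_pos_pos mult_pos_pos divide_pos_pos) auto
 \<comment> \<open>Keeps the error \<open>d * r\<close> below half of the gain \<open>n\<close>, and
   the set \<open>s <= r\<^sup>2\<close> inside \<open>s <= S / 2\<close>.\<close>
 define r0 where "r0 = min (min 1 (n / (2 * d))) (sqrt (S / 4))"
 have r0: "r0 > 0" "r0 <= 1" "d * r0 <= n / 2" "r0\<^sup>2 <= S / 4"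
 proof -
  show "r0 > 0" "r0 <= 1" using n d0 S by (auto simp: r0_def)
  have "r0 <= n / (2 * d)" by (simp add: r0_def)
  then show "d * r0 <= n / 2" using d0 by (simp add: field_simps)
  have "r0 <= sqrt (S / 4)" by (simp add: r0_def)
  then have "r0\<^sup>2 <= (sqrt (S / 4))\<^sup>2" using \<open>r0 > 0\<close> by (intro power_mono) auto
  then show "r0\<^sup>2 <= S / 4" using S by simp
 qed
 define c where "c = n / 8 * 2 powr (- n / 2)"
 have cp: "c > 0" using n by (simp add: c_def)
 define g1 where "g1 = (S / 2) powr (- n / 2) * exp (ka * sqrt (S + 1))"
 have g1p: "g1 > 0" using S by (simp add: g1_def)
 define h1 where "h1 = n / S + ka / (2 * sqrt (S / 2)) + 2 * (1 / S)"
 define C' where "C' = (4 * (S / th) * (h1 * g1) + (2 * n + C * sqrt S) * g1) + 1"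
 have ka0: "ka > 0" using d0 by (simp add: ka_def)
 have h1p: "h1 >= 0" using n S ka0 unfolding h1_def by (intro add_nonneg_nonneg divide_nonneg_nonneg) auto
 have C'p: "C' > 0" using h1p g1p n C S th unfolding C'_def by (intro add_nonneg_pos add_nonneg_nonneg mult_nonneg_nonneg) auto
 show ?thesis
 proof (rule that[OF cp C'p S(1) r0(1)])
  fix r :: real assume r: "0 < r" "r <= r0"
  define si where "si s = max s 0 + r\<^sup>2" for s
  have r2: "r\<^sup>2 > 0" "r\<^sup>2 <= S / 4" "r\<^sup>2 <= 1" "d * r <= n / 2"
  proof -
   have "r\<^sup>2 <= r0\<^sup>2" using r by (intro power_mono) auto
   with r0(4) show "r\<^sup>2 <= S / 4" by linarith
   show "r\<^sup>2 > 0" "r\<^sup>2 <= 1" using r r0 by (auto simp: power_le_one)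
   have "d * r <= d * r0" using r d0 by (intro mult_left_mono) auto
   with r0(3) show "d * r <= n / 2" by linarith
  qed
  define g where "g t = t powr (- n / 2) * exp (ka * sqrt t)" for t :: real
  define l where "l t = n / (2 * t) - ka / (2 * sqrt t)" for t
  have gd: "(g has_real_derivative (- l t * g t)) (at t)" if "t > 0" for t
  proof -
   have "(g has_real_derivative (- n / 2) * t powr (- n / 2 - 1) * exp (ka * sqrt t) + t powr (- n / 2) * (exp (ka * sqrt t) * (ka * (inverse (sqrt t) / 2)))) (at t)"
   unfolding g_def[abs_def] using that by (auto intro!: derivative_eq_intros)
   moreover have e: "t powr (- n / 2 - 1) = t powr (- n / 2) / t"
   using that by (simp add: powr_diff)
   have "(- n / 2) * t powr (- n / 2 - 1) * exp (ka * sqrt t) + t powr (- n / 2) * (exp (ka * sqrt t) * (ka * (inverse (sqrt t) / 2))) = - l t * g t"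
   unfolding e l_def g_def using powr_exp_derivative_eq[of n "t powr (- n / 2)" t "exp (ka * sqrt t)" "- ka" "sqrt t"] by simp
   ultimately show ?thesis by simp
  qed
  have gp: "g t > 0" if "t > 0" for t using that by (simp add: g_def)
  \<comment> \<open>The barrier is evaluated at \<open>s >= 0\<close>; the linear continuation to
    negative \<open>s\<close> makes \<open>G\<close> differentiable on the whole line.\<close>
  define gx where "gx s = (if s >= 0 then g (s + r\<^sup>2) else g (0 + r\<^sup>2) + (- l (0 + r\<^sup>2) * g (0 + r\<^sup>2)) * (s - 0))" for s
  have gxd: "(gx has_real_derivative (- l (si s) * g (si s))) (at s)" for s
  proof -
   have "((%s. g (s + r\<^sup>2)) has_real_derivative (- l (s + r\<^sup>2) * g (s + r\<^sup>2))) (at s)" if "s >= 0" for s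
   proof -
   have "((%s. s + r\<^sup>2) has_real_derivative 1) (at s)" by (auto intro!: derivative_eq_intros)
   moreover have "0 < s + r\<^sup>2" using that r2(1) by linarith
   ultimately show ?thesis using DERIV_chain2[where f=g, OF gd] by fastforce
   qed
   from C1_extend_linear[of 0 "%s. g (s + r\<^sup>2)" "%s. - l (s + r\<^sup>2) * g (s + r\<^sup>2)", OF this]
   show ?thesis unfolding gx_def[abs_def] si_def by simp
  qed
  define w where "w s = (max 0 (1 - s / S))\<^sup>2" for s
  define w' where "w' s = 2 * max 0 (1 - s / S) * (- (1 / S))" for s
  have wd: "(w has_real_derivative w' s) (at s)" for s
  proof -
   have "((%s. 1 - s / S) has_real_derivative - (1 / S)) (at s)" using S by (auto intro!: derivative_eq_intros)
   from DERIV_chain2[where f="%s. max 0 s ^ Suc (Suc 0)", OF DERIV_pos_part_power[of 0] this]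
   show ?thesis by (simp add: w_def[abs_def] w'_def power2_eq_square)
  qed
  define G where "G s = gx s * w s" for s
  define G' where "G' s = (- l (si s) * g (si s)) * w s + gx s * w' s" for s
  have Gd: "(G has_real_derivative G' s) (at s)" for s
   unfolding G_def[abs_def] G'_def by (rule derivative_eq_intros gxd wd refl)+ (simp add: mult.commute)
  have sip: "si s > 0" for s unfolding si_def using r2(1) by linarith
  have cont: "continuous_on UNIV G'"
  proof -
   have "continuous_on UNIV gx" by (rule DERIV_continuous_on, rule gxd)
   moreover have "continuous_on UNIV w" by (rule DERIV_continuous_on, rule wd)
   moreover have "continuous_on UNIV (%s. l (si s))" "continuous_on UNIV (%s. g (si s))"
   proof -
   have "continuous_on UNIV si" unfolding si_def[abs_def] by (intro continuous_intros)
   moreover have "si s \<noteq> 0" for s using sip[of s] by simp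
   ultimately show "continuous_on UNIV (%s. l (si s))" "continuous_on UNIV (%s. g (si s))"
   unfolding l_def g_def by (intro continuous_intros; simp)+
   qed
   moreover have "continuous_on UNIV w'" unfolding w'_def[abs_def] using S(1) by (intro continuous_intros) simp_all
   ultimately show ?thesis unfolding G'_def[abs_def] by (intro continuous_intros)
  qed
  have supp: "G s = 0" if "s >= S" for s using that S by (simp add: G_def w_def max_def)
  have main: "- 4 * a * G' s - \<tau> * G s <= C' * (if s <= S then 1 else 0) - c * r powr (- n) * (if s <= r\<^sup>2 then 1 else 0)"
   if s0: "0 <= s" and t1: "\<bar>\<tau> - 2 * n\<bar> <= C * sqrt s" and t2: "\<bar>a - s\<bar> <= C * s * sqrt s"
   and t3: "th * s <= a" and t4: "a <= s / th" for s a \<tau>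
  proof (cases "s >= S")
   case True
   then have "w s = 0" "w' s = 0" using S by (auto simp: w_def w'_def max_def)
   then show ?thesis using True r2 S C'p by (simp add: G_def G'_def)
  next
   case False
   define t where "t = s + r\<^sup>2"
   have t: "si s = t" "t > 0" "s <= t" using s0 r2(1) unfolding si_def t_def by linarith+
   have gxs: "gx s = g t" using s0 by (simp add: gx_def t_def)
   have ann: "a >= 0" using t3 s0 th by (smt (verit) mult_nonneg_nonneg)
   define v where "v = 1 - s / S"
   have v: "0 < v" "v <= 1" using False s0 S by (auto simp: v_def)
   have wv: "w s = v\<^sup>2" "w' s = - (2 / S) * v" using v by (auto simp: w_def w'_def v_def[symmetric])
   have E: "- 4 * a * G' s - \<tau> * G s = g t * v * ((4 * a * l t - \<tau>) * v + 8 * a * (1 / S))"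
   unfolding G_def G'_def t(1) gxs wv by (simp add: power2_eq_square algebra_simps)
   show ?thesis
   proof (cases "s <= S / 2")
   case True
   define q where "q = sqrt s"
   have q: "q >= 0" "q * q = s" using s0 by (auto simp: q_def)
   define u where "u = sqrt t"
   have u: "u > 0" "u * u = t" using t by (auto simp: u_def)
   have qS: "q <= sqrt S" using False by (simp add: q_def)
   then have Cq: "C * q <= 1/2" using S C by (simp add: field_simps)
   have v2: "v >= 1/2" using True S by (simp add: v_def field_simps)
   have al: "a <= s * (1 + C * q)" and ag: "a >= s / 2"
   proof -
   have "s * (C * q) <= s * (1/2)" using Cq s0 by (intro mult_left_mono) auto
   with t2 show "a <= s * (1 + C * q)" "a >= s / 2" by (auto simp: q_def algebra_simps)
   qed
   have b1: "4 * a * (n / (2 * t)) <= 2 * n * (s / t) + 2 * n * C * q"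
   proof -
   have "4 * a * (n / (2 * t)) = 2 * n * (a / t)" using t by (simp add: field_simps)
   also have "a / t <= s * (1 + C * q) / t" using al t by (intro divide_right_mono) auto
   also have "s * (1 + C * q) / t = s / t + C * q * (s / t)" by (simp add: algebra_simps add_divide_distrib)
   also have "C * q * (s / t) <= C * q * 1" using t C q by (intro mult_left_mono) auto
   finally have "4 * a * (n / (2 * t)) <= 2 * n * (s / t + C * q)" using n by (simp add: mult_left_mono)
   then show ?thesis by (simp add: algebra_simps)
   qed
   have b2: "4 * a * (ka / (2 * u)) >= ka * (s / u)"
   proof -
   have "4 * a * (ka / (2 * u)) >= 4 * (s / 2) * (ka / (2 * u))" using ag ka0 u by (intro mult_right_mono mult_left_mono) auto
   then show ?thesis by (simp add: field_simps)
   qed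
   have b3: "8 * a * (1 / S) <= 16 / sqrt S * q"
   proof -
   have "s * (1 + C * q) <= s * (1 + 1)" using Cq s0 by (intro mult_left_mono) linarith+
   with al have "a <= s * (1 + 1)" by linarith
   then have "8 * a * (1 / S) <= 8 * (2 * s) * (1 / S)" using S by (intro mult_right_mono) auto
   also have "... = 16 * (q * (q / (sqrt S * sqrt S)))"
   proof -
   have SS: "sqrt S * sqrt S = S" using S(1) by simp
   show ?thesis unfolding SS q(2)[symmetric] by simp
   qed
   also have "... <= 16 * (q * (1 / sqrt S))"
   proof -
   have "q / (sqrt S * sqrt S) <= sqrt S / (sqrt S * sqrt S)" using qS S(1) by (intro divide_right_mono) auto
   also have "sqrt S / (sqrt S * sqrt S) = 1 / sqrt S" using S(1) by (simp del: real_sqrt_mult_self)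
   finally have "q / (sqrt S * sqrt S) <= 1 / sqrt S" .
   then show ?thesis using q by (intro mult_left_mono) auto
   qed
   finally show ?thesis by simp
   qed
   have b4: "- \<tau> <= - 2 * n + C * q" using t1 by (simp add: q_def)
   have lt: "4 * a * l t = 4 * a * (n / (2 * t)) - 4 * a * (ka / (2 * u))" by (simp add: l_def u_def algebra_simps)
   have st: "s / t = 1 - r\<^sup>2 / t" using t by (simp add: t_def field_simps)
   have X: "4 * a * l t - \<tau> <= - 2 * n * (r\<^sup>2 / t) + (2 * n * C + C) * q - ka * (s / u)"
   using b1 b2 b4 unfolding lt st by (simp add: algebra_simps)
   have Y: "8 * a * (1 / S) <= v * (32 / sqrt S * q)"
   proof -
   have "(1/2) * (32 / sqrt S * q) <= v * (32 / sqrt S * q)" using v2 q(1) S(1) by (intro mult_right_mono) simp_all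
   then show ?thesis using b3 by simp
   qed
   have "(4 * a * l t - \<tau>) * v <= (- 2 * n * (r\<^sup>2 / t) + (2 * n * C + C) * q - ka * (s / u)) * v"
   using X v by (intro mult_right_mono) auto
   with Y have Z: "(4 * a * l t - \<tau>) * v + 8 * a * (1 / S) <= v * (- 2 * n * (r\<^sup>2 / t) + d * q - ka * (s / u))"
   by (simp add: d_def algebra_simps)
   show ?thesis
   proof (cases "s <= r\<^sup>2")
   case False
   have "u <= 2 * q"
   proof (rule power2_le_imp_le)
   have "t <= 2 * s" using False by (simp add: t_def)
   then show "u\<^sup>2 <= (2 * q)\<^sup>2" using u q s0 by (simp add: power2_eq_square)
   qed (use q in simp)
   have "s > 0" using False r2(1) by linarith
   then have qp: "q > 0" by (simp add: q_def)
   have "s / u >= q * q / (2 * q)" unfolding q(2) using \<open>u <= 2 * q\<close> u s0 by (intro divide_left_mono) auto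
   then have "s / u >= q / 2" using qp by simp
   then have "ka * (s / u) >= ka * (q / 2)" using ka0 by (intro mult_left_mono) auto
   then have "ka * (s / u) >= d * q" by (simp add: ka_def)
   moreover have "2 * n * (r\<^sup>2 / t) >= 0" using n t by auto
   ultimately have "v * (- 2 * n * (r\<^sup>2 / t) + d * q - ka * (s / u)) <= 0"
   using v by (intro mult_nonneg_nonpos) auto
   with Z have "(4 * a * l t - \<tau>) * v + 8 * a * (1 / S) <= 0" by linarith
   then have "- 4 * a * G' s - \<tau> * G s <= 0"
   unfolding E using gp[OF t(2)] v by (intro mult_nonneg_nonpos) auto
   then show ?thesis using False \<open>\<not> s >= S\<close> C'p by simp
   next
   case True
   have "t <= 2 * r\<^sup>2" using True by (simp add: t_def)
   then have "r\<^sup>2 / t >= 1/2" using t by (simp add: field_simps)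
   then have "2 * n * (r\<^sup>2 / t) >= 2 * n * (1/2)" using n by (intro mult_left_mono) auto
   moreover have "q <= r" using True r by (simp add: q_def real_le_lsqrt)
   then have "d * q <= d * r" using d0 by (intro mult_left_mono) auto
   moreover have "ka * (s / u) >= 0" using ka0 s0 u by auto
   ultimately have "- 2 * n * (r\<^sup>2 / t) + d * q - ka * (s / u) <= - (n / 2)" using r2(4) by linarith
   then have "v * (- 2 * n * (r\<^sup>2 / t) + d * q - ka * (s / u)) <= v * (- (n / 2))"
   using v by (intro mult_left_mono) auto
   with Z have "(4 * a * l t - \<tau>) * v + 8 * a * (1 / S) <= - (v * (n / 2))" by linarith
   then have le: "- 4 * a * G' s - \<tau> * G s <= g t * v * (- (v * (n / 2)))"
   unfolding E using gp[OF t(2)] v by (intro mult_left_mono) auto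
   have "g t >= t powr (- n / 2) * 1" unfolding g_def using ka0 u by (intro mult_left_mono) (auto simp: u_def)
   moreover have "t powr (- n / 2) >= (2 * r\<^sup>2) powr (- n / 2)"
   using \<open>t <= 2 * r\<^sup>2\<close> t n by (intro powr_mono2') auto
   moreover have "(2 * r\<^sup>2) powr (- n / 2) = 2 powr (- n / 2) * r powr (- n)"
   using r square_powr_half[of r n] by (simp add: powr_mult)
   ultimately have gt: "g t >= 2 powr (- n / 2) * r powr (- n)" by simp
   have "v * v >= (1/2) * (1/2)" using v2 by (intro mult_mono) auto
   then have "g t * (v * v) >= (2 powr (- n / 2) * r powr (- n)) * (1/4)"
   using gt gp[OF t(2)] by (intro mult_mono) auto
   then have "n / 2 * (g t * (v * v)) >= n / 2 * ((2 powr (- n / 2) * r powr (- n)) * (1/4))"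
   using n by (intro mult_left_mono) auto
   moreover have "n / 2 * ((2 powr (- n / 2) * r powr (- n)) * (1/4)) = c * r powr (- n)" by (simp add: c_def)
   ultimately have "c * r powr (- n) <= n / 2 * (g t * (v * v))" by linarith
   moreover have "g t * v * (- (v * (n / 2))) = - (n / 2 * (g t * (v * v)))" by simp
   ultimately have "- 4 * a * G' s - \<tau> * G s <= - (c * r powr (- n))" using le by linarith
   then show ?thesis using True \<open>\<not> s >= S\<close> C'p by simp
   qed
   next
   case sS: False
   have tS: "S / 2 <= t" "t <= S + 1" using sS False r2(1,3) s0 unfolding t_def by linarith+
   have g1: "g t <= g1"
   unfolding g_def g1_def using tS S n ka0 by (intro mult_mono powr_mono2') auto
   have l1: "\<bar>l t\<bar> + 2 * (1 / S) <= h1"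
   proof -
   have "n / (2 * t) <= n / (2 * (S / 2))" using tS S n by (intro divide_left_mono) auto
   moreover have "ka / (2 * sqrt t) <= ka / (2 * sqrt (S / 2))" using tS S ka0 by (intro divide_left_mono) auto
   moreover have "n / (2 * t) >= 0" "ka / (2 * sqrt t) >= 0" using n ka0 t by auto
   ultimately show ?thesis unfolding l_def h1_def by simp
   qed
   have a1: "a <= S / th" using t4 False th by (meson divide_right_mono less_imp_le not_le order_trans)
   have "\<bar>\<tau>\<bar> <= 2 * n + C * sqrt S"
   proof -
   have "C * sqrt s <= C * sqrt S" using False C by (intro mult_left_mono) auto
   then show ?thesis using t1 n by linarith
   qed
   have "(4 * a * l t - \<tau>) * v <= (4 * a * \<bar>l t\<bar> + \<bar>\<tau>\<bar>) * 1"
   proof (rule mult_mono)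
   have "4 * a * l t <= 4 * a * \<bar>l t\<bar>" using ann by (intro mult_left_mono) auto
   then show "4 * a * l t - \<tau> <= 4 * a * \<bar>l t\<bar> + \<bar>\<tau>\<bar>" by linarith
   qed (use v ann in auto)
   then have "(4 * a * l t - \<tau>) * v + 8 * a * (1 / S) <= 4 * a * (\<bar>l t\<bar> + 2 * (1 / S)) + \<bar>\<tau>\<bar>"
   by (simp add: algebra_simps)
   also have "4 * a * (\<bar>l t\<bar> + 2 * (1 / S)) <= 4 * (S / th) * h1"
   using a1 l1 ann h1p S th by (intro mult_mono) auto
   finally have "(4 * a * l t - \<tau>) * v + 8 * a * (1 / S) <= 4 * (S / th) * h1 + (2 * n + C * sqrt S)"
   using \<open>\<bar>\<tau>\<bar> <= 2 * n + C * sqrt S\<close> by linarith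
   then have "- 4 * a * G' s - \<tau> * G s <= g t * v * (4 * (S / th) * h1 + (2 * n + C * sqrt S))"
   unfolding E using gp[OF t(2)] v by (intro mult_left_mono) auto
   also have "... <= (g1 * 1) * (4 * (S / th) * h1 + (2 * n + C * sqrt S))"
   using g1 gp[OF t(2)] v g1p h1p S th n C by (intro mult_right_mono mult_mono) auto
   also have "... <= C'" by (simp add: C'_def algebra_simps)
   finally have "- 4 * a * G' s - \<tau> * G s <= C'" .
   moreover have "\<not> s <= r\<^sup>2" using sS r2(2) S(1) by linarith
   ultimately show ?thesis using False by simp
   qed
  qed
  show "EX G G'. (ALL s. (G has_real_derivative G' s) (at s)) & continuous_on UNIV G' \<and>
   (\<forall>s\<ge>S. G s = 0) \<and>
   (ALL s a \<tau>. 0 <= s --> \<bar>\<tau> - 2 * n\<bar> <= C * sqrt s --> \<bar>a - s\<bar> <= C * s * sqrt s --> th * s <= a --> a <= s / th -->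
   - 4 * a * G' s - \<tau> * G s <= C' * (if s <= S then 1 else 0) - c * r powr (- n) * (if s <= r\<^sup>2 then 1 else 0))"
   using Gd cont supp main by (intro exI[of _ G] exI[of _ G']) auto
 qed
qed

subsection \<open>Differentiation under the integral\<close>

lemma lborel_integral_compact_support:
 fixes f :: "real ^ 'n::finite => real"
 assumes f: "continuous_on UNIV f" "!!y. norm y > R ==> f y = 0"
 shows "integrable lborel f" "(LINT y|lborel. f y) = integral (cbox (- (\<chi> i. R)) (\<chi> i. R)) f"
proof -
 let ?B = "cbox (- (\<chi> i. R)) (\<chi> i. R) :: (real ^ 'n) set"
 have z: "f y = 0" if "y \<notin> ?B" for y
 proof -
  have "EX i. \<bar>y $ i\<bar> > R"
  proof (rule ccontr)
   assume "\<not> ?thesis"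
   then have "\<bar>y $ i\<bar> <= R" for i by (simp add: not_less)
   then have "- R <= y $ i & y $ i <= R" for i by (simp add: abs_le_iff minus_le_iff)
   then have "y \<in> ?B" by (simp add: mem_box_cart)
   with that show False by simp
  qed
  then have "norm y > R" using component_le_norm_cart[of y] by (meson less_le_trans)
  then show ?thesis by (rule f(2))
 qed
 have "integrable lborel (%x. indicator ?B x *\<^sub>R f x)"
  by (rule borel_integrable_compact[OF compact_cbox]) (use f continuous_on_subset in blast)
 moreover have "(%x. indicator ?B x *\<^sub>R f x) = f"
 proof (rule ext)
  show "indicator ?B x *\<^sub>R f x = f x" for x by (cases "x \<in> ?B") (simp_all add: z)
 qed
 ultimately show i: "integrable lborel f" by simp
 have "(f has_integral (LINT y|lborel. f y)) UNIV" by (rule has_integral_integral_lborel[OF i])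
 moreover have "f = (%x. if x \<in> ?B then f x else 0)" using z by auto
 ultimately have "((%x. if x \<in> ?B then f x else 0) has_integral (LINT y|lborel. f y)) UNIV" by metis
 then have "(f has_integral (LINT y|lborel. f y)) ?B" by (simp add: has_integral_restrict_UNIV)
 then show "(LINT y|lborel. f y) = integral ?B f" by (simp add: integral_unique)
qed

lemma continuous_on_Pair_section:
 assumes "continuous_on UNIV (%(x, y). k x y)"
 shows "continuous_on S (%y. k x y)" "continuous_on S (%x. k x y)"
proof -
 have "continuous_on S (%y. (%(x, y). k x y) (x, y))"
  by (rule continuous_on_compose2[OF assms]) (auto intro!: continuous_intros)
 then show "continuous_on S (%y. k x y)" by simp
 have "continuous_on S (%x. (%(x, y). k x y) (x, y))"
  by (rule continuous_on_compose2[OF assms]) (auto intro!: continuous_intros)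
 then show "continuous_on S (%x. k x y)" by simp
qed

lemma C1_integral:
 fixes k :: "real ^ 'n::finite => real ^ 'n => real"
 assumes kc: "continuous_on UNIV (%(x, y). k x y)"
  and kd: "!!i. continuous_on UNIV (%(x, y). pd i (%x. k x y) x)"
  and C1: "!!y. C1 (%x. k x y)" and supp: "!!x y. norm y > R ==> k x y = 0"
 shows "C1 (%x. LINT y|lborel. k x y)"
  "pd i (%x. LINT y|lborel. k x y) x = (LINT y|lborel. pd i (%x. k x y) x)"
proof -
 let ?B = "cbox (- (\<chi> i. R)) (\<chi> i. R) :: (real ^ 'n) set"
 have supp': "pd i (%x. k x y) x = 0" if "norm y > R" for x y i
 proof -
  have "(%x. k x y) = (%x. 0)" using supp that by auto
  then show ?thesis by (simp only: pd_const)
 qed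
 have e1: "(LINT y|lborel. k x y) = integral ?B (k x)" for x
  by (rule lborel_integral_compact_support(2)[OF continuous_on_Pair_section(1)[OF kc] supp])
 have e2: "(LINT y|lborel. pd i (%x. k x y) x) = integral ?B (%y. pd i (%x. k x y) x)" for x i
  by (rule lborel_integral_compact_support(2)[OF continuous_on_Pair_section(1)[OF kd] supp'])
 have der: "((%s. LINT y|lborel. k (x + s *\<^sub>R axis i 1) y) has_real_derivative (LINT y|lborel. pd i (%x. k x y) x)) (at 0)" for x i
  unfolding e1 e2
 proof (rule DERIV_cong[OF leibniz_rule_field_derivative[where U=UNIV and fx="%s y. pd i (%x. k x y) (x + s *\<^sub>R axis i 1)"]])
  show "((%s. k (x + s *\<^sub>R axis i 1) y) has_real_derivative pd i (%x. k x y) (x + s *\<^sub>R axis i 1)) (at s within UNIV)" for s y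
   using C1_line_deriv[OF C1] by simp
  show "k (x + s *\<^sub>R axis i 1) integrable_on ?B" for s
   by (rule integrable_continuous, rule continuous_on_Pair_section(1)[OF kc])
  have "continuous_on (UNIV \<times> ?B) (%p. (%(x, y). pd i (%x. k x y) x) (x + fst p *\<^sub>R axis i 1, snd p))"
   by (rule continuous_on_compose2[OF kd]) (auto intro!: continuous_intros)
  then show "continuous_on (UNIV \<times> ?B) (%(s, y). pd i (%x. k x y) (x + s *\<^sub>R axis i 1))"
   by (simp add: case_prod_beta')
 qed auto
 have pd: "pd i (%x. LINT y|lborel. k x y) x = (LINT y|lborel. pd i (%x. k x y) x)" for i x
  unfolding pd_def[of i "%x. LINT y|lborel. k x y"] by (rule DERIV_imp_deriv[OF der])
 then show "pd i (%x. LINT y|lborel. k x y) x = (LINT y|lborel. pd i (%x. k x y) x)" .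
 show "C1 (%x. LINT y|lborel. k x y)" unfolding C1_def
 proof (intro conjI allI)
  show "(%s. LINT y|lborel. k (x + s *\<^sub>R axis i 1) y) field_differentiable at 0" for i x
   using der by (auto simp: field_differentiable_def)
  have "continuous_on UNIV (%x. integral ?B (%y. pd i (%x. k x y) x))" for i
   by (rule integral_continuous_on_param) (rule continuous_on_subset[OF kd], simp)
  then show "continuous_on UNIV (pd i (%x. LINT y|lborel. k x y))" for i
   by (simp add: pd[abs_def] e2)
 qed
qed

context periodic_diffusion
begin

lemma Lop_explicit:
 assumes "C2 h"
 shows "Lop b h x = (\<Sum>i\<in>UNIV. \<Sum>j\<in>UNIV. pd i (%y. A y $ i $ j) x * pd j h x + A x $ i $ j * pd i (pd j h) x)
  + (\<Sum>i\<in>UNIV. b x $ i * pd i h x)"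
 by (simp add: Lop_def D_explicit[OF assms] inner_vec_def)

lemma C2_integral:
 fixes k :: "real ^ 'n => real ^ 'n => real"
 assumes kc: "continuous_on UNIV (%(x, y). k x y)"
  and kd: "!!i. continuous_on UNIV (%(x, y). pd i (%x. k x y) x)"
  and kdd: "!!i j. continuous_on UNIV (%(x, y). pd i (pd j (%x. k x y)) x)"
  and C2: "!!y. C2 (%x. k x y)" and supp: "!!x y. norm y > R ==> k x y = 0"
 shows "C2 (%x. LINT y|lborel. k x y)"
  "Lop b (%x. LINT y|lborel. k x y) x = (LINT y|lborel. Lop b (%x. k x y) x)"
  "integrable lborel (%y. Lop b (%x. k x y) x)"
proof -
 have z: "pd i (%x. k x y) x = 0" if "norm y > R" for x y i
 proof -
  have "(%x. k x y) = (%x. 0)" using supp that by auto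
  then show ?thesis by (simp only: pd_const)
 qed
 have zz: "pd i (pd j (%x. k x y)) x = 0" if "norm y > R" for x y i j
 proof -
  have "pd j (%x. k x y) = (%x. 0)" using z that by auto
  then show ?thesis by (simp only: pd_const)
 qed
 note I1 = C1_integral[OF kc kd C2_C1[OF C2] supp]
 have p1: "pd j (%x. LINT y|lborel. k x y) = (%x. LINT y|lborel. pd j (%x. k x y) x)" for j
  using I1(2) by auto
 note I2 = C1_integral[where k="%x y. pd j (%x. k x y) x" for j, OF kd kdd C2_pd[OF C2] z]
 show C: "C2 (%x. LINT y|lborel. k x y)" unfolding C2_def p1 using I1(1) I2(1) by blast
 have p1x: "pd j (%x. LINT y|lborel. k x y) x = (LINT y|lborel. pd j (%x. k x y) x)" for j
  by (simp only: p1)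
 have p2: "pd i (pd j (%x. LINT y|lborel. k x y)) x = (LINT y|lborel. pd i (pd j (%x. k x y)) x)" for i j
  unfolding p1 by (rule I2(2))
 have i1: "integrable lborel (%y. pd i (%x. k x y) x)" for i
  by (rule lborel_integral_compact_support(1)[OF continuous_on_Pair_section(1)[OF kd] z])
 have i2: "integrable lborel (%y. pd i (pd j (%x. k x y)) x)" for i j
  by (rule lborel_integral_compact_support(1)[OF continuous_on_Pair_section(1)[OF kdd] zz])
 show "integrable lborel (%y. Lop b (%x. k x y) x)"
  unfolding Lop_explicit[OF C2] using i1 i2 by auto
 show "Lop b (%x. LINT y|lborel. k x y) x = (LINT y|lborel. Lop b (%x. k x y) x)"
  unfolding Lop_explicit[OF C] Lop_explicit[OF C2] p2 p1x
  using i1 i2 by (simp add: Bochner_Integration.integral_add Bochner_Integration.integral_sum)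
qed

subsection \<open>The frozen quadratic form\<close>

definition Kf :: "real ^ 'n => real ^ 'n ^ 'n" where "Kf y = matrix_inv (A y)"

lemma A_lower: "\<alpha>0 * norm v <= norm (A x *v v)"
proof (cases "v = 0")
 case False
 have "\<alpha>0 * (norm v)\<^sup>2 <= norm v * norm (A x *v v)"
  using elliptic[of v x] norm_cauchy_schwarz[of v "A x *v v"] by linarith
 then show ?thesis using False by (simp add: power2_eq_square)
qed simp

lemma Kf_inv: "A y *v (Kf y *v z) = z" "Kf y *v (A y *v z) = z"
proof -
 have "invertible (A y)"
  unfolding invertible_left_inverse matrix_left_invertible_ker
 proof (intro allI impI)
  fix v assume "A y *v v = 0"
  then show "v = 0" using A_lower[of v y] \<alpha>0 by (simp add: mult_le_0_iff)
 qed
 then have "A y ** Kf y = mat 1 & Kf y ** A y = mat 1"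
  unfolding Kf_def matrix_inv_def invertible_def by (rule someI_ex)
 then show "A y *v (Kf y *v z) = z" "Kf y *v (A y *v z) = z"
  by (simp_all add: matrix_vector_mul_assoc)
qed

lemma Kf_norm: "\<alpha>0 * norm (Kf y *v z) <= norm z"
 using A_lower[of "Kf y *v z" y] by (simp add: Kf_inv)

lemma Kf_sym: "inner u (Kf y *v v) = inner v (Kf y *v u)"
 using A_inner_sym[of "Kf y *v v" y "Kf y *v u"] by (simp add: Kf_inv inner_commute)

lemma Kf_entry: "Kf y $ i $ j = (Kf y *v axis j 1) $ i"
 by (simp add: matrix_vector_mul_component inner_axis)

lemma A_vec_cont: "continuous_on S (%y. A y *v w)"
 unfolding matrix_vector_mult_def
 by (intro continuous_on_vec_lambda continuous_intros C1_cont A_C1)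

lemma Kf_cont: "continuous_on S (%y. Kf y $ i $ j)"
proof -
 have "isCont (%y. Kf y *v v) y0" for v y0
  unfolding isCont_def
 proof (rule Lim_null[THEN iffD2], rule Lim_null_comparison)
  let ?w = "Kf y0 *v v"
  have "isCont (%y. A y *v ?w) y0"
   using A_vec_cont[of UNIV ?w] by (simp add: continuous_on_eq_continuous_at)
  then have "((%y. norm (A y0 *v ?w - A y *v ?w) / \<alpha>0) \<longlongrightarrow> norm (A y0 *v ?w - A y0 *v ?w) / \<alpha>0) (at y0)"
   using \<alpha>0 unfolding isCont_def by (intro tendsto_intros) auto
  then show "((%y. norm (A y0 *v ?w - A y *v ?w) / \<alpha>0) \<longlongrightarrow> 0) (at y0)" by simp
  have "norm (Kf y *v v - Kf y0 *v v) <= norm (A y0 *v ?w - A y *v ?w) / \<alpha>0" for y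
  proof -
   have "Kf y *v v - Kf y0 *v v = Kf y *v (A y0 *v ?w - A y *v ?w)"
   by (simp add: matrix_vector_mult_diff_distrib Kf_inv)
   then show ?thesis using Kf_norm[of y "A y0 *v ?w - A y *v ?w"] \<alpha>0 by (simp add: field_simps)
  qed
  then show "\<forall>\<^sub>F y in at y0. norm (Kf y *v v - Kf y0 *v v) <= norm (A y0 *v ?w - A y *v ?w) / \<alpha>0"
   by (intro always_eventually) auto
 qed
 then have "continuous_on S (%y. Kf y *v v)" for v
  by (intro continuous_at_imp_continuous_on) blast
 then show ?thesis unfolding Kf_entry by (rule continuous_on_component)
qed

text \<open>Squared distance in the metric of the coefficients frozen at \<open>y\<close>. It is a
  quadratic polynomial in \<open>x\<close>, so derivatives in \<open>x\<close> cost no smoothness of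
  the inverse matrix, and at \<open>x = y\<close> the operator takes it to exactly twice the
  dimension.\<close>

definition qf :: "real ^ 'n => real ^ 'n => real" where
 "qf y x = inner (x - y) (Kf y *v (x - y))"

lemma qf_GDERIV: "GDERIV (qf y) x :> 2 *\<^sub>R (Kf y *v (x - y))"
proof -
 have bl: "((%x. Kf y *v (x - y)) has_derivative (%h. Kf y *v h)) (at x)"
  by (rule bounded_linear.has_derivative[OF matrix_vector_mul_bounded_linear]) (auto intro!: derivative_eq_intros)
 have "((%x. inner (x - y) (Kf y *v (x - y))) has_derivative (%h. inner (x - y) (Kf y *v h) + inner h (Kf y *v (x - y)))) (at x)"
  by (rule has_derivative_inner[OF _ bl]) (auto intro!: derivative_eq_intros)
 moreover have "inner (x - y) (Kf y *v h) = inner h (Kf y *v (x - y))" for h by (rule Kf_sym)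
 ultimately show ?thesis unfolding gderiv_def qf_def[abs_def] by (simp add: inner_scaleR_right)
qed

lemma qf_grad: "grad (qf y) x = 2 *\<^sub>R (Kf y *v (x - y))"
 by (rule GDERIV_grad[OF qf_GDERIV])

lemma qf_pd: "pd j (qf y) x = 2 * (Kf y *v (x - y)) $ j"
 using arg_cong[OF qf_grad[of y x], of "%v. v $ j"] by simp

lemma lin_GDERIV: "GDERIV (%x. (2 *\<^sub>R (M *v (x - y))) $ j) x :> 2 *\<^sub>R (M $ j)" for M :: "real ^ 'n ^ 'n"
 unfolding gderiv_def
proof -
 have "((%x. inner (2 *\<^sub>R (M $ j)) (x - y)) has_derivative (%h. inner (2 *\<^sub>R (M $ j)) h)) (at x)"
  by (auto intro!: derivative_eq_intros)
 then show "((%x. (2 *\<^sub>R (M *v (x - y))) $ j) has_derivative (%h. inner h (2 *\<^sub>R (M $ j)))) (at x)"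
  by (simp add: matrix_vector_mul_component inner_commute)
qed

lemma qf_C2: "C2 (qf y)"
proof (rule C2I[OF _ qf_grad])
 show "C1 (qf y)"
  by (rule C1I[OF qf_GDERIV])
   (auto intro!: continuous_intros linear_continuous_on_compose[OF _ matrix_vector_mul_linear])
 show "C1 (%x. (2 *\<^sub>R (Kf y *v (x - y))) $ i)" for i
  by (rule C1I[OF lin_GDERIV]) auto
qed

lemma qf_pd2: "pd i (pd j (qf y)) x = 2 * Kf y $ j $ i"
proof -
 have "pd j (qf y) = (%x. (2 *\<^sub>R (Kf y *v (x - y))) $ j)" by (rule ext) (simp add: qf_pd)
 then show ?thesis using GDERIV_pd(2)[OF lin_GDERIV, of i "Kf y" y j x] by simp
qed

lemma Lop_qf_compose:
 assumes G: "!!s. (P has_real_derivative - G s) (at s)" "!!s. (G has_real_derivative G' s) (at s)" "continuous_on UNIV G'"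
 shows "C2 (%x. P (qf y x))"
  "Lop b (%x. P (qf y x)) x = - 4 * inner (Kf y *v (x - y)) (A x *v (Kf y *v (x - y))) * G' (qf y x) - Lop b (qf y) x * G (qf y x)"
  "pd j (%x. P (qf y x)) x = - G (qf y x) * (2 * (Kf y *v (x - y)) $ j)"
  "pd i (pd j (%x. P (qf y x))) x = - G' (qf y x) * (2 * (Kf y *v (x - y)) $ i) * (2 * (Kf y *v (x - y)) $ j) - G (qf y x) * (2 * Kf y $ j $ i)"
proof -
 have c: "continuous_on UNIV (%x. - G' (qf y x))"
  by (intro continuous_intros continuous_on_compose2[OF G(3)] C2_cont qf_C2) auto
 have g: "((%s. - G s) has_real_derivative - G' s) (at s)" for s by (intro DERIV_minus G)
 show "C2 (%x. P (qf y x))"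
  by (rule C2_compose[OF qf_C2, where F'="%s. - G s" and F''="%s. - G' s"]) (use G(1) g c in auto)
 have gr: "grad (%x. P (qf y x)) x = - G (qf y x) *\<^sub>R grad (qf y) x" for x
  by (rule grad_compose[OF C2_C1[OF qf_C2], where F'="%s. - G s"]) (rule G(1))
 have "D (%x. P (qf y x)) x = - G (qf y x) * D (qf y) x + - G' (qf y x) * inner (grad (qf y) x) (A x *v grad (qf y) x)"
  by (rule D_compose[OF qf_C2, where F'="%s. - G s" and F''="%s. - G' s"]) (use G(1) g c in auto)
 then show "Lop b (%x. P (qf y x)) x = - 4 * inner (Kf y *v (x - y)) (A x *v (Kf y *v (x - y))) * G' (qf y x) - Lop b (qf y) x * G (qf y x)"
  by (simp add: Lop_def gr qf_grad matrix_vector_mult_scaleR algebra_simps)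
 have pj: "pd j (%x. P (qf y x)) = (%x. - G (qf y x) * (2 *\<^sub>R (Kf y *v (x - y))) $ j)" for j
 proof (rule ext)
  show "pd j (%x. P (qf y x)) x = - G (qf y x) * (2 *\<^sub>R (Kf y *v (x - y))) $ j" for x
   using arg_cong[OF gr[of x], of "%v. v $ j"] by (simp add: qf_pd)
 qed
 show "pd j (%x. P (qf y x)) x = - G (qf y x) * (2 * (Kf y *v (x - y)) $ j)" by (simp add: pj)
 have C1G: "C1 (%x. - G (qf y x))"
  by (rule C1_compose[OF C2_C1[OF qf_C2], where F'="%s. - G' s"]) (use g c in auto)
 have lin: "C1 (%x. (2 *\<^sub>R (Kf y *v (x - y))) $ j)" for j
  by (rule C1I[OF lin_GDERIV]) auto
 have "grad (%x. - G (qf y x)) x = - G' (qf y x) *\<^sub>R grad (qf y) x"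
  by (rule grad_compose[OF C2_C1[OF qf_C2], where F'="%s. - G' s"]) (rule g)
 then have "grad (%x. - G (qf y x) * (2 *\<^sub>R (Kf y *v (x - y))) $ j) x
   = - G (qf y x) *\<^sub>R (2 *\<^sub>R (Kf y $ j)) + (2 *\<^sub>R (Kf y *v (x - y))) $ j *\<^sub>R (- G' (qf y x) *\<^sub>R (2 *\<^sub>R (Kf y *v (x - y))))"
  by (subst grad_mult[OF C1G lin], subst GDERIV_grad[OF lin_GDERIV]) (simp add: qf_grad)
 from arg_cong[OF this, of "%v. v $ i"]
 show "pd i (pd j (%x. P (qf y x))) x = - G' (qf y x) * (2 * (Kf y *v (x - y)) $ i) * (2 * (Kf y *v (x - y)) $ j) - G (qf y x) * (2 * Kf y $ j $ i)"
  unfolding pj by (simp add: algebra_simps)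
qed

lemma entry_lipschitz:
 obtains K where "K > 0" "!!i j x y. \<bar>A x $ i $ j - A y $ i $ j\<bar> <= K * norm (x - y)"
  "!!i j x. \<bar>A x $ i $ j\<bar> <= K" "!!i j l x. \<bar>pd l (%y. A y $ i $ j) x\<bar> <= K"
proof -
 have per: "periodic L (%x. A x $ i $ j)" for i j using A_per by (simp add: periodic_def)
 have "\<exists>K>0. ALL x. norm (A x $ i $ j) <= K & norm (grad (%y. A y $ i $ j) x) <= K" for i j
 proof -
  obtain K1 where "K1 > 0" "!!x. norm (A x $ i $ j) <= K1"
   using periodic_bounded[OF L_pos per C1_cont[OF A_C1]] by blast
  moreover obtain K2 where "K2 > 0" "!!x. norm (grad (%y. A y $ i $ j) x) <= K2"
   using periodic_bounded[OF L_pos periodic_grad[OF per] C1_grad_cont[OF A_C1]] by blast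
  ultimately show ?thesis by (intro exI[of _ "max K1 K2"]) (auto simp: le_max_iff_disj)
 qed
 then obtain Kf where Kf: "!!i j. Kf i j > 0" "!!i j x. norm (A x $ i $ j) <= Kf i j"
  "!!i j x. norm (grad (%y. A y $ i $ j) x) <= Kf i j" by metis
 define K where "K = Max (range (%(i, j). Kf i j))"
 have K: "Kf i j <= K" for i j unfolding K_def by (rule Max_ge) auto
 show ?thesis
 proof (rule that)
  show "K > 0" using Kf(1) K by (meson less_le_trans)
  show "\<bar>A x $ i $ j\<bar> <= K" for i j x using Kf(2)[of x i j] K[of i j] by auto
  show "\<bar>pd l (%y. A y $ i $ j) x\<bar> <= K" for i j l x
   using component_le_norm_cart[of "grad (%y. A y $ i $ j) x" l] Kf(3)[of i j x] K[of i j] by simp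
  show "\<bar>A x $ i $ j - A y $ i $ j\<bar> <= K * norm (x - y)" for i j x y
  proof -
   let ?h = "%y. A y $ i $ j"
   have "\<bar>?h (y + 1 *\<^sub>R (x - y)) - ?h (y + 0 *\<^sub>R (x - y))\<bar> <= K * norm (x - y) * \<bar>1 - 0\<bar>"
   proof (rule field_differentiable_bound[where S="{0..1::real}" and f="%s. ?h (y + s *\<^sub>R (x - y))", unfolded real_norm_def])
   fix s :: real assume "s \<in> {0..1}"
   show "((%s. ?h (y + s *\<^sub>R (x - y))) has_field_derivative inner (x - y) (grad ?h (y + s *\<^sub>R (x - y)))) (at s within {0..1})"
   by (rule has_field_derivative_at_within[OF C1_line[OF A_C1]])
   have "\<bar>inner (x - y) (grad ?h (y + s *\<^sub>R (x - y)))\<bar> <= norm (x - y) * norm (grad ?h (y + s *\<^sub>R (x - y)))"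
   by (rule Cauchy_Schwarz_ineq2)
   also have "... <= norm (x - y) * K" using Kf(3)[of i j] K[of i j] by (intro mult_left_mono) (auto intro: order_trans)
   finally show "\<bar>inner (x - y) (grad ?h (y + s *\<^sub>R (x - y)))\<bar> <= K * norm (x - y)" by (simp add: mult.commute)
   qed auto
   then show ?thesis by simp
  qed
 qed
qed

lemma matrix_bound:
 fixes M :: "real ^ 'n ^ 'n"
 assumes "!!i j. \<bar>M $ i $ j\<bar> <= B"
 shows "norm (M *v v) <= (real CARD('n))\<^sup>2 * B * norm v"
proof -
 have "norm (M *v v) <= (\<Sum>i\<in>UNIV. \<bar>(M *v v) $ i\<bar>)" by (rule norm_le_l1_cart)
 also have "... <= (\<Sum>i\<in>(UNIV :: 'n set). real CARD('n) * (B * norm v))"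
 proof (rule sum_mono)
  fix i
  have "\<bar>(M *v v) $ i\<bar> <= (\<Sum>j\<in>UNIV. \<bar>M $ i $ j * v $ j\<bar>)"
   unfolding matrix_vector_mult_def by simp
  also have "... <= (\<Sum>j\<in>(UNIV :: 'n set). B * norm v)"
   unfolding abs_mult by (intro sum_mono mult_mono assms component_le_norm_cart) (use assms order_trans abs_ge_zero in blast)+
  finally show "\<bar>(M *v v) $ i\<bar> <= real CARD('n) * (B * norm v)" by simp
 qed
 finally show ?thesis by (simp add: power2_eq_square)
qed

lemma qf_estimates:
 assumes Bd: "Bd >= 0"
 obtains C th where "C > 0" "th > 0"
  "!!b x y. norm (b x) <= Bd ==> \<bar>Lop b (qf y) x - 2 * real CARD('n)\<bar> <= C * sqrt (qf y x)"
  "!!x y. \<bar>inner (Kf y *v (x - y)) (A x *v (Kf y *v (x - y))) - qf y x\<bar> <= C * qf y x * sqrt (qf y x)"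
  "!!x y. th * qf y x <= inner (Kf y *v (x - y)) (A x *v (Kf y *v (x - y)))"
  "!!x y. inner (Kf y *v (x - y)) (A x *v (Kf y *v (x - y))) <= qf y x / th"
  "!!x y. th * (norm (x - y))\<^sup>2 <= qf y x" "!!x y. qf y x <= (norm (x - y))\<^sup>2 / th"
proof -
 obtain K where K: "K > 0" "!!i j x y. \<bar>A x $ i $ j - A y $ i $ j\<bar> <= K * norm (x - y)"
  "!!i j x. \<bar>A x $ i $ j\<bar> <= K" "!!i j l x. \<bar>pd l (%y. A y $ i $ j) x\<bar> <= K"
  using entry_lipschitz by blast
 define m where "m = (real CARD('n))\<^sup>2"
 have m1: "m >= 1" by (simp add: m_def)
 define a1 where "a1 = max 1 (m * K)"
 have a1: "a1 >= 1" "a1 > 0" by (auto simp: a1_def)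
 have An: "norm (A x *v v) <= a1 * norm v" for x v
 proof -
  have "norm (A x *v v) <= m * K * norm v" unfolding m_def by (rule matrix_bound[OF K(3)])
  also have "... <= a1 * norm v" by (intro mult_right_mono) (auto simp: a1_def)
  finally show ?thesis .
 qed
 have q1: "\<alpha>0 * (norm (Kf y *v (x - y)))\<^sup>2 <= qf y x" for x y
  using elliptic[of "Kf y *v (x - y)" y] by (simp add: qf_def Kf_inv inner_commute)
 have q2: "norm (x - y) <= a1 * norm (Kf y *v (x - y))" for x y
  using An[of y "Kf y *v (x - y)"] by (simp add: Kf_inv)
 have q3: "qf y x <= a1 * (norm (Kf y *v (x - y)))\<^sup>2" for x y
 proof -
  have "qf y x <= norm (x - y) * norm (Kf y *v (x - y))" unfolding qf_def by (rule norm_cauchy_schwarz)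
  also have "... <= (a1 * norm (Kf y *v (x - y))) * norm (Kf y *v (x - y))" by (intro mult_right_mono q2) auto
  finally show ?thesis by (simp add: power2_eq_square mult_ac)
 qed
 have q4: "(\<alpha>0 / a1\<^sup>2) * (norm (x - y))\<^sup>2 <= qf y x" for x y
 proof -
  have "(norm (x - y))\<^sup>2 <= (a1 * norm (Kf y *v (x - y)))\<^sup>2" by (intro power_mono q2) auto
  then have "(\<alpha>0 / a1\<^sup>2) * (norm (x - y))\<^sup>2 <= (\<alpha>0 / a1\<^sup>2) * (a1 * norm (Kf y *v (x - y)))\<^sup>2"
   using \<alpha>0 by (intro mult_left_mono) auto
  also have "... = \<alpha>0 * (norm (Kf y *v (x - y)))\<^sup>2" using a1 by (simp add: power_mult_distrib)
  finally show ?thesis using q1[of y x] by linarith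
 qed
 have qnn: "qf y x >= 0" for x y using q1[of y x] \<alpha>0 by (smt (verit) mult_nonneg_nonneg zero_le_power2)
 have q5: "qf y x <= (norm (x - y))\<^sup>2 / \<alpha>0" for x y
 proof -
  have "qf y x <= norm (x - y) * norm (Kf y *v (x - y))" unfolding qf_def by (rule norm_cauchy_schwarz)
  also have "... <= norm (x - y) * (norm (x - y) / \<alpha>0)"
   using Kf_norm[of y "x - y"] \<alpha>0 by (intro mult_left_mono) (auto simp: field_simps)
  finally show ?thesis by (simp add: power2_eq_square mult_ac)
 qed
 define e where "e = a1 / sqrt \<alpha>0"
 have e0: "e > 0" using a1 \<alpha>0 by (simp add: e_def)
 have zq: "norm (x - y) <= e * sqrt (qf y x)" for x y
 proof (rule power2_le_imp_le)
  have "(e * sqrt (qf y x))\<^sup>2 = a1\<^sup>2 / \<alpha>0 * qf y x"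
   using \<alpha>0 qnn by (simp add: e_def power_mult_distrib power_divide)
  moreover have "(norm (x - y))\<^sup>2 = a1\<^sup>2 / \<alpha>0 * ((\<alpha>0 / a1\<^sup>2) * (norm (x - y))\<^sup>2)" using \<alpha>0 a1 by simp
  moreover have "a1\<^sup>2 / \<alpha>0 * ((\<alpha>0 / a1\<^sup>2) * (norm (x - y))\<^sup>2) <= a1\<^sup>2 / \<alpha>0 * qf y x"
   using q4[of x y] \<alpha>0 by (intro mult_left_mono) auto
  ultimately show "(norm (x - y))\<^sup>2 <= (e * sqrt (qf y x))\<^sup>2" by linarith
 qed (use e0 qnn in simp)
 define d where "d = m * K * e / \<alpha>0"
 define d2 where "d2 = 2 * ((m * K + m * K + Bd) / \<alpha>0) * e"
 define C where "C = max d d2"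
 have d0: "d > 0" using m1 K(1) e0 \<alpha>0 by (simp add: d_def)
 define th where "th = min (\<alpha>0 / a1\<^sup>2) (min (\<alpha>0 / a1) \<alpha>0)"
 have th: "th > 0" "th <= \<alpha>0 / a1\<^sup>2" "th <= \<alpha>0 / a1" "th <= \<alpha>0" using \<alpha>0 a1 by (auto simp: th_def)
 show ?thesis
 proof (rule that[of C th])
  show "C > 0" using d0 by (simp add: C_def)
  show "th > 0" by (rule th(1))
  fix x y
  let ?k = "Kf y *v (x - y)"
  let ?a = "inner ?k (A x *v ?k)"
  have aL: "\<alpha>0 * (norm ?k)\<^sup>2 <= ?a" by (rule elliptic)
  have aU: "?a <= a1 * (norm ?k)\<^sup>2"
  proof -
   have "?a <= norm ?k * norm (A x *v ?k)" by (rule norm_cauchy_schwarz)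
   also have "... <= norm ?k * (a1 * norm ?k)" by (intro mult_left_mono An) auto
   finally show ?thesis by (simp add: power2_eq_square mult_ac)
  qed
  show "th * qf y x <= ?a"
  proof -
   have "th * qf y x <= (\<alpha>0 / a1) * (a1 * (norm ?k)\<^sup>2)"
   using th q3[of y x] qnn \<alpha>0 a1 by (intro mult_mono) auto
   then show ?thesis using aL a1 by simp
  qed
  show "?a <= qf y x / th"
  proof -
   have "(norm ?k)\<^sup>2 <= qf y x / \<alpha>0" using q1[of y x] \<alpha>0 by (simp add: field_simps)
   then have "a1 * (norm ?k)\<^sup>2 <= a1 * (qf y x / \<alpha>0)" using a1 by (intro mult_left_mono) auto
   also have "... = qf y x / (\<alpha>0 / a1)" using a1 \<alpha>0 by simp
   also have "... <= qf y x / th" using th qnn a1 \<alpha>0 by (intro divide_left_mono) auto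
   finally show ?thesis using aU by linarith
  qed
  show "th * (norm (x - y))\<^sup>2 <= qf y x"
   using q4[of x y] mult_right_mono[OF th(2), of "(norm (x - y))\<^sup>2"] by simp
  show "qf y x <= (norm (x - y))\<^sup>2 / th"
  proof -
   have "(norm (x - y))\<^sup>2 / \<alpha>0 <= (norm (x - y))\<^sup>2 / th" using th \<alpha>0 by (intro divide_left_mono) auto
   with q5[of y x] show ?thesis by linarith
  qed
  have dA: "norm ((A x - A y) *v v) <= m * K * norm (x - y) * norm v" for v
   using matrix_bound[of "A x - A y" "K * norm (x - y)" v] K(2) by (simp add: m_def mult.assoc)
  show "\<bar>?a - qf y x\<bar> <= C * qf y x * sqrt (qf y x)"
  proof -
   have "qf y x = inner ?k (A y *v ?k)" by (simp add: qf_def Kf_inv inner_commute)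
   then have "?a - qf y x = inner ?k ((A x - A y) *v ?k)"
   by (simp add: matrix_vector_mult_diff_rdistrib inner_diff_right)
   then have "\<bar>?a - qf y x\<bar> <= norm ?k * norm ((A x - A y) *v ?k)" by (simp add: Cauchy_Schwarz_ineq2)
   also have "... <= norm ?k * (m * K * norm (x - y) * norm ?k)" by (intro mult_left_mono dA) auto
   also have "... = (m * K) * (norm ?k)\<^sup>2 * norm (x - y)" by (simp add: power2_eq_square mult_ac)
   also have "... <= (m * K) * (qf y x / \<alpha>0) * (e * sqrt (qf y x))"
   using q1[of y x] \<alpha>0 m1 K(1) zq[of x y] qnn by (intro mult_mono) (auto simp: field_simps)
   also have "... = d * (qf y x * sqrt (qf y x))" by (simp add: d_def)
   also have "... <= C * (qf y x * sqrt (qf y x))" using qnn by (intro mult_right_mono) (auto simp: C_def)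
   finally show ?thesis by (simp add: mult.assoc)
  qed
  fix b :: "real ^ 'n => real ^ 'n" assume b: "norm (b x) <= Bd"
  show "\<bar>Lop b (qf y) x - 2 * real CARD('n)\<bar> <= C * sqrt (qf y x)"
  proof -
   have kn: "norm ?k <= norm (x - y) / \<alpha>0" using Kf_norm[of y "x - y"] \<alpha>0 by (simp add: field_simps)
   have pdq: "pd j (qf y) x = 2 * ?k $ j" for j by (rule qf_pd)
   \<comment> \<open>Twice the trace of \<open>A y\<close> times its inverse.\<close>
   have tr: "(\<Sum>i\<in>UNIV. \<Sum>j\<in>UNIV. A y $ i $ j * (2 * Kf y $ j $ i)) = 2 * real CARD('n)"
   proof -
   have "(\<Sum>j\<in>UNIV. A y $ i $ j * (2 * Kf y $ j $ i)) = 2 * (A y *v (Kf y *v axis i 1)) $ i" for i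
   by (simp add: matrix_vector_mult_def[of "A y"] Kf_entry sum_distrib_left algebra_simps)
   then show ?thesis by (simp add: Kf_inv)
   qed
   have e1: "Lop b (qf y) x - 2 * real CARD('n) = (\<Sum>i\<in>UNIV. \<Sum>j\<in>UNIV. pd i (%y. A y $ i $ j) x * (2 * ?k $ j))
   + (\<Sum>i\<in>UNIV. \<Sum>j\<in>UNIV. (A x $ i $ j - A y $ i $ j) * (2 * Kf y $ j $ i)) + inner (b x) (2 *\<^sub>R ?k)"
   unfolding tr[symmetric] by (simp add: Lop_def D_explicit[OF qf_C2] pdq qf_pd2 qf_grad sum.distrib left_diff_distrib sum_subtractf)
   have b1: "\<bar>\<Sum>i\<in>UNIV. \<Sum>j\<in>UNIV. pd i (%y. A y $ i $ j) x * (2 * ?k $ j)\<bar> <= m * (K * (2 * (norm (x - y) / \<alpha>0)))"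
   proof -
   have "\<bar>\<Sum>i\<in>UNIV. \<Sum>j\<in>UNIV. pd i (%y. A y $ i $ j) x * (2 * ?k $ j)\<bar> <= (\<Sum>i\<in>UNIV. \<Sum>j\<in>UNIV. \<bar>pd i (%y. A y $ i $ j) x * (2 * ?k $ j)\<bar>)"
   by (intro order_trans[OF sum_abs] sum_mono sum_abs)
   also have "... <= (\<Sum>i\<in>(UNIV::'n set). \<Sum>j\<in>(UNIV::'n set). K * (2 * (norm (x - y) / \<alpha>0)))"
   unfolding abs_mult using K(1) component_le_norm_cart[of ?k] kn
   by (intro sum_mono mult_mono K(4)) (auto intro: order_trans)
   finally show ?thesis by (simp add: m_def power2_eq_square)
   qed
   have b2: "\<bar>\<Sum>i\<in>UNIV. \<Sum>j\<in>UNIV. (A x $ i $ j - A y $ i $ j) * (2 * Kf y $ j $ i)\<bar> <= m * ((K * norm (x - y)) * (2 * (1 / \<alpha>0)))"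
   proof -
   have kb: "\<bar>Kf y $ j $ i\<bar> <= 1 / \<alpha>0" for i j
   using component_le_norm_cart[of "Kf y *v axis i 1" j] Kf_norm[of y "axis i 1"] \<alpha>0
   by (simp add: Kf_entry[symmetric] field_simps) (metis mult.commute mult_left_mono less_imp_le order_trans)
   have "\<bar>\<Sum>i\<in>UNIV. \<Sum>j\<in>UNIV. (A x $ i $ j - A y $ i $ j) * (2 * Kf y $ j $ i)\<bar> <= (\<Sum>i\<in>UNIV. \<Sum>j\<in>UNIV. \<bar>(A x $ i $ j - A y $ i $ j) * (2 * Kf y $ j $ i)\<bar>)"
   by (intro order_trans[OF sum_abs] sum_mono sum_abs)
   also have "... <= (\<Sum>i\<in>(UNIV::'n set). \<Sum>j\<in>(UNIV::'n set). (K * norm (x - y)) * (2 * (1 / \<alpha>0)))"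
   unfolding abs_mult using K(1) kb by (intro sum_mono mult_mono K(2)) auto
   finally show ?thesis by (simp add: m_def power2_eq_square)
   qed
   have b3: "\<bar>inner (b x) (2 *\<^sub>R ?k)\<bar> <= Bd * (2 * (norm (x - y) / \<alpha>0))"
   proof -
   have "\<bar>inner (b x) (2 *\<^sub>R ?k)\<bar> <= norm (b x) * norm (2 *\<^sub>R ?k)" by (rule Cauchy_Schwarz_ineq2)
   also have "... <= Bd * (2 * (norm (x - y) / \<alpha>0))" using b Bd kn by (intro mult_mono) auto
   finally show ?thesis .
   qed
   have "\<bar>Lop b (qf y) x - 2 * real CARD('n)\<bar> <= m * (K * (2 * (norm (x - y) / \<alpha>0))) + m * ((K * norm (x - y)) * (2 * (1 / \<alpha>0))) + Bd * (2 * (norm (x - y) / \<alpha>0))"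
   unfolding e1 using b1 b2 b3 by linarith
   also have "... = 2 * ((m * K + m * K + Bd) / \<alpha>0) * norm (x - y)" using \<alpha>0 by (simp add: field_simps)
   also have "... <= 2 * ((m * K + m * K + Bd) / \<alpha>0) * (e * sqrt (qf y x))"
   using m1 K(1) Bd \<alpha>0 by (intro mult_left_mono zq) auto
   also have "... = d2 * sqrt (qf y x)" by (simp add: d2_def)
   also have "... <= C * sqrt (qf y x)" using qnn by (intro mult_right_mono) (auto simp: C_def)
   finally show ?thesis .
  qed
 qed
qed

end

subsection \<open>Bounds for the invariant functional\<close>

definition tent :: "real => real ^ 'n::finite => real" where
 "tent rh z = max 0 (min 1 (rh - norm z))"

lemma tent_simps: "0 <= tent rh z" "tent rh z <= 1" "norm z <= rh - 1 ==> tent rh z = 1" "norm z >= rh ==> tent rh z = 0"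
 by (auto simp: tent_def)

lemma tent_cont: "continuous_on S f ==> continuous_on S (%x. tent rh (f x))"
 unfolding tent_def by (intro continuous_intros)

lemma Cc_tent: "Cc (tent rh)"
 unfolding Cc_def by (auto intro!: exI[of _ rh] tent_simps tent_cont[where f="%x. x"])

text \<open>For large enough \<open>rh\<close> its periodization lies between the integral of a
  nonnegative \<open>g\<close> and a multiple of it, since each point meets at least one and at most
  \<open>lat_count rh\<close> translates of the tent; so the size of the functional on it is
  known.\<close>

definition smear :: "real => (real ^ 'n::finite => real) => real ^ 'n => real" where
 "smear rh g x = (LINT y|lborel. g y * tent rh (x - y))"

lemma Cc_integrable: "Cc g ==> integrable lborel g"
 unfolding Cc_def using lborel_integral_compact_support(1) by blast

lemma smear_integrable:
 assumes "Cc g" shows "integrable lborel (%y. g y * tent rh (x - y))"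
proof -
 have "Cc (%y. tent rh (x - y) * g y)"
  by (rule Cc_mult[OF assms]) (intro tent_cont continuous_intros)
 then show ?thesis using Cc_integrable by (simp add: mult.commute)
qed

lemma smear_zero:
 assumes "!!y. norm y > R ==> g y = 0" "norm x > R + rh"
 shows "smear rh g x = 0"
proof -
 have "g y * tent rh (x - y) = 0" for y
 proof (cases "norm y > R")
  case False
  have "norm x <= norm y + norm (x - y)" using norm_triangle_ineq[of y "x - y"] by simp
  then have "norm (x - y) >= rh" using assms(2) False by linarith
  then show ?thesis by (simp add: tent_simps)
 qed (simp add: assms)
 then have "(%y. g y * tent rh (x - y)) = (%_. 0)" by (rule ext)
 then show ?thesis by (simp only: smear_def) simp
qed

lemma Cc_smear:
 assumes "Cc g" shows "Cc (smear rh g)"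
proof -
 obtain R where R: "!!y. norm y > R ==> g y = 0" using assms by (auto simp: Cc_def)
 let ?B = "cbox (- (\<chi> i. R)) (\<chi> i. R) :: (real ^ 'a) set"
 have c: "continuous_on UNIV g" using assms by (simp add: Cc_def)
 have "smear rh g x = integral ?B (%y. g y * tent rh (x - y))" for x
  unfolding smear_def by (rule lborel_integral_compact_support(2)) (auto simp: R intro!: continuous_intros c tent_cont)
 moreover have "continuous_on UNIV (%x. integral ?B (%y. g y * tent rh (x - y)))"
 proof (rule integral_continuous_on_param)
  have "continuous_on (UNIV \<times> ?B) (%p. g (snd p) * tent rh (fst p - snd p))"
   by (intro continuous_intros tent_cont continuous_on_compose2[OF c]) auto
  then show "continuous_on (UNIV \<times> ?B) (%(x, y). g y * tent rh (x - y))" by (simp add: case_prod_beta')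
 qed
 ultimately have "continuous_on UNIV (smear rh g)" by presburger
 moreover have "smear rh g x = 0" if "norm x > R + rh" for x
  by (rule smear_zero[where g=g and R=R, OF _ that]) (rule R)
 ultimately show ?thesis unfolding Cc_def by blast
qed

lemma Cc_unif:
 fixes g :: "real ^ 'n::finite => real"
 assumes "Cc g" "e > 0"
 obtains d where "d > 0" "!!x y. norm (x - y) < d ==> \<bar>g x - g y\<bar> < e"
proof -
 obtain R where R: "!!y. norm y > R ==> g y = 0" using assms by (auto simp: Cc_def)
 have "uniformly_continuous_on (cball 0 (R + 1)) g"
  using assms(1) by (intro compact_uniformly_continuous) (auto simp: Cc_def intro: continuous_on_subset)
 then obtain d where d: "d > 0" "!!x y. x \<in> cball 0 (R + 1) ==> y \<in> cball 0 (R + 1) ==> dist y x < d ==> dist (g y) (g x) < e"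
  using assms(2) unfolding uniformly_continuous_on_def by metis
 show ?thesis
 proof (rule that)
  show "min d 1 > 0" using d by simp
  fix x y :: "real ^ 'n" assume xy: "norm (x - y) < min d 1"
  have n: "norm x <= norm y + norm (x - y)" "norm y <= norm x + norm (x - y)"
   using norm_triangle_ineq[of y "x - y"] norm_triangle_ineq[of x "y - x"] by (simp_all add: norm_minus_commute)
  show "\<bar>g x - g y\<bar> < e"
  proof (cases "norm x <= R + 1 & norm y <= R + 1")
   case True
   then show ?thesis using d(2)[of y x] xy by (simp add: dist_norm)
  next
   case False
   then have "g x = 0" "g y = 0" using n xy by (auto intro!: R)
   then show ?thesis using assms by simp
  qed
 qed
qed

context periodic_diffusion
begin

lemma lat_near: "EX z. norm (x + lat L z) <= norm L"
proof -
 obtain y z where x: "x = y + lat L z" "y \<in> cbox 0 L" by (rule cell_cover[OF L_pos])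
 have "norm y <= norm L"
 proof (rule norm_le_componentwise_cart)
  fix i
  have "0 <= y $ i & y $ i <= L $ i" using x(2) by (simp add: mem_box_cart)
  then show "norm (y $ i) <= norm (L $ i)" by simp
 qed
 then show ?thesis using x by (intro exI[of _ "%i. 0 - z i"]) (simp only: lat_diff, simp add: lat_def zero_vec_def[symmetric])
qed

definition lat_count :: "real => real" where
 "lat_count rh = real (card {z. norm (lat L z) <= rh + norm L})"

text \<open>Subtracting the index of a translate close to the origin embeds the contributing indices
  into a fixed finite set.\<close>

lemma lat_count_bound:
 assumes "finite Z"
 shows "(\<Sum>z\<in>Z. tent rh (x + lat L z)) <= lat_count rh"
proof -
 obtain z0 where z0: "norm (x + lat L z0) <= norm L" using lat_near by blast
 have "(\<Sum>z\<in>Z. tent rh (x + lat L z)) = (\<Sum>z\<in>{z\<in>Z. norm (x + lat L z) <= rh}. tent rh (x + lat L z))"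
 proof (rule sum.mono_neutral_right[OF assms])
  show "\<forall>z\<in>Z - {z \<in> Z. norm (x + lat L z) <= rh}. tent rh (x + lat L z) = 0"
   by (intro ballI tent_simps(4)) auto
 qed auto
 also have "... <= (\<Sum>z\<in>{z\<in>Z. norm (x + lat L z) <= rh}. 1)" by (intro sum_mono tent_simps)
 also have "... = real (card {z\<in>Z. norm (x + lat L z) <= rh})" by simp
 also have "... <= lat_count rh" unfolding lat_count_def of_nat_le_iff
 proof (rule card_inj_on_le[where f="%z i. z i - z0 i"])
  show "inj_on (%z i. z i - z0 i) {z \<in> Z. norm (x + lat L z) <= rh}"
   by (rule inj_onI) (auto simp: fun_eq_iff)
  show "(%z i. z i - z0 i) ` {z \<in> Z. norm (x + lat L z) <= rh} \<subseteq> {z. norm (lat L z) <= rh + norm L}"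
  proof clarify
   fix z assume "norm (x + lat L z) <= rh"
   then show "norm (lat L (%i. z i - z0 i)) <= rh + norm L"
   using norm_triangle_ineq4[of "x + lat L z" "x + lat L z0"] z0 by (simp add: lat_diff)
  qed
  show "finite {z. norm (lat L z) <= rh + norm L}" by (rule finite_lat[OF L_pos])
 qed
 finally show ?thesis .
qed

lemma Per_smear:
 assumes g: "Cc g" "!!x. 0 <= g x"
 shows "Per L (smear rh g) x <= lat_count rh * (LINT y|lborel. g y)"
  "rh >= norm L + 1 ==> (LINT y|lborel. g y) <= Per L (smear rh g) x"
proof -
 obtain R where R: "!!y. norm y > R ==> g y = 0" using g by (auto simp: Cc_def)
 define Z where "Z = {z. norm (lat L z) <= (R + rh) + norm x}"
 have Z: "finite Z" unfolding Z_def by (rule finite_lat[OF L_pos])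
 have "Per L (smear rh g) x = (\<Sum>z\<in>Z. smear rh g (x + lat L z))"
  unfolding Z_def by (rule Per_local[OF L_pos smear_zero[OF R] order_refl])
 also have "... = (LINT y|lborel. (\<Sum>z\<in>Z. g y * tent rh (x + lat L z - y)))"
  unfolding smear_def by (rule Bochner_Integration.integral_sum[symmetric]) (rule smear_integrable[OF g(1)])
 finally have P: "Per L (smear rh g) x = (LINT y|lborel. (\<Sum>z\<in>Z. g y * tent rh (x + lat L z - y)))" .
 have int: "integrable lborel (%y. \<Sum>z\<in>Z. g y * tent rh (x + lat L z - y))"
  by (intro Bochner_Integration.integrable_sum smear_integrable g)
 have "(\<Sum>z\<in>Z. g y * tent rh (x + lat L z - y)) <= lat_count rh * g y" for y
 proof -
  have "(\<Sum>z\<in>Z. g y * tent rh (x + lat L z - y)) = g y * (\<Sum>z\<in>Z. tent rh ((x - y) + lat L z))"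
   by (simp add: sum_distrib_left algebra_simps)
  also have "... <= g y * lat_count rh" by (intro mult_left_mono lat_count_bound Z g)
  finally show ?thesis by (simp add: mult.commute)
 qed
 then have "Per L (smear rh g) x <= (LINT y|lborel. lat_count rh * g y)"
  unfolding P by (intro integral_mono int) (use Cc_integrable[OF g(1)] in auto)
 then show "Per L (smear rh g) x <= lat_count rh * (LINT y|lborel. g y)" by simp
 assume rh: "rh >= norm L + 1"
 have "g y <= (\<Sum>z\<in>Z. g y * tent rh (x + lat L z - y))" for y
 proof (cases "norm y > R")
  case False
  obtain z where z: "norm ((x - y) + lat L z) <= norm L" using lat_near by blast
  have "norm (lat L z) <= norm ((x - y) + lat L z) + (norm x + norm y)"
   using norm_triangle_ineq4[of "(x - y) + lat L z" "x - y"] norm_triangle_ineq4[of x y] by simp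
  then have "z \<in> Z" using False z rh by (simp add: Z_def)
  then have "tent rh (x + lat L z - y) <= (\<Sum>z\<in>Z. tent rh (x + lat L z - y))"
   by (intro member_le_sum Z tent_simps)
  moreover have "tent rh (x + lat L z - y) = 1"
   using z rh by (intro tent_simps) (simp add: algebra_simps)
  ultimately show ?thesis unfolding sum_distrib_left[symmetric]
   using g(2)[of y] by (metis mult_left_mono mult.right_neutral)
 qed (simp add: R)
 then show "(LINT y|lborel. g y) <= Per L (smear rh g) x"
  unfolding P by (intro integral_mono int Cc_integrable g)
qed

lemma Kz_cont: "continuous_on UNIV (%(x, y). (Kf y *v (x - y)) $ i)"
 unfolding matrix_vector_mult_def case_prod_beta'
 by (simp, intro continuous_intros continuous_on_compose2[OF Kf_cont[of UNIV]]) auto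

lemma Kz_cont': "continuous_on UNIV (%p. (Kf (snd p) *v (fst p - snd p)) $ i)"
 using Kz_cont[of i] by (simp add: case_prod_beta')

lemma qf_cont: "continuous_on UNIV (%p. qf (snd p) (fst p))"
 unfolding qf_def inner_vec_def inner_real_def
 by (intro continuous_on_sum continuous_on_mult Kz_cont' continuous_on_component continuous_on_diff
   continuous_on_fst continuous_on_snd continuous_on_id)

text \<open>Spreads the radial barriers with density \<open>g\<close> over their centres, so that
  the functional can be tested against arbitrary data. The support is compact because
  \<open>P\<close> vanishes beyond \<open>S\<close> and \<open>qf\<close> grows
  quadratically.\<close>

lemma barrier_superposition:
 assumes G: "!!s. (G has_real_derivative G' s) (at s)" "continuous_on UNIV G'" "\<forall>s\<ge>S. G s = 0"
  and g: "Cc g" and th: "th > 0" "!!x y. th * (norm (x - y))\<^sup>2 <= qf y x"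
 shows "EX h. C2 h & Cc h & (ALL b x. Lop b h x = (LINT y|lborel. g y * (- 4 * inner (Kf y *v (x - y)) (A x *v (Kf y *v (x - y))) * G' (qf y x) - Lop b (qf y) x * G (qf y x)))) \<and>
  (ALL b x. integrable lborel (%y. g y * (- 4 * inner (Kf y *v (x - y)) (A x *v (Kf y *v (x - y))) * G' (qf y x) - Lop b (qf y) x * G (qf y x))))"
proof -
 have Gc: "continuous_on UNIV G" by (rule DERIV_continuous_on, rule G(1))
 obtain F where F: "!!s. (F has_real_derivative G s) (at s)"
 proof -
  have 1: "!!x. isCont G x" using Gc by (simp add: continuous_on_eq_continuous_at)

  have "EX F. \<forall>x\<in>UNIV. (F has_vector_derivative G x) (at x within UNIV)"
   using einterval_antiderivative[of "- \<infinity>" "\<infinity>" G] 1 by auto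
  then show ?thesis using that by (auto simp: has_real_derivative_iff_has_vector_derivative)
 qed
 \<comment> \<open>The antiderivative of \<open>- G\<close> normalised to vanish at
   \<open>S\<close>, and hence beyond it.\<close>
 define P where "P s = F S - F s" for s
 have Pd: "(P has_real_derivative - G s) (at s)" for s
  unfolding P_def[abs_def] by (auto intro!: derivative_eq_intros F)
 have P0: "P s = 0" if "s >= S" for s
 proof (cases "s = S")
  case False
  then have "\<exists>z>S. z < s & F s - F S = (s - S) * G z" using that F by (intro MVT2) auto
  then show ?thesis using G(3) by (auto simp: P_def)
 qed (simp add: P_def)
 have Pc: "continuous_on UNIV P" by (rule DERIV_continuous_on, rule Pd)
 note L1 = Lop_qf_compose[OF Pd G(1,2)]
 define k where "k x y = g y * P (qf y x)" for x y :: "real ^ 'n"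
 obtain R where R: "!!y. norm y > R ==> g y = 0" using g by (auto simp: Cc_def)
 have gc: "continuous_on UNIV g" using g by (simp add: Cc_def)
 have pk: "pd j (%x. k x y) = (%x. g y * pd j (%x. P (qf y x)) x)" for j y
 proof (rule ext)
  fix x
  have "grad (%x. k x y) x = g y *\<^sub>R grad (%x. P (qf y x)) x"
   unfolding k_def by (rule grad_cmult[OF C2_C1[OF L1(1)]])
  from arg_cong[OF this, of "%v. v $ j"] show "pd j (%x. k x y) x = g y * pd j (%x. P (qf y x)) x" by simp
 qed
 have pk2: "pd i (pd j (%x. k x y)) x = g y * pd i (pd j (%x. P (qf y x))) x" for i j x y
 proof -
  have "grad (%x. g y * pd j (%x. P (qf y x)) x) x = g y *\<^sub>R grad (pd j (%x. P (qf y x))) x"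
   by (rule grad_cmult[OF C2_pd[OF L1(1)]])
  from arg_cong[OF this, of "%v. v $ i"] show ?thesis unfolding pk by simp
 qed
 have ci: "continuous_on UNIV (%p. f (snd p))" if "continuous_on UNIV f" for f :: "real ^ 'n => real"
  by (rule continuous_on_compose2[OF that]) (auto intro: continuous_intros)
 have cq: "continuous_on UNIV (%p. f (qf (snd p) (fst p)))" if "continuous_on UNIV f" for f :: "real => real"
  by (rule continuous_on_compose2[OF that qf_cont]) auto
 have kc: "continuous_on UNIV (%(x, y). k x y)"
  unfolding k_def case_prod_beta' by (intro continuous_intros ci[OF gc] cq[OF Pc])
 have kd: "continuous_on UNIV (%(x, y). pd i (%x. k x y) x)" for i
  unfolding pk L1(3) case_prod_beta' by (intro continuous_intros ci[OF gc] cq[OF Gc] Kz_cont')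
 have kdd: "continuous_on UNIV (%(x, y). pd i (pd j (%x. k x y)) x)" for i j
  unfolding pk2 L1(4) case_prod_beta' by (intro continuous_intros ci[OF gc] cq[OF Gc] cq[OF G(2)] Kz_cont' ci[OF Kf_cont])
 have kC2: "C2 (%x. k x y)" for y unfolding k_def by (rule C2_cmult[OF L1(1)])
 have ks: "k x y = 0" if "norm y > R" for x y :: "real ^ 'n" using R[OF that] by (simp add: k_def)
 note CI = C2_integral[OF kc kd kdd kC2 ks]
 have Lk: "Lop b (%x. k x y) x = g y * (- 4 * inner (Kf y *v (x - y)) (A x *v (Kf y *v (x - y))) * G' (qf y x) - Lop b (qf y) x * G (qf y x))" for b x y
  unfolding k_def by (subst Lop_cmult[OF L1(1)]) (simp only: L1(2))
 show ?thesis
 proof (intro exI[of _ "%x. LINT y|lborel. k x y"] conjI)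
  show C2: "C2 (%x. LINT y|lborel. k x y)" by (rule CI(1))
  show "Cc (%x. LINT y|lborel. k x y)" unfolding Cc_def
  proof (intro conjI C2_cont[OF C2] exI allI impI)
   fix x :: "real ^ 'n" assume x: "norm x > R + sqrt (\<bar>S\<bar> / th)"
   have "k x y = 0" for y
   proof (cases "norm y > R")
   case False
   have "norm x <= norm y + norm (x - y)" using norm_triangle_ineq[of y "x - y"] by simp
   then have "norm (x - y) > sqrt (\<bar>S\<bar> / th)" using x False by linarith
   then have "(norm (x - y))\<^sup>2 > (sqrt (\<bar>S\<bar> / th))\<^sup>2" using th(1) by (intro power_strict_mono) auto
   then have "(norm (x - y))\<^sup>2 > \<bar>S\<bar> / th" using th(1) by simp
   then have "th * (norm (x - y))\<^sup>2 >= \<bar>S\<bar>" using th(1) by (simp add: field_simps)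
   then have "qf y x >= S" using th(2)[of x y] by linarith
   then show ?thesis by (simp add: k_def P0)
   qed (rule ks)
   then show "(LINT y|lborel. k x y) = 0" by simp
  qed
 qed (use CI(2,3) Lk in auto)
qed

text \<open>The error is written as \<open>e\<close> times a tent, not as a constant, because only
  functions of compact support may be fed to the functional.\<close>

lemma cball_average:
 fixes g :: "real ^ 'n => real"
 assumes g: "Cc g" "!!x. 0 <= g x" and R0: "ALL y. norm y > R --> g y = 0"
  and r: "0 < r" "r < 1" and e0: "ALL x y. norm (x - y) <= r --> \<bar>g x - g y\<bar> <= e" and enn: "e >= 0"
 shows "(LINT y|lborel. g y * indicator (cball x r) y) <= (g x + e * tent (R + 3) x) * (unit_ball_vol (real CARD('n)) * r ^ CARD('n))"
  "(g x - e * tent (R + 3) x) * (unit_ball_vol (real CARD('n)) * r ^ CARD('n)) <= (LINT y|lborel. g y * indicator (cball x r) y)"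
  "integrable lborel (%y. g y * indicator (cball x r) y)"
proof -
 note R = R0[rule_format] and e = e0[rule_format] enn
 show int: "integrable lborel (%y. g y * indicator (cball x r) y)"
  by (intro integrable_real_mult_indicator Cc_integrable g) simp
 have c: "(LINT y|lborel. a * indicator (cball x r) y) = a * (unit_ball_vol (real CARD('n)) * r ^ CARD('n))" for a
  using r by (simp add: content_cball)
 have ic: "integrable lborel (%y. a * indicator (cball x r) y :: real)" for a
  by (intro integrable_mult_right integrable_real_indicator emeasure_lborel_cball_finite) simp
 have far: "g y = 0" if "norm x > R + 1" "y \<in> cball x r" for y
 proof (rule R)
  have "norm x <= norm y + norm (x - y)" using norm_triangle_ineq[of y "x - y"] by simp
  then show "norm y > R" using that r by (simp add: dist_norm)
 qed
 have near: "tent (R + 3) x = 1" if "\<not> norm x > R + 1" using that by (intro tent_simps) simp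
 have "g y * indicator (cball x r) y <= (g x + e * tent (R + 3) x) * indicator (cball x r) y" for y
 proof (cases "y \<in> cball x r")
  case True
  show ?thesis
  proof (cases "norm x > R + 1")
   case True
   with far[OF True \<open>y \<in> cball x r\<close>] show ?thesis using g(2) e(2) by (simp add: tent_simps add_nonneg_nonneg)
  next
   case False
   then show ?thesis using near e(1)[of x y] True by (simp add: dist_norm abs_le_iff)
  qed
 qed simp
 then have "(LINT y|lborel. g y * indicator (cball x r) y) <= (LINT y|lborel. (g x + e * tent (R + 3) x) * indicator (cball x r) y)"
  by (intro integral_mono int ic)
 then show "(LINT y|lborel. g y * indicator (cball x r) y) <= (g x + e * tent (R + 3) x) * (unit_ball_vol (real CARD('n)) * r ^ CARD('n))"
  unfolding c .
 have "(g x - e * tent (R + 3) x) * indicator (cball x r) y <= g y * indicator (cball x r) y" for y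
 proof (cases "y \<in> cball x r")
  case True
  show ?thesis
  proof (cases "norm x > R + 1")
   case far': True
   then have "g x = 0" by (intro R) simp
   moreover have "0 <= e * tent (R + 3) x" by (intro mult_nonneg_nonneg e(2) tent_simps)
   ultimately show ?thesis using g(2)[of y] True by simp
  next
   case False
   then show ?thesis using near e(1)[of x y] True by (simp add: dist_norm abs_le_iff)
  qed
 qed simp
 then have "(LINT y|lborel. (g x - e * tent (R + 3) x) * indicator (cball x r) y) <= (LINT y|lborel. g y * indicator (cball x r) y)"
  by (intro integral_mono int ic)
 then show "(g x - e * tent (R + 3) x) * (unit_ball_vol (real CARD('n)) * r ^ CARD('n)) <= (LINT y|lborel. g y * indicator (cball x r) y)"
  unfolding c .
qed

definition invariant :: "(real ^ 'n => real ^ 'n) => real => real => ((real ^ 'n => real) => real) => bool" where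
 "invariant b c C I \<longleftrightarrow>
   (ALL g h. Cc g --> Cc h --> I (%x. g x + h x) = I g + I h) \<and>
   (ALL g a. Cc g --> I (%x. a * g x) = a * I g) \<and>
   (ALL h. C2 h --> Cc h --> I (Lop b h) = 0) \<and>
   (ALL g. Cc g --> (ALL x. 0 <= g x) --> c * (LINT x|lborel. g x) <= I g & I g <= C * (LINT x|lborel. g x))"

text \<open>The functional is 0 on the image of the superposed barrier under the operator, and that
  image compares a smear of \<open>g\<close> with \<open>r powr (- N)\<close> times integrals of
  \<open>g\<close> over small balls. The latter approach a multiple of \<open>g\<close> as
  \<open>r\<close> shrinks, the former has a functional of known size, and so \<open>I g\<close> is
  compared with the integral of \<open>g\<close>.\<close>

theorem invariant_functional_bounds:
 assumes Bd: "Bd >= 0"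
 obtains c C where "c > 0" "C > 0"
  "!!b. continuous_on UNIV b ==> periodic L b ==> (!!x. norm (b x) <= Bd) ==> EX I. invariant b c C I"
proof -
 define N where "N = real CARD('n)"
 define V where "V = unit_ball_vol N"
 have V: "V > 0" by (simp add: V_def N_def)
 obtain Q th where Q: "Q > 0" and th: "th > 0"
  and q1: "!!b x y. norm (b x) <= Bd ==> \<bar>Lop b (qf y) x - 2 * N\<bar> <= Q * sqrt (qf y x)"
  and q2: "!!x y. \<bar>inner (Kf y *v (x - y)) (A x *v (Kf y *v (x - y))) - qf y x\<bar> <= Q * qf y x * sqrt (qf y x)"
  and q3: "!!x y. th * qf y x <= inner (Kf y *v (x - y)) (A x *v (Kf y *v (x - y)))"
  and q4: "!!x y. inner (Kf y *v (x - y)) (A x *v (Kf y *v (x - y))) <= qf y x / th"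
  and q5: "!!x y. th * (norm (x - y))\<^sup>2 <= qf y x" and q6: "!!x y. qf y x <= (norm (x - y))\<^sup>2 / th"
  unfolding N_def by (rule qf_estimates[OF Bd]) blast
 have qnn: "qf y x >= 0" for x y using q5[of x y] th by (smt (verit) mult_nonneg_nonneg zero_le_power2)
 \<comment> \<open>The tent equals 1 on the ball of radius \<open>norm L\<close>, which meets every
   class modulo the lattice; \<open>S\<close> in the next line is large enough for
   \<open>qf y x <= S\<close> on its support.\<close>
 define rh where "rh = norm L + 1"
 define S where "S = max 1 (rh\<^sup>2 / th)"
 have N1: "N >= 1" by (simp add: N_def Suc_leI)
 have S1: "S >= 1" by (simp add: S_def)
 obtain c1 K1 where c1: "c1 > 0" "K1 > 0" and low:
  "!!r. 0 < r ==> r <= 1 ==> EX G G'. (ALL s. (G has_real_derivative G' s) (at s)) & continuous_on UNIV G' \<and>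
   (\<forall>s\<ge>S + 1. G s = 0) \<and>
   (ALL s a \<tau>. 0 <= s --> \<bar>\<tau> - 2 * N\<bar> <= Q * sqrt s --> \<bar>a - s\<bar> <= Q * s * sqrt s --> th * s <= a --> a <= s / th -->
   c1 * (if s <= S then 1 else 0) - K1 * r powr (- N) * (if s <= r\<^sup>2 then 1 else 0) <= - 4 * a * G' s - \<tau> * G s)"
  by (rule barrier_lower[OF N1 Q th S1]) blast
 obtain c2 K2 S2 r0 where c2: "c2 > 0" "K2 > 0" "S2 > 0" "r0 > 0" and up:
  "!!r. 0 < r ==> r <= r0 ==> EX G G'. (ALL s. (G has_real_derivative G' s) (at s)) & continuous_on UNIV G' \<and>
   (\<forall>s\<ge>S2. G s = 0) \<and>
   (ALL s a \<tau>. 0 <= s --> \<bar>\<tau> - 2 * N\<bar> <= Q * sqrt s --> \<bar>a - s\<bar> <= Q * s * sqrt s --> th * s <= a --> a <= s / th -->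
   - 4 * a * G' s - \<tau> * G s <= K2 * (if s <= S2 then 1 else 0) - c2 * r powr (- N) * (if s <= r\<^sup>2 then 1 else 0))"
  by (rule barrier_upper[OF N1 Q th]) blast
 define rh2 where "rh2 = sqrt (S2 / th) + 1"
 \<comment> \<open>Passes between the sets \<open>qf y x <= r\<^sup>2\<close> and Euclidean balls:
   such a set lies in the ball of radius \<open>r / sq\<close> and contains that of radius
   \<open>sq * r\<close>.\<close>
 define sq where "sq = sqrt th"
 have sq: "sq > 0" "sq\<^sup>2 = th" using th by (auto simp: sq_def)
 define cc where "cc = c1 / (K1 * V * (1 / sq) ^ CARD('n))"
 define CC where "CC = K2 * (lat_count rh2 + 1) / (c2 * V * sq ^ CARD('n))"
 have pos: "K1 * V * (1 / sq) ^ CARD('n) > 0" "c2 * V * sq ^ CARD('n) > 0" using c1 c2 V sq by simp_all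
 have cc: "cc > 0" unfolding cc_def using c1 pos by simp
 have CC: "CC > 0" unfolding CC_def by (intro divide_pos_pos[OF _ pos(2)] mult_pos_pos[OF c2(2)]) (auto simp: lat_count_def add_nonneg_pos)
 \<comment> \<open>The power of \<open>r\<close> in the barrier cancels against the volume of the
   ball.\<close>
 have rp: "r powr (- N) * (a * r) ^ CARD('n) = a ^ CARD('n)" if "r > 0" for r a :: real
 proof -
  have "r powr (- N) = inverse (r ^ CARD('n))" using that by (simp add: N_def powr_minus powr_realpow)
  then show ?thesis using that by (simp add: power_mult_distrib)
 qed
 show ?thesis
 proof (rule that[OF cc CC])
  fix b :: "real ^ 'n => real ^ 'n"
  assume b: "continuous_on UNIV b" "periodic L b" "!!x. norm (b x) <= Bd"
  show "EX I. invariant b cc CC I"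
  proof (rule invariant_functional[OF b(1,2)])
  fix I assume I1: "!!g h. Cc g ==> Cc h ==> I (%x. g x + h x) = I g + I h"
   and I2: "!!g c. Cc g ==> I (%x. c * g x) = c * I g"
   and I3: "!!g r. Cc g ==> (!!x. Per L g x <= r) ==> I g <= r"
   and I4: "!!h. C2 h ==> Cc h ==> I (Lop b h) = 0"

  have Ineg: "I g >= r" if "Cc g" "!!x. r <= Per L g x" for g r
  proof -
   have "I (%x. (- 1) * g x) <= - r"
   by (rule I3) (use that Cc_cmult[of g "- 1"] Per_cmult[of L "- 1" g] in auto)
   then show ?thesis using I2[OF that(1), of "- 1"] by simp
  qed
  have Ipos: "I g >= 0" if "Cc g" "!!x. 0 <= g x" for g
   by (rule Ineg[OF that(1)]) (use that in "auto simp: Per_def intro: sum_nonneg")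
  have Imono: "I g <= I h" if "Cc g" "Cc h" "!!x. g x <= h x" for g h
  proof -
   have "Cc (%x. h x + (- 1) * g x)" using that Cc_add Cc_cmult by blast
   then have "I (%x. h x + (- 1) * g x) >= 0" by (rule Ipos) (use that in simp)
   then show ?thesis using I1[OF that(2) Cc_cmult[OF that(1), of "- 1"]] I2[OF that(1), of "- 1"] by simp
  qed
  have bounds: "cc * (LINT x|lborel. g x) <= I g & I g <= CC * (LINT x|lborel. g x)"
   if g: "Cc g" "!!x. 0 <= g x" for g
  proof -
   obtain R where R: "ALL y. norm y > R --> g y = 0" using g by (auto simp: Cc_def)
   define X where "X = I (tent (R + 3))"
   have X: "X >= 0" unfolding X_def by (intro Ipos Cc_tent tent_simps)
   have gi: "integrable lborel g" by (rule Cc_integrable[OF g(1)])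
   have comb: "Cc (%x. a1 * smear rh' g x + (a2 * g x + a3 * tent (R + 3) x))"
   "I (%x. a1 * smear rh' g x + (a2 * g x + a3 * tent (R + 3) x)) = a1 * I (smear rh' g) + (a2 * I g + a3 * X)" for a1 a2 a3 rh'
   unfolding X_def by (simp_all add: I1 I2 Cc_add Cc_cmult Cc_smear g Cc_tent)
   have lower: "c1 * (LINT x|lborel. g x) <= (K1 * V * (1 / sq) ^ CARD('n)) * I g"
   proof (rule field_le_epsilon)
   fix e :: real assume e: "e > 0"
   define M where "M = K1 * V * (1 / sq) ^ CARD('n)"
   have M: "M > 0" using pos by (simp add: M_def)
   \<comment> \<open>The oscillation of \<open>g\<close> allowed on the small balls, chosen so that
     the total error \<open>M * \<omega> * X\<close> is at most \<open>e\<close>.\<close>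
   define \<omega> where "\<omega> = e / (M * (X + 1))"
   have \<omega>: "\<omega> > 0" using e M X by (simp add: \<omega>_def)
   obtain d where d: "d > 0" "!!x y. norm (x - y) < d ==> \<bar>g x - g y\<bar> < \<omega>"
   by (rule Cc_unif[OF g(1) \<omega>]) blast
   define r where "r = min 1 (min d 1 * sq / 2)"
   have r: "0 < r" "r <= 1" "1 / sq * r < d" "1 / sq * r < 1"
   proof -
   show "0 < r" "r <= 1" using d sq by (auto simp: r_def)
   have "r <= min d 1 * sq / 2" by (simp add: r_def)
   then have "1 / sq * r <= min d 1 / 2" using pos_divide_le_eq[OF sq(1), of r "min d 1 / 2"] by simp
   moreover have "min d 1 <= d" "min d 1 <= 1" "min d 1 > 0" using d(1) by simp_all
   ultimately show "1 / sq * r < d" "1 / sq * r < 1" by linarith+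
   qed
   obtain G G' where G: "!!s. (G has_real_derivative G' s) (at s)" "continuous_on UNIV G'" "\<forall>s\<ge>S + 1. G s = 0"
   and Gi: "!!s a \<tau>. 0 <= s ==> \<bar>\<tau> - 2 * N\<bar> <= Q * sqrt s ==> \<bar>a - s\<bar> <= Q * s * sqrt s ==> th * s <= a ==> a <= s / th ==>
   c1 * (if s <= S then 1 else 0) - K1 * r powr (- N) * (if s <= r\<^sup>2 then 1 else 0) <= - 4 * a * G' s - \<tau> * G s"
   using low[OF r(1,2)] by blast
   from barrier_superposition[where S="S + 1", OF G g(1) th q5]
   obtain h where h: "C2 h" "Cc h" and Lh0: "ALL b x. Lop b h x = (LINT y|lborel. g y * (- 4 * inner (Kf y *v (x - y)) (A x *v (Kf y *v (x - y))) * G' (qf y x) - Lop b (qf y) x * G (qf y x)))"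
   and Li0: "ALL b x. integrable lborel (%y. g y * (- 4 * inner (Kf y *v (x - y)) (A x *v (Kf y *v (x - y))) * G' (qf y x) - Lop b (qf y) x * G (qf y x)))"
   by (elim exE conjE)
   note Lh = Lh0[rule_format] and Li = Li0[rule_format]
   have ball: "ALL x y. norm (x - y) <= 1 / sq * r --> \<bar>g x - g y\<bar> <= \<omega>" using d(2) r(3) by (meson le_less_trans less_imp_le)
   have rr: "0 < 1 / sq * r" using r sq by simp
   note av = cball_average[OF g R rr r(4) ball less_imp_le[OF \<omega>]]
   have ptw: "c1 * smear rh g x + ((- M) * g x + (- M * \<omega>) * tent (R + 3) x) <= Lop b h x" for x
   proof -
   have "c1 * smear rh g x - K1 * r powr (- N) * (LINT y|lborel. g y * indicator (cball x (1 / sq * r)) y)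
   = (LINT y|lborel. c1 * (g y * tent rh (x - y)) - K1 * r powr (- N) * (g y * indicator (cball x (1 / sq * r)) y))"
   unfolding smear_def
   by (subst Bochner_Integration.integral_diff[OF integrable_mult_right[OF smear_integrable[OF g(1)]] integrable_mult_right[OF av(3)]])
   (simp only: integral_mult_right_zero)
   also have "... <= Lop b h x" unfolding Lh
   proof (intro integral_mono Li)
   show "integrable lborel (%y. c1 * (g y * tent rh (x - y)) - K1 * r powr (- N) * (g y * indicator (cball x (1 / sq * r)) y))"
   by (intro Bochner_Integration.integrable_diff integrable_mult_right smear_integrable g av(3))
   fix y
   have t: "tent rh (x - y) <= (if qf y x <= S then 1 else 0)"
   proof (cases "norm (x - y) <= rh")
   case True
   then have "(norm (x - y))\<^sup>2 <= rh\<^sup>2" by (intro power_mono) auto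
   then have "(norm (x - y))\<^sup>2 / th <= rh\<^sup>2 / th" using th by (intro divide_right_mono) auto
   then have "qf y x <= S" using q6[of y x] by (simp add: S_def)
   then show ?thesis by (simp add: tent_simps)
   qed (simp add: tent_simps)
   have i: "(if qf y x <= r\<^sup>2 then 1 else 0) <= (indicator (cball x (1 / sq * r)) y :: real)"
   proof (cases "qf y x <= r\<^sup>2")
   case True
   then have "th * (norm (x - y))\<^sup>2 <= r\<^sup>2" using q5[of x y] by linarith
   then have "(sq * norm (x - y))\<^sup>2 <= r\<^sup>2" by (simp only: power_mult_distrib sq(2))
   then have "sq * norm (x - y) <= r" by (rule power2_le_imp_le) (use r(1) in simp)
   then have "norm (x - y) <= 1 / sq * r"
   using pos_le_divide_eq[OF sq(1), of "norm (x - y)" r] by (simp add: mult.commute)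
   then show ?thesis using True by (simp add: dist_norm indicator_def)
   qed simp
   have "c1 * tent rh (x - y) - K1 * r powr (- N) * indicator (cball x (1 / sq * r)) y
   <= c1 * (if qf y x <= S then 1 else 0) - K1 * r powr (- N) * (if qf y x <= r\<^sup>2 then 1 else 0)"
   using c1 by (intro diff_mono mult_left_mono t i) auto
   also have "... <= - 4 * inner (Kf y *v (x - y)) (A x *v (Kf y *v (x - y))) * G' (qf y x) - Lop b (qf y) x * G (qf y x)"
   by (rule Gi[OF qnn q1[where b=b, OF b(3)] q2 q3 q4])
   finally have "g y * (c1 * tent rh (x - y) - K1 * r powr (- N) * indicator (cball x (1 / sq * r)) y) <= g y * (- 4 * inner (Kf y *v (x - y)) (A x *v (Kf y *v (x - y))) * G' (qf y x) - Lop b (qf y) x * G (qf y x))"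
   by (rule mult_left_mono[OF _ g(2)])
   then show "c1 * (g y * tent rh (x - y)) - K1 * r powr (- N) * (g y * indicator (cball x (1 / sq * r)) y) <= g y * (- 4 * inner (Kf y *v (x - y)) (A x *v (Kf y *v (x - y))) * G' (qf y x) - Lop b (qf y) x * G (qf y x))"
   by (simp add: algebra_simps)
   qed
   finally have 1: "c1 * smear rh g x - K1 * r powr (- N) * (LINT y|lborel. g y * indicator (cball x (1 / sq * r)) y) <= Lop b h x" .
   have "K1 * r powr (- N) * (LINT y|lborel. g y * indicator (cball x (1 / sq * r)) y)
   <= K1 * r powr (- N) * ((g x + \<omega> * tent (R + 3) x) * (V * (1 / sq * r) ^ CARD('n)))"
   unfolding V_def N_def using c1 by (intro mult_left_mono av(1)) auto
   also have "... = K1 * V * (r powr (- N) * (1 / sq * r) ^ CARD('n)) * (g x + \<omega> * tent (R + 3) x)" by (simp only: mult_ac)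
   also have "... = M * (g x + \<omega> * tent (R + 3) x)" unfolding rp[OF r(1)] M_def ..
   finally show ?thesis using 1 by (simp add: algebra_simps)
   qed
   have "c1 * I (smear rh g) + ((- M) * I g + (- M * \<omega>) * X) <= I (Lop b h)"
   unfolding comb(2)[symmetric] by (intro Imono comb ptw Lop_Cc b h)
   then have "c1 * I (smear rh g) <= M * I g + M * \<omega> * X" using I4[OF h] by simp
   moreover have "(LINT x|lborel. g x) <= I (smear rh g)"
   by (intro Ineg Cc_smear g Per_smear(2)) (auto simp: rh_def)
   then have "c1 * (LINT x|lborel. g x) <= c1 * I (smear rh g)" using c1 by (intro mult_left_mono) auto
   moreover have "M * \<omega> * X <= e"
   proof -
   have "M * \<omega> = e / (X + 1)" using M X by (simp add: \<omega>_def)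
   then have "M * \<omega> * X = e * (X / (X + 1))" by simp
   also have "... <= e * 1" using X e by (intro mult_left_mono) auto
   finally show ?thesis by simp
   qed
   ultimately show "c1 * (LINT x|lborel. g x) <= (K1 * V * (1 / sq) ^ CARD('n)) * I g + e"
   unfolding M_def by linarith
   qed
   have upper: "(c2 * V * sq ^ CARD('n)) * I g <= K2 * (lat_count rh2 + 1) * (LINT x|lborel. g x)"
   proof (rule field_le_epsilon)
   fix e :: real assume e: "e > 0"
   define M where "M = c2 * V * sq ^ CARD('n)"
   have M: "M > 0" using pos by (simp add: M_def)
   define \<omega> where "\<omega> = e / (M * (X + 1))"
   have \<omega>: "\<omega> > 0" using e M X by (simp add: \<omega>_def)
   obtain d where d: "d > 0" "!!x y. norm (x - y) < d ==> \<bar>g x - g y\<bar> < \<omega>"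
   by (rule Cc_unif[OF g(1) \<omega>]) blast
   define r where "r = min r0 (min d 1 / sq / 2)"
   have r: "0 < r" "r <= r0" "sq * r < d" "sq * r < 1"
   proof -
   show "0 < r" "r <= r0" using d sq c2 by (auto simp: r_def)
   have "r <= min d 1 / sq / 2" by (simp add: r_def)
   then have "r <= (min d 1 / 2) / sq" by simp
   then have "sq * r <= min d 1 / 2" using pos_le_divide_eq[OF sq(1), of r "min d 1 / 2"] by (simp add: mult.commute)
   moreover have "min d 1 <= d" "min d 1 <= 1" "min d 1 > 0" using d(1) by simp_all
   ultimately show "sq * r < d" "sq * r < 1" by linarith+
   qed
   obtain G G' where G: "!!s. (G has_real_derivative G' s) (at s)" "continuous_on UNIV G'" "\<forall>s\<ge>S2. G s = 0"
   and Gi: "!!s a \<tau>. 0 <= s ==> \<bar>\<tau> - 2 * N\<bar> <= Q * sqrt s ==> \<bar>a - s\<bar> <= Q * s * sqrt s ==> th * s <= a ==> a <= s / th ==>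
   - 4 * a * G' s - \<tau> * G s <= K2 * (if s <= S2 then 1 else 0) - c2 * r powr (- N) * (if s <= r\<^sup>2 then 1 else 0)"
   using up[OF r(1,2)] by blast
   from barrier_superposition[where S=S2, OF G g(1) th q5]
   obtain h where h: "C2 h" "Cc h" and Lh0: "ALL b x. Lop b h x = (LINT y|lborel. g y * (- 4 * inner (Kf y *v (x - y)) (A x *v (Kf y *v (x - y))) * G' (qf y x) - Lop b (qf y) x * G (qf y x)))"
   and Li0: "ALL b x. integrable lborel (%y. g y * (- 4 * inner (Kf y *v (x - y)) (A x *v (Kf y *v (x - y))) * G' (qf y x) - Lop b (qf y) x * G (qf y x)))"
   by (elim exE conjE)
   note Lh = Lh0[rule_format] and Li = Li0[rule_format]
   have ball: "ALL x y. norm (x - y) <= sq * r --> \<bar>g x - g y\<bar> <= \<omega>" using d(2) r(3) by (meson le_less_trans less_imp_le)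
   have rr: "0 < sq * r" using r sq by simp
   note av = cball_average[OF g R rr r(4) ball less_imp_le[OF \<omega>]]
   have ptw: "Lop b h x <= K2 * smear rh2 g x + ((- M) * g x + (M * \<omega>) * tent (R + 3) x)" for x
   proof -
   have "Lop b h x <= (LINT y|lborel. K2 * (g y * tent rh2 (x - y)) - c2 * r powr (- N) * (g y * indicator (cball x (sq * r)) y))"
   unfolding Lh
   proof (intro integral_mono Li)
   show "integrable lborel (%y. K2 * (g y * tent rh2 (x - y)) - c2 * r powr (- N) * (g y * indicator (cball x (sq * r)) y))"
   by (intro Bochner_Integration.integrable_diff integrable_mult_right smear_integrable g av(3))
   fix y
   have t: "(if qf y x <= S2 then 1 else 0) <= tent rh2 (x - y)"
   proof (cases "qf y x <= S2")
   case True
   then have "(norm (x - y))\<^sup>2 <= S2 / th" using q5[of x y] th by (simp add: field_simps)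
   then have "norm (x - y) <= sqrt (S2 / th)" by (rule real_le_rsqrt)
   then show ?thesis using True by (simp add: tent_simps rh2_def)
   qed (simp add: tent_simps)
   have i: "(indicator (cball x (sq * r)) y :: real) <= (if qf y x <= r\<^sup>2 then 1 else 0)"
   proof (cases "norm (x - y) <= sq * r")
   case True
   then have "(norm (x - y))\<^sup>2 <= (sq * r)\<^sup>2" by (intro power_mono) auto
   then have "(norm (x - y))\<^sup>2 <= th * r\<^sup>2" by (simp add: power_mult_distrib sq)
   then have "(norm (x - y))\<^sup>2 / th <= r\<^sup>2" using th by (simp add: field_simps)
   then have "qf y x <= r\<^sup>2" using q6[of y x] by linarith
   then show ?thesis by (simp add: indicator_def)
   qed (simp add: indicator_def dist_norm)
   have "- 4 * inner (Kf y *v (x - y)) (A x *v (Kf y *v (x - y))) * G' (qf y x) - Lop b (qf y) x * G (qf y x)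
   <= K2 * (if qf y x <= S2 then 1 else 0) - c2 * r powr (- N) * (if qf y x <= r\<^sup>2 then 1 else 0)"
   by (rule Gi[OF qnn q1[where b=b, OF b(3)] q2 q3 q4])
   also have "... <= K2 * tent rh2 (x - y) - c2 * r powr (- N) * indicator (cball x (sq * r)) y"
   using c2 by (intro diff_mono mult_left_mono t i) auto
   finally have "g y * (- 4 * inner (Kf y *v (x - y)) (A x *v (Kf y *v (x - y))) * G' (qf y x) - Lop b (qf y) x * G (qf y x)) <= g y * (K2 * tent rh2 (x - y) - c2 * r powr (- N) * indicator (cball x (sq * r)) y)"
   by (rule mult_left_mono[OF _ g(2)])
   then show "g y * (- 4 * inner (Kf y *v (x - y)) (A x *v (Kf y *v (x - y))) * G' (qf y x) - Lop b (qf y) x * G (qf y x)) <= K2 * (g y * tent rh2 (x - y)) - c2 * r powr (- N) * (g y * indicator (cball x (sq * r)) y)"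
   by (simp add: algebra_simps)
   qed
   also have "... = K2 * smear rh2 g x - c2 * r powr (- N) * (LINT y|lborel. g y * indicator (cball x (sq * r)) y)"
   unfolding smear_def
   by (subst Bochner_Integration.integral_diff[OF integrable_mult_right[OF smear_integrable[OF g(1)]] integrable_mult_right[OF av(3)]])
   (simp only: integral_mult_right_zero)
   finally have 1: "Lop b h x <= K2 * smear rh2 g x - c2 * r powr (- N) * (LINT y|lborel. g y * indicator (cball x (sq * r)) y)" .
   have "M * (g x - \<omega> * tent (R + 3) x) = c2 * V * (r powr (- N) * (sq * r) ^ CARD('n)) * (g x - \<omega> * tent (R + 3) x)"
   unfolding rp[OF r(1)] M_def ..
   also have "... = c2 * r powr (- N) * ((g x - \<omega> * tent (R + 3) x) * (V * (sq * r) ^ CARD('n)))" by (simp only: mult_ac)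
   also have "... <= c2 * r powr (- N) * (LINT y|lborel. g y * indicator (cball x (sq * r)) y)"
   unfolding V_def N_def using c2 by (intro mult_left_mono av(2)) auto
   finally show ?thesis using 1 by (simp add: algebra_simps)
   qed
   have "I (Lop b h) <= K2 * I (smear rh2 g) + ((- M) * I g + (M * \<omega>) * X)"
   unfolding comb(2)[symmetric] by (intro Imono comb ptw Lop_Cc b h)
   then have "M * I g <= K2 * I (smear rh2 g) + M * \<omega> * X" using I4[OF h] by simp
   moreover have "I (smear rh2 g) <= lat_count rh2 * (LINT x|lborel. g x)"
   by (intro I3 Cc_smear g Per_smear(1))
   then have "K2 * I (smear rh2 g) <= K2 * (lat_count rh2 * (LINT x|lborel. g x))" using c2 by (intro mult_left_mono) auto
   moreover have "K2 * (lat_count rh2 * (LINT x|lborel. g x)) <= K2 * (lat_count rh2 + 1) * (LINT x|lborel. g x)"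
   proof -
   have "0 <= K2 * (LINT x|lborel. g x)" using c2 g(2) by (intro mult_nonneg_nonneg integral_nonneg) auto
   then show ?thesis by (simp add: algebra_simps)
   qed
   moreover have "M * \<omega> * X <= e"
   proof -
   have "M * \<omega> = e / (X + 1)" using M X by (simp add: \<omega>_def)
   then have "M * \<omega> * X = e * (X / (X + 1))" by simp
   also have "... <= e * 1" using X e by (intro mult_left_mono) auto
   finally show ?thesis by simp
   qed
   ultimately show "(c2 * V * sq ^ CARD('n)) * I g <= K2 * (lat_count rh2 + 1) * (LINT x|lborel. g x) + e"
   unfolding M_def by linarith
   qed
   show ?thesis
   proof
   show "cc * (LINT x|lborel. g x) <= I g"
   unfolding cc_def times_divide_eq_left pos_divide_le_eq[OF pos(1)]
   using lower by (simp only: mult.commute[of "I g"])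
   show "I g <= CC * (LINT x|lborel. g x)"
   unfolding CC_def times_divide_eq_left pos_le_divide_eq[OF pos(2)]
   using upper by (simp only: mult.commute[of "I g"])
   qed
  qed
  show "EX I. invariant b cc CC I"
   unfolding invariant_def using I1 I2 I4 bounds by (intro exI[of _ I] conjI allI impI) auto
  qed
 qed
qed

end

subsection \<open>Nash's inequality\<close>

lemma lborel_integral_shift:
 fixes f :: "real ^ 'n::finite => real"
 assumes "f \<in> borel_measurable borel"
 shows "(LINT x|lborel. f (x + a)) = (LINT x|lborel. f x)"
proof -
 have "(LINT x|lborel. f x) = (LINT x|distr lborel borel ((+) a). f x)" by (simp add: lborel_distr_plus)
 also have "... = (LINT x|lborel. f (a + x))" by (rule integral_distr) (use assms in auto)
 finally show ?thesis by (simp add: add.commute)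
qed

lemma Cc_borel: "Cc g ==> g \<in> borel_measurable borel"
 by (auto simp: Cc_def intro: borel_measurable_continuous_onI)

text \<open>Nonnegativity of the variance of \<open>f\<close>.\<close>

lemma unit_interval_jensen:
 fixes f :: "real => real"
 assumes f: "continuous_on {0..1} f"
 shows "(integral {0..1} f)\<^sup>2 <= integral {0..1} (%s. (f s)\<^sup>2)"
proof -
 define m where "m = integral {0..1} f"
 have i1: "f integrable_on {0..1}" "(%s. (f s)\<^sup>2) integrable_on {0..1}"
  by (intro integrable_continuous_real f continuous_intros)+
 have "0 <= integral {0..1} (%s. (f s - m)\<^sup>2)"
  by (rule integral_nonneg) (auto intro!: integrable_continuous_real f continuous_intros)
 also have "(%s. (f s - m)\<^sup>2) = (%s. ((f s)\<^sup>2 - (2 * m) * f s) + m\<^sup>2)"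
  by (auto simp: power2_eq_square algebra_simps)
 also have "integral {0..1} ... = (integral {0..1} (%s. (f s)\<^sup>2) - (2 * m) * m) + m\<^sup>2"
 proof -
  have "((%s. ((f s)\<^sup>2 - (2 * m) * f s) + m\<^sup>2) has_integral ((integral {0..1} (%s. (f s)\<^sup>2) - (2 * m) * m) + m\<^sup>2 * (1 - 0))) {0..1}"
   unfolding m_def[symmetric] using i1
   by (intro has_integral_add has_integral_diff has_integral_mult_right)
   (auto simp: m_def intro: integrable_integral has_integral_const_real[of _ 0 1, simplified])
  then show ?thesis by (simp add: integral_unique)
 qed
 finally show ?thesis by (simp add: m_def power2_eq_square)
qed

lemma Cc_lint_cbox:
 fixes f :: "real ^ 'n::finite => real"
 assumes "continuous_on UNIV f" "!!y. norm y > R ==> f y = 0" "R <= S"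
 shows "(LINT y|lborel. f y) = integral (cbox (- (\<chi> i. S)) (\<chi> i. S)) f"
 by (rule lborel_integral_compact_support(2)) (use assms in auto)

text \<open>The fundamental theorem along the segment from \<open>x\<close> to \<open>x + z\<close>,
  Jensen in the segment parameter, then Fubini and translation invariance.\<close>

lemma translation_bound:
 fixes g :: "real ^ 'n::finite => real"
 assumes g: "C1 g" "!!x. norm x > R ==> g x = 0"
 shows "(LINT x|lborel. (g (x + z) - g x)\<^sup>2) <= (norm z)\<^sup>2 * (LINT x|lborel. (norm (grad g x))\<^sup>2)"
proof -
 define S where "S = \<bar>R\<bar> + norm z + 1"
 let ?B = "cbox (- (\<chi> i. S)) (\<chi> i. S) :: (real ^ 'n) set"
 have g0: "grad g x = 0" if "norm x > \<bar>R\<bar> + 1" for x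
 proof -
  have "g y = 0" if "dist y x < 1" for y
   using that \<open>norm x > \<bar>R\<bar> + 1\<close> norm_triangle_ineq2[of x y] by (intro g(2)) (auto simp: dist_norm norm_minus_commute)
  then have "pd i g x = pd i (%_. 0) x" for i by (intro pd_local[of 1]) auto
  then show ?thesis by (simp add: vec_eq_iff)
 qed
 have gc: "continuous_on UNIV g" by (rule C1_cont[OF g(1)])
 have dc: "continuous_on UNIV (grad g)" by (rule C1_grad_cont[OF g(1)])
 have far: "norm (x + s *\<^sub>R z) > \<bar>R\<bar> + 1" if "norm x > S" "0 <= s" "s <= 1" for x s
 proof -
  have "norm (s *\<^sub>R z) <= norm z" using that by (simp add: mult_left_le_one_le)
  then show ?thesis using norm_triangle_ineq2[of x "- (s *\<^sub>R z)"] that by (auto simp: S_def)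
 qed
 have pt: "(g (x + z) - g x)\<^sup>2 <= integral {0..1} (%s. (norm z)\<^sup>2 * (norm (grad g (x + s *\<^sub>R z)))\<^sup>2)" for x
 proof -
  let ?f = "%s. inner z (grad g (x + s *\<^sub>R z))"
  have fc: "continuous_on {0..1} ?f"
   by (intro continuous_intros continuous_on_compose2[OF dc]) auto
  have "(?f has_integral (g (x + 1 *\<^sub>R z) - g (x + 0 *\<^sub>R z))) {0..1}"
  proof (rule fundamental_theorem_of_calculus)
   show "((%s. g (x + s *\<^sub>R z)) has_vector_derivative ?f s) (at s within {0..1})" for s
   using C1_line[OF g(1), of x z s] by (simp add: has_real_derivative_iff_has_vector_derivative has_vector_derivative_at_within)
  qed simp
  then have "(g (x + z) - g x)\<^sup>2 = (integral {0..1} ?f)\<^sup>2" by (simp add: integral_unique)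
  also have "... <= integral {0..1} (%s. (?f s)\<^sup>2)" by (rule unit_interval_jensen[OF fc])
  also have "... <= integral {0..1} (%s. (norm z)\<^sup>2 * (norm (grad g (x + s *\<^sub>R z)))\<^sup>2)"
  proof (rule integral_le)
   show "(%s. (?f s)\<^sup>2) integrable_on {0..1}" by (intro integrable_continuous_real continuous_intros fc)
   show "(%s. (norm z)\<^sup>2 * (norm (grad g (x + s *\<^sub>R z)))\<^sup>2) integrable_on {0..1}"
   by (intro integrable_continuous_real continuous_intros continuous_on_compose2[OF dc]) auto
   fix s :: real
   have "\<bar>?f s\<bar> <= norm z * norm (grad g (x + s *\<^sub>R z))" by (rule Cauchy_Schwarz_ineq2)
   then have "\<bar>?f s\<bar>\<^sup>2 <= (norm z * norm (grad g (x + s *\<^sub>R z)))\<^sup>2" by (intro power_mono) auto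
   then show "(?f s)\<^sup>2 <= (norm z)\<^sup>2 * (norm (grad g (x + s *\<^sub>R z)))\<^sup>2" by (simp add: power_mult_distrib)
  qed
  finally show ?thesis .
 qed
 have c2: "continuous_on UNIV (%p. (norm z)\<^sup>2 * (norm (grad g (fst p + snd p *\<^sub>R z)))\<^sup>2)"
  by (intro continuous_intros continuous_on_compose2[OF dc]) auto
 have sh: "integral ?B (%x. (norm z)\<^sup>2 * (norm (grad g (x + s *\<^sub>R z)))\<^sup>2) = (norm z)\<^sup>2 * (LINT x|lborel. (norm (grad g x))\<^sup>2)"
  if s: "0 <= s" "s <= 1" for s
 proof -
  have e1: "(LINT x|lborel. (norm z)\<^sup>2 * (norm (grad g (x + s *\<^sub>R z)))\<^sup>2) = integral ?B (%x. (norm z)\<^sup>2 * (norm (grad g (x + s *\<^sub>R z)))\<^sup>2)"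
  proof (rule lborel_integral_compact_support(2))
   show "continuous_on UNIV (%x. (norm z)\<^sup>2 * (norm (grad g (x + s *\<^sub>R z)))\<^sup>2)"
   by (intro continuous_intros continuous_on_compose2[OF dc]) auto
   show "(norm z)\<^sup>2 * (norm (grad g (x + s *\<^sub>R z)))\<^sup>2 = 0" if "norm x > S" for x
   using g0[OF far[OF that s]] by simp
  qed
  have e2: "(LINT x|lborel. (norm z)\<^sup>2 * (norm (grad g (x + s *\<^sub>R z)))\<^sup>2) = (LINT x|lborel. (norm z)\<^sup>2 * (norm (grad g x))\<^sup>2)"
   by (rule lborel_integral_shift[where f="%x. (norm z)\<^sup>2 * (norm (grad g x))\<^sup>2"])
   (intro borel_measurable_continuous_onI continuous_intros dc)
  show ?thesis by (rule trans[OF e1[symmetric] trans[OF e2 integral_mult_right_zero]])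
 qed
 have "(LINT x|lborel. (g (x + z) - g x)\<^sup>2) = integral ?B (%x. (g (x + z) - g x)\<^sup>2)"
 proof (rule lborel_integral_compact_support(2))
  show "continuous_on UNIV (%x. (g (x + z) - g x)\<^sup>2)"
   by (intro continuous_intros gc continuous_on_compose2[OF gc]) auto
  show "(g (x + z) - g x)\<^sup>2 = 0" if "norm x > S" for x
  proof -
   have "norm (x + 1 *\<^sub>R z) > \<bar>R\<bar> + 1" "norm (x + 0 *\<^sub>R z) > \<bar>R\<bar> + 1" by (rule far[OF that]; simp)+
   then have "g (x + z) = 0" "g x = 0" by (auto intro!: g(2))
   then show ?thesis by simp
  qed
 qed
 also have "... <= integral ?B (%x. integral {0..1} (%s. (norm z)\<^sup>2 * (norm (grad g (x + s *\<^sub>R z)))\<^sup>2))"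
 proof (rule integral_le)
  show "(%x. (g (x + z) - g x)\<^sup>2) integrable_on ?B"
   by (intro integrable_continuous continuous_intros continuous_on_compose2[OF gc] continuous_on_subset[OF gc]) auto
  have "continuous_on ?B (%x. integral (cbox 0 1) (%s. (norm z)\<^sup>2 * (norm (grad g (x + s *\<^sub>R z)))\<^sup>2))"
   by (rule integral_continuous_on_param) (use continuous_on_subset[OF c2] in "auto simp: case_prod_beta'")
  then show "(%x. integral {0..1} (%s. (norm z)\<^sup>2 * (norm (grad g (x + s *\<^sub>R z)))\<^sup>2)) integrable_on ?B"
   by (intro integrable_continuous) simp
 qed (rule pt)
 also have "... = integral (cbox 0 1) (%s. integral ?B (%x. (norm z)\<^sup>2 * (norm (grad g (x + s *\<^sub>R z)))\<^sup>2))"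
  using integral_swap_continuous[of "- (\<chi> i. S)" "0::real" "\<chi> i. S" 1 "%x s. (norm z)\<^sup>2 * (norm (grad g (x + s *\<^sub>R z)))\<^sup>2"]
   continuous_on_subset[OF c2] by (simp add: case_prod_beta')
 also have "... = (norm z)\<^sup>2 * (LINT x|lborel. (norm (grad g x))\<^sup>2)" (is "_ = ?K")
 proof -
  have "((%s::real. ?K) has_integral ?K) {0..1}"
   using has_integral_const_real[of ?K 0 1] by simp
  then have "((%s. integral ?B (%x. (norm z)\<^sup>2 * (norm (grad g (x + s *\<^sub>R z)))\<^sup>2)) has_integral ?K) {0..1}"
  proof (rule has_integral_eq[rotated])
   fix s :: real assume "s \<in> {0..1}"
   then have "0 <= s" "s <= 1" by auto
   from sh[OF this] show "?K = integral ?B (%x. (norm z)\<^sup>2 * (norm (grad g (x + s *\<^sub>R z)))\<^sup>2)" by (rule sym)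
  qed
  then show ?thesis unfolding box_real by (rule integral_unique)
 qed
 finally show ?thesis .
qed

text \<open>From g(x)^2 <= (g(x+z) - g(x))^2 + 2 |g(x)| |g(x+z)|, averaged over z in a cube of side
  \<open>r\<close>: the first term is a translation difference, and averaging |g(x+z)| over z costs
  at most the L1 norm divided by the volume. The side \<open>r\<close> stays free and is optimised
  where the inequality is applied.\<close>

lemma nash_inequality:
 fixes g :: "real ^ 'n::finite => real"
 assumes g: "C1 g" "!!x. norm x > R ==> g x = 0" and r: "r > 0"
 shows "(LINT x|lborel. (g x)\<^sup>2) <= real CARD('n) * r\<^sup>2 * (LINT x|lborel. (norm (grad g x))\<^sup>2)
   + 2 / r ^ CARD('n) * (LINT x|lborel. \<bar>g x\<bar>)\<^sup>2"
proof -
 let ?Q = "cbox 0 (\<chi> i. r) :: (real ^ 'n) set"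
 let ?n = "real CARD('n)"
 have gc: "continuous_on UNIV g" by (rule C1_cont[OF g(1)])
 define Y where "Y = (LINT x|lborel. (g x)\<^sup>2)"
 define Dg where "Dg = (LINT x|lborel. (norm (grad g x))\<^sup>2)"
 define N where "N = (LINT x|lborel. \<bar>g x\<bar>)"
 define S where "S = \<bar>R\<bar>"
 let ?B = "cbox (- (\<chi> i. S)) (\<chi> i. S) :: (real ^ 'n) set"
 have CcI: "Cc h" if "continuous_on UNIV h" "!!x. g x = 0 ==> h x = 0" for h
  using that g(2) unfolding Cc_def by blast
 have Dnn: "Dg >= 0" unfolding Dg_def by simp
 have per_z: "Y <= ?n * r\<^sup>2 * Dg + 2 * integral ?B (%x. \<bar>g x\<bar> * \<bar>g (x + z)\<bar>)" if z: "z \<in> ?Q" for z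
 proof -
  have nz: "(norm z)\<^sup>2 <= ?n * r\<^sup>2"
  proof -
   have "(norm z)\<^sup>2 = (\<Sum>i\<in>UNIV. (z $ i)\<^sup>2)" unfolding power2_norm_eq_inner inner_vec_def by (simp add: power2_eq_square)
   also have "... <= (\<Sum>i\<in>(UNIV :: 'n set). r\<^sup>2)" using z by (intro sum_mono power_mono) (auto simp: mem_box_cart)
   finally show ?thesis by simp
  qed
  have gz: "continuous_on UNIV (%x. g (x + z))" by (intro continuous_on_compose2[OF gc] continuous_intros) auto
  have i2: "Cc (%x. (g x)\<^sup>2)" by (rule CcI) (auto intro!: continuous_intros gc)
  have i3: "Cc (%x. \<bar>g x\<bar> * \<bar>g (x + z)\<bar>)" by (rule CcI) (auto intro!: continuous_intros gc gz)
  have i4: "Cc (%x. (g (x + z) - g x)\<^sup>2)" unfolding Cc_def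
  proof (intro conjI exI allI impI)
   show "continuous_on UNIV (%x. (g (x + z) - g x)\<^sup>2)" by (intro continuous_intros gc gz)
   show "(g (x + z) - g x)\<^sup>2 = 0" if "norm x > \<bar>R\<bar> + norm z" for x
   proof -
   have "norm x - norm z <= norm (x + z)" using norm_triangle_ineq2[of x "- z"] by simp
   then have "norm (x + z) > R" "norm x > R" using that norm_ge_zero[of z] by linarith+
   then have "g (x + z) = 0" "g x = 0" by (auto intro!: g(2))
   then show ?thesis by simp
   qed
  qed
  have "Y <= (LINT x|lborel. (g (x + z) - g x)\<^sup>2 + 2 * (\<bar>g x\<bar> * \<bar>g (x + z)\<bar>))" unfolding Y_def
  proof (rule integral_mono)
   show "integrable lborel (%x. (g x)\<^sup>2)" by (rule Cc_integrable[OF i2])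
   show "integrable lborel (%x. (g (x + z) - g x)\<^sup>2 + 2 * (\<bar>g x\<bar> * \<bar>g (x + z)\<bar>))"
   by (rule Bochner_Integration.integrable_add[OF Cc_integrable[OF i4] integrable_mult_right[OF Cc_integrable[OF i3]]])
   fix x
   have "g x * g (x + z) <= \<bar>g x\<bar> * \<bar>g (x + z)\<bar>" by (metis abs_ge_self abs_mult)
   moreover have "(g (x + z) - g x)\<^sup>2 + 2 * (g x * g (x + z)) = (g x)\<^sup>2 + (g (x + z))\<^sup>2"
   by (simp add: power2_eq_square algebra_simps)
   moreover have "0 <= (g (x + z))\<^sup>2" by simp
   ultimately show "(g x)\<^sup>2 <= (g (x + z) - g x)\<^sup>2 + 2 * (\<bar>g x\<bar> * \<bar>g (x + z)\<bar>)" by linarith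
  qed
  also have "... = (LINT x|lborel. (g (x + z) - g x)\<^sup>2) + 2 * (LINT x|lborel. \<bar>g x\<bar> * \<bar>g (x + z)\<bar>)"
   using Cc_integrable[OF i3] Cc_integrable[OF i4] by simp
  also have "(LINT x|lborel. (g (x + z) - g x)\<^sup>2) <= (norm z)\<^sup>2 * Dg" unfolding Dg_def by (rule translation_bound[OF g])
  also have "(norm z)\<^sup>2 * Dg <= ?n * r\<^sup>2 * Dg" by (intro mult_right_mono nz Dnn)
  also have "(LINT x|lborel. \<bar>g x\<bar> * \<bar>g (x + z)\<bar>) = integral ?B (%x. \<bar>g x\<bar> * \<bar>g (x + z)\<bar>)"
   by (rule Cc_lint_cbox[where R=R]) (auto simp: S_def g(2) intro!: continuous_intros gc gz)
  finally show ?thesis by simp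
 qed
 have c2: "continuous_on UNIV (%p. \<bar>g (snd p)\<bar> * \<bar>g (snd p + fst p)\<bar>)"
  by (intro continuous_intros continuous_on_compose2[OF gc]) auto
 have contQ: "continuous_on ?Q (%z. integral ?B (%x. \<bar>g x\<bar> * \<bar>g (x + z)\<bar>))"
  by (rule integral_continuous_on_param) (use continuous_on_subset[OF c2] in "auto simp: case_prod_beta'")
 have vol: "measure lborel ?Q = r ^ CARD('n)"
 proof -
  have "0 \<in> ?Q" using r by (simp add: mem_box_cart)
  then have "?Q \<noteq> {}" by blast
  from content_cbox_cart[OF this] show ?thesis by simp
 qed
 have "r ^ CARD('n) * Y = integral ?Q (%z. Y)" using vol by simp
 also have "... <= integral ?Q (%z. ?n * r\<^sup>2 * Dg + 2 * integral ?B (%x. \<bar>g x\<bar> * \<bar>g (x + z)\<bar>))"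
  by (rule integral_le) (auto intro!: integrable_continuous continuous_intros contQ per_z)
 also have "... = r ^ CARD('n) * (?n * r\<^sup>2 * Dg) + 2 * integral ?Q (%z. integral ?B (%x. \<bar>g x\<bar> * \<bar>g (x + z)\<bar>))"
 proof -
  have ih: "(%z. integral ?B (%x. \<bar>g x\<bar> * \<bar>g (x + z)\<bar>)) integrable_on ?Q" by (rule integrable_continuous[OF contQ])
  have "((%z::real ^ 'n. ?n * r\<^sup>2 * Dg) has_integral (r ^ CARD('n) * (?n * r\<^sup>2 * Dg))) ?Q"
   using has_integral_const[of "?n * r\<^sup>2 * Dg" 0 "(\<chi> i. r) :: real ^ 'n"] vol by simp
  from has_integral_add[OF this has_integral_mult_right[OF integrable_integral[OF ih], of 2]]
  show ?thesis by (rule integral_unique)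
 qed
 also have "integral ?Q (%z. integral ?B (%x. \<bar>g x\<bar> * \<bar>g (x + z)\<bar>)) = integral ?B (%x. integral ?Q (%z. \<bar>g x\<bar> * \<bar>g (x + z)\<bar>))"
  by (rule integral_swap_continuous) (use continuous_on_subset[OF c2] in "auto simp: case_prod_beta'")
 also have "... <= integral ?B (%x. \<bar>g x\<bar> * N)"
 proof (rule integral_le)
  have "continuous_on ?B (%x. integral ?Q (%z. \<bar>g x\<bar> * \<bar>g (x + z)\<bar>))"
  proof (rule integral_continuous_on_param)
   have "continuous_on UNIV (%p. \<bar>g (fst p)\<bar> * \<bar>g (fst p + snd p)\<bar>)"
   by (intro continuous_intros continuous_on_compose2[OF gc]) auto
   then show "continuous_on (?B \<times> ?Q) (%(x, z). \<bar>g x\<bar> * \<bar>g (x + z)\<bar>)"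
   by (auto simp: case_prod_beta' intro: continuous_on_subset)
  qed
  then show "(%x. integral ?Q (%z. \<bar>g x\<bar> * \<bar>g (x + z)\<bar>)) integrable_on ?B" by (rule integrable_continuous)
  show "(%x. \<bar>g x\<bar> * N) integrable_on ?B"
   by (intro integrable_continuous continuous_intros continuous_on_subset[OF gc]) auto
  fix x
  have gx: "continuous_on UNIV (%z. g (x + z))" by (intro continuous_on_compose2[OF gc] continuous_intros) auto
  have "integral ?Q (%z. \<bar>g (x + z)\<bar>) <= N"
  proof -
   have ci: "Cc (%z. \<bar>g (z + x)\<bar>)" unfolding Cc_def
   proof (intro conjI exI allI impI)
   show "continuous_on UNIV (%z. \<bar>g (z + x)\<bar>)" using gx by (auto intro!: continuous_intros simp: add.commute)
   show "\<bar>g (z + x)\<bar> = 0" if "norm z > \<bar>R\<bar> + norm x" for z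
   using that norm_triangle_ineq2[of z "- x"] by (simp add: g(2))
   qed
   have "((%z. \<bar>g (z + x)\<bar>) has_integral (LINT z|lborel. \<bar>g (z + x)\<bar>)) UNIV"
   by (rule has_integral_integral_lborel[OF Cc_integrable[OF ci]])
   moreover have "(LINT z|lborel. \<bar>g (z + x)\<bar>) = N" unfolding N_def
   by (rule lborel_integral_shift[where f="%x. \<bar>g x\<bar>"]) (intro borel_measurable_continuous_onI continuous_intros gc)
   ultimately have hi: "((%z. \<bar>g (x + z)\<bar>) has_integral N) UNIV" by (simp add: add.commute)
   have hq: "(%z. \<bar>g (x + z)\<bar>) integrable_on ?Q"
   by (intro integrable_continuous continuous_intros continuous_on_subset[OF gx]) auto
   show ?thesis
   by (rule has_integral_subset_le[OF subset_UNIV integrable_integral[OF hq] hi]) auto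
  qed
  then show "integral ?Q (%z. \<bar>g x\<bar> * \<bar>g (x + z)\<bar>) <= \<bar>g x\<bar> * N"
   by (simp add: mult_left_mono)
 qed
 also have "integral ?B (%x. \<bar>g x\<bar> * N) = N * N"
 proof -
  have "(LINT x|lborel. \<bar>g x\<bar>) = integral ?B (%x. \<bar>g x\<bar>)"
   by (rule Cc_lint_cbox[where R=R]) (auto simp: S_def g(2) intro!: continuous_intros gc)
  then show ?thesis by (simp add: N_def)
 qed
 finally have "r ^ CARD('n) * Y <= r ^ CARD('n) * (?n * r\<^sup>2 * Dg) + 2 * (N * N)" by simp
 then have "Y <= (r ^ CARD('n) * (?n * r\<^sup>2 * Dg) + 2 * (N * N)) / r ^ CARD('n)"
  using r by (simp add: field_simps)
 also have "... = ?n * r\<^sup>2 * Dg + 2 / r ^ CARD('n) * N\<^sup>2"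
  using r by (simp add: add_divide_distrib power2_eq_square)
 finally show ?thesis unfolding Y_def Dg_def N_def .
qed

text \<open>The power \<open>y powr (- \<nu>)\<close> grows at least at the constant rate
  \<open>\<nu> * k\<close>, whatever its initial value, so the bound does not involve
  \<open>y s\<close>. If \<open>y t > 0\<close>, the monotonicity assumption keeps \<open>y\<close>
  positive on the whole interval.\<close>

lemma nash_ode:
 fixes y y' :: "real => real"
 assumes st: "s < t" and y: "!!u. s <= u ==> u <= t ==> (y has_real_derivative y' u) (at u)"
  "!!u. s <= u ==> u <= t ==> y u >= 0"
  and k: "k > 0" "\<nu> > 0" and d: "!!u. s <= u ==> u <= t ==> y u > 0 ==> y' u <= - k * y u powr (1 + \<nu>)"
  and mono: "!!u. s <= u ==> u <= t ==> y t <= y u"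
 shows "y t <= (\<nu> * k * (t - s)) powr (- 1 / \<nu>)"
proof (cases "y t > 0")
 case True
 have yp: "y u > 0" if "s <= u" "u <= t" for u using mono[OF that] True by linarith
 have "\<exists>z>s. z < t & y t powr (- \<nu>) - y s powr (- \<nu>) = (t - s) * (- \<nu> * y z powr (- \<nu> - 1) * y' z)"
  using st by (intro MVT2) (auto intro!: derivative_eq_intros y yp simp: yp)
 then obtain z where z: "s < z" "z < t" "y t powr (- \<nu>) - y s powr (- \<nu>) = (t - s) * (- \<nu> * y z powr (- \<nu> - 1) * y' z)" by blast
 have "y z powr (- \<nu> - 1) * y' z <= y z powr (- \<nu> - 1) * (- k * y z powr (1 + \<nu>))"
  using z yp[of z] by (intro mult_left_mono d) auto
 also have "... = - k * (y z powr (- \<nu> - 1) * y z powr (1 + \<nu>))" by simp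
 also have "y z powr (- \<nu> - 1) * y z powr (1 + \<nu>) = 1"
  using yp[of z] z by (simp add: powr_add[symmetric])
 finally have "\<nu> * (y z powr (- \<nu> - 1) * y' z) <= \<nu> * (- k * 1)" using k by (intro mult_left_mono) auto
 then have "\<nu> * k <= - \<nu> * y z powr (- \<nu> - 1) * y' z" by (simp add: mult_ac)
 then have "(t - s) * (\<nu> * k) <= (t - s) * (- \<nu> * y z powr (- \<nu> - 1) * y' z)"
  using st by (intro mult_left_mono) auto
 then have "(t - s) * (\<nu> * k) <= y t powr (- \<nu>)" using z(3) powr_ge_zero[of "y s" "- \<nu>"] by linarith
 then have "(y t powr (- \<nu>)) powr (- 1 / \<nu>) <= ((t - s) * (\<nu> * k)) powr (- 1 / \<nu>)"
  using st k by (intro powr_mono2') auto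
 moreover have "(y t powr (- \<nu>)) powr (- 1 / \<nu>) = y t" using k True by (simp add: powr_powr)
 ultimately show ?thesis by (simp add: mult_ac)
next
 case False
 then show ?thesis using powr_ge_zero[of "\<nu> * k * (t - s)" "- 1 / \<nu>"] by linarith
qed

subsection \<open>Ultracontractivity for subsolutions with compact support\<close>

context periodic_diffusion
begin

lemma invariantD:
 assumes "invariant b c C I"
 shows "Cc g ==> Cc h ==> I (%x. g x + h x) = I g + I h" "Cc g ==> I (%x. a * g x) = a * I g"
  "C2 h ==> Cc h ==> I (Lop b h) = 0"
  "Cc g ==> (!!x. 0 <= g x) ==> c * (LINT x|lborel. g x) <= I g"
  "Cc g ==> (!!x. 0 <= g x) ==> I g <= C * (LINT x|lborel. g x)"
 using assms unfolding invariant_def by blast+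

lemma invariant_mono:
 assumes I: "invariant b c C I" "c > 0" and gh: "Cc g" "Cc h" "!!x. g x <= h x"
 shows "I g <= I h"
proof -
 have cc: "Cc (%x. h x + (- 1) * g x)" using gh Cc_add Cc_cmult by blast
 have "0 <= c * (LINT x|lborel. h x + (- 1) * g x)"
  using I(2) gh by (intro mult_nonneg_nonneg Bochner_Integration.integral_nonneg) auto
 also have "... <= I (%x. h x + (- 1) * g x)" by (rule invariantD(4)[OF I(1) cc]) (use gh in simp)
 also have "... = I h + (- 1) * I g"
  using invariantD(1)[OF I(1) gh(2) Cc_cmult[OF gh(1), of "- 1"]] invariantD(2)[OF I(1) gh(1), of "- 1"] by simp
 finally show ?thesis by simp
qed

lemma invariant_diff:
 assumes I: "invariant b c C I" and gh: "Cc g" "Cc h"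
 shows "I (%x. g x - h x) = I g - I h"
 using invariantD(1)[OF I gh(1) Cc_cmult[OF gh(2), of "- 1"]] invariantD(2)[OF I gh(2), of "- 1"] by simp

lemma Cc_diff: "Cc g ==> Cc h ==> Cc (%x. g x - h x)"
 using Cc_add[of g "%x. - 1 * h x"] Cc_cmult[of h "- 1"] by simp

text \<open>Continuity of the functional under uniform convergence with fixed support, which stands
  in for dominated convergence.\<close>

lemma invariant_small:
 assumes I: "invariant b c C I" "c > 0" and g: "Cc g" "!!x. \<bar>g x\<bar> <= e * tent R x"
 shows "\<bar>I g\<bar> <= e * I (tent R)"
proof -
 have "I g <= I (%x. e * tent R x)"
  by (rule invariant_mono[OF I g(1) Cc_cmult[OF Cc_tent]]) (use g(2) in "simp add: abs_le_iff")
 moreover have "I (%x. (- e) * tent R x) <= I g"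
  by (rule invariant_mono[OF I Cc_cmult[OF Cc_tent] g(1)]) (use g(2) in "simp add: abs_le_iff minus_le_iff")
 ultimately show ?thesis using invariantD(2)[OF I(1) Cc_tent, of e R] invariantD(2)[OF I(1) Cc_tent, of "- e" R] by simp
qed

text \<open>By the mean value theorem and uniform continuity on a compact set the difference
  quotients converge uniformly with common support, so \<open>invariant_small\<close>
  applies.\<close>

lemma invariant_DERIV:
 assumes I: "invariant b c C I" "c > 0" and t: "t \<in> {T0<..<T1}"
  and d: "!!s x. s \<in> {T0<..<T1} ==> ((%s. g s x) has_real_derivative g' s x) (at s)"
  and gc: "!!s. s \<in> {T0<..<T1} ==> continuous_on UNIV (g s)"
  and c': "continuous_on ({T0<..<T1} \<times> UNIV) (%(s, x). g' s x)"
  and supp: "!!s x. s \<in> {T0<..<T1} ==> norm x > R ==> g s x = 0"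
 shows "((%s. I (g s)) has_real_derivative I (g' t)) (at t)"
proof -
 define rh where "rh = \<bar>R\<bar> + 1"
 obtain a where a: "a > 0" "{t - a..t + a} \<subseteq> {T0<..<T1}"
 proof
  show "min (t - T0) (T1 - t) / 2 > 0" using t by auto
  show "{t - min (t - T0) (T1 - t) / 2..t + min (t - T0) (T1 - t) / 2} \<subseteq> {T0<..<T1}"
   using t by (auto simp: min_def field_simps)
 qed
 have tin: "s \<in> {T0<..<T1}" if "\<bar>s - t\<bar> <= a" for s
 proof -
  have "s \<in> {t - a..t + a}" using that by (simp add: abs_le_iff)
  then show ?thesis using a(2) by blast
 qed
 have supp': "g' s x = 0" if "s \<in> {T0<..<T1}" "norm x > R" for s x
 proof (rule DERIV_unique[OF d[OF that(1)]])
  show "((%s. g s x) has_real_derivative 0) (at s)"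
   by (rule has_field_derivative_transform_within_open[OF DERIV_const[of 0], where S="{T0<..<T1}"])
   (use that supp in auto)
 qed
 have g'c: "continuous_on UNIV (g' s)" if "s \<in> {T0<..<T1}" for s
 proof -
  have "continuous_on UNIV (%x. (%(s, x). g' s x) (s, x))"
   by (rule continuous_on_compose2[OF c']) (use that in "auto intro!: continuous_intros")
  then show ?thesis by simp
 qed
 have Ccg: "Cc (g s)" "Cc (g' s)" if "s \<in> {T0<..<T1}" for s
  unfolding Cc_def using gc[OF that] g'c[OF that] supp[OF that] supp'[OF that] by blast+
 have uc: "uniformly_continuous_on ({t - a..t + a} \<times> cball 0 rh) (%(s, x). g' s x)"
  by (rule compact_uniformly_continuous[OF continuous_on_subset[OF c']])
   (use a(2) in "auto intro!: compact_Times")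
 define X where "X = I (tent (rh + 1))"
 have X: "X >= 0"
 proof -
  have "I (%x. 0 * tent (rh + 1) x) <= X" unfolding X_def
   by (rule invariant_mono[OF I Cc_cmult[OF Cc_tent] Cc_tent]) (simp add: tent_simps)
  then show ?thesis using invariantD(2)[OF I(1) Cc_tent, of 0 "rh + 1"] by simp
 qed
 show ?thesis unfolding has_field_derivative_iff
 proof (rule LIM_I)
  fix e :: real assume e: "e > 0"
  define e' where "e' = e / (X + 1) / 2"
  have e': "e' > 0" using e X by (simp add: e'_def)
  obtain dt where dt: "dt > 0" "!!p q. p \<in> {t - a..t + a} \<times> cball 0 rh ==> q \<in> {t - a..t + a} \<times> cball 0 rh ==> dist q p < dt ==>
   dist ((%(s, x). g' s x) q) ((%(s, x). g' s x) p) < e'"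
   using uc e' unfolding uniformly_continuous_on_def by metis
  show "\<exists>s>0. ALL x. x \<noteq> t & norm (x - t) < s --> norm ((I (g x) - I (g t)) / (x - t) - I (g' t)) < e"
  proof (intro exI[of _ "min a dt"] conjI allI impI)
   show "min a dt > 0" using a dt by simp
   fix s assume s: "s \<noteq> t & norm (s - t) < min a dt"
   have sin: "s \<in> {T0<..<T1}" by (rule tin) (use s in simp)
   define ph where "ph x = (1 / (s - t)) * (g s x - g t x) - g' t x" for x
   have phc: "Cc ph" unfolding ph_def[abs_def] by (intro Cc_diff Cc_cmult Ccg sin t)
   have "\<bar>ph x\<bar> <= e' * tent (rh + 1) x" for x
   proof (cases "norm x > R")
   case True
   then show ?thesis using supp[OF sin True] supp[OF t True] supp'[OF t True] e' by (simp add: ph_def tent_simps)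
   next
   case False
   then have xr: "x \<in> cball 0 rh" by (simp add: rh_def)
   have "EX z. z \<in> open_segment t s & g s x - g t x = (s - t) * g' z x"
   proof (cases "t < s")
   case True
   have "\<exists>z>t. z < s & g s x - g t x = (s - t) * g' z x"
   by (rule MVT2[OF True]) (rule d[OF tin], use s True in auto)
   then show ?thesis using True by (auto simp: open_segment_eq_real_ivl)
   next
   case False
   then have "s < t" using s by auto
   have "\<exists>z>s. z < t & g t x - g s x = (t - s) * g' z x"
   by (rule MVT2[OF \<open>s < t\<close>]) (rule d[OF tin], use s \<open>s < t\<close> in auto)
   then obtain z where "s < z" "z < t" "g t x - g s x = (t - s) * g' z x" by blast
   then have "z \<in> open_segment t s" "g s x - g t x = (s - t) * g' z x"
   using \<open>s < t\<close> by (auto simp: open_segment_eq_real_ivl algebra_simps)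
   then show ?thesis by blast
   qed
   then obtain z where z: "z \<in> open_segment t s" "g s x - g t x = (s - t) * g' z x" by blast
   have zt: "\<bar>z - t\<bar> < min a dt"
   using z(1) s by (auto simp: open_segment_eq_real_ivl split: if_splits)
   have "ph x = g' z x - g' t x" using s by (simp add: ph_def z(2))
   moreover have "dist ((%(s, x). g' s x) (z, x)) ((%(s, x). g' s x) (t, x)) < e'"
   by (rule dt(2)) (use zt a(1) xr in "auto simp: dist_Pair_Pair dist_real_def abs_le_iff")
   moreover have "tent (rh + 1) x = 1" using xr by (intro tent_simps) simp
   ultimately show ?thesis by (simp add: dist_real_def)
   qed
   then have "\<bar>I ph\<bar> <= e' * X" unfolding X_def by (rule invariant_small[OF I phc])
   also have "... < e"
   proof -
   have "e' * X <= e' * (X + 1)" using e' by simp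
   also have "e' * (X + 1) = e / 2"
   proof -
   have "X + 1 \<noteq> 0" using X by linarith
   from nonzero_eq_divide_eq[OF this, of e' "e / 2"] show ?thesis by (simp add: e'_def)
   qed
   finally show ?thesis using e by linarith
   qed
   finally have "\<bar>I ph\<bar> < e" .
   moreover have "I ph = (1 / (s - t)) * (I (g s) - I (g t)) - I (g' t)"
   unfolding ph_def[abs_def]
   by (subst invariant_diff[OF I(1) Cc_cmult[OF Cc_diff[OF Ccg(1)[OF sin] Ccg(1)[OF t]]] Ccg(2)[OF t]],
   subst invariantD(2)[OF I(1) Cc_diff[OF Ccg(1)[OF sin] Ccg(1)[OF t]]],
   subst invariant_diff[OF I(1) Ccg(1)[OF sin] Ccg(1)[OF t]]) simp
   ultimately show "norm ((I (g s) - I (g t)) / (s - t) - I (g' t)) < e" by simp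
  qed
 qed
qed

text \<open>Writing the exponent as \<open>Suc (Suc m)\<close> keeps the exponents of both
  derivatives free of truncated subtraction.\<close>

lemma power_C2:
 assumes "C2 h"
 shows "C2 (%x. h x ^ Suc (Suc m))"
  "Lop b (%x. h x ^ Suc (Suc m)) x = real (m + 2) * h x ^ Suc m * Lop b h x + real (m + 2) * real (m + 1) * h x ^ m * inner (grad h x) (A x *v grad h x)"
  "grad (%x. h x ^ Suc (Suc m)) x = (real (m + 2) * h x ^ Suc m) *\<^sub>R grad h x"
proof -
 have d1: "((%s. s ^ Suc (Suc m)) has_real_derivative real (m + 2) * s ^ Suc m) (at s)" for s :: real
  using DERIV_pow[of "Suc (Suc m)" s] by (simp del: power_Suc)
 have d2: "((%s. real (m + 2) * s ^ Suc m) has_real_derivative real (m + 2) * (real (m + 1) * s ^ m)) (at s)" for s :: real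
  using DERIV_cmult[OF DERIV_pow[of "Suc m" s], of "real (m + 2)"] by (simp del: power_Suc)
 have ct: "continuous_on UNIV (%x. real (m + 2) * (real (m + 1) * h x ^ m))"
  by (intro continuous_intros C2_cont[OF assms])
 show "C2 (%x. h x ^ Suc (Suc m))"
  by (rule C2_compose[where F="%s. s ^ Suc (Suc m)" and F'="%s. real (m + 2) * s ^ Suc m" and F''="%s. real (m + 2) * (real (m + 1) * s ^ m)",
   OF assms d1 d2 ct])
 show gr: "grad (%x. h x ^ Suc (Suc m)) x = (real (m + 2) * h x ^ Suc m) *\<^sub>R grad h x"
  by (rule grad_compose[where F="%s. s ^ Suc (Suc m)" and F'="%s. real (m + 2) * s ^ Suc m", OF C2_C1[OF assms] d1])
 show "Lop b (%x. h x ^ Suc (Suc m)) x = real (m + 2) * h x ^ Suc m * Lop b h x + real (m + 2) * real (m + 1) * h x ^ m * inner (grad h x) (A x *v grad h x)"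
  unfolding Lop_def gr D_compose[where F="%s. s ^ Suc (Suc m)" and F'="%s. real (m + 2) * s ^ Suc m" and F''="%s. real (m + 2) * (real (m + 1) * s ^ m)",
   OF assms d1 d2 ct] by (simp add: algebra_simps del: power_Suc)
qed

lemma power_C1:
 assumes "C1 h"
 shows "C1 (%x. h x ^ m)" "grad (%x. h x ^ m) x = (real m * h x ^ (m - 1)) *\<^sub>R grad h x"
proof -
 have d: "((%s. s ^ m) has_real_derivative real m * s ^ (m - 1)) (at s)" for s :: real
  using DERIV_pow[of m s] by simp
 show "C1 (%x. h x ^ m)"
  by (rule C1_compose[where F="%s. s ^ m" and F'="%s. real m * s ^ (m - 1)", OF assms d])
   (intro continuous_intros C1_cont[OF assms])
 show "grad (%x. h x ^ m) x = (real m * h x ^ (m - 1)) *\<^sub>R grad h x"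
  by (rule grad_compose[where F="%s. s ^ m" and F'="%s. real m * s ^ (m - 1)", OF assms d])
qed

text \<open>Recovers a supremum bound from the moments of order \<open>2 ^ k\<close>: if
  \<open>m > \<Lambda>\<close>, the quotient \<open>(m / \<Lambda>) ^ (2 ^ k)\<close> outgrows every
  constant.\<close>

lemma double_exponent_bounded:
 fixes m \<Lambda> K :: real
 assumes "0 <= \<Lambda>" "\<Lambda> < m" "K > 0" "!!k::nat. K * m ^ (2 ^ k) <= Q * \<Lambda> ^ (2 ^ k)"
 shows False
proof (cases "\<Lambda> = 0")
 case True
 then have "K * m > 0" using mult_pos_pos[OF assms(3)] assms(2) by simp
 moreover have "K * m <= 0" using assms(4)[of 0] True by simp
 ultimately show False by linarith
next
 case False
 then have \<Lambda>: "\<Lambda> > 0" using assms(1) by simp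
 define q where "q = m / \<Lambda>"
 have q: "q > 1" using \<Lambda> assms(2) by (simp add: q_def)
 obtain k where k: "Q / K < q ^ k" using real_arch_pow[OF q] by blast
 have "k <= 2 ^ k" by (simp add: less_imp_le)
 then have "q ^ k <= q ^ (2 ^ k)" using q by (intro power_increasing) auto
 with k have "Q / K < q ^ (2 ^ k)" by linarith
 then have "Q < K * q ^ (2 ^ k)" using assms(3) by (simp add: field_simps)
 then have "Q * \<Lambda> ^ (2 ^ k) < K * q ^ (2 ^ k) * \<Lambda> ^ (2 ^ k)" using \<Lambda> by (intro mult_strict_right_mono) auto
 also have "... = K * m ^ (2 ^ k)" using \<Lambda> by (simp add: q_def power_divide)
 finally show False using assms(4)[of k] by simp
qed

text \<open>Going from L1 to the supremum through the powers \<open>2 ^ k\<close> avoids the usual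
  duality step, which would need the adjoint equation. Since the functional vanishes on the operator
  applied to powers of \<open>g\<close>, Nash's inequality bounds the moment
  \<open>F (Suc k) v\<close> by \<open>E * (v - u) powr (- n / 2) * (F k u)\<^sup>2\<close>; this is
  iterated over times that halve the distance to \<open>t\<close>.\<close>

lemma ultracontractive:
 assumes cC: "c > 0" "C > 0"
 obtains K where "K > 0"
  "!!b I g g' T0 s t x. invariant b c C I ==> continuous_on UNIV b ==> T0 < s ==> s < t ==>
   (ALL u x. T0 < u --> 0 <= g u x) ==> (ALL u. T0 < u --> C2 (g u)) ==>
   (ALL u x. T0 < u --> ((%u. g u x) has_real_derivative g' u x) (at u)) ==>
   continuous_on ({T0<..} \<times> UNIV) (%(u, x). g u x) ==> continuous_on ({T0<..} \<times> UNIV) (%(u, x). g' u x) ==>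
   (ALL u x. T0 < u --> g' u x <= Lop b (g u) x) ==>
   (ALL T1. EX R. ALL u x. T0 < u --> u < T1 --> norm x > R --> g u x = 0) ==>
   I (g t) <= I (g s) & g t x <= K * (t - s) powr (- real CARD('n) / 2) * I (g s)"
proof -
 define n where "n = real CARD('n)"
 have n1: "n >= 1" by (simp add: n_def Suc_leI)
 define \<nu> where "\<nu> = 2 / n"
 have \<nu>: "\<nu> > 0" using n1 by (simp add: \<nu>_def)
 define k0 where "k0 = \<alpha>0 * c / (C * n)"
 have k0: "k0 > 0" using \<alpha>0 cC n1 by (simp add: k0_def)
 define B where "B = 2 powr (n / 2)"
 have B: "B >= 1" using n1 by (simp add: B_def ge_one_powr_ge_zero)
 define E where "E = (\<nu> * k0) powr (- 1 / \<nu>) * (4 * C / c\<^sup>2)"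
 have E: "E > 0" using \<nu> k0 cC by (simp add: E_def)
 show ?thesis
 proof (rule that[of "E * B\<^sup>2"])
  show "E * B\<^sup>2 > 0" using E B by simp
  fix b I g g' T0 s t x
  assume I: "invariant b c C I" and bc: "continuous_on UNIV b" and st: "T0 < s" "s < t"
   and g0: "ALL u x. T0 < u --> 0 <= g u x" and gC2: "ALL u. T0 < u --> C2 (g u)"
   and gd: "ALL u x. T0 < u --> ((%u. g u x) has_real_derivative g' u x) (at u)"
   and gcont: "continuous_on ({T0<..} \<times> UNIV) (%(u, x). g u x)" and g'cont: "continuous_on ({T0<..} \<times> UNIV) (%(u, x). g' u x)"
   and sub: "ALL u x. T0 < u --> g' u x <= Lop b (g u) x"
   and supp: "ALL T1. EX R. ALL u x. T0 < u --> u < T1 --> norm x > R --> g u x = 0"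
  obtain R where R: "!!u x. T0 < u ==> u < t + 1 ==> norm x > R ==> g u x = 0" using supp by meson
  have R': "g' u x = 0" if "T0 < u" "u < t + 1" "norm x > R" for u x
  proof (rule DERIV_unique[OF gd[rule_format, OF that(1)]])
   show "((%u. g u x) has_real_derivative 0) (at u)"
   by (rule has_field_derivative_transform_within_open[OF DERIV_const[of 0], where S="{T0<..<t + 1}"])
   (use that R in auto)
  qed
  have slice: "continuous_on UNIV (f u)" if "continuous_on ({T0<..} \<times> UNIV) (%(u, x). f u x)" "T0 < u" for f :: "real => real ^ 'n => real" and u
  proof -
   have "continuous_on UNIV (%x. (%(u, x). f u x) (u, x))"
   by (rule continuous_on_compose2[OF that(1)]) (use that(2) in "auto intro!: continuous_intros")
   then show ?thesis by simp
  qed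
  have gCc: "Cc (g u)" if "T0 < u" "u < t + 1" for u
   unfolding Cc_def using slice[OF gcont that(1)] R[OF that] by blast
  have g'Cc: "Cc (g' u)" if "T0 < u" "u < t + 1" for u
   unfolding Cc_def using slice[OF g'cont that(1)] R'[OF that] by blast
  have pw: "Cc (%x. g u x ^ Suc m)" if "T0 < u" "u < t + 1" for u m
   unfolding power_Suc2 by (rule Cc_mult[OF gCc[OF that]]) (intro continuous_intros C2_cont[OF gC2[rule_format]] that)
  define F where "F k u = I (%x. g u x ^ (2 ^ k))" for k :: nat and u
  have pos2: "EX m. (2::nat) ^ k = Suc m" for k by (metis gr0_conv_Suc zero_less_power pos2)
  have pwk: "Cc (%x. g u x ^ (2 ^ k))" if "T0 < u" "u < t + 1" for u k
   using pos2[of k] pw[OF that] by metis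
  have Fnn: "F k u >= c * (LINT x|lborel. g u x ^ (2 ^ k))" "F k u <= C * (LINT x|lborel. g u x ^ (2 ^ k))"
   if "T0 < u" "u < t + 1" for k u
   unfolding F_def using g0 that by (auto intro!: invariantD[OF I] pwk)
  have F0: "F k u >= 0" if "T0 < u" "u < t + 1" for k u
  proof -
   have "0 <= c * (LINT x|lborel. g u x ^ (2 ^ k))" using cC g0 that by (intro mult_nonneg_nonneg Bochner_Integration.integral_nonneg) auto
   then show ?thesis using Fnn(1)[OF that, of k] by linarith
  qed
  have der: "(F k has_real_derivative I (%x. real (2 ^ k) * g u x ^ (2 ^ k - 1) * g' u x)) (at u)" if u: "T0 < u" "u < t + 1" for k u
   unfolding F_def[abs_def]
  proof (rule invariant_DERIV[OF I cC(1), where ?T0.0=T0 and ?T1.0="t + 1" and R=R])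
   show "u \<in> {T0<..<t + 1}" using u by simp
   fix v assume v: "v \<in> {T0<..<t + 1}"
   show "((%s. g s x ^ 2 ^ k) has_real_derivative real (2 ^ k) * g v x ^ (2 ^ k - 1) * g' v x) (at v)" for x
   using DERIV_power[OF gd[rule_format, of v x], of "2 ^ k"] v by (simp add: mult_ac)
   show "continuous_on UNIV (%x. g v x ^ 2 ^ k)" using pwk[of v k] v by (simp add: Cc_def)
   show "g v x ^ 2 ^ k = 0" if "norm x > R" for x using R[of v x] v that by simp
  next
   have "continuous_on ({T0<..<t + 1} \<times> UNIV) (%p. (%(u, x). g u x) p)"
   "continuous_on ({T0<..<t + 1} \<times> UNIV) (%p. (%(u, x). g' u x) p)"
   by (rule continuous_on_subset[OF gcont], force) (rule continuous_on_subset[OF g'cont], force)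
   then show "continuous_on ({T0<..<t + 1} \<times> UNIV) (%(s, x). real (2 ^ k) * g s x ^ (2 ^ k - 1) * g' s x)"
   unfolding case_prod_beta' by (intro continuous_intros)
  qed
  \<comment> \<open>The first moment has no dissipation to exploit, only monotonicity.\<close>
  have diss0: "I (%x. real (2 ^ 0) * g u x ^ (2 ^ 0 - 1) * g' u x) <= 0" if u: "T0 < u" "u < t + 1" for u
  proof -
   have "I (g' u) <= I (Lop b (g u))"
   by (rule invariant_mono[OF I cC(1) g'Cc[OF u] Lop_Cc[OF bc]]) (use gC2 gCc sub u in auto)
   also have "... = 0" by (rule invariantD(3)[OF I]) (use gC2 gCc u in auto)
   finally show ?thesis by simp
  qed
  \<comment> \<open>The second-order term of the chain rule carries
    \<open>2 ^ Suc k * (2 ^ Suc k - 1)\<close>, at least twice the factor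
    \<open>(2 ^ k)\<^sup>2\<close> that arises from the gradient of the \<open>2 ^ k\<close>-th
    power; hence a dissipation constant uniform in \<open>k\<close>.\<close>
  have diss: "I (%x. real (2 ^ Suc k) * g u x ^ (2 ^ Suc k - 1) * g' u x) <= - 2 * \<alpha>0 * c * (LINT x|lborel. (norm (grad (%x. g u x ^ (2 ^ k)) x))\<^sup>2)"
   if u: "T0 < u" "u < t + 1" for k u
  proof -
   obtain m where m: "(2::nat) ^ Suc k = Suc (Suc m)"
   proof -
   have "(2::nat) ^ Suc k >= 2" by simp
   then show ?thesis using that[of "2 ^ Suc k - 2"] by (simp del: power_Suc)
   qed
   note P = power_C2[where m=m, OF gC2[rule_format, OF u(1)]]
   have C2k: "C1 (%x. g u x ^ (2 ^ k))"
   by (rule power_C1[OF C2_C1[OF gC2[rule_format, OF u(1)]]])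
   have grk: "grad (%x. g u x ^ (2 ^ k)) x = (real (2 ^ k) * g u x ^ (2 ^ k - 1)) *\<^sub>R grad (g u) x" for x
   by (rule power_C1[OF C2_C1[OF gC2[rule_format, OF u(1)]]])
   define W where "W x = (norm (grad (%x. g u x ^ (2 ^ k)) x))\<^sup>2" for x
   have Wc: "Cc W" unfolding Cc_def
   proof (intro conjI exI[of _ "R"] allI impI)
   show "continuous_on UNIV W" unfolding W_def[abs_def] by (intro continuous_intros C1_grad_cont C2k)
   fix x :: "real ^ 'n" assume "norm x > R"
   have "W x = (real (2 ^ k) * g u x ^ (2 ^ k - 1))\<^sup>2 * (norm (grad (g u) x))\<^sup>2"
   by (simp add: W_def grk power_mult_distrib)
   moreover have "grad (g u) x = 0"
   proof -
   have e: "norm x - R > 0" using \<open>norm x > R\<close> by simp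
   have "g u y = 0" if "dist y x < norm x - R" for y
   using that norm_triangle_ineq2[of x y] by (intro R u) (auto simp: dist_norm norm_minus_commute)
   then have "pd i (g u) x = pd i (%_. 0) x" for i by (intro pd_local[OF e]) auto
   then show ?thesis by (simp add: vec_eq_iff)
   qed
   ultimately show "W x = 0" by simp
   qed
   have "real (2 ^ Suc k) * g u x ^ (2 ^ Suc k - 1) * g' u x <= Lop b (%x. g u x ^ (2 ^ Suc k)) x + (- 2 * \<alpha>0) * W x" for x
   proof -
   let ?e = "inner (grad (g u) x) (A x *v grad (g u) x)"
   have gx: "g u x >= 0" using g0 u by auto
   have "real (2 ^ Suc k) * g u x ^ (2 ^ Suc k - 1) * g' u x <= real (2 ^ Suc k) * g u x ^ (2 ^ Suc k - 1) * Lop b (g u) x"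
   using gx sub u by (intro mult_left_mono) auto
   also have "... = Lop b (%x. g u x ^ (2 ^ Suc k)) x - real (m + 2) * real (m + 1) * g u x ^ m * ?e"
   unfolding m P(2) by (simp del: power_Suc)
   also have "... <= Lop b (%x. g u x ^ (2 ^ Suc k)) x - 2 * \<alpha>0 * W x"
   proof -
   have m2: "m + 2 = 2 * 2 ^ k" using m by simp
   then have mk: "m = (2 ^ k - 1) + (2 ^ k - 1)" by simp
   have gm: "g u x ^ m = g u x ^ (2 ^ k - 1) * g u x ^ (2 ^ k - 1)" by (subst mk) (rule power_add)
   have Wx: "W x = real (2 ^ k) ^ 2 * g u x ^ m * (norm (grad (g u) x))\<^sup>2"
   unfolding W_def grk gm by (simp add: power_mult_distrib power2_eq_square mult_ac)
   have e: "?e >= \<alpha>0 * (norm (grad (g u) x))\<^sup>2" by (rule elliptic)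
   have q: "real (m + 2) = 2 * 2 ^ k" using m2 by (metis of_nat_mult of_nat_numeral of_nat_power)
   then have q1: "real (m + 1) >= 2 ^ k" using one_le_power[of "2::real" k] by simp
   have "2 * \<alpha>0 * W x = (2 * 2 ^ k) * 2 ^ k * g u x ^ m * (\<alpha>0 * (norm (grad (g u) x))\<^sup>2)"
   by (simp add: Wx power2_eq_square)
   also have "... <= real (m + 2) * real (m + 1) * g u x ^ m * ?e"
   unfolding q using q1 gx e \<alpha>0 by (intro mult_mono mult_nonneg_nonneg) auto
   finally show ?thesis by linarith
   qed
   finally show ?thesis by simp
   qed
   then have "I (%x. real (2 ^ Suc k) * g u x ^ (2 ^ Suc k - 1) * g' u x) <= I (%x. Lop b (%x. g u x ^ (2 ^ Suc k)) x + (- 2 * \<alpha>0) * W x)"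
   proof (intro invariant_mono[OF I cC(1)])
   show "Cc (%x. real (2 ^ Suc k) * g u x ^ (2 ^ Suc k - 1) * g' u x)"
   by (rule Cc_mult[OF g'Cc[OF u]]) (intro continuous_intros C2_cont[OF gC2[rule_format]] u)
   show "Cc (%x. Lop b (%x. g u x ^ (2 ^ Suc k)) x + (- 2 * \<alpha>0) * W x)"
   by (intro Cc_add Cc_cmult Wc Lop_Cc bc pwk u) (unfold m, rule P(1))
   qed
   also have "... = I (Lop b (%x. g u x ^ (2 ^ Suc k))) + (- 2 * \<alpha>0) * I W"
   proof -
   have LC: "Cc (Lop b (%x. g u x ^ (2 ^ Suc k)))"
   by (intro Lop_Cc bc pwk u) (unfold m, rule P(1))
   show ?thesis
   by (subst invariantD(1)[OF I LC Cc_cmult[OF Wc]]) (simp only: invariantD(2)[OF I Wc])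
   qed
   also have "I (Lop b (%x. g u x ^ (2 ^ Suc k))) = 0"
   by (rule invariantD(3)[OF I _ pwk[OF u]]) (unfold m, rule P(1))
   also have "0 + (- 2 * \<alpha>0) * I W <= (- 2 * \<alpha>0) * (c * (LINT x|lborel. W x))"
   using invariantD(4)[OF I Wc] \<alpha>0 by (simp add: W_def)
   finally show ?thesis by (simp add: W_def mult_ac)
  qed
  have nonincr: "F k v <= F k u" if uv: "T0 < u" "u <= v" "v < t + 1" for k u v
  proof (cases "u = v")
   case False
   have "\<exists>z>u. z < v & F k v - F k u = (v - u) * I (%x. real (2 ^ k) * g z x ^ (2 ^ k - 1) * g' z x)"
   using uv False by (intro MVT2 der) auto
   then obtain z where z: "u < z" "z < v" "F k v - F k u = (v - u) * I (%x. real (2 ^ k) * g z x ^ (2 ^ k - 1) * g' z x)" by blast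
   have zz: "T0 < z" "z < t + 1" using z uv by auto
   have "I (%x. real (2 ^ k) * g z x ^ (2 ^ k - 1) * g' z x) <= 0"
   proof (cases k)
   case 0
   then show ?thesis using diss0[OF zz] by simp
   next
   case (Suc j)
   have "0 <= 2 * \<alpha>0 * c * (LINT x|lborel. (norm (grad (%x. g z x ^ (2 ^ j)) x))\<^sup>2)"
   using \<alpha>0 cC by (intro mult_nonneg_nonneg Bochner_Integration.integral_nonneg) auto
   then show ?thesis using diss[OF zz, of j] Suc by simp
   qed
   then have "(v - u) * I (%x. real (2 ^ k) * g z x ^ (2 ^ k - 1) * g' z x) <= 0"
   using uv by (intro mult_nonneg_nonpos) auto
   then show ?thesis using z(3) by linarith
  qed simp
  have step: "F (Suc k) v <= E * (v - u) powr (- n / 2) * (F k u)\<^sup>2" if uv: "T0 < u" "u < v" "v < t + 1" for k u v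
  proof -
   \<comment> \<open>The shift by \<open>\<eta>\<close> makes \<open>N\<close> positive even if
     \<open>F k u = 0\<close>; it tends to 0 at the end.\<close>
   have main: "F (Suc k) v <= E * (v - u) powr (- n / 2) * (F k u + \<eta>)\<^sup>2" if \<eta>: "\<eta> > 0" for \<eta>
   proof -
   define N where "N = (F k u + \<eta>) / c"
   have N: "N > 0" using F0[of u k] uv \<eta> cC by (simp add: N_def add_nonneg_pos)
   define kk where "kk = k0 * (4 * C * N\<^sup>2) powr (- \<nu>)"
   have kk: "kk > 0" using k0 cC N by (simp add: kk_def)
   have "F (Suc k) v <= (\<nu> * kk * (v - u)) powr (- 1 / \<nu>)"
   proof (rule nash_ode[OF uv(2) der])
   fix w assume w: "u <= w" "w <= v"
   show "T0 < w" "w < t + 1" using w uv by auto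
   show "F (Suc k) w >= 0" "F (Suc k) v <= F (Suc k) w" using w uv by (auto intro: F0 nonincr)
   assume y: "F (Suc k) w > 0"
   have ww: "T0 < w" "w < t + 1" using w uv by auto
   define y where "y = F (Suc k) w"
   \<comment> \<open>Makes the L1 term of Nash's inequality at most \<open>y / (2 * C)\<close>, half
     of the lower bound \<open>y / C\<close> for its left side, so that the gradient term must carry
     the other half.\<close>
   define r where "r = (4 * C * N\<^sup>2 / y) powr (1 / n)"
   have yp: "y > 0" using y by (simp add: y_def)
   have rp: "r > 0" using cC N yp by (simp add: r_def)
   have rn: "r ^ CARD('n) = 4 * C * N\<^sup>2 / y"
   proof -
   have "r powr n = 4 * C * N\<^sup>2 / y"
   unfolding r_def using cC N yp n1 by (simp add: powr_powr)
   then show ?thesis using powr_realpow[OF rp, of "CARD('n)"] by (simp add: n_def)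
   qed
   let ?h = "%x. g w x ^ (2 ^ k)"
   define Dh where "Dh = (LINT x|lborel. (norm (grad ?h x))\<^sup>2)"
   have C1h: "C1 ?h"
   by (rule power_C1[OF C2_C1[OF gC2[rule_format, OF ww(1)]]])
   have "(LINT x|lborel. (?h x)\<^sup>2) <= n * r\<^sup>2 * Dh + 2 / r ^ CARD('n) * (LINT x|lborel. \<bar>?h x\<bar>)\<^sup>2"
   unfolding n_def Dh_def by (rule nash_inequality[OF C1h _ rp, where R=R]) (simp add: R[OF ww])
   moreover have "(LINT x|lborel. \<bar>?h x\<bar>) = (LINT x|lborel. ?h x)" using g0 ww by simp
   moreover have "(LINT x|lborel. (?h x)\<^sup>2) = (LINT x|lborel. g w x ^ (2 ^ Suc k))"
   by (simp add: power_mult[symmetric] mult.commute)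
   ultimately have nash: "(LINT x|lborel. g w x ^ (2 ^ Suc k)) <= n * r\<^sup>2 * Dh + 2 / r ^ CARD('n) * (LINT x|lborel. ?h x)\<^sup>2" by simp
   have "c * (LINT x|lborel. ?h x) <= F k u"
   using Fnn(1)[OF ww, of k] nonincr[of u w k] w uv by linarith
   then have "(LINT x|lborel. ?h x) <= N" using cC \<eta> by (simp add: N_def field_simps)
   moreover have "0 <= (LINT x|lborel. ?h x)" using g0 ww by (intro Bochner_Integration.integral_nonneg) auto
   ultimately have "(LINT x|lborel. ?h x)\<^sup>2 <= N\<^sup>2" by (intro power_mono) auto
   then have "2 / r ^ CARD('n) * (LINT x|lborel. ?h x)\<^sup>2 <= 2 / r ^ CARD('n) * N\<^sup>2" using rp by (intro mult_left_mono) auto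
   also have "... = y / (2 * C)" unfolding rn using yp cC N by (simp add: field_simps)
   finally have b1: "2 / r ^ CARD('n) * (LINT x|lborel. ?h x)\<^sup>2 <= y / (2 * C)" .
   have "y <= C * (LINT x|lborel. g w x ^ (2 ^ Suc k))" unfolding y_def by (rule Fnn(2)[OF ww])
   then have "y / C <= (LINT x|lborel. g w x ^ (2 ^ Suc k))" using cC by (simp add: field_simps)
   also have "... <= n * r\<^sup>2 * Dh + y / (2 * C)" using nash b1 by linarith
   finally have "y / (2 * C) <= n * r\<^sup>2 * Dh" by (simp add: field_simps)
   then have Dl: "y / (2 * C * n * r\<^sup>2) <= Dh" using n1 rp cC by (simp add: field_simps)
   have "I (%x. real (2 ^ Suc k) * g w x ^ (2 ^ Suc k - 1) * g' w x) <= - 2 * \<alpha>0 * c * Dh"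
   unfolding Dh_def by (rule diss[OF ww])
   also have "... <= - 2 * \<alpha>0 * c * (y / (2 * C * n * r\<^sup>2))"
   using Dl \<alpha>0 cC by (intro mult_left_mono_neg) auto
   also have "... = - k0 * (y / r\<^sup>2)" by (simp add: k0_def)
   also have "y / r\<^sup>2 = (4 * C * N\<^sup>2) powr (- \<nu>) * y powr (1 + \<nu>)"
   proof -
   have "r\<^sup>2 = (4 * C * N\<^sup>2 / y) powr \<nu>"
   proof -
   have "r powr 2 = (4 * C * N\<^sup>2 / y) powr \<nu>"
   unfolding r_def by (simp add: powr_powr \<nu>_def)
   then show ?thesis using powr_realpow[OF rp, of 2] by simp
   qed
   also have "... = (4 * C * N\<^sup>2) powr \<nu> / y powr \<nu>" using cC N yp by (simp add: powr_divide)
   finally have r2: "r\<^sup>2 = (4 * C * N\<^sup>2) powr \<nu> / y powr \<nu>" .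
   show ?thesis unfolding r2 using yp by (simp add: powr_minus_divide powr_add)
   qed
   finally show "I (%x. real (2 ^ Suc k) * g w x ^ (2 ^ Suc k - 1) * g' w x) <= - kk * F (Suc k) w powr (1 + \<nu>)"
   by (simp add: kk_def y_def mult.assoc)
   qed (use kk \<nu> in auto)
   also have "... = (\<nu> * k0) powr (- 1 / \<nu>) * (v - u) powr (- n / 2) * (4 * C * N\<^sup>2)"
   proof -
   have "\<nu> * kk * (v - u) = (\<nu> * k0) * (v - u) * ((4 * C * N\<^sup>2) powr (- \<nu>))" by (simp add: kk_def)
   moreover have q: "((4 * C * N\<^sup>2) powr (- \<nu>)) powr (- 1 / \<nu>) = 4 * C * N\<^sup>2"
   using \<nu> cC N by (simp add: powr_powr)
   moreover have e: "- 1 / \<nu> = - n / 2" by (simp add: \<nu>_def)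
   moreover have m: "(\<nu> * k0 * (v - u) * Q) powr e = (\<nu> * k0) powr e * (v - u) powr e * Q powr e" if "Q >= 0" for Q e
   using that \<nu> k0 uv by (simp add: powr_mult)
   ultimately show ?thesis using m[of "(4 * C * N\<^sup>2) powr (- \<nu>)" "- 1 / \<nu>"]
   by (simp only: powr_ge_zero)
   qed
   also have "... = E * (v - u) powr (- n / 2) * (F k u + \<eta>)\<^sup>2"
   by (simp add: E_def N_def power_divide)
   finally show ?thesis .
   qed
   define P where "P = E * (v - u) powr (- n / 2)"
   have "((%\<eta>. P * (F k u + \<eta>)\<^sup>2) \<longlongrightarrow> P * (F k u + 0)\<^sup>2) (at_right 0)"
   by (intro tendsto_intros)
   moreover have "\<forall>\<^sub>F \<eta> in at_right 0. F (Suc k) v <= P * (F k u + \<eta>)\<^sup>2"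
   using main by (auto simp: P_def eventually_at_right_field intro!: exI[of _ 1])
   ultimately have "F (Suc k) v <= P * (F k u + 0)\<^sup>2"
   by (rule tendsto_lowerbound) simp
   then show ?thesis by (simp add: P_def)
  qed
  define sk where "sk k = t - (t - s) / 2 ^ k" for k :: nat
  have sk: "s <= sk k" "sk k < sk (Suc k)" "sk k < t" for k
  proof -
   have p: "(t - s) / 2 ^ k > 0" using st by simp
   have "(t - s) / 2 ^ k <= (t - s) / 1" using st by (intro divide_left_mono) auto
   then show "s <= sk k" by (simp add: sk_def)
   show "sk k < t" using p by (simp add: sk_def)
   have "sk k = t - z" "sk (Suc k) = t - z / 2" if "z = (t - s) / 2 ^ k" for z by (simp_all add: sk_def that)
   moreover have "t - z < t - z / 2" if "z > 0" for z :: real using that by simp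
   ultimately show "sk k < sk (Suc k)" using p by metis
  qed
  define E' where "E' = E * (t - s) powr (- n / 2)"
  have E': "E' > 0" using E st by (simp add: E'_def)
  \<comment> \<open>Halving the remaining time costs a factor \<open>B ^ Suc k\<close> at each step;
    the weight \<open>B ^ (k + 2)\<close> turns the recursion into
    \<open>d (Suc k) <= (d k)\<^sup>2\<close>, as
    \<open>(k + 3) + (k + 1) = 2 * (k + 2)\<close>.\<close>
  define d where "d k = E' * B ^ (k + 2) * F k (sk k)" for k
  have dnn: "d k >= 0" for k using E' B F0[of "sk k" k] sk[of k] st by (simp add: d_def)
  have dstep: "d (Suc k) <= (d k)\<^sup>2" for k
  proof -
   have "F (Suc k) (sk (Suc k)) <= E * (sk (Suc k) - sk k) powr (- n / 2) * (F k (sk k))\<^sup>2"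
   using sk[of k] sk[of "Suc k"] st by (intro step) auto
   also have "sk (Suc k) - sk k = (t - s) * (1 / 2) ^ Suc k"
   by (simp add: sk_def power_divide field_simps)
   also have "((t - s) * (1 / 2) ^ Suc k) powr (- n / 2) = (t - s) powr (- n / 2) * B ^ Suc k"
   proof -
   have "((1 / 2) ^ Suc k) powr (- n / 2) = ((1 / 2) powr (- n / 2)) ^ Suc k"
   proof -
   have "((1 / 2 :: real) ^ Suc k) powr (- n / 2) = ((1 / 2) powr real (Suc k)) powr (- n / 2)"
   by (subst powr_realpow) auto
   also have "... = ((1 / 2) powr (- n / 2)) powr real (Suc k)" by (simp only: powr_powr mult.commute)
   also have "... = ((1 / 2) powr (- n / 2)) ^ Suc k" by (rule powr_realpow) simp
   finally show ?thesis .
   qed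
   moreover have "(1 / 2) powr (- n / 2) = B" by (simp add: B_def powr_minus powr_divide)
   moreover have "((t - s) * (1 / 2) ^ Suc k) powr (- n / 2) = (t - s) powr (- n / 2) * ((1 / 2) ^ Suc k) powr (- n / 2)"
   by (rule powr_mult)
   ultimately show ?thesis by simp
   qed
   finally have "F (Suc k) (sk (Suc k)) <= E' * B ^ Suc k * (F k (sk k))\<^sup>2" by (simp add: E'_def mult_ac)
   then have "d (Suc k) <= E' * B ^ (Suc k + 2) * (E' * B ^ Suc k * (F k (sk k))\<^sup>2)"
   unfolding d_def using E' B by (intro mult_left_mono) auto
   also have "... = (d k)\<^sup>2" by (simp add: d_def power2_eq_square power_add algebra_simps)
   finally show ?thesis .
  qed
  have dpow: "d k <= d 0 ^ (2 ^ k)" for k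
  proof (induction k)
   case (Suc k)
   have "d (Suc k) <= (d k)\<^sup>2" by (rule dstep)
   also have "... <= (d 0 ^ (2 ^ k))\<^sup>2" using Suc dnn by (intro power_mono) auto
   also have "... = d 0 ^ (2 ^ Suc k)" by (simp add: power_mult[symmetric] mult.commute)
   finally show ?case .
  qed simp
  have Fbound: "F k t <= (1 / E') * d 0 ^ (2 ^ k)" for k
  proof -
   have "1 <= B ^ (k + 2)" using B by (intro one_le_power) auto
   then have "E' * 1 * F k (sk k) <= d k"
   unfolding d_def using E' F0[of "sk k" k] sk[of k] st by (intro mult_right_mono mult_left_mono) auto
   moreover have "F k t <= F k (sk k)" using sk[of k] st by (intro nonincr) auto
   then have "E' * F k t <= E' * F k (sk k)" using E' by (intro mult_left_mono) auto
   ultimately have "E' * F k t <= d 0 ^ (2 ^ k)" using dpow[of k] by simp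
   then show ?thesis using E' by (simp add: field_simps)
  qed
  have "g t x <= d 0"
  proof (rule ccontr)
   assume "\<not> ?thesis"
   define m where "m = (d 0 + g t x) / 2"
   have m: "d 0 < m" "m < g t x" using \<open>\<not> g t x <= d 0\<close> by (auto simp: m_def)
   have gtc: "continuous_on UNIV (g t)" by (rule slice[OF gcont]) (use st in simp)
   then have "\<exists>dt>0. ALL y. dist y x < dt --> dist (g t y) (g t x) < g t x - m"
   using m by (metis UNIV_I continuous_on_iff diff_gt_0_iff_gt)
   then obtain dt where dt: "dt > 0" "!!y. dist y x < dt ==> m < g t y" by (force simp: dist_real_def abs_less_iff)
   have tt: "T0 < t" "t < t + 1" using st by auto
   show False
   proof (rule double_exponent_bounded[of "d 0" m "c * measure lborel (ball x dt)" "1 / E'"])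
   show "0 <= d 0" by (rule dnn)
   show "d 0 < m" by (rule m)
   show "c * measure lborel (ball x dt) > 0" using cC dt by simp
   fix k :: nat
   have "m ^ (2 ^ k) * measure lborel (ball x dt) = (LINT y|lborel. m ^ (2 ^ k) * indicator (ball x dt) y)" by simp
   also have "... <= (LINT y|lborel. g t y ^ (2 ^ k))"
   proof (rule integral_mono)
   show "integrable lborel (%y. g t y ^ (2 ^ k))" by (intro Cc_integrable pwk tt)
   show "integrable lborel (%y. m ^ (2 ^ k) * indicator (ball x dt) y)"
   by (intro integrable_mult_right integrable_real_indicator emeasure_lborel_ball_finite) simp
   show "m ^ (2 ^ k) * indicator (ball x dt) y <= g t y ^ (2 ^ k)" for y
   proof (cases "y \<in> ball x dt")
   case True
   then have "m <= g t y" using dt(2)[of y] by (simp add: dist_commute)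
   then show ?thesis using True m dnn[of 0] by (auto intro!: power_mono)
   next
   case False
   then show ?thesis using g0 tt by simp
   qed
   qed
   finally have "c * (m ^ (2 ^ k) * measure lborel (ball x dt)) <= c * (LINT y|lborel. g t y ^ (2 ^ k))" using cC by (intro mult_left_mono) auto
   then show "c * measure lborel (ball x dt) * m ^ 2 ^ k <= 1 / E' * d 0 ^ 2 ^ k"
   using Fnn(1)[OF tt, of k] Fbound[of k] by (simp add: mult_ac)
   qed
  qed
  also have "d 0 = E * B\<^sup>2 * (t - s) powr (- real CARD('n) / 2) * I (g s)"
   by (simp add: d_def E'_def F_def sk_def n_def mult_ac power2_eq_square)
  finally show "I (g t) <= I (g s) & g t x <= E * B\<^sup>2 * (t - s) powr (- real CARD('n) / 2) * I (g s)"
   using nonincr[of s t 0] st by (simp add: F_def)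
 qed
qed

end

subsection \<open>Functions of time and space\<close>

text \<open>A second difference of the cubed positive part: \<open>F''\<close> is a tent on
  \<open>{0..2 * th}\<close> of integral 1, so \<open>F\<close> is convex, twice continuously
  differentiable, zero for negative arguments and equal to \<open>s - th\<close> beyond
  \<open>2 * th\<close>. Convexity and monotonicity are what preserves subsolutions.\<close>

lemma smooth_pos_part:
 assumes th: "th > (0::real)"
 obtains F F' F'' where "!!s. (F has_real_derivative F' s) (at s)" "!!s. (F' has_real_derivative F'' s) (at s)"
  "continuous_on UNIV F''" "!!s. F s >= 0" "!!s. F' s >= 0" "!!s. F'' s >= 0"
  "!!s. s <= 0 ==> F s = 0 & F' s = 0" "!!s. F s <= max 0 s" "!!s. s - 2 * th <= F s"
proof
 let ?p = "%k s. max 0 s ^ k - 2 * max 0 (s - th) ^ k + max 0 (s - 2 * th) ^ k"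
 define F where "F s = ?p 3 s / (6 * th\<^sup>2)" for s
 define F' where "F' s = ?p 2 s / (2 * th\<^sup>2)" for s
 define F'' where "F'' s = ?p 1 s / th\<^sup>2" for s
 have sh: "((%s. max 0 (s - a) ^ (k + 2)) has_real_derivative real (k + 2) * max 0 (s - a) ^ (k + 1)) (at s)" for k a s
  using DERIV_shift[of "%s. max 0 s ^ (k + 2)" "real (k + 2) * max 0 (s - a) ^ (k + 1)" s "- a"] DERIV_pos_part_power[of k "s - a"]
  by simp
 have d3: "((%s. max 0 (s - a) ^ 3) has_real_derivative 3 * max 0 (s - a) ^ 2) (at s)" for a s
  using sh[of a 1 s] by (simp add: numeral_3_eq_3 numeral_2_eq_2)
 have d2: "((%s. max 0 (s - a) ^ 2) has_real_derivative 2 * max 0 (s - a) ^ 1) (at s)" for a s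
  using sh[of a 0 s] by (simp add: numeral_2_eq_2)
 note d30 = d3[of 0, simplified] and d20 = d2[of 0, simplified]
 show "(F has_real_derivative F' s) (at s)" for s
  unfolding F_def[abs_def] F'_def
  by (rule DERIV_cong[OF DERIV_cdivide[OF DERIV_add[OF DERIV_diff[OF d30 DERIV_cmult[OF d3]] d3]]]) (use th in "simp add: field_simps")
 show "(F' has_real_derivative F'' s) (at s)" for s
  unfolding F''_def F'_def[abs_def]
  by (rule DERIV_cong[OF DERIV_cdivide[OF DERIV_add[OF DERIV_diff[OF d20 DERIV_cmult[OF d2]] d2]]]) (use th in "simp add: field_simps")
 show "continuous_on UNIV F''" unfolding F''_def[abs_def] using th by (intro continuous_intros) auto
 have p1: "?p 1 s >= 0" for s using th by (simp add: max_def)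
 then show "F'' s >= 0" for s by (simp add: F''_def)
 have p2: "?p 2 s >= 0" for s
 proof -
  consider "s <= th" | "th <= s" "s <= 2 * th" | "s >= 2 * th" by linarith
  then show ?thesis
  proof cases
   case 2
   have "(2 * th - s)\<^sup>2 <= th\<^sup>2" using 2 th by (intro power_mono) auto
   moreover have "?p 2 s = 2 * th\<^sup>2 - (2 * th - s)\<^sup>2" using 2 th by (simp add: max_def power2_eq_square algebra_simps)
   moreover have "th\<^sup>2 >= 0" by simp
   ultimately show ?thesis by linarith
  next
   case 3
   then have "?p 2 s = 2 * th\<^sup>2" using th by (simp add: max_def power2_eq_square algebra_simps)
   then show ?thesis by simp
  qed (use th in "simp add: max_def")
 qed
 then show "F' s >= 0" for s by (simp add: F'_def)
 have cube: "a ^ 3 = a * a * a" for a :: real by (simp add: power3_eq_cube)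
 have mid: "0 <= s ^ 3 - 2 * (s - th) ^ 3 & s ^ 3 - 2 * (s - th) ^ 3 <= 6 * th\<^sup>2 * s" if s: "th <= s" "s <= 2 * th" for s
 proof -
  define a where "a = s - th"
  have a: "0 <= a" "a <= th" using s by (auto simp: a_def)
  have s: "s = th + a" by (simp add: a_def)
  have e: "s ^ 3 - 2 * (s - th) ^ 3 = th ^ 3 + 3 * th\<^sup>2 * a + 3 * th * a\<^sup>2 - a ^ 3"
   unfolding s by (simp add: cube power2_eq_square algebra_simps)
  have a2: "a\<^sup>2 <= th\<^sup>2" using a by (intro power_mono) auto
  have a3: "a ^ 3 <= th ^ 3" using a by (intro power_mono) auto
  have "th * a\<^sup>2 <= th * th\<^sup>2" using a2 th by (intro mult_left_mono) auto
  moreover have "0 <= th\<^sup>2 * a" "0 <= th * a\<^sup>2" "0 <= a ^ 3" "0 <= th ^ 3" using a th by auto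
  moreover have "th * th\<^sup>2 = th ^ 3" "6 * (th\<^sup>2 * s) = 6 * th ^ 3 + 6 * (th\<^sup>2 * a)" by (simp_all add: s cube power2_eq_square algebra_simps)
  ultimately show ?thesis unfolding e mult.assoc using a3 by (intro conjI) linarith+
 qed
 have big: "F s = s - th" if "s >= 2 * th" for s
  using that th by (simp add: F_def max_def cube power2_eq_square field_simps)
 show F0: "F s >= 0" for s
 proof -
  consider "s <= th" | "th <= s" "s <= 2 * th" | "s >= 2 * th" by linarith
  then show ?thesis
  proof cases
   case 2
   then show ?thesis using mid[OF 2] th by (simp add: F_def max_def)
  next
   case 3
   then show ?thesis using big th by simp
  qed (use th in "simp add: max_def F_def")
 qed
 show "F s = 0 & F' s = 0" if "s <= 0" for s using that th by (simp add: F_def F'_def max_def)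
 show "F s <= max 0 s" for s
 proof -
  consider "s <= 0" | "0 <= s" "s <= th" | "th <= s" "s <= 2 * th" | "s >= 2 * th" by linarith
  then show ?thesis
  proof cases
   case 2
   have "s\<^sup>2 <= th\<^sup>2" using 2 by (intro power_mono) auto
   then have "s\<^sup>2 * s <= th\<^sup>2 * s" using 2 by (intro mult_right_mono) auto
   also have "... <= 6 * (th\<^sup>2 * s)" using 2 th by simp
   finally have "s ^ 3 <= s * (6 * th\<^sup>2)" by (simp add: cube power2_eq_square mult_ac)
   moreover have "max 0 s = s" "max 0 (s - th) = 0" "max 0 (s - 2 * th) = 0" using 2 th by auto
   ultimately show ?thesis using th by (simp add: F_def divide_le_eq)
  next
   case 3
   then show ?thesis using mid[OF 3] th by (simp add: F_def max_def divide_le_eq mult_ac)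
  next
   case 4
   then show ?thesis using big th by simp
  qed (use th in "simp add: max_def F_def")
 qed
 show "s - 2 * th <= F s" for s
  using F0[of s] big[of s] th by (cases "s >= 2 * th") auto
qed

text \<open>The time derivative is carried as a separate function, so that differences, products
  with weights and cut-offs come with theirs in closed form.\<close>

definition evolution :: "real => (real => real ^ 'n::finite => real) => (real => real ^ 'n => real) => bool" where
 "evolution T0 v v' \<longleftrightarrow>
   (\<forall>t>T0. C2 (v t)) & (\<forall>t>T0. ALL x. ((%t. v t x) has_real_derivative v' t x) (at t)) \<and>
   continuous_on ({T0<..} \<times> UNIV) (%(t, x). v t x) & continuous_on ({T0<..} \<times> UNIV) (%(t, x). v' t x)"

lemma evolutionD:
 assumes "evolution T0 v v'"
 shows "t > T0 ==> C2 (v t)" "t > T0 ==> ((%t. v t x) has_real_derivative v' t x) (at t)"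
  "continuous_on ({T0<..} \<times> UNIV) (%p. v (fst p) (snd p))" "continuous_on ({T0<..} \<times> UNIV) (%p. v' (fst p) (snd p))"
 using assms unfolding evolution_def case_prod_beta' by blast+

lemma evolutionI:
 assumes "!!t. t > T0 ==> C2 (v t)" "!!t x. t > T0 ==> ((%t. v t x) has_real_derivative v' t x) (at t)"
  "continuous_on ({T0<..} \<times> UNIV) (%p. v (fst p) (snd p))" "continuous_on ({T0<..} \<times> UNIV) (%p. v' (fst p) (snd p))"
 shows "evolution T0 v v'"
 unfolding evolution_def case_prod_beta' using assms by blast

lemma evolution_const: "evolution T0 (%t x. c) (%t x. 0)"
 by (rule evolutionI) auto

lemma evolution_mono: "evolution T0 v v' ==> T0 <= T1 ==> evolution T1 v v'"
 unfolding evolution_def by (auto elim!: continuous_on_subset)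

lemma evolution_diff:
 assumes "evolution T0 v v'" "evolution T0 w w'"
 shows "evolution T0 (%t x. v t x - w t x) (%t x. v' t x - w' t x)"
 by (rule evolutionI) (intro C2_diff DERIV_diff continuous_on_diff evolutionD[OF assms(1)] evolutionD[OF assms(2)]; assumption)+

lemma evolution_scale:
 assumes v: "evolution T0 v v'" and a: "!!t. t > T0 ==> (a has_real_derivative a' t) (at t)" "continuous_on {T0<..} a'" and ph: "C2 ph"
 shows "evolution T0 (%t x. a t * ph x * v t x) (%t x. ph x * (a' t * v t x + a t * v' t x))"
proof (rule evolutionI)
 have ac: "continuous_on {T0<..} a" by (rule DERIV_continuous_on) (use a in "auto intro: has_field_derivative_at_within")
 have fc: "continuous_on ({T0<..} \<times> UNIV) (%p. a (fst p))" "continuous_on ({T0<..} \<times> UNIV) (%p. a' (fst p))" "continuous_on ({T0<..} \<times> UNIV) (%p. ph (snd p))"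
  by (rule continuous_on_compose2[OF ac], auto intro!: continuous_intros) (rule continuous_on_compose2[OF a(2)], auto intro!: continuous_intros,
   rule continuous_on_compose2[OF C2_cont[OF ph, of UNIV]], auto intro!: continuous_intros)
 show "C2 (%x. a t * ph x * v t x)" if "t > T0" for t
  by (intro C2_mult C2_cmult ph evolutionD(1)[OF v that])
 show "((%t. a t * ph x * v t x) has_real_derivative ph x * (a' t * v t x + a t * v' t x)) (at t)" if "t > T0" for t x
  by (rule derivative_eq_intros a(1)[OF that] evolutionD(2)[OF v that] refl)+ (simp add: algebra_simps)
 show "continuous_on ({T0<..} \<times> UNIV) (%p. a (fst p) * ph (snd p) * v (fst p) (snd p))"
  by (intro continuous_on_mult fc evolutionD(3)[OF v])
 show "continuous_on ({T0<..} \<times> UNIV) (%p. ph (snd p) * (a' (fst p) * v (fst p) (snd p) + a (fst p) * v' (fst p) (snd p)))"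
  by (intro continuous_on_mult continuous_on_add fc evolutionD(3,4)[OF v])
qed

text \<open>The cut-off \<open>Om\<close> does not produce a boundary term because \<open>{h >= 0}\<close> stays inside
 two disjoint open sets.\<close>

lemma evolution_cutoff:
 fixes h h' :: "real => real ^ 'n::finite => real" and Om Om' :: "(real \<times> (real ^ 'n)) set"
 assumes h: "evolution T0 h h'" and Om: "open Om" "open Om'" "Om \<inter> Om' = {}"
  and sep: "!!t x. t > T0 ==> h t x >= 0 ==> (t, x) \<in> Om \<union> Om'"
  and F: "!!s. (F has_real_derivative F' s) (at s)" "!!s. (F' has_real_derivative F'' s) (at s)" "continuous_on UNIV F''"
  and F0: "!!s. s <= 0 ==> F s = 0 & F' s = 0"
 shows "evolution T0 (%t x. if (t, x) \<in> Om then F (h t x) else 0) (%t x. if (t, x) \<in> Om then F' (h t x) * h' t x else 0)"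
proof -
 define g where "g t x = (if (t, x) \<in> Om then F (h t x) else 0)" for t x
 define g' where "g' t x = (if (t, x) \<in> Om then F' (h t x) * h' t x else 0)" for t x
 let ?S = "{T0<..} \<times> (UNIV :: (real ^ 'n) set)"
 have oS: "open ?S" by (simp add: open_Times)
 have Fc: "continuous_on UNIV F" "continuous_on UNIV F'"
  by (rule DERIV_continuous_on, rule F(1)[THEN has_field_derivative_at_within], rule DERIV_continuous_on, rule F(2)[THEN has_field_derivative_at_within])
 have Fh: "continuous_on ?S (%p. F (h (fst p) (snd p)))" "continuous_on ?S (%p. F' (h (fst p) (snd p)))"
  by (rule continuous_on_compose2[OF Fc(1) evolutionD(3)[OF h]], simp, rule continuous_on_compose2[OF Fc(2) evolutionD(3)[OF h]], simp)
 have loc: "\<exists>r>0. ball (t, x) r \<subseteq> ?S & ((ALL s y. (s, y) \<in> ball (t, x) r --> g s y = F (h s y) & g' s y = F' (h s y) * h' s y)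
   | (ALL s y. (s, y) \<in> ball (t, x) r --> g s y = 0 & g' s y = 0))" if t: "t > T0" for t x
 proof -
  consider "(t, x) \<in> Om" | "(t, x) \<in> Om'" | "h t x < 0" using sep[OF t, of x] by fastforce
  then show ?thesis
  proof cases
   case 1
   then have "(t, x) \<in> Om \<inter> ?S" using t by simp
   then obtain r where r: "r > 0" "ball (t, x) r \<subseteq> Om \<inter> ?S" by (rule openE[OF open_Int[OF Om(1) oS]])
   have "(s, y) \<in> Om \<inter> ?S" if "(s, y) \<in> ball (t, x) r" for s y by (rule subsetD[OF r(2) that])
   then have "g s y = F (h s y) & g' s y = F' (h s y) * h' s y" if "(s, y) \<in> ball (t, x) r" for s y
   using that by (simp add: g_def g'_def)
   moreover have "ball (t, x) r \<subseteq> ?S" by (rule order_trans[OF r(2) Int_lower2])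
   ultimately show ?thesis using r(1) by (intro exI[of _ r] conjI disjI1 allI impI) simp_all
  next
   case 2
   then have "(t, x) \<in> Om' \<inter> ?S" using t by simp
   then obtain r where r: "r > 0" "ball (t, x) r \<subseteq> Om' \<inter> ?S" by (rule openE[OF open_Int[OF Om(2) oS]])
   have "(s, y) \<in> Om' \<inter> ?S" if "(s, y) \<in> ball (t, x) r" for s y by (rule subsetD[OF r(2) that])
   then have "(s, y) \<notin> Om" if "(s, y) \<in> ball (t, x) r" for s y using that Om(3) by (metis IntD1 IntI emptyE)
   then have "g s y = 0 & g' s y = 0" if "(s, y) \<in> ball (t, x) r" for s y using that by (simp add: g_def g'_def)
   moreover have "ball (t, x) r \<subseteq> ?S" by (rule order_trans[OF r(2) Int_lower2])
   ultimately show ?thesis using r(1) by (intro exI[of _ r] conjI disjI2 allI impI) simp_all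
  next
   case 3
   have o: "open (?S \<inter> (%p. h (fst p) (snd p)) -` {..<0})"
   by (rule continuous_open_preimage[OF evolutionD(3)[OF h] oS open_lessThan])
   have "(t, x) \<in> ?S \<inter> (%p. h (fst p) (snd p)) -` {..<0}" using 3 t by simp
   then obtain r where r: "r > 0" "ball (t, x) r \<subseteq> ?S \<inter> (%p. h (fst p) (snd p)) -` {..<0}" by (rule openE[OF o])
   have "h s y <= 0" if "(s, y) \<in> ball (t, x) r" for s y using subsetD[OF r(2) that] by simp
   then have "g s y = 0 & g' s y = 0" if "(s, y) \<in> ball (t, x) r" for s y using that F0 by (simp add: g_def g'_def)
   moreover have "ball (t, x) r \<subseteq> ?S" by (rule order_trans[OF r(2) Int_lower1])
   ultimately show ?thesis using r(1) by (intro exI[of _ r] conjI disjI2 allI impI) simp_all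
  qed
 qed
 have "evolution T0 g g'"
 proof (rule evolutionI)
  show "C2 (g t)" if t: "t > T0" for t
  proof (rule C2_local)
   fix x
   obtain r where r: "r > 0" and alt: "(ALL s y. (s, y) \<in> ball (t, x) r --> g s y = F (h s y) & g' s y = F' (h s y) * h' s y)
   | (ALL s y. (s, y) \<in> ball (t, x) r --> g s y = 0 & g' s y = 0)" using loc[OF t] by blast
   have in_ball: "(t, y) \<in> ball (t, x) r" if "dist y x < r" for y using that by (simp add: dist_Pair_Pair dist_commute)
   have c2: "C2 (%y. F (h t y))"
   by (rule C2_compose[where F=F and F'=F' and F''=F'']) (use evolutionD(1)[OF h t] F continuous_on_compose2[OF F(3) C2_cont[OF evolutionD(1)[OF h t]]] in auto)
   from alt show "EX h r. r > 0 & C2 h & (ALL y. dist y x < r --> g t y = h y)"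
   proof
   assume "ALL s y. (s, y) \<in> ball (t, x) r --> g s y = F (h s y) & g' s y = F' (h s y) * h' s y"
   then show ?thesis using in_ball r c2 by (intro exI[of _ "%y. F (h t y)"] exI[of _ r]) blast
   next
   assume "ALL s y. (s, y) \<in> ball (t, x) r --> g s y = 0 & g' s y = 0"
   then show ?thesis using in_ball r by (intro exI[of _ "%y. 0"] exI[of _ r]) auto
   qed
  qed
  show "((%t. g t x) has_real_derivative g' t x) (at t)" if t: "t > T0" for t x
  proof -
   obtain r where r: "r > 0" and alt: "(ALL s y. (s, y) \<in> ball (t, x) r --> g s y = F (h s y) & g' s y = F' (h s y) * h' s y)
   | (ALL s y. (s, y) \<in> ball (t, x) r --> g s y = 0 & g' s y = 0)" using loc[OF t] by blast
   have in_ball: "(s, x) \<in> ball (t, x) r" if "s \<in> ball t r" for s using that by (simp add: dist_Pair_Pair)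
   have tb: "t \<in> ball t r" using r by simp
   from alt show ?thesis
   proof
   assume e: "ALL s y. (s, y) \<in> ball (t, x) r --> g s y = F (h s y) & g' s y = F' (h s y) * h' s y"
   have "((%t. F (h t x)) has_real_derivative F' (h t x) * h' t x) (at t)"
   by (rule DERIV_chain2[OF F(1) evolutionD(2)[OF h t]])
   then have "((%t. g t x) has_real_derivative F' (h t x) * h' t x) (at t)"
   by (rule has_field_derivative_transform_within_open[where S="ball t r"]) (use e in_ball tb in auto)
   then show ?thesis using e in_ball tb by simp
   next
   assume e: "ALL s y. (s, y) \<in> ball (t, x) r --> g s y = 0 & g' s y = 0"
   have "((%t. g t x) has_real_derivative 0) (at t)"
   by (rule has_field_derivative_transform_within_open[where S="ball t r", OF DERIV_const[of 0]]) (use e in_ball tb in auto)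
   then show ?thesis using e in_ball tb by simp
   qed
  qed
  have "isCont (%p. g (fst p) (snd p)) q & isCont (%p. g' (fst p) (snd p)) q" if q: "q \<in> ?S" for q
  proof -
   obtain t x where tx: "q = (t, x)" "t > T0" using q by auto
   obtain r where r: "r > 0" and alt: "(ALL s y. (s, y) \<in> ball (t, x) r --> g s y = F (h s y) & g' s y = F' (h s y) * h' s y)
   | (ALL s y. (s, y) \<in> ball (t, x) r --> g s y = 0 & g' s y = 0)" using loc[OF tx(2)] by blast
   have ev: "\<forall>\<^sub>F p in nhds q. p \<in> ball (t, x) r"
   by (rule eventually_nhds_in_open) (use r tx in auto)
   from alt show ?thesis
   proof
   assume e: "ALL s y. (s, y) \<in> ball (t, x) r --> g s y = F (h s y) & g' s y = F' (h s y) * h' s y"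
   have c: "isCont (%p. F (h (fst p) (snd p))) q" "isCont (%p. F' (h (fst p) (snd p)) * h' (fst p) (snd p)) q"
   proof -
   have qi: "q \<in> interior ?S" using q interior_open[OF oS] by simp
   show "isCont (%p. F (h (fst p) (snd p))) q" by (rule continuous_on_interior[OF Fh(1) qi])
   show "isCont (%p. F' (h (fst p) (snd p)) * h' (fst p) (snd p)) q"
   by (rule continuous_on_interior[OF continuous_on_mult[OF Fh(2) evolutionD(4)[OF h]] qi])
   qed
   have 1: "\<forall>\<^sub>F p in nhds q. g (fst p) (snd p) = F (h (fst p) (snd p))"
   by (rule eventually_mono[OF ev]) (use e in "auto simp: split_paired_all")
   have 2: "\<forall>\<^sub>F p in nhds q. g' (fst p) (snd p) = F' (h (fst p) (snd p)) * h' (fst p) (snd p)"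
   by (rule eventually_mono[OF ev]) (use e in "auto simp: split_paired_all")
   show ?thesis using isCont_cong[OF 1] isCont_cong[OF 2] c by simp
   next
   assume e: "ALL s y. (s, y) \<in> ball (t, x) r --> g s y = 0 & g' s y = 0"
   have 1: "\<forall>\<^sub>F p in nhds q. g (fst p) (snd p) = 0"
   by (rule eventually_mono[OF ev]) (use e in "auto simp: split_paired_all")
   have 2: "\<forall>\<^sub>F p in nhds q. g' (fst p) (snd p) = 0"
   by (rule eventually_mono[OF ev]) (use e in "auto simp: split_paired_all")
   show ?thesis using isCont_cong[OF 1] isCont_cong[OF 2] by simp
   qed
  qed
  then show "continuous_on ?S (%p. g (fst p) (snd p))" "continuous_on ?S (%p. g' (fst p) (snd p))"
   by (simp_all add: continuous_at_imp_continuous_on)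
 qed
 then show ?thesis unfolding g_def[abs_def] g'_def[abs_def] .
qed

section \<open>A supersolution of exponential growth\<close>

context periodic_diffusion
begin

lemma Lop_compose:
 assumes "C2 h" "!!s. (F has_real_derivative F' s) (at s)" "!!s. (F' has_real_derivative F'' s) (at s)" "continuous_on UNIV F''"
 shows "Lop b (%x. F (h x)) x = F' (h x) * Lop b h x + F'' (h x) * inner (grad h x) (A x *v grad h x)"
proof -
 have "continuous_on UNIV (%x. F'' (h x))" by (rule continuous_on_compose2[OF assms(4) C2_cont[OF assms(1)]]) simp
 then have "D (%x. F (h x)) x = F' (h x) * D h x + F'' (h x) * inner (grad h x) (A x *v grad h x)"
  by (intro D_compose[where F=F and F'=F' and F''=F'']) (use assms in auto)
 moreover have "grad (%x. F (h x)) x = F' (h x) *\<^sub>R grad h x"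
  by (rule grad_compose[where F=F and F'=F']) (use assms C2_C1 in auto)
 ultimately show ?thesis by (simp add: Lop_def algebra_simps)
qed

text \<open>Subtracting a small multiple of \<open>Z\<close> makes functions of slower exponential
  growth negative far out, which produces bounded supports. A hyperbolic cosine reproduces itself
  under two derivatives and dominates its first one; some coordinate is at least
  \<open>norm x / n\<close> in modulus, whence \<open>\<beta> = n * B\<close>.\<close>

lemma growing_supersolution:
 assumes Bd: "Bd >= 0" and B: "B > 0"
 obtains Z ka where "C2 Z" "!!x. exp (B * norm x) / 2 <= Z x" "ka >= 0"
  "!!b x. norm (b x) <= Bd ==> Lop b Z x <= ka * Z x"
proof -
 define n where "n = real CARD('n)"
 have n: "n >= 1" by (simp add: n_def Suc_leI)
 define \<beta> where "\<beta> = n * B"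
 have \<beta>: "\<beta> > 0" using n B by (simp add: \<beta>_def)
 have "\<exists>K>0. ALL x. norm (D (%y. y $ i) x) <= K" for i
 proof -
  have "periodic L (%x. div_field (%y. A y *v axis i 1) x)"
  proof -
   have "periodic L (%y. (A y *v axis i 1) $ j)" for j using A_per by (simp add: periodic_def)
   then show ?thesis using periodic_pd unfolding div_field_def periodic_def by (metis (no_types, lifting) sum.cong)
  qed
  then have "periodic L (D (%y. y $ i))" by (simp add: D_def[abs_def] grad_component)
  then show ?thesis using periodic_bounded[OF L_pos _ D_continuous[OF C2_nth]] by metis
 qed
 then obtain Kd where Kd: "!!i. Kd i > 0" "!!i x. \<bar>D (%y. y $ i) x\<bar> <= Kd i" by (metis real_norm_def)
 define K1 where "K1 = (\<Sum>i\<in>UNIV. Kd i)"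
 have K1: "\<bar>D (%y. y $ i) x\<bar> <= K1" for i x
  using Kd(2)[of i x] member_le_sum[of i UNIV Kd] Kd(1) unfolding K1_def by (smt (verit) UNIV_I finite)
 obtain K2 where K2: "K2 > 0" "!!i j x. \<bar>A x $ i $ j\<bar> <= K2" using entry_lipschitz by metis
 define ka where "ka = \<beta> * (K1 + Bd) + \<beta>\<^sup>2 * K2"
 have K10: "K1 >= 0" unfolding K1_def using Kd(1) by (intro sum_nonneg) (simp add: less_imp_le)
 have cd: "((%s. cosh (\<beta> * s)) has_real_derivative \<beta> * sinh (\<beta> * s)) (at s)" "((%s. \<beta> * sinh (\<beta> * s)) has_real_derivative \<beta>\<^sup>2 * cosh (\<beta> * s)) (at s)" for s
  by (auto intro!: derivative_eq_intros simp: power2_eq_square)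
 have cc: "continuous_on UNIV (%s. \<beta>\<^sup>2 * cosh (\<beta> * s))" by (intro continuous_intros)
 have c2: "C2 (%x. cosh (\<beta> * x $ i))" for i
  by (rule C2_compose[where F="%s. cosh (\<beta> * s)" and F'="%s. \<beta> * sinh (\<beta> * s)" and F''="%s. \<beta>\<^sup>2 * cosh (\<beta> * s)"])
   (auto intro!: cd continuous_intros)
 define Z where "Z x = (\<Sum>i\<in>UNIV. cosh (\<beta> * x $ i))" for x :: "real ^ 'n"
 show ?thesis
 proof (rule that[of Z ka])
  show "C2 Z" unfolding Z_def[abs_def] by (intro C2_sum c2)
  show "ka >= 0" unfolding ka_def using \<beta> K10 Bd K2 by (intro add_nonneg_nonneg mult_nonneg_nonneg) auto
  show "exp (B * norm x) / 2 <= Z x" for x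
  proof -
   have "EX i. norm x <= n * \<bar>x $ i\<bar>"
   proof (rule ccontr)
   assume "\<not> ?thesis"
   then have "n * \<bar>x $ i\<bar> < norm x" for i by (simp add: not_le)
   then have "(\<Sum>i\<in>UNIV. n * \<bar>x $ i\<bar>) < (\<Sum>i\<in>(UNIV::'n set). norm x)" by (intro sum_strict_mono) auto
   then have "n * (\<Sum>i\<in>UNIV. \<bar>x $ i\<bar>) < n * norm x" by (simp add: sum_distrib_left n_def)
   then show False using norm_le_l1_cart[of x] n by simp
   qed
   then obtain i where i: "norm x <= n * \<bar>x $ i\<bar>" by blast
   have "B * norm x <= B * (n * \<bar>x $ i\<bar>)" using i B by (intro mult_left_mono) auto
   also have "... = \<bar>\<beta> * x $ i\<bar>" using B by (simp add: \<beta>_def abs_mult n_def)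
   finally have "exp (B * norm x) / 2 <= exp \<bar>\<beta> * x $ i\<bar> / 2" by simp
   also have "... <= cosh (\<beta> * x $ i)" by (auto simp: cosh_def abs_if)
   also have "... <= Z x" unfolding Z_def by (rule member_le_sum) auto
   finally show ?thesis .
  qed
  fix b :: "real ^ 'n => real ^ 'n" and x assume b: "norm (b x) <= Bd"
  have "Lop b (%x. cosh (\<beta> * x $ i)) x <= ka * cosh (\<beta> * x $ i)" for i
  proof -
   let ?c = "cosh (\<beta> * x $ i)" and ?s = "sinh (\<beta> * x $ i)"
   have "Lop b (%x. cosh (\<beta> * x $ i)) x = \<beta> * ?s * Lop b (%x. x $ i) x + \<beta>\<^sup>2 * ?c * inner (axis i 1) (A x *v axis i 1)"
   using Lop_compose[OF C2_nth[of i] cd cc, of b x] by (simp add: grad_component)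
   also have "inner (axis i 1) (A x *v axis i 1) = A x $ i $ i" by (simp add: inner_axis inner_axis' matrix_vector_mul_component)
   also have "\<beta>\<^sup>2 * ?c * A x $ i $ i <= \<beta>\<^sup>2 * ?c * K2" using K2(2)[of x i i] by (intro mult_left_mono) (auto simp: abs_le_iff)
   also have "\<beta> * ?s * Lop b (%x. x $ i) x <= \<beta> * (?c * (K1 + Bd))"
   proof -
   have "\<bar>Lop b (%x. x $ i) x\<bar> <= K1 + Bd"
   using K1[of i x] component_le_norm_cart[of "b x" i] b by (simp add: Lop_def grad_component inner_axis)
   moreover have "\<bar>?s\<bar> <= ?c" by (auto simp: cosh_def sinh_def abs_le_iff)
   ultimately have "\<bar>?s\<bar> * \<bar>Lop b (%x. x $ i) x\<bar> <= ?c * (K1 + Bd)" by (intro mult_mono) auto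
   then have "?s * Lop b (%x. x $ i) x <= ?c * (K1 + Bd)" by (metis abs_le_D1 abs_mult)
   then show ?thesis using \<beta> by (simp add: mult.assoc)
   qed
   finally show ?thesis by (simp add: ka_def algebra_simps)
  qed
  then have "(\<Sum>i\<in>UNIV. Lop b (%x. cosh (\<beta> * x $ i)) x) <= (\<Sum>i\<in>UNIV. ka * cosh (\<beta> * x $ i))" by (intro sum_mono)
  then show "Lop b Z x <= ka * Z x" unfolding Z_def[abs_def] by (simp add: Lop_sum c2 sum_distrib_left)
 qed
qed

end

subsection \<open>The weighted decay estimate\<close>

text \<open>The rate \<open>B\<close> is chosen before the time horizon \<open>T1\<close>, since one
  supersolution \<open>Z\<close> has to serve all horizons.\<close>

definition growth :: "real => (real \<times> (real ^ 'n::finite)) set => (real => real ^ 'n => real) => bool" where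
 "growth T0 Om v \<longleftrightarrow> (\<exists>B>0. ALL T1. EX K. ALL t x. T0 < t --> t < T1 --> (t, x) \<in> Om --> v t x <= K * exp (B * norm x))"

text \<open>The initial data enter only as an upper bound, almost everywhere and as a limit from
  later times, since they may be discontinuous. Points that \<open>Om\<close> does not reach at
  times just after \<open>T0\<close> are unconstrained.\<close>

definition dominated :: "real => (real \<times> (real ^ 'n::finite)) set => (real => real ^ 'n => real) => (real ^ 'n => real) => bool" where
 "dominated T0 Om v j \<longleftrightarrow> (AE x in lborel. \<forall>\<eta>>0. \<forall>\<^sub>F t in at_right T0. (t, x) \<in> Om --> v t x <= j x + \<eta>)"

lemma open_time_section:
 assumes "open (Om :: (real \<times> (real ^ 'n::finite)) set)"
 shows "open {x. (t, x) \<in> Om}"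
proof -
 have "open ((%x. (t, x)) -` Om)" by (rule open_vimage[OF assms]) (intro continuous_intros)
 then show ?thesis by (simp add: vimage_def)
qed

context periodic_diffusion
begin

lemma Lop_local:
 assumes "r > 0" "!!y. dist y x < r ==> g y = h y"
 shows "Lop b g x = Lop b h x"
 proof -
 have "D g x = D h x" by (rule D_local[OF assms])
 moreover have "grad g x = grad h x" unfolding vec_eq_iff grad_nth by (intro allI pd_local[OF assms])
 ultimately show ?thesis by (simp add: Lop_def)
qed

lemma local_min_Lop:
 assumes "C2 h" "!!x. h x0 <= h x"
 shows "Lop b h x0 >= 0"
 unfolding Lop_def using local_min_D[OF assms(1) zero_less_one, of x0] local_min_second_order(1)[OF assms(1) zero_less_one, of x0] assms(2)
 by simp

lemma Lop_diff: "C2 g ==> C2 h ==> Lop b (%x. g x - h x) x = Lop b g x - Lop b h x"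
 using Lop_add[of g "%x. (- 1) * h x" b x] Lop_cmult[of h b "- 1" x] C2_cmult[of h "- 1"] by simp

text \<open>Prepares a subsolution for \<open>ultracontractive\<close>: subtracting the growing
  supersolution makes the support bounded on bounded time intervals, and the convex \<open>F\<close>
  smooths the positive part. At points outside \<open>Om\<close> the function is 0, its minimum, so
  the operator is nonnegative there.\<close>

lemma cut_regular:
 fixes b :: "real ^ 'n => real ^ 'n" and y y' :: "real => real ^ 'n => real"
 assumes y: "evolution T0 y y'" and Om: "open Om" "open Om'" "Om \<inter> Om' = {}"
  and sep: "!!t x. T0 < t ==> 0 < y t x ==> (t, x) \<in> Om \<union> Om'"
  and B: "B > 0" and gr: "!!T1. EX K. ALL t x. T0 < t --> t < T1 --> (t, x) \<in> Om --> y t x <= K * exp (B * norm x)"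
  and sub: "!!t x. T0 < t ==> (t, x) \<in> Om ==> 0 < y t x ==> y' t x <= Lop b (y t) x"
  and Z: "C2 Z" "!!x. exp ((B + 1) * norm x) / 2 <= Z x" and ka: "ka >= 0" "!!x. Lop b Z x <= ka * Z x"
  and dt: "dt > 0" and F: "!!s. (F has_real_derivative F' s) (at s)" "!!s. (F' has_real_derivative F'' s) (at s)" "continuous_on UNIV F''"
  and F0: "!!s. s <= 0 ==> F s = 0 & F' s = 0" and Fp: "!!s. F s >= 0" "!!s. F' s >= 0" "!!s. F'' s >= 0"
 defines "g \<equiv> %t x. if (t, x) \<in> Om then F (y t x - dt * exp (ka * (t - T0)) * Z x) else 0"
 obtains g' where "evolution T0 g g'" "ALL u x. T0 < u --> g' u x <= Lop b (g u) x"
  "ALL T1. EX R. ALL u x. T0 < u --> u < T1 --> norm x > R --> g u x = 0"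
proof -
 define a where "a t = dt * exp (ka * (t - T0))" for t
 define a' where "a' t = dt * (ka * exp (ka * (t - T0)))" for t
 have a': "a' t = ka * a t" for t by (simp add: a_def a'_def)
 have ap: "a t > 0" for t using dt by (simp add: a_def)
 have Zp: "Z x > 0" for x using Z(2)[of x] exp_gt_zero[of "(B + 1) * norm x"] by linarith
 define h where "h t x = y t x - a t * Z x * 1" for t x
 define h' where "h' t x = y' t x - Z x * (a' t * 1 + a t * 0)" for t x
 have h: "evolution T0 h h'" unfolding h_def[abs_def] h'_def[abs_def]
 proof (intro evolution_diff y evolution_scale evolution_const Z)
  show "(a has_real_derivative a' t) (at t)" for t unfolding a_def[abs_def] a'_def
   by (auto intro!: derivative_eq_intros)
  show "continuous_on {T0<..} a'" unfolding a'_def[abs_def] by (intro continuous_intros)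
 qed
 have hy: "h t x < y t x" for t x using mult_pos_pos[OF ap[of t] Zp[of x]] by (simp add: h_def)
 define g' where "g' t x = (if (t, x) \<in> Om then F' (h t x) * h' t x else 0)" for t x
 have g: "g t x = (if (t, x) \<in> Om then F (h t x) else 0)" for t x by (simp add: g_def h_def a_def)
 have ge: "evolution T0 g g'"
  unfolding g[abs_def] g'_def[abs_def]
 proof (rule evolution_cutoff[OF h Om _ F])
  show "(t, x) \<in> Om \<union> Om'" if "T0 < t" "0 <= h t x" for t x
   by (rule sep[OF that(1)]) (use hy[of t x] that(2) in linarith)
  show "F s = 0 & F' s = 0" if "s <= 0" for s by (rule F0[OF that])
 qed
 show ?thesis
 proof (rule that[OF ge])
  show "ALL u x. T0 < u --> g' u x <= Lop b (g u) x"
  proof (intro allI impI)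
   fix u x assume u: "T0 < u"
   note C2h = evolutionD(1)[OF h u] and C2y = evolutionD(1)[OF y u]
   show "g' u x <= Lop b (g u) x"
   proof (cases "(u, x) \<in> Om")
   case True
   then have "x \<in> {x. (u, x) \<in> Om}" by simp
   then obtain r where r: "r > 0" "ball x r \<subseteq> {x. (u, x) \<in> Om}"
   using openE[OF open_time_section[OF Om(1)]] by metis
   have "Lop b (g u) x = Lop b (%z. F (h u z)) x"
   proof (rule Lop_local[OF r(1)])
   fix z assume "dist z x < r"
   then have "z \<in> {x. (u, x) \<in> Om}" using r(2) by (auto simp: dist_commute)
   then show "g u z = F (h u z)" by (simp add: g)
   qed
   also have "... = F' (h u x) * Lop b (h u) x + F'' (h u x) * inner (grad (h u) x) (A x *v grad (h u) x)"
   by (rule Lop_compose[OF C2h F])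
   finally have L: "Lop b (g u) x = ..." .
   have e: "inner (grad (h u) x) (A x *v grad (h u) x) >= 0"
   using elliptic[of "grad (h u) x" x] \<alpha>0 by (smt (verit) zero_le_power2 mult_nonneg_nonneg)
   have "F' (h u x) * h' u x <= F' (h u x) * Lop b (h u) x"
   proof (cases "h u x > 0")
   case pos: True
   have "Lop b (h u) x = Lop b (y u) x - a u * Lop b Z x"
   unfolding h_def[abs_def] using Lop_diff[OF C2y C2_cmult[OF Z(1), of "a u"]] Lop_cmult[OF Z(1)] by simp
   moreover have "a u * Lop b Z x <= a u * (ka * Z x)" using ka(2)[of x] ap[of u] by (intro mult_left_mono) auto
   moreover have "y' u x <= Lop b (y u) x" using sub[OF u True] pos hy[of u x] by simp
   ultimately have "h' u x <= Lop b (h u) x" by (simp add: h'_def a' mult_ac)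
   then show ?thesis using Fp(2) by (intro mult_left_mono) auto
   qed (use F0[of "h u x"] in simp)
   then show ?thesis unfolding L g'_def using True mult_nonneg_nonneg[OF Fp(3)[of "h u x"] e] by simp
   next
   case False
   have "Lop b (g u) x >= 0"
   by (rule local_min_Lop[OF evolutionD(1)[OF ge u]]) (use False Fp(1) in "simp add: g")
   then show ?thesis using False by (simp add: g'_def)
   qed
  qed
  show "ALL T1. EX R. ALL u x. T0 < u --> u < T1 --> norm x > R --> g u x = 0"
  proof
   fix T1
   obtain K where K: "ALL t x. T0 < t --> t < T1 --> (t, x) \<in> Om --> y t x <= K * exp (B * norm x)" using gr by blast
   have "g u x = 0" if u: "T0 < u" "u < T1" "norm x > 2 * K / dt" for u x
   proof (cases "(u, x) \<in> Om")
   case True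
   \<comment> \<open>The extra 1 in the rate \<open>B + 1\<close> of \<open>Z\<close> leaves a
     factor \<open>exp (norm x)\<close> that beats the constant \<open>K\<close>.\<close>
   have "exp (norm x) >= 2 * K / dt" using exp_ge_add_one_self[of "norm x"] u by linarith
   then have "2 * K <= dt * exp (norm x)" using dt by (simp add: field_simps)
   then have "2 * K * exp (B * norm x) <= dt * exp (norm x) * exp (B * norm x)" by (intro mult_right_mono) auto
   also have "... = dt * exp ((B + 1) * norm x)" by (simp add: exp_add[symmetric] algebra_simps)
   finally have "K * exp (B * norm x) <= dt * (exp ((B + 1) * norm x) / 2)" by simp
   also have "... <= a u * Z x"
   proof (rule mult_mono)
   have "exp (ka * (u - T0)) >= 1" using ka u by simp
   then show "dt <= a u" using dt by (simp add: a_def)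
   qed (use Z(2)[of x] ap[of u] in auto)
   finally have "h u x <= 0" using K u True by (auto simp: h_def intro: order_trans)
   then show ?thesis using F0 by (simp add: g)
   qed (simp add: g)
   then show "EX R. ALL u x. T0 < u --> u < T1 --> norm x > R --> g u x = 0" by blast
  qed
 qed
qed

text \<open>\<open>ultracontractive\<close> is applied from times \<open>s m\<close> just after
  \<open>T0\<close>, where the function is regular; \<open>s m\<close> is sent to \<open>T0\<close>
  first, the regularisation \<open>dt\<close> to 0 afterwards. The constant depends on the drift
  only through \<open>Bd\<close>, so it serves a whole family of weights.\<close>

theorem drift_bound:
 assumes Bd: "Bd >= 0"
 obtains K where "K > 0"
  "!!b y y' T0 Om Om' j t. continuous_on UNIV b ==> periodic L b ==> (ALL x. norm (b x) <= Bd) ==>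
   evolution T0 y y' ==> open Om ==> open Om' ==> Om \<inter> Om' = {} ==>
   (ALL t x. T0 < t --> 0 < y t x --> (t, x) \<in> Om \<union> Om') ==> growth T0 Om y ==> dominated T0 Om y j ==>
   integrable lborel j ==> (ALL x. 0 <= j x) ==>
   (ALL t x. T0 < t --> (t, x) \<in> Om --> 0 < y t x --> y' t x <= Lop b (y t) x) ==> T0 < t ==>
   (ALL x. (t, x) \<in> Om --> y t x <= K * (t - T0) powr (- real CARD('n) / 2) * (LINT x|lborel. j x)) \<and>
   (\<integral>\<^sup>+x. ennreal (indicator {x. (t, x) \<in> Om} x * max 0 (y t x)) \<partial>lborel) <= ennreal (K * (LINT x|lborel. j x))"
proof -
 obtain c C where cC: "c > 0" "C > 0"
  and inv: "!!b. continuous_on UNIV b ==> periodic L b ==> (!!x. norm (b x) <= Bd) ==> EX I. invariant b c C I"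
  using invariant_functional_bounds[OF Bd] by metis
 show ?thesis
 proof (rule ultracontractive[OF cC])
  fix K0 :: real assume K0: "K0 > 0"
  assume U: "!!b I g g' T0 s t x. invariant b c C I ==> continuous_on UNIV b ==> T0 < s ==> s < t ==>
   (ALL u x. T0 < u --> 0 <= g u x) ==> (ALL u. T0 < u --> C2 (g u)) ==>
   (ALL u x. T0 < u --> ((%u. g u x) has_real_derivative g' u x) (at u)) ==>
   continuous_on ({T0<..} \<times> UNIV) (%(u, x). g u x) ==> continuous_on ({T0<..} \<times> UNIV) (%(u, x). g' u x) ==>
   (ALL u x. T0 < u --> g' u x <= Lop b (g u) x) ==>
   (ALL T1. EX R. ALL u x. T0 < u --> u < T1 --> norm x > R --> g u x = 0) ==>
   I (g t) <= I (g s) & g t x <= K0 * (t - s) powr (- real CARD('n) / 2) * I (g s)"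
  define K where "K = max (K0 * C) (C / c)"
  have K: "K > 0" "K0 * C <= K" "C / c <= K" using K0 cC by (auto simp: K_def less_max_iff_disj)
  show ?thesis
  proof (rule that[OF K(1)])
   fix b y y' T0 Om Om' j t
   assume b: "continuous_on UNIV b" "periodic L b" "ALL x. norm (b x) <= Bd" and y: "evolution T0 y y'"
   and Om: "open Om" "open Om'" "Om \<inter> Om' = {}" and sep: "ALL t x. T0 < t --> 0 < y t x --> (t, x) \<in> Om \<union> Om'"
   and gr: "growth T0 Om y" and dom: "dominated T0 Om y j" and j: "integrable lborel j" "ALL x. 0 <= j x"
   and sub: "ALL t x. T0 < t --> (t, x) \<in> Om --> 0 < y t x --> y' t x <= Lop b (y t) x" and t: "T0 < t"
   obtain I where I: "invariant b c C I" using inv[OF b(1,2)] b(3) by blast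
   obtain B where B: "B > 0" and gB: "ALL T1. EX K. ALL t x. T0 < t --> t < T1 --> (t, x) \<in> Om --> y t x <= K * exp (B * norm x)"
   using gr unfolding growth_def by blast
   have B1: "B + 1 > 0" using B by simp
   obtain Z ka where Z: "C2 Z" "!!x. exp ((B + 1) * norm x) / 2 <= Z x" "ka >= 0"
   and LZ: "!!b x. norm (b x) <= Bd ==> Lop b Z x <= ka * Z x"
   by (rule growing_supersolution[OF Bd B1]) blast
   have Zp: "Z x > 0" for x using Z(2)[of x] exp_gt_zero[of "(B + 1) * norm x"] by linarith
   define J where "J = (LINT x|lborel. j x)"
   have J: "J >= 0" unfolding J_def using j by (intro Bochner_Integration.integral_nonneg) auto
   define S where "S = {x. (t, x) \<in> Om}"
   \<comment> \<open>What the regularisation takes away, divided by \<open>dt\<close>: the multiple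
     of \<open>Z\<close> at time \<open>t\<close>, and 2 from
     \<open>s - 2 * dt <= F s\<close>.\<close>
   define Q where "Q x = exp (ka * (t - T0)) * Z x + 2" for x
   have Qp: "Q x > 0" for x using mult_pos_pos[OF exp_gt_zero Zp] by (simp add: Q_def add_pos_pos)
   have main: "(\<forall>x\<in>S. y t x - dt * Q x <= K0 * (t - T0) powr (- real CARD('n) / 2) * (C * J)) \<and>
   (\<integral>\<^sup>+x. ennreal (indicator S x * max 0 (y t x - dt * Q x)) \<partial>lborel) <= ennreal (C / c * J)" if dt: "dt > 0" for dt
   proof (rule smooth_pos_part[OF dt])
   fix F F' F'' :: "real => real"
   assume F: "!!s. (F has_real_derivative F' s) (at s)" "!!s. (F' has_real_derivative F'' s) (at s)" "continuous_on UNIV F''"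
   and Fp: "!!s. F s >= 0" "!!s. F' s >= 0" "!!s. F'' s >= 0"
   and F0: "!!s. s <= 0 ==> F s = 0 & F' s = 0" and Fs: "!!s. F s <= max 0 s" "!!s. s - 2 * dt <= F s"
   define g where "g = (%t x. if (t, x) \<in> Om then F (y t x - dt * exp (ka * (t - T0)) * Z x) else 0)"
   have "EX g'. evolution T0 g g' & (ALL u x. T0 < u --> g' u x <= Lop b (g u) x) \<and>
   (ALL T1. EX R. ALL u x. T0 < u --> u < T1 --> norm x > R --> g u x = 0)"
   unfolding g_def
   proof (rule cut_regular[OF y Om _ B _ _ Z(1,2,3) _ dt F F0 Fp])
   show "(t, x) \<in> Om \<union> Om'" if "T0 < t" "0 < y t x" for t x using sep that by simp
   show "EX K. ALL t x. T0 < t --> t < T1 --> (t, x) \<in> Om --> y t x <= K * exp (B * norm x)" for T1 using gB by simp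
   show "y' t x <= Lop b (y t) x" if "T0 < t" "(t, x) \<in> Om" "0 < y t x" for t x using sub that by simp
   show "Lop b Z x <= ka * Z x" for x by (rule LZ) (use b(3) in simp)
   qed (assumption | blast)+
   then obtain g' where g': "evolution T0 g g'" "ALL u x. T0 < u --> g' u x <= Lop b (g u) x"
   and supp: "ALL T1. EX R. ALL u x. T0 < u --> u < T1 --> norm x > R --> g u x = 0" by blast
   have g0: "g u x >= 0" for u x using Fp(1) by (simp add: g_def)
   have gy: "g u x <= max 0 (y u x)" for u x
   proof -
   have "0 <= dt * exp (ka * (u - T0)) * Z x" using dt Zp[of x] by (intro mult_nonneg_nonneg) auto
   then show ?thesis using Fs(1)[of "y u x - dt * exp (ka * (u - T0)) * Z x"] by (auto simp: g_def max_def split: if_splits)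
   qed
   obtain R where R: "!!u x. T0 < u ==> u < t + 1 ==> norm x > R ==> g u x = 0" using supp[rule_format, of "t + 1"] by blast
   have gCc: "Cc (g u)" if "T0 < u" "u < t + 1" for u
   unfolding Cc_def using C2_cont[OF evolutionD(1)[OF g'(1) that(1)]] R[OF that] by blast
   define s where "s m = T0 + (t - T0) / 2 * inverse (real (Suc m))" for m
   have s: "T0 < s m" "s m < t" for m
   proof -
   have "inverse (real (Suc m)) <= 1" by (simp add: inverse_le_1_iff)
   then have "(t - T0) / 2 * inverse (real (Suc m)) <= (t - T0) / 2 * 1" using t by (intro mult_left_mono) auto
   then show "s m < t" using t by (simp add: s_def field_simps)
   show "T0 < s m" using t by (simp add: s_def)
   qed
   have slim: "s \<longlonglongrightarrow> T0" unfolding s_def[abs_def]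
   by (rule tendsto_eq_intros LIMSEQ_inverse_real_of_nat refl)+ simp
   have sr: "filterlim s (at_right T0) sequentially"
   by (rule tendsto_imp_filterlim_at_right[OF slim]) (use s in auto)
   obtain K1 where K1: "ALL u x. T0 < u --> u < t --> (u, x) \<in> Om --> y u x <= K1 * exp (B * norm x)" using gB by blast
   \<comment> \<open>The mass by which the regularised function exceeds \<open>j\<close>; it tends
     to 0 by dominated convergence, the support of \<open>g\<close> being bounded up to time
     \<open>t\<close>.\<close>
   define e where "e m = (LINT x|lborel. max 0 (g (s m) x - j x))" for m
   have ig: "integrable lborel (g (s m))" for m by (intro Cc_integrable gCc) (use s[of m] in auto)
   have "e \<longlonglongrightarrow> (LINT x|(lborel :: (real ^ 'n) measure). 0)" unfolding e_def[abs_def]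
   proof (rule integral_dominated_convergence)
   show "(%x. max 0 (g (s m) x - j x)) \<in> borel_measurable lborel" for m
   using ig j(1) by (intro borel_measurable_max borel_measurable_diff borel_measurable_const) (auto dest: borel_measurable_integrable)
   show "integrable lborel (%x. \<bar>K1\<bar> * exp (B * R) * indicator (cball 0 R) x :: real)"
   by (intro integrable_mult_right integrable_real_indicator emeasure_lborel_cball_finite) simp
   show "AE x in lborel. norm (max 0 (g (s m) x - j x)) <= \<bar>K1\<bar> * exp (B * R) * indicator (cball 0 R) x" for m
   proof (rule AE_I2)
   fix x
   have sm: "T0 < s m" "s m < t" "s m < t + 1" using s[of m] by auto
   have jx: "0 <= j x" using j by simp
   have "g (s m) x <= \<bar>K1\<bar> * exp (B * R) * indicator (cball 0 R) x"
   proof (cases "norm x > R")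
   case True
   then show ?thesis using R[OF sm(1,3) True] by simp
   next
   case False
   then have "exp (B * norm x) <= exp (B * R)" using B by simp
   then have "K1 * exp (B * norm x) <= \<bar>K1\<bar> * exp (B * R)" by (intro mult_mono) auto
   moreover have "g (s m) x <= max 0 (K1 * exp (B * norm x))"
   proof (cases "(s m, x) \<in> Om")
   case True
   have "y (s m) x <= K1 * exp (B * norm x)" using K1 sm True by blast
   then show ?thesis using gy[of "s m" x] by (auto simp: max_def split: if_splits)
   qed (simp add: g_def)
   moreover have "0 <= \<bar>K1\<bar> * exp (B * R)" by simp
   ultimately have "g (s m) x <= \<bar>K1\<bar> * exp (B * R)" by linarith
   then show ?thesis using False by simp
   qed
   moreover have "0 <= \<bar>K1\<bar> * exp (B * R) * indicator (cball 0 R) x" by simp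
   ultimately show "norm (max 0 (g (s m) x - j x)) <= \<bar>K1\<bar> * exp (B * R) * indicator (cball 0 R) x"
   using jx by (simp add: max_def)
   qed
   show "AE x in lborel. (%m. max 0 (g (s m) x - j x)) \<longlonglongrightarrow> 0"
   using dom unfolding dominated_def
   proof (rule AE_mp, intro AE_I2 impI)
   fix x assume dx: "\<forall>\<eta>>0. \<forall>\<^sub>F t in at_right T0. (t, x) \<in> Om --> y t x <= j x + \<eta>"
   show "(%m. max 0 (g (s m) x - j x)) \<longlonglongrightarrow> 0"
   proof (rule tendstoI)
   fix \<eta> :: real assume \<eta>: "\<eta> > 0"
   then have "\<forall>\<^sub>F t in at_right T0. (t, x) \<in> Om --> y t x <= j x + \<eta> / 2" using dx by simp
   then have "\<forall>\<^sub>F m in sequentially. (s m, x) \<in> Om --> y (s m) x <= j x + \<eta> / 2"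
   using sr by (rule eventually_compose_filterlim)
   then show "\<forall>\<^sub>F m in sequentially. dist (max 0 (g (s m) x - j x)) 0 < \<eta>"
   proof (rule eventually_mono)
   fix m assume *: "(s m, x) \<in> Om --> y (s m) x <= j x + \<eta> / 2"
   have jx: "0 <= j x" using j by simp
   have "g (s m) x <= j x + \<eta> / 2"
   proof (cases "(s m, x) \<in> Om")
   case True
   then have "y (s m) x <= j x + \<eta> / 2" using * by simp
   then show ?thesis using gy[of "s m" x] jx \<eta> by (simp add: max_def split: if_splits)
   next
   case False
   then show ?thesis using jx \<eta> by (simp add: g_def)
   qed
   then show "dist (max 0 (g (s m) x - j x)) 0 < \<eta>" using \<eta> by (simp add: max_def)
   qed
   qed
   qed
   qed simp
   then have elim: "e \<longlonglongrightarrow> 0" by simp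
   have gs: "I (g (s m)) <= C * (J + e m)" for m
   proof -
   have "I (g (s m)) <= C * (LINT x|lborel. g (s m) x)"
   by (rule invariantD(5)[OF I gCc]) (use s[of m] g0 in auto)
   also have "(LINT x|lborel. g (s m) x) <= (LINT x|lborel. j x + max 0 (g (s m) x - j x))"
   using ig j(1) by (intro integral_mono Bochner_Integration.integrable_add integrable_max Bochner_Integration.integrable_diff) auto
   also have "... = J + e m" unfolding J_def e_def
   using ig j(1) by (intro Bochner_Integration.integral_add integrable_max Bochner_Integration.integrable_diff) auto
   finally show ?thesis using cC by simp
   qed
   have u: "I (g t) <= I (g (s m)) & g t x <= K0 * (t - s m) powr (- real CARD('n) / 2) * I (g (s m))" for m x
   by (rule U[OF I b(1) s[of m], of g g' x])
   (use g' g0 supp in "simp_all add: evolution_def")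
   have 1: "I (g t) <= C * J"
   proof (rule LIMSEQ_le_const)
   show "(%m. C * (J + e m)) \<longlonglongrightarrow> C * J" using tendsto_mult[OF tendsto_const tendsto_add[OF tendsto_const elim], of C J] by simp
   show "EX N. \<forall>m\<ge>N. I (g t) <= C * (J + e m)" using u gs order_trans by blast
   qed
   have 2: "g t x <= K0 * (t - T0) powr (- real CARD('n) / 2) * (C * J)" for x
   proof (rule LIMSEQ_le_const)
   show "(%m. K0 * (t - s m) powr (- real CARD('n) / 2) * (C * (J + e m))) \<longlonglongrightarrow> K0 * (t - T0) powr (- real CARD('n) / 2) * (C * J)"
   proof -
   have "(%m. K0 * (t - s m) powr (- real CARD('n) / 2) * (C * (J + e m))) \<longlonglongrightarrow> K0 * (t - T0) powr (- real CARD('n) / 2) * (C * (J + 0))"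
   by (intro tendsto_mult tendsto_add tendsto_powr tendsto_diff tendsto_const elim slim) (use t in auto)
   then show ?thesis by simp
   qed
   have "g t x <= K0 * (t - s m) powr (- real CARD('n) / 2) * (C * (J + e m))" for m
   proof -
   have "K0 * (t - s m) powr (- real CARD('n) / 2) * I (g (s m)) <= K0 * (t - s m) powr (- real CARD('n) / 2) * (C * (J + e m))"
   using gs[of m] K0 by (intro mult_left_mono) auto
   then show ?thesis using u[of m x] by linarith
   qed
   then show "EX N. \<forall>m\<ge>N. g t x <= K0 * (t - s m) powr (- real CARD('n) / 2) * (C * (J + e m))" by blast
   qed
   have lower: "indicator S x * max 0 (y t x - dt * Q x) <= g t x" for x
   proof (cases "x \<in> S")
   case True
   have "y t x - dt * exp (ka * (t - T0)) * Z x - 2 * dt <= g t x" using True Fs(2) by (simp add: S_def g_def)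
   then show ?thesis using True g0[of t x] by (simp add: Q_def algebra_simps)
   qed (use g0 in simp)
   have tt: "T0 < t" "t < t + 1" using t by auto
   have 3: "(LINT x|lborel. g t x) <= C / c * J"
   using invariantD(4)[OF I gCc[OF tt] g0] 1 cC by (simp add: field_simps)
   show ?thesis
   proof (intro conjI ballI)
   fix x assume "x \<in> S"
   then have "y t x - dt * Q x <= g t x" using lower[of x] by simp
   then show "y t x - dt * Q x <= K0 * (t - T0) powr (- real CARD('n) / 2) * (C * J)" using 2[of x] by linarith
   next
   have "(\<integral>\<^sup>+x. ennreal (indicator S x * max 0 (y t x - dt * Q x)) \<partial>lborel) <= (\<integral>\<^sup>+x. ennreal (g t x) \<partial>lborel)"
   using lower by (intro nn_integral_mono ennreal_leI) auto
   also have "... = ennreal (LINT x|lborel. g t x)"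
   using g0 by (intro nn_integral_eq_integral Cc_integrable gCc tt) auto
   also have "... <= ennreal (C / c * J)" using 3 by (rule ennreal_leI)
   finally show "(\<integral>\<^sup>+x. ennreal (indicator S x * max 0 (y t x - dt * Q x)) \<partial>lborel) <= ennreal (C / c * J)" .
   qed
   qed
   define d where "d m = inverse (real (Suc m))" for m
   have d: "d m > 0" for m by (simp add: d_def)
   have dlim: "d \<longlonglongrightarrow> 0" unfolding d_def[abs_def] by (rule LIMSEQ_inverse_real_of_nat)
   have lim: "(%m. y t x - d m * Q x) \<longlonglongrightarrow> y t x" for x
   by (rule tendsto_eq_intros dlim refl)+ simp
   have yt: "continuous_on UNIV (y t)" by (rule C2_cont[OF evolutionD(1)[OF y t]])
   have Qc: "continuous_on UNIV Q" unfolding Q_def[abs_def] by (intro continuous_intros C2_cont[OF Z(1)])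
   have Sm: "S \<in> sets borel" unfolding S_def by (intro borel_open open_time_section Om)
   have P: "K0 * (t - T0) powr (- real CARD('n) / 2) * (C * J) <= K * (t - T0) powr (- real CARD('n) / 2) * J"
   using mult_right_mono[OF K(2), of "(t - T0) powr (- real CARD('n) / 2) * J"] J by (simp add: mult_ac)
   show "(ALL x. (t, x) \<in> Om --> y t x <= K * (t - T0) powr (- real CARD('n) / 2) * (LINT x|lborel. j x)) \<and>
   (\<integral>\<^sup>+x. ennreal (indicator {x. (t, x) \<in> Om} x * max 0 (y t x)) \<partial>lborel) <= ennreal (K * (LINT x|lborel. j x))"
   proof (intro conjI allI impI)
   fix x assume "(t, x) \<in> Om"
   then have "x \<in> S" by (simp add: S_def)
   then have "y t x <= K0 * (t - T0) powr (- real CARD('n) / 2) * (C * J)"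
   by (intro LIMSEQ_le_const2[OF lim]) (use main d in blast)
   then show "y t x <= K * (t - T0) powr (- real CARD('n) / 2) * (LINT x|lborel. j x)" using P unfolding J_def by linarith
   next
   have "(\<integral>\<^sup>+x. ennreal (indicator S x * max 0 (y t x)) \<partial>lborel) = (\<integral>\<^sup>+x. liminf (%m. ennreal (indicator S x * max 0 (y t x - d m * Q x))) \<partial>lborel)"
   proof (intro nn_integral_cong)
   fix x
   have "(%m. ennreal (indicator S x * max 0 (y t x - d m * Q x))) \<longlonglongrightarrow> ennreal (indicator S x * max 0 (y t x))"
   by (intro tendsto_intros lim)
   then show "ennreal (indicator S x * max 0 (y t x)) = liminf (%m. ennreal (indicator S x * max 0 (y t x - d m * Q x)))"
   by (intro lim_imp_Liminf[symmetric]) simp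
   qed
   \<comment> \<open>Fatou's lemma suffices, as only an upper bound passes to the limit.\<close>
   also have "... <= liminf (%m. \<integral>\<^sup>+x. ennreal (indicator S x * max 0 (y t x - d m * Q x)) \<partial>lborel)"
   proof (rule nn_integral_liminf)
   fix m
   have "(%x. y t x - d m * Q x) \<in> borel_measurable borel"
   by (intro borel_measurable_continuous_onI continuous_intros yt Qc)
   then show "(%x. ennreal (indicator S x * max 0 (y t x - d m * Q x))) \<in> borel_measurable lborel"
   using Sm unfolding measurable_lborel2
   by (intro measurable_compose[OF _ measurable_ennreal] borel_measurable_times borel_measurable_indicator borel_measurable_max borel_measurable_const)
   qed
   also have "... <= ennreal (C / c * J)"
   by (rule Liminf_le) (use main d in "auto intro!: always_eventually")
   also have "... <= ennreal (K * J)" using K(3) J by (intro ennreal_leI mult_right_mono) auto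
   finally show "(\<integral>\<^sup>+x. ennreal (indicator {x. (t, x) \<in> Om} x * max 0 (y t x)) \<partial>lborel) <= ennreal (K * (LINT x|lborel. j x))"
   by (simp add: S_def J_def)
   qed
  qed
 qed
qed

section \<open>Division by a positive weight\<close>

lemma C2_inverse:
 assumes "C2 Ph" "!!x. 0 < Ph x"
 shows "C2 (%x. inverse (Ph x))"
proof (rule C2_compose[where F=inverse and F'="%s. - (inverse s ^ 2)" and F''="%s. 2 * inverse s ^ 3"])
 show "(inverse has_real_derivative (- ((inverse (Ph x))\<^sup>2))) (at (Ph x))" for x
  using DERIV_inverse[of "Ph x"] assms(2)[of x] by (simp add: numeral_2_eq_2)
 show "((%s. - ((inverse s)\<^sup>2)) has_real_derivative 2 * inverse (Ph x) ^ 3) (at (Ph x))" for x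
  using assms(2)[of x] by (auto intro!: derivative_eq_intros simp: power2_eq_square power3_eq_cube)
 show "continuous_on UNIV (%x. 2 * inverse (Ph x) ^ 3)"
  using assms(2) by (intro continuous_intros C2_cont[OF assms(1)]) (metis less_irrefl)
qed (rule assms(1))

theorem weighted_bound:
 assumes Bd: "Bd >= 0"
 obtains K where "K > 0"
  "!!Ph si a v v' T0 Om Om' j t. C2 Ph ==> (ALL x. 0 < Ph x) ==> periodic L (%x. inverse (Ph x) *\<^sub>R grad Ph x) ==>
   (ALL x. norm (grad Ph x) <= Bd * Ph x) ==>
   evolution T0 v v' ==> open Om ==> open Om' ==> Om \<inter> Om' = {} ==>
   (ALL t x. T0 < t --> 0 < v t x --> (t, x) \<in> Om \<union> Om') ==> growth T0 Om (%t x. v t x / Ph x) ==> dominated T0 Om v (%x. Ph x * j x) ==>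
   integrable lborel j ==> (ALL x. 0 <= j x) ==>
   (ALL t x. T0 < t --> (t, x) \<in> Om --> 0 < v t x -->
   v' t x <= D (v t) x + a t x * v t x & D Ph x + a t x * Ph x <= si * Ph x) ==> T0 < t ==>
   (ALL x. (t, x) \<in> Om --> v t x <= K * (t - T0) powr (- real CARD('n) / 2) * exp (si * (t - T0)) * Ph x * (LINT x|lborel. j x)) \<and>
   (\<integral>\<^sup>+x. ennreal (indicator {x. (t, x) \<in> Om} x * max 0 (v t x / Ph x)) \<partial>lborel)
   <= ennreal (exp (si * (t - T0))) * ennreal (K * (LINT x|lborel. j x))"
proof -
 obtain Kl where Kl: "Kl > 0" "!!i j x. \<bar>A x $ i $ j\<bar> <= Kl" using entry_lipschitz by metis
 define Bb where "Bb = 2 * ((real CARD('n))\<^sup>2 * Kl) * Bd"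
 have Bb: "Bb >= 0" using Kl Bd by (simp add: Bb_def)
 show ?thesis
 proof (rule drift_bound[OF Bb])
  fix K :: real assume K: "K > 0"
  assume E: "!!b y y' T0 Om Om' j t. continuous_on UNIV b ==> periodic L b ==> (ALL x. norm (b x) <= Bb) ==>
   evolution T0 y y' ==> open Om ==> open Om' ==> Om \<inter> Om' = {} ==>
   (ALL t x. T0 < t --> 0 < y t x --> (t, x) \<in> Om \<union> Om') ==> growth T0 Om y ==> dominated T0 Om y j ==>
   integrable lborel j ==> (ALL x. 0 <= j x) ==>
   (ALL t x. T0 < t --> (t, x) \<in> Om --> 0 < y t x --> y' t x <= Lop b (y t) x) ==> T0 < t ==>
   (ALL x. (t, x) \<in> Om --> y t x <= K * (t - T0) powr (- real CARD('n) / 2) * (LINT x|lborel. j x)) \<and>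
   (\<integral>\<^sup>+x. ennreal (indicator {x. (t, x) \<in> Om} x * max 0 (y t x)) \<partial>lborel) <= ennreal (K * (LINT x|lborel. j x))"
  show ?thesis
  proof (rule that[OF K])
   fix Ph si a v v' T0 Om Om' j t
   assume Ph: "C2 Ph" and Php: "ALL x. 0 < Ph x" and per: "periodic L (%x. inverse (Ph x) *\<^sub>R grad Ph x)"
   and gb: "ALL x. norm (grad Ph x) <= Bd * Ph x" and v: "evolution T0 v v'"
   and Om: "open Om" "open Om'" "Om \<inter> Om' = {}" and sep: "ALL t x. T0 < t --> 0 < v t x --> (t, x) \<in> Om \<union> Om'"
   and gr: "growth T0 Om (%t x. v t x / Ph x)" and dom: "dominated T0 Om v (%x. Ph x * j x)"
   and j: "integrable lborel j" "ALL x. 0 <= j x"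
   and sub: "ALL t x. T0 < t --> (t, x) \<in> Om --> 0 < v t x -->
   v' t x <= D (v t) x + a t x * v t x & D Ph x + a t x * Ph x <= si * Ph x" and t: "T0 < t"
   define b where "b x = 2 *\<^sub>R (A x *v (inverse (Ph x) *\<^sub>R grad Ph x))" for x
   define q where "q t = exp (- si * (t - T0))" for t
   define q' where "q' t = - si * exp (- si * (t - T0))" for t
   define y where "y t x = q t * inverse (Ph x) * v t x" for t x
   define y' where "y' t x = inverse (Ph x) * (q' t * v t x + q t * v' t x)" for t x
   have Ph0: "0 < Ph x" for x using Php by simp
   have qp: "q t > 0" for t by (simp add: q_def)
   have C2i: "C2 (%x. inverse (Ph x))" by (rule C2_inverse[OF Ph Ph0])
   have y: "evolution T0 y y'" unfolding y_def[abs_def] y'_def[abs_def]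
   proof (rule evolution_scale[OF v _ _ C2i])
   show "(q has_real_derivative q' t) (at t)" for t unfolding q_def[abs_def] q'_def
   by (auto intro!: derivative_eq_intros)
   show "continuous_on {T0<..} q'" unfolding q'_def[abs_def] by (intro continuous_intros)
   qed
   have bc: "continuous_on UNIV b"
   proof -
   have "continuous_on UNIV (%x. (A x *v (inverse (Ph x) *\<^sub>R grad Ph x)) $ i)" for i
   unfolding matrix_vector_mult_def
   by (simp, intro continuous_intros C1_cont[OF A_C1] C2_cont[OF C2i] C1_pd_cont C2_C1 Ph)
   then have "continuous_on UNIV (%x. A x *v (inverse (Ph x) *\<^sub>R grad Ph x))"
   by (subst continuous_on_componentwise) (auto simp: Basis_vec_def inner_axis)
   then show ?thesis unfolding b_def[abs_def] by (intro continuous_intros)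
   qed
   have bp: "periodic L b" using per A_per by (simp add: periodic_def b_def)
   have bb: "norm (b x) <= Bb" for x
   proof -
   have "norm (A x *v (inverse (Ph x) *\<^sub>R grad Ph x)) <= (real CARD('n))\<^sup>2 * Kl * norm (inverse (Ph x) *\<^sub>R grad Ph x)"
   by (rule matrix_bound) (rule Kl)
   also have "... <= (real CARD('n))\<^sup>2 * Kl * Bd"
   using gb[rule_format, of x] Ph0[of x] Kl by (intro mult_left_mono) (auto simp: field_simps)
   finally show ?thesis by (simp add: b_def Bb_def)
   qed
   have yv: "0 < y t x \<longleftrightarrow> 0 < v t x" for t x
   unfolding y_def using qp[of t] Ph0[of x] mult_pos_pos[OF qp[of t] positive_imp_inverse_positive[OF Ph0[of x]]]
   by (meson mult_pos_pos zero_less_mult_pos)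
   have ysub: "y' t x <= Lop b (y t) x" if tx: "T0 < t" "(t, x) \<in> Om" "0 < v t x" for t x
   proof -
   \<comment> \<open>In terms of \<open>v = Ph * z\<close> the cross term of \<open>D_mult\<close>
     is the drift, and the supersolution property of \<open>Ph\<close> disposes of the multiple of
     \<open>z\<close>.\<close>
   define z where "z x = inverse (Ph x) * v t x" for x
   have z: "C2 z" unfolding z_def[abs_def] by (intro C2_mult C2i evolutionD(1)[OF v tx(1)])
   have "v t = (%x. Ph x * z x)" using Ph0 by (auto simp: z_def less_imp_neq[symmetric])
   then have "D (v t) x = Ph x * D z x + z x * D Ph x + 2 * inner (grad Ph x) (A x *v grad z x)"
   by (simp add: D_mult[OF Ph z])
   moreover have "Ph x * inner (b x) (grad z x) = 2 * inner (grad Ph x) (A x *v grad z x)"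
   using Ph0[of x] A_inner_sym[of "grad z x" x "grad Ph x"]
   by (simp add: b_def matrix_vector_mult_scaleR inner_commute)
   ultimately have Dv: "D (v t) x = Ph x * Lop b z x + z x * D Ph x" by (simp add: Lop_def algebra_simps)
   have zp: "z x > 0" using tx Ph0[of x] by (simp add: z_def)
   have vz: "v t x = Ph x * z x" using Ph0[of x] by (simp add: z_def)
   have s: "v' t x <= D (v t) x + a t x * v t x" "D Ph x + a t x * Ph x <= si * Ph x" using sub tx by blast+
   have "z x * (D Ph x + a t x * Ph x) <= z x * (si * Ph x)" using s(2) zp by (intro mult_left_mono) auto
   then have "v' t x - si * v t x <= Ph x * Lop b z x" using s(1) unfolding Dv vz by (simp add: algebra_simps)
   then have "inverse (Ph x) * (v' t x - si * v t x) <= inverse (Ph x) * (Ph x * Lop b z x)"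
   using Ph0[of x] by (intro mult_left_mono) auto
   then have "inverse (Ph x) * (v' t x - si * v t x) <= Lop b z x" using Ph0[of x] by (simp add: mult.assoc[symmetric])
   then have "q t * (inverse (Ph x) * (v' t x - si * v t x)) <= q t * Lop b z x" using qp[of t] by (intro mult_left_mono) auto
   moreover have "q t * (inverse (Ph x) * (v' t x - si * v t x)) = y' t x" by (simp add: y'_def q'_def q_def algebra_simps)
   moreover have "Lop b (y t) x = q t * Lop b z x"
   using Lop_cmult[OF z, of b "q t" x] by (simp add: y_def[abs_def] z_def mult.assoc)
   ultimately show ?thesis by simp
   qed
   have gry: "growth T0 Om y"
   proof -
   obtain B where B: "B > 0" "ALL T1. EX K. ALL t x. T0 < t --> t < T1 --> (t, x) \<in> Om --> v t x / Ph x <= K * exp (B * norm x)"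
   using gr unfolding growth_def by blast
   have "EX K. ALL t x. T0 < t --> t < T1 --> (t, x) \<in> Om --> y t x <= K * exp (B * norm x)" for T1
   proof -
   obtain K where K: "ALL t x. T0 < t --> t < T1 --> (t, x) \<in> Om --> v t x / Ph x <= K * exp (B * norm x)" using B(2) by blast
   have "y t x <= (exp (\<bar>si\<bar> * (T1 - T0)) * \<bar>K\<bar>) * exp (B * norm x)" if "T0 < t" "t < T1" "(t, x) \<in> Om" for t x
   proof -
   have "v t x / Ph x <= K * exp (B * norm x)" using K that by blast
   also have "... <= \<bar>K\<bar> * exp (B * norm x)" by (intro mult_right_mono) auto
   finally have "v t x / Ph x <= \<bar>K\<bar> * exp (B * norm x)" .
   then have "q t * (v t x / Ph x) <= q t * (\<bar>K\<bar> * exp (B * norm x))" using qp[of t] by (intro mult_left_mono) auto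
   also have "... <= exp (\<bar>si\<bar> * (T1 - T0)) * (\<bar>K\<bar> * exp (B * norm x))"
   proof (rule mult_right_mono)
   have "- si * (t - T0) <= \<bar>si\<bar> * (T1 - T0)" using that by (intro mult_mono) auto
   then show "q t <= exp (\<bar>si\<bar> * (T1 - T0))" by (simp add: q_def)
   qed simp
   finally show ?thesis by (simp add: y_def divide_inverse mult_ac)
   qed
   then show ?thesis by blast
   qed
   then show ?thesis unfolding growth_def using B(1) by blast
   qed
   have domy: "dominated T0 Om y j"
   using dom unfolding dominated_def
   proof (rule AE_mp, intro AE_I2 impI allI)
   fix x \<eta> assume dx: "\<forall>\<eta>>0. \<forall>\<^sub>F t in at_right T0. (t, x) \<in> Om --> v t x <= Ph x * j x + \<eta>" and \<eta>: "(\<eta>::real) > 0"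
   have "((%t. q t * (j x + \<eta> / 2)) \<longlongrightarrow> exp (- si * (T0 - T0)) * (j x + \<eta> / 2)) (at_right T0)"
   unfolding q_def by (intro tendsto_intros)
   then have "\<forall>\<^sub>F t in at_right T0. q t * (j x + \<eta> / 2) < j x + \<eta>"
   by (rule order_tendstoD) (use \<eta> in simp)
   moreover have "\<forall>\<^sub>F t in at_right T0. (t, x) \<in> Om --> v t x <= Ph x * j x + Ph x * (\<eta> / 2)"
   using dx \<eta> Ph0[of x] by simp
   ultimately show "\<forall>\<^sub>F t in at_right T0. (t, x) \<in> Om --> y t x <= j x + \<eta>"
   proof eventually_elim
   case (elim t)
   show ?case
   proof
   assume "(t, x) \<in> Om"
   then have "v t x <= Ph x * (j x + \<eta> / 2)" using elim(2) by (simp add: algebra_simps)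
   then have "inverse (Ph x) * v t x <= j x + \<eta> / 2" using Ph0[of x] by (simp add: field_simps)
   then have "q t * (inverse (Ph x) * v t x) <= q t * (j x + \<eta> / 2)" using qp[of t] by (intro mult_left_mono) auto
   then show "y t x <= j x + \<eta>" using elim(1) by (simp add: y_def mult.assoc)
   qed
   qed
   qed
   have e: "(ALL x. (t, x) \<in> Om --> y t x <= K * (t - T0) powr (- real CARD('n) / 2) * (LINT x|lborel. j x)) \<and>
   (\<integral>\<^sup>+x. ennreal (indicator {x. (t, x) \<in> Om} x * max 0 (y t x)) \<partial>lborel) <= ennreal (K * (LINT x|lborel. j x))"
   proof (rule E[OF bc bp _ y Om _ gry domy j _ t])
   show "ALL x. norm (b x) <= Bb" using bb by simp
   show "ALL t x. T0 < t --> 0 < y t x --> (t, x) \<in> Om \<union> Om'" unfolding yv by (rule sep)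
   show "ALL t x. T0 < t --> (t, x) \<in> Om --> 0 < y t x --> y' t x <= Lop b (y t) x" unfolding yv using ysub by blast
   qed
   have qi: "exp (si * (t - T0)) * q t = 1" by (simp add: q_def exp_add[symmetric])
   have vy: "v t x / Ph x = exp (si * (t - T0)) * y t x" for x
   proof -
   have "exp (si * (t - T0)) * y t x = (exp (si * (t - T0)) * q t) * (inverse (Ph x) * v t x)" by (simp add: y_def mult_ac)
   then show ?thesis unfolding qi by (simp add: divide_inverse)
   qed
   show "(ALL x. (t, x) \<in> Om --> v t x <= K * (t - T0) powr (- real CARD('n) / 2) * exp (si * (t - T0)) * Ph x * (LINT x|lborel. j x)) \<and>
   (\<integral>\<^sup>+x. ennreal (indicator {x. (t, x) \<in> Om} x * max 0 (v t x / Ph x)) \<partial>lborel)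
   <= ennreal (exp (si * (t - T0))) * ennreal (K * (LINT x|lborel. j x))"
   proof (intro conjI allI impI)
   fix x assume "(t, x) \<in> Om"
   then have "y t x <= K * (t - T0) powr (- real CARD('n) / 2) * (LINT x|lborel. j x)" using e by blast
   then have "(exp (si * (t - T0)) * Ph x) * y t x <= (exp (si * (t - T0)) * Ph x) * (K * (t - T0) powr (- real CARD('n) / 2) * (LINT x|lborel. j x))"
   using Ph0[of x] by (intro mult_left_mono) auto
   moreover have "(exp (si * (t - T0)) * Ph x) * y t x = v t x"
   using vy[of x] Ph0[of x] by (simp add: field_simps)
   ultimately show "v t x <= K * (t - T0) powr (- real CARD('n) / 2) * exp (si * (t - T0)) * Ph x * (LINT x|lborel. j x)"
   by (simp add: mult_ac)
   next
   have "(\<integral>\<^sup>+x. ennreal (indicator {x. (t, x) \<in> Om} x * max 0 (v t x / Ph x)) \<partial>lborel)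
   = (\<integral>\<^sup>+x. ennreal (exp (si * (t - T0))) * ennreal (indicator {x. (t, x) \<in> Om} x * max 0 (y t x)) \<partial>lborel)"
   proof (intro nn_integral_cong)
   fix x
   have "max 0 (v t x / Ph x) = exp (si * (t - T0)) * max 0 (y t x)"
   unfolding vy by (simp add: max_def zero_le_mult_iff)
   then show "ennreal (indicator {x. (t, x) \<in> Om} x * max 0 (v t x / Ph x)) =
   ennreal (exp (si * (t - T0))) * ennreal (indicator {x. (t, x) \<in> Om} x * max 0 (y t x))"
   by (simp add: ennreal_mult[symmetric] mult_ac)
   qed
   also have "... = ennreal (exp (si * (t - T0))) * (\<integral>\<^sup>+x. ennreal (indicator {x. (t, x) \<in> Om} x * max 0 (y t x)) \<partial>lborel)"
   proof (rule nn_integral_cmult)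
   have "y t \<in> borel_measurable borel"
   by (intro borel_measurable_continuous_onI C2_cont[OF evolutionD(1)[OF y t]])
   moreover have "{x. (t, x) \<in> Om} \<in> sets borel" by (intro borel_open open_time_section Om)
   ultimately show "(%x. ennreal (indicator {x. (t, x) \<in> Om} x * max 0 (y t x))) \<in> borel_measurable lborel"
   unfolding measurable_lborel2
   by (intro measurable_compose[OF _ measurable_ennreal] borel_measurable_times borel_measurable_indicator borel_measurable_max borel_measurable_const)
   qed
   also have "... <= ennreal (exp (si * (t - T0))) * ennreal (K * (LINT x|lborel. j x))"
   using e by (intro mult_left_mono) auto
   finally show "(\<integral>\<^sup>+x. ennreal (indicator {x. (t, x) \<in> Om} x * max 0 (v t x / Ph x)) \<partial>lborel)
   <= ennreal (exp (si * (t - T0))) * ennreal (K * (LINT x|lborel. j x))" .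
   qed
  qed
 qed
qed

end

subsection \<open>Mollification of weak solutions\<close>

text \<open>Evenness lets the bump be moved between the two arguments of a convolution. The last
  clause, a bound for \<open>r\<close> times the L1 norm of each partial derivative with
  \<open>C\<close> chosen independently of \<open>r\<close>, is what the commutator estimate
  needs.\<close>

definition bump :: "real => real => (real ^ 'n::finite => real) => bool" where
 "bump r C rh \<longleftrightarrow> C1 rh & (ALL z. 0 <= rh z) & (ALL z. norm z > r --> rh z = 0) & (ALL z. rh (- z) = rh z) \<and>
   (ALL i z. pd i rh (- z) = - pd i rh z) & (LINT z|lborel. rh z) = 1 & (ALL i. r * (LINT z|lborel. \<bar>pd i rh z\<bar>) <= C)"

lemma pd_cmult: "C1 h ==> pd i (%x. c * h x) x = c * pd i h x"
 using arg_cong[OF grad_cmult[of h c x], of "%v. v $ i"] by simp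

text \<open>The normalised \<open>max 0 (r\<^sup>2 - Q z) ^ 2\<close>. One derivative of the bump is
  enough, since the other falls on a function that is itself \<open>C1\<close>. The constant comes
  from comparing the derivative on the ball with the mass on the ball of half the radius.\<close>

lemma bump_exists:
 assumes r: "r > 0"
 obtains rh :: "real ^ 'n::finite => real" where "bump r (8 * 2 ^ CARD('n)) rh"
proof -
 define Q where "Q z = (\<Sum>i\<in>UNIV. z $ i * z $ i)" for z :: "real ^ 'n"
 have Qn: "Q z = (norm z)\<^sup>2" for z by (simp add: Q_def power2_norm_eq_inner inner_vec_def)
 have Q1: "C1 Q" unfolding Q_def[abs_def] by (intro C1_sum C1_mult C1_nth)
 have gQ: "grad Q z = 2 *\<^sub>R z" for z
 proof -
  have "grad Q z = (\<Sum>i\<in>UNIV. z $ i *\<^sub>R axis i 1 + z $ i *\<^sub>R axis i 1)"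
   unfolding Q_def[abs_def] by (subst grad_sum) (auto intro!: C1_mult simp: grad_mult grad_component)
  then show ?thesis by (simp add: vec_eq_iff axis_def sum.distrib if_distrib cong: if_cong)
 qed
 define P where "P z = max 0 (r\<^sup>2 - Q z) ^ 2" for z
 have dF: "((%s. max 0 (r\<^sup>2 - s) ^ 2) has_real_derivative - 2 * max 0 (r\<^sup>2 - s)) (at s)" for s
 proof -
  have "((%s. r\<^sup>2 - s) has_real_derivative - 1) (at s)" by (auto intro!: derivative_eq_intros)
  from DERIV_chain2[OF DERIV_pos_part_power[of 0] this] show ?thesis by (simp add: numeral_2_eq_2)
 qed
 have cF: "continuous_on UNIV (%x. - 2 * max 0 (r\<^sup>2 - Q x))" by (intro continuous_intros C1_cont[OF Q1])
 have P1: "C1 P" unfolding P_def[abs_def]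
  by (rule C1_compose[where F="%s. max 0 (r\<^sup>2 - s) ^ 2" and F'="%s. - 2 * max 0 (r\<^sup>2 - s)", OF Q1 dF cF])
 have gP: "grad P z = (- 2 * max 0 (r\<^sup>2 - Q z)) *\<^sub>R (2 *\<^sub>R z)" for z
  unfolding P_def[abs_def] gQ[symmetric]
  by (rule grad_compose[where F="%s. max 0 (r\<^sup>2 - s) ^ 2" and F'="%s. - 2 * max 0 (r\<^sup>2 - s)", OF Q1 dF])
 have pP: "pd i P z = - 4 * max 0 (r\<^sup>2 - Q z) * z $ i" for i z
  using arg_cong[OF gP[of z], of "%v. v $ i"] by simp
 have supp: "max 0 (r\<^sup>2 - Q z) = 0" if "norm z > r" for z
  using power_strict_mono[OF that, of 2] r by (simp add: Qn)
 have P0: "P z >= 0" for z by (simp add: P_def)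
 have PCc: "Cc P" unfolding Cc_def using C1_cont[OF P1] supp by (auto simp: P_def intro!: exI[of _ r])
 define V where "V = unit_ball_vol (real CARD('n))"
 have V: "V > 0" by (simp add: V_def)
 have vol: "measure lborel (cball (0 :: real ^ 'n) s) = V * s ^ CARD('n)" if "s >= 0" for s
  using content_cball[OF that, of "0 :: real ^ 'n"] by (simp add: V_def)
 define N where "N = (LINT z|lborel. P z)"
 have NV: "9 / 16 * r ^ 4 * (V * (r / 2) ^ CARD('n)) <= N"
 proof -
  have "9 / 16 * r ^ 4 * (V * (r / 2) ^ CARD('n)) = (LINT z|lborel. 9 / 16 * r ^ 4 * indicator (cball (0 :: real ^ 'n) (r / 2)) z)"
   using vol[of "r / 2"] r by simp
  also have "... <= N" unfolding N_def
  proof (rule integral_mono)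
   show "integrable lborel (%z. 9 / 16 * r ^ 4 * indicator (cball (0 :: real ^ 'n) (r / 2)) z)"
   by (intro integrable_mult_right integrable_real_indicator emeasure_lborel_cball_finite) simp
   show "integrable lborel P" by (rule Cc_integrable[OF PCc])
   show "9 / 16 * r ^ 4 * indicator (cball 0 (r / 2)) z <= P z" for z
   proof (cases "z \<in> cball 0 (r / 2)")
   case True
   then have "Q z <= (r / 2)\<^sup>2" unfolding Qn by (intro power_mono) auto
   then have "3 / 4 * r\<^sup>2 <= r\<^sup>2 - Q z" by (simp add: power_divide)
   also have "... <= max 0 (r\<^sup>2 - Q z)" by simp
   finally have "3 / 4 * r\<^sup>2 <= max 0 (r\<^sup>2 - Q z)" .
   then have "(3 / 4 * r\<^sup>2)\<^sup>2 <= P z" unfolding P_def by (intro power_mono) auto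
   then show ?thesis using True by (simp add: power2_eq_square power4_eq_xxxx)
   qed (simp add: P0)
  qed
  finally show ?thesis .
 qed
 have N: "N > 0" using NV V r by (intro less_le_trans[OF _ NV] mult_pos_pos) auto
 have dP: "r * (LINT z|lborel. \<bar>pd i P z\<bar>) <= 8 * 2 ^ CARD('n) * N" for i
 proof -
  have "(LINT z|lborel. \<bar>pd i P z\<bar>) <= (LINT z|lborel. 4 * r ^ 3 * indicator (cball (0 :: real ^ 'n) r) z)"
  proof (rule integral_mono)
   have "Cc (%z. \<bar>pd i P z\<bar>)" unfolding Cc_def
   by (intro conjI continuous_intros C1_pd_cont P1) (auto simp: pP supp intro!: exI[of _ r])
   then show "integrable lborel (%z. \<bar>pd i P z\<bar>)" by (rule Cc_integrable)
   show "integrable lborel (%z. 4 * r ^ 3 * indicator (cball (0 :: real ^ 'n) r) z)"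
   by (intro integrable_mult_right integrable_real_indicator emeasure_lborel_cball_finite) simp
   show "\<bar>pd i P z\<bar> <= 4 * r ^ 3 * indicator (cball 0 r) z" for z
   proof (cases "norm z > r")
   case True
   then show ?thesis using supp[OF True] by (simp add: pP)
   next
   case False
   have "max 0 (r\<^sup>2 - Q z) * \<bar>z $ i\<bar> <= r\<^sup>2 * r"
   using False component_le_norm_cart[of z i] by (intro mult_mono) (auto simp: Qn)
   then show ?thesis using False by (simp add: pP abs_mult power2_eq_square power3_eq_cube)
   qed
  qed
  also have "... = 4 * r ^ 3 * (V * r ^ CARD('n))" using vol[of r] r by simp
  finally have "r * (LINT z|lborel. \<bar>pd i P z\<bar>) <= r * (4 * r ^ 3 * (V * r ^ CARD('n)))" using r by (intro mult_left_mono) auto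
  also have "... = 4 * (r ^ 4 * V * r ^ CARD('n))" by (simp add: power3_eq_cube power4_eq_xxxx)
  also have "... <= 9 / 2 * (r ^ 4 * V * r ^ CARD('n))" using r V by (intro mult_right_mono) auto
  also have "... = 8 * 2 ^ CARD('n) * (9 / 16 * r ^ 4 * (V * (r / 2) ^ CARD('n)))" by (simp add: power_divide)
  also have "... <= 8 * 2 ^ CARD('n) * N" by (intro mult_left_mono NV) auto
  finally show ?thesis .
 qed
 have pd: "pd i (%z. inverse N * P z) z = inverse N * pd i P z" for i z by (rule pd_cmult[OF P1])
 have "bump r (8 * 2 ^ CARD('n)) (%z. inverse N * P z)"
  unfolding bump_def pd
 proof (intro conjI allI impI)
  show "C1 (%z. inverse N * P z)" by (intro C1_cmult P1)
  show "0 <= inverse N * P z" for z using N P0 by simp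
  show "inverse N * P z = 0" if "r < norm z" for z using supp[OF that] by (simp add: P_def)
  show "inverse N * P (- z) = inverse N * P z" for z by (simp add: P_def Qn)
  show "inverse N * pd i P (- z) = - (inverse N * pd i P z)" for i z by (simp add: pP Qn)
  show "(LINT z|lborel. inverse N * P z) = 1" using N by (simp add: N_def)
  have "r * (LINT z|lborel. \<bar>inverse N * pd i P z\<bar>) = inverse N * (r * (LINT z|lborel. \<bar>pd i P z\<bar>))" for i
   using N by (simp add: abs_mult)
  also have "inverse N * (r * (LINT z|lborel. \<bar>pd i P z\<bar>)) <= 8 * 2 ^ CARD('n)" for i
   using dP[of i] N by (simp add: field_simps)
  finally show "r * (LINT z|lborel. \<bar>inverse N * pd i P z\<bar>) <= 8 * 2 ^ CARD('n)" for i .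
 qed
 then show ?thesis by (rule that)
qed

definition mollify :: "(real ^ 'n::finite => real) => (real ^ 'n => real) => real ^ 'n => real" where
 "mollify rh h x = (LINT z|lborel. rh z * h (x + z))"

context
 fixes r C :: real and rh :: "real ^ 'n::finite => real"
 assumes b: "bump r C rh" and r: "r > 0"
begin

lemma bumpD: "C1 rh" "0 <= rh z" "norm z > r ==> rh z = 0" "rh (- z) = rh z" "pd i rh (- z) = - pd i rh z"
 "(LINT z|lborel. rh z) = 1" "r * (LINT z|lborel. \<bar>pd i rh z\<bar>) <= C"
 using b by (auto simp: bump_def)

lemma bump_flip: "rh (x - y) = rh (y - x)" "pd i rh (x - y) = - pd i rh (y - x)"
 using bumpD(4)[of "y - x"] bumpD(5)[of i "y - x"] by simp_all

lemma bump_pd_zero: "norm z > r ==> pd i rh z = 0"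
proof -
 assume z: "norm z > r"
 have "pd i rh z = pd i (%_. 0) z"
 proof (rule pd_local[of "norm z - r"])
  fix y assume "dist y z < norm z - r"
  then have "norm y > r" using norm_triangle_ineq2[of z y] by (auto simp: dist_norm norm_minus_commute)
  then show "rh y = 0" by (rule bumpD(3))
 qed (use z in simp)
 then show ?thesis by simp
qed

lemma bump_Cc: "continuous_on UNIV h ==> Cc (%y. h y * rh (x - y))" "continuous_on UNIV h ==> Cc (%y. h y * pd i rh (x - y))"
 "continuous_on UNIV h ==> Cc (%z. rh z * h z)"
proof -
 have far: "norm (x - y) > r" if "norm y > norm x + r" for y
  using that norm_triangle_ineq2[of y x] by (simp add: norm_minus_commute)
 assume h: "continuous_on UNIV h"
 show "Cc (%y. h y * rh (x - y))" unfolding Cc_def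
  by (intro conjI continuous_intros h continuous_on_compose2[OF C1_cont[OF bumpD(1), of UNIV]] exI[of _ "norm x + r"])
   (auto simp: bumpD(3)[OF far])
 show "Cc (%y. h y * pd i rh (x - y))" unfolding Cc_def
  by (intro conjI continuous_intros h continuous_on_compose2[OF C1_pd_cont[OF bumpD(1), of UNIV]] exI[of _ "norm x + r"])
   (auto simp: bump_pd_zero[OF far])
 show "Cc (%z. rh z * h z)" unfolding Cc_def
  by (intro conjI continuous_intros h C1_cont[OF bumpD(1)] exI[of _ r]) (auto simp: bumpD(3))
qed

lemma mollify_shift:
 assumes "continuous_on UNIV h"
 shows "mollify rh h x = (LINT y|lborel. h y * rh (x - y))"
 using lborel_integral_shift[OF Cc_borel[OF bump_Cc(1)[OF assms, of x]], of x] bumpD(4)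
 by (simp add: mollify_def add.commute mult.commute)

lemma mollify_C1:
 assumes h: "continuous_on UNIV h"
 shows "C1 (mollify rh h)" "pd i (mollify rh h) x = (LINT y|lborel. h y * pd i rh (x - y))"
proof -
 have *: "EX g. C1 g & (ALL x. dist x x0 < 1 --> mollify rh h x = g x) & (ALL i. pd i g x0 = (LINT y|lborel. h y * pd i rh (x0 - y)))" for x0
 proof -
  define S where "S = norm x0 + 1 + r"
  \<comment> \<open>For \<open>x\<close> near \<open>x0\<close> only \<open>y\<close> with
    \<open>norm y <= S\<close> contribute, so the tent changes nothing and supplies the fixed
    compact support that differentiation under the integral asks for.\<close>
  define k where "k x y = tent (S + 1) y * h y * rh (x + (- y))" for x y
  have far: "norm (x - y) > r" if "dist x x0 < 1" "norm y > S" for x y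
   using that norm_triangle_ineq2[of y x] norm_triangle_ineq2[of x x0] by (auto simp: S_def dist_norm norm_minus_commute)
  have t1: "tent (S + 1) y = 1" if "\<not> norm y > S" for y :: "real ^ 'n" by (rule tent_simps(3)) (use that in simp)
  have pk: "pd i (%x. k x y) x = tent (S + 1) y * h y * pd i rh (x + (- y))" for i x y
   unfolding k_def pd_cmult[OF C1_translate[OF bumpD(1)]] pd_translate ..
  have c: "continuous_on UNIV (%(x, y). k x y)" "continuous_on UNIV (%(x, y). pd i (%x. k x y) x)" for i
   unfolding pk unfolding k_def case_prod_beta'
   by (intro continuous_intros tent_cont continuous_on_compose2[OF h] continuous_on_compose2[OF C1_cont[OF bumpD(1), of UNIV]]
   continuous_on_compose2[OF C1_pd_cont[OF bumpD(1), of UNIV]] subset_UNIV)+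
  have C1k: "C1 (%x. k x y)" for y unfolding k_def by (intro C1_cmult C1_translate bumpD(1))
  have sk: "k x y = 0" if "norm y > S + 1" for x y using that by (simp add: k_def tent_simps(4))
  note CI = C1_integral[OF c C1k sk]
  have "mollify rh h x = (LINT y|lborel. k x y)" if "dist x x0 < 1" for x
   unfolding mollify_shift[OF h]
  proof (rule Bochner_Integration.integral_cong[OF refl])
   show "h y * rh (x - y) = k x y" for y
   using bumpD(3)[OF far[OF that]] t1[of y] by (cases "norm y > S") (auto simp: k_def)
  qed
  moreover have "pd i (%x. LINT y|lborel. k x y) x0 = (LINT y|lborel. h y * pd i rh (x0 - y))" for i
  proof -
   have "pd i (%x. LINT y|lborel. k x y) x0 = (LINT y|lborel. pd i (%x. k x y) x0)" by (rule CI(2))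
   also have "... = (LINT y|lborel. h y * pd i rh (x0 - y))" unfolding pk
  proof (rule Bochner_Integration.integral_cong[OF refl])
   show "tent (S + 1) y * h y * pd i rh (x0 + - y) = h y * pd i rh (x0 - y)" for y
   using bump_pd_zero[OF far[of x0]] t1[of y] by (cases "norm y > S") auto
  qed
   finally show ?thesis .
  qed
  ultimately show ?thesis using CI(1) by (intro exI[of _ "%x. LINT y|lborel. k x y"]) auto
 qed
 show "C1 (mollify rh h)"
 proof (rule C1_local)
  fix x0
  from * obtain g where "C1 g" "ALL x. dist x x0 < 1 --> mollify rh h x = g x" by blast
  then show "EX g r. r > 0 & C1 g & (ALL x. dist x x0 < r --> mollify rh h x = g x)" by (intro exI[of _ g] exI[of _ 1]) auto
 qed
 obtain g where g: "ALL y. dist y x < 1 --> mollify rh h y = g y" "pd i g x = (LINT y|lborel. h y * pd i rh (x - y))"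
  using * by blast
 have "pd i (mollify rh h) x = pd i g x" by (rule pd_local[of 1]) (use g in auto)
 then show "pd i (mollify rh h) x = (LINT y|lborel. h y * pd i rh (x - y))" using g by simp
qed

lemma mollify_pd:
 assumes h: "C1 h"
 shows "pd i (mollify rh h) x = mollify rh (pd i h) x"
proof -
 have pk: "pd i (%x. rh z * h (x + z)) x = rh z * pd i h (x + z)" for i x z
  unfolding pd_cmult[OF C1_translate[OF h]] pd_translate ..
 have c: "continuous_on UNIV (%(x, z). rh z * h (x + z))" "continuous_on UNIV (%(x, z). pd i (%x. rh z * h (x + z)) x)" for i
  unfolding pk unfolding case_prod_beta'
  by (intro continuous_intros continuous_on_compose2[OF C1_cont[OF bumpD(1), of UNIV]] continuous_on_compose2[OF C1_cont[OF h, of UNIV]]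
   continuous_on_compose2[OF C1_pd_cont[OF h, of UNIV]] subset_UNIV)+
 have "pd i (%x. LINT z|lborel. rh z * h (x + z)) x = (LINT z|lborel. pd i (%x. rh z * h (x + z)) x)"
  by (rule C1_integral(2)[OF c, where R=r]) (auto intro!: C1_cmult C1_translate h simp: bumpD(3))
 then show ?thesis unfolding pk by (simp add: mollify_def[abs_def])
qed

lemma mollify_close:
 assumes h: "continuous_on UNIV h" and \<omega>: "!!z. norm z <= r ==> \<bar>h (x + z) - h x\<bar> <= \<omega>"
 shows "\<bar>mollify rh h x - h x\<bar> <= \<omega>"
proof -
 have hc: "continuous_on UNIV (%z. h (x + z))" by (intro continuous_on_compose2[OF h] continuous_intros) auto
 have i: "integrable lborel rh" using Cc_integrable[OF bump_Cc(3)[of "%_. 1"]] by simp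
 have i1: "integrable lborel (%z. rh z * h (x + z))" by (rule Cc_integrable[OF bump_Cc(3)[OF hc]])
 have i2: "integrable lborel (%z. rh z * (h (x + z) - h x))"
  by (rule Cc_integrable[OF bump_Cc(3)]) (intro continuous_intros hc)
 have "mollify rh h x - h x = (LINT z|lborel. rh z * h (x + z)) - (LINT z|lborel. rh z * h x)"
  using bumpD(6) by (simp add: mollify_def)
 also have "... = (LINT z|lborel. rh z * (h (x + z) - h x))"
  using i i1 by (subst Bochner_Integration.integral_diff[symmetric]) (auto simp: algebra_simps)
 finally have "\<bar>mollify rh h x - h x\<bar> <= (LINT z|lborel. \<bar>rh z * (h (x + z) - h x)\<bar>)" using integral_abs_bound by metis
 also have "... <= (LINT z|lborel. rh z * \<omega>)"
 proof (rule integral_mono)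
  show "integrable lborel (%z. \<bar>rh z * (h (x + z) - h x)\<bar>)" using i2 by (rule integrable_abs)
  show "integrable lborel (%z. rh z * \<omega>)" using i by simp
  show "\<bar>rh z * (h (x + z) - h x)\<bar> <= rh z * \<omega>" for z
   using \<omega>[of z] bumpD(2)[of z] bumpD(3)[of z] by (cases "norm z <= r") (auto simp: abs_mult intro: mult_left_mono)
 qed
 also have "... = \<omega>" using bumpD(6) by simp
 finally show ?thesis .
qed

lemma mollify_periodic: "periodic L h ==> periodic L (mollify rh h)"
proof -
 assume "periodic L h"
 then have "h (x + a *\<^sub>R axis i 1 + z) = h (x + z)" if "a = L $ i" for x z i a
  using that unfolding periodic_def by (metis add.assoc add.commute)
 then show "periodic L (mollify rh h)" unfolding periodic_def mollify_def by simp
qed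

end

lemma periodic_unif_finite:
 fixes L :: "real ^ 'n::finite" and \<H> :: "(real ^ 'n => real) set"
 assumes L: "!!i. 0 < L $ i" and e: "e > 0" and "finite \<H>" "!!h. h \<in> \<H> ==> periodic L h & continuous_on UNIV h"
 shows "\<exists>d>0. \<forall>h\<in>\<H>. ALL x y. dist x y < d --> \<bar>h x - h y\<bar> < e"
 using assms(3,4)
proof (induction \<H>)
 case empty
 then show ?case by (auto intro!: exI[of _ 1])
next
 case (insert h \<H>)
 then obtain d where d: "d > 0" "\<forall>h\<in>\<H>. ALL x y. dist x y < d --> \<bar>h x - h y\<bar> < e" by blast
 have hp: "periodic L h" "continuous_on UNIV h" using insert.prems by auto
 obtain d' where d': "d' > 0" "!!x y. dist x y < d' ==> dist (h x) (h y) < e"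
  by (rule periodic_unif[OF L hp e]) blast
 show ?case using d d' by (intro exI[of _ "min d d'"]) (auto simp: dist_real_def)
qed

context periodic_diffusion
begin

text \<open>Friedrichs' commutator argument. The weak solution has no second derivatives, so
  \<open>D ps\<close> is compared with the mollified right-hand side \<open>G\<close>: testing the
  weak equation with the bump centred at \<open>x\<close> puts the outer derivative on the bump, and
  the coefficient difference between \<open>x\<close> and \<open>y\<close>, of order
  \<open>r\<close>, compensates the gradient of the bump, of order \<open>1 / r\<close>.\<close>

theorem weak_approximation:
 assumes ph: "C1 ph" "periodic L ph" and w: "has_weak_divergence (%x. A x *v grad ph x) G" and G: "periodic L G" and ep: "ep > 0"
 obtains ps where "C2 ps" "periodic L ps" "!!x. \<bar>ps x - ph x\<bar> <= ep" "!!x. norm (grad ps x - grad ph x) <= ep" "!!x. \<bar>D ps x - G x\<bar> <= ep"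
proof -
 define n where "n = real CARD('n)"
 have n1: "n >= 1" by (simp add: n_def Suc_leI)
 define C :: real where "C = 8 * 2 ^ CARD('n)"
 have C: "C > 0" by (simp add: C_def)
 obtain K where K: "K > 0" "!!i j x y. \<bar>A x $ i $ j - A y $ i $ j\<bar> <= K * norm (x - y)"
  "!!i j l x. \<bar>pd l (%y. A y $ i $ j) x\<bar> <= K" using entry_lipschitz by metis
 obtain M where M: "M > 0" "!!x. norm (grad ph x) <= M"
  using periodic_bounded[OF L_pos periodic_grad[OF ph(2)] C1_grad_cont[OF ph(1)]] by metis
 have Mp: "\<bar>pd j ph x\<bar> <= M" for j x using M(2)[of x] component_le_norm_cart[of "grad ph x" j] by simp
 have Gc: "continuous_on UNIV G" using w by (simp add: has_weak_divergence_def)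
 \<comment> \<open>The modulus of continuity for which the \<open>n * n\<close> commutator terms,
   the gradient error and the mollification of \<open>G\<close> add up to \<open>ep\<close>.\<close>
 define dt where "dt = ep / (n * n * (K + M + K * C) + n + 1)"
 have den: "n * n * (K + M + K * C) + n + 1 > 0" using n1 K M C by (intro add_nonneg_pos add_nonneg_nonneg) auto
 have dt: "dt > 0" using ep den by (simp add: dt_def)
 have dte: "n * n * (K + M + K * C) * dt + n * dt + dt = ep"
 proof -
  have "n * n * (K + M + K * C) * dt + n * dt + dt = (n * n * (K + M + K * C) + n + 1) * dt" by (simp add: algebra_simps)
  also have "... = ep" using den by (simp add: dt_def)
  finally show ?thesis .
 qed
 have dt1: "dt <= ep" "n * dt <= ep" "n * n * (K + M + K * C) * dt + dt <= ep"
 proof -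
  have "0 <= n * n * (K + M + K * C) * dt" "0 <= n * dt" using n1 K M C dt by auto
  then show "dt <= ep" "n * dt <= ep" "n * n * (K + M + K * C) * dt + dt <= ep" using dte dt by linarith+
 qed
 define \<H> where "\<H> = insert ph (insert G (range (%j. pd j ph) \<union> (%(i, j). pd i (%y. A y $ i $ j)) ` UNIV))"
 have "periodic L (%y. A y $ i $ j)" for i j using A_per by (simp add: periodic_def)
 then have "periodic L (pd l (%y. A y $ i $ j))" for i j l by (rule periodic_pd)
 moreover have "periodic L (pd j ph)" for j by (rule periodic_pd[OF ph(2)])
 ultimately have H: "periodic L h & continuous_on UNIV h" if "h \<in> \<H>" for h
  using that ph(2) G Gc C1_pd_cont[OF ph(1)] C1_pd_cont[OF A_C1] C1_cont[OF ph(1)] by (auto simp: \<H>_def)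
 have "finite \<H>" by (simp add: \<H>_def)
 from periodic_unif_finite[OF L_pos dt this H]
 obtain d where d: "d > 0" "\<forall>h\<in>\<H>. ALL x y. dist x y < d --> \<bar>h x - h y\<bar> < dt" by blast
 define r where "r = d / 2"
 have r: "r > 0" using d by (simp add: r_def)
 have cl: "\<bar>h x - h y\<bar> <= dt" if "h \<in> \<H>" "norm (x - y) <= r" for h x y
 proof -
  have "dist x y < d" using that(2) d(1) by (simp add: r_def dist_norm)
  then have "\<bar>h x - h y\<bar> < dt" using d(2) that(1) by blast
  then show ?thesis by simp
 qed
 obtain rh :: "real ^ 'n => real" where b: "bump r C rh" using bump_exists[OF r] unfolding C_def by blast
 note mC1 = mollify_C1[OF b r] and mpd = mollify_pd[OF b r]
 have mc: "\<bar>mollify rh h x - h x\<bar> <= dt" if "h \<in> \<H>" for h x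
  by (rule mollify_close[OF b r]) (use H[OF that] cl[OF that] in auto)
 have phc: "continuous_on UNIV ph" and pc: "continuous_on UNIV (pd j ph)" for j using C1_cont[OF ph(1)] C1_pd_cont[OF ph(1)] by auto
 have inH: "ph \<in> \<H>" "G \<in> \<H>" "pd j ph \<in> \<H>" "pd i (%y. A y $ i $ j) \<in> \<H>" for i j
  by (auto simp: \<H>_def intro: image_eqI[where x="(i, j)"])
 define ps where "ps = mollify rh ph"
 have pps: "pd j ps = mollify rh (pd j ph)" for j unfolding ps_def using mpd[OF ph(1)] by auto
 have C2ps: "C2 ps" unfolding C2_def pps using mC1(1)[OF phc] mC1(1)[OF pc] by (simp add: ps_def)
 show ?thesis
 proof (rule that[OF C2ps])
  show "periodic L ps" unfolding ps_def by (rule mollify_periodic[OF b r ph(2)])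
  show "\<bar>ps x - ph x\<bar> <= ep" for x using mc[OF inH(1), of x] dt1 by (simp add: ps_def)
  show "norm (grad ps x - grad ph x) <= ep" for x
  proof -
   have "norm (grad ps x - grad ph x) <= (\<Sum>i\<in>UNIV. \<bar>(grad ps x - grad ph x) $ i\<bar>)" by (rule norm_le_l1_cart)
   also have "... <= (\<Sum>i\<in>(UNIV::'n set). dt)" using mc[OF inH(3)] by (intro sum_mono) (simp add: pps)
   also have "... = n * dt" by (simp add: n_def)
   finally show ?thesis using dt1 by linarith
  qed
  show "\<bar>D ps x - G x\<bar> <= ep" for x
  proof -
   let ?a = "%i j y. A y $ i $ j"
   let ?R = "%i y. pd i rh (x - y)"
   have ac: "continuous_on UNIV (?a i j)" for i j by (rule C1_cont[OF A_C1])
   have int: "integrable lborel (%y. h y * ?R i y)" if "continuous_on UNIV h" for h i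
   by (rule Cc_integrable[OF bump_Cc(2)[OF b r that]])
   have weak: "(\<Sum>i\<in>UNIV. \<Sum>j\<in>UNIV. LINT y|lborel. ?a i j y * pd j ph y * ?R i y) = mollify rh G x"
   proof -
   define \<eta> where "\<eta> y = rh (y + (- x))" for y
   have \<eta>1: "C1 \<eta>" unfolding \<eta>_def[abs_def] by (intro C1_translate bumpD(1)[OF b r])
   have \<eta>s: "EX R. ALL y. norm y > R --> \<eta> y = 0"
   proof (intro exI[of _ "norm x + r"] allI impI)
   fix y :: "real ^ 'n" assume "norm y > norm x + r"
   then have "norm (y + (- x)) > r" using norm_triangle_ineq2[of y x] by simp
   then show "\<eta> y = 0" unfolding \<eta>_def by (rule bumpD(3)[OF b r])
   qed
   have \<eta>p: "pd i \<eta> y = - ?R i y" for i y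
   unfolding \<eta>_def[abs_def] pd_translate using bump_flip(2)[OF b r, of i y x] by simp
   have "(LINT y|lborel. inner (A y *v grad ph y) (grad \<eta> y)) = - (LINT y|lborel. G y * \<eta> y)"
   using w \<eta>1 \<eta>s by (simp add: has_weak_divergence_def)
   moreover have "(LINT y|lborel. G y * \<eta> y) = mollify rh G x"
   unfolding mollify_shift[OF b r Gc] \<eta>_def using bump_flip(1)[OF b r] by simp
   moreover have "(LINT y|lborel. inner (A y *v grad ph y) (grad \<eta> y)) = - (\<Sum>i\<in>UNIV. \<Sum>j\<in>UNIV. LINT y|lborel. ?a i j y * pd j ph y * ?R i y)"
   proof -
   have "inner (A y *v grad ph y) (grad \<eta> y) = - (\<Sum>i\<in>UNIV. \<Sum>j\<in>UNIV. ?a i j y * pd j ph y * ?R i y)" for y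
   by (simp add: inner_vec_def matrix_vector_mult_def \<eta>p sum_distrib_right sum_negf)
   then have "(LINT y|lborel. inner (A y *v grad ph y) (grad \<eta> y)) = - (LINT y|lborel. (\<Sum>i\<in>UNIV. \<Sum>j\<in>UNIV. ?a i j y * pd j ph y * ?R i y))" by simp
   also have "(LINT y|lborel. (\<Sum>i\<in>UNIV. \<Sum>j\<in>UNIV. ?a i j y * pd j ph y * ?R i y)) = (\<Sum>i\<in>UNIV. \<Sum>j\<in>UNIV. LINT y|lborel. ?a i j y * pd j ph y * ?R i y)"
   proof -
   have i1: "integrable lborel (%y. ?a i j y * pd j ph y * ?R i y)" for i j by (intro int continuous_intros ac pc)
   show ?thesis by (simp add: Bochner_Integration.integral_sum Bochner_Integration.integrable_sum i1)
   qed
   finally show ?thesis .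
   qed
   ultimately show ?thesis by simp
   qed
   have tm: "\<bar>pd i (?a i j) x * pd j ps x + ?a i j x * pd i (pd j ps) x - (LINT y|lborel. ?a i j y * pd j ph y * ?R i y)\<bar> <= (K + M + K * C) * dt" for i j
   proof -
   \<comment> \<open>The oscillation of \<open>pd j ph\<close> makes this part small. The rest, with
     \<open>pd j ph x\<close> frozen, integrates to the mollified derivative of the coefficient and
     cancels, up to small errors, against the first-order term of \<open>D_explicit\<close>.\<close>
   define E where "E = (LINT y|lborel. (?a i j x - ?a i j y) * (pd j ph y - pd j ph x) * ?R i y)"
   have p2: "pd i (pd j ps) x = (LINT y|lborel. pd j ph y * ?R i y)" unfolding pps by (rule mC1(2)[OF pc])
   have "?a i j x * pd i (pd j ps) x - (LINT y|lborel. ?a i j y * pd j ph y * ?R i y)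
   = (LINT y|lborel. ?a i j x * (pd j ph y * ?R i y) - ?a i j y * pd j ph y * ?R i y)"
   unfolding p2 by (subst Bochner_Integration.integral_diff) (auto intro!: int continuous_intros ac pc)
   also have "... = (LINT y|lborel. (?a i j x - ?a i j y) * (pd j ph y - pd j ph x) * ?R i y + pd j ph x * ((?a i j x - ?a i j y) * ?R i y))"
   by (intro Bochner_Integration.integral_cong) (auto simp: algebra_simps)
   also have "... = E + pd j ph x * (LINT y|lborel. (?a i j x - ?a i j y) * ?R i y)"
   unfolding E_def by (subst Bochner_Integration.integral_add) (auto intro!: int continuous_intros ac pc)
   also have "(LINT y|lborel. (?a i j x - ?a i j y) * ?R i y) = - mollify rh (pd i (?a i j)) x"
   proof -
   have c1: "C1 (%y. ?a i j x - ?a i j y)" by (intro C1_diff C1_const A_C1)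
   have pd: "pd i (%y. ?a i j x - ?a i j y) y = - pd i (?a i j) y" for y
   using arg_cong[OF grad_diff[OF C1_const A_C1, of "?a i j x" i j y], of "%v. v $ i"] by simp
   have "(LINT y|lborel. (?a i j x - ?a i j y) * ?R i y) = pd i (mollify rh (%y. ?a i j x - ?a i j y)) x"
   by (rule mC1(2)[OF C1_cont[OF c1], symmetric])
   also have "... = mollify rh (pd i (%y. ?a i j x - ?a i j y)) x" by (rule mpd[OF c1])
   also have "... = - mollify rh (pd i (?a i j)) x" by (simp add: mollify_def pd)
   finally show ?thesis .
   qed
   finally have e: "pd i (?a i j) x * pd j ps x + ?a i j x * pd i (pd j ps) x - (LINT y|lborel. ?a i j y * pd j ph y * ?R i y)
   = pd i (?a i j) x * (pd j ps x - pd j ph x) - pd j ph x * (mollify rh (pd i (?a i j)) x - pd i (?a i j) x) + E"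
   by (simp add: algebra_simps)
   have "\<bar>pd i (?a i j) x * (pd j ps x - pd j ph x)\<bar> <= K * dt"
   unfolding abs_mult pps using K by (intro mult_mono mc inH) auto
   moreover have "\<bar>pd j ph x * (mollify rh (pd i (?a i j)) x - pd i (?a i j) x)\<bar> <= M * dt"
   unfolding abs_mult using M by (intro mult_mono mc inH Mp) auto
   moreover have "\<bar>E\<bar> <= K * C * dt"
   proof -
   have "\<bar>E\<bar> <= (LINT y|lborel. \<bar>(?a i j x - ?a i j y) * (pd j ph y - pd j ph x) * ?R i y\<bar>)"
   unfolding E_def by (rule integral_abs_bound)
   also have "... <= (LINT y|lborel. K * r * dt * \<bar>pd i rh (y + (- x))\<bar>)"
   proof (rule integral_mono)
   show "integrable lborel (%y. \<bar>(?a i j x - ?a i j y) * (pd j ph y - pd j ph x) * ?R i y\<bar>)"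
   by (intro integrable_abs int continuous_intros ac pc)
   show "integrable lborel (%y. K * r * dt * \<bar>pd i rh (y + - x)\<bar>)"
   using integrable_abs[OF int[OF continuous_on_const[of _ "1::real"], of i]] bump_flip(2)[OF b r, of i x] by simp
   show "\<bar>(?a i j x - ?a i j y) * (pd j ph y - pd j ph x) * ?R i y\<bar> <= K * r * dt * \<bar>pd i rh (y + - x)\<bar>" for y
   proof (cases "norm (x - y) <= r")
   case True
   have "\<bar>?a i j x - ?a i j y\<bar> <= K * r" using K(2)[of x i j y] mult_left_mono[OF True, of K] K(1) by linarith
   moreover have "\<bar>pd j ph y - pd j ph x\<bar> <= dt" using cl[OF inH(3)] True by (simp add: norm_minus_commute)
   moreover have "\<bar>?R i y\<bar> = \<bar>pd i rh (y + - x)\<bar>" using bump_flip(2)[OF b r, of i x y] by simp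
   ultimately show ?thesis unfolding abs_mult using K(1) r by (intro mult_mono) auto
   next
   case False
   then show ?thesis using bump_pd_zero[OF b r, of "x - y" i] K r dt by simp
   qed
   qed
   also have "... = K * r * dt * (LINT y|lborel. \<bar>pd i rh y\<bar>)"
   proof -
   have "(%y. \<bar>pd i rh y\<bar>) \<in> borel_measurable borel"
   by (intro borel_measurable_continuous_onI continuous_intros C1_pd_cont bumpD(1)[OF b r])
   from lborel_integral_shift[OF this, of "- x"] show ?thesis by simp
   qed
   also have "... = K * dt * (r * (LINT y|lborel. \<bar>pd i rh y\<bar>))" by simp
   also have "... <= K * dt * C" using bumpD(7)[OF b r] K dt by (intro mult_left_mono) auto
   finally show ?thesis by (simp add: mult_ac)
   qed
   ultimately show ?thesis unfolding e by (simp add: algebra_simps abs_le_iff)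
   qed
   have "\<bar>D ps x - mollify rh G x\<bar> = \<bar>\<Sum>i\<in>UNIV. \<Sum>j\<in>UNIV. pd i (?a i j) x * pd j ps x + ?a i j x * pd i (pd j ps) x - (LINT y|lborel. ?a i j y * pd j ph y * ?R i y)\<bar>"
   unfolding D_explicit[OF C2ps] weak[symmetric] by (simp add: sum_subtractf)
   also have "... <= (\<Sum>i\<in>(UNIV::'n set). \<Sum>j\<in>(UNIV::'n set). (K + M + K * C) * dt)"
   by (intro order_trans[OF sum_abs] sum_mono order_trans[OF sum_abs] tm)
   also have "... = n * n * (K + M + K * C) * dt" by (simp add: n_def)
   finally show ?thesis using mc[OF inH(2), of x] dt1(3) by linarith
  qed
 qed
qed

end

subsection \<open>Comparison principle and approximate eigenfunctions\<close>

lemma evolution_cmult: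
 assumes v: "evolution T0 v v'"
 shows "evolution T0 (%t x. c * v t x) (%t x. c * v' t x)"
 by (rule evolutionI) (intro C2_cmult DERIV_cmult continuous_on_mult continuous_on_const evolutionD[OF v]; assumption)+

lemma growth_bounded:
 assumes "B > 0" "!!t x. T0 < t ==> (t, x) \<in> Om ==> v t x <= M * exp (B * norm x)"
 shows "growth T0 Om v"
 unfolding growth_def using assms by blast

lemma dominatedI:
 assumes "AE x in lborel. EX V. ((%t. v t x) \<longlongrightarrow> V) (at_right T0) & ((\<exists>\<^sub>F t in at_right T0. (t, x) \<in> Om) --> V <= j x)"
 shows "dominated T0 Om v j"
 using assms unfolding dominated_def
proof (rule AE_mp, intro AE_I2 impI allI)
 fix x \<eta> assume "EX V. ((%t. v t x) \<longlongrightarrow> V) (at_right T0) & ((\<exists>\<^sub>F t in at_right T0. (t, x) \<in> Om) --> V <= j x)" and \<eta>: "(\<eta>::real) > 0"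
 then obtain V where V: "((%t. v t x) \<longlongrightarrow> V) (at_right T0)" "(\<exists>\<^sub>F t in at_right T0. (t, x) \<in> Om) --> V <= j x" by blast
 show "\<forall>\<^sub>F t in at_right T0. (t, x) \<in> Om --> v t x <= j x + \<eta>"
 proof (cases "\<exists>\<^sub>F t in at_right T0. (t, x) \<in> Om")
  case True
  then have "V < j x + \<eta>" using V(2) \<eta> by simp
  from order_tendstoD(2)[OF V(1) this] show ?thesis by (rule eventually_mono) simp
 next
  case False
  then have "\<forall>\<^sub>F t in at_right T0. (t, x) \<notin> Om" by (simp add: frequently_def)
  then show ?thesis by (rule eventually_mono) simp
 qed
qed

lemma evolution_right_limit:
 assumes v: "evolution T1 v v'" and "T1 < T0"
 shows "((%t. v t x) \<longlongrightarrow> v T0 x) (at_right T0)"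
proof -
 have "isCont (%t. v t x) T0" by (rule DERIV_isCont[OF evolutionD(2)[OF v assms(2)]])
 then show ?thesis by (simp add: isCont_def filterlim_at_split)
qed

context periodic_diffusion
begin

text \<open>The weighted estimate with constant weight and initial bound 0, whose right-hand side is
  0 at all later times; unbounded domains and discontinuous data come along.\<close>

lemma comparison:
 assumes v: "evolution T0 v v'" and Om: "open Om" and sep: "!!t x. T0 < t ==> 0 < v t x ==> (t, x) \<in> Om"
  and bd: "!!t x. T0 < t ==> v t x <= M"
  and init: "AE x in lborel. \<exists>V\<le>0. ((%t. v t x) \<longlongrightarrow> V) (at_right T0)"
  and sub: "!!t x. T0 < t ==> (t, x) \<in> Om ==> 0 < v t x ==> v' t x <= D (v t) x + K * v t x" and t: "T0 < t"
 shows "v t x <= 0"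
proof (rule weighted_bound[OF order_refl])
 fix Kw :: real
 assume E: "!!Ph si a v v' T0 Om Om' j t. C2 Ph ==> (ALL x. 0 < Ph x) ==> periodic L (%x. inverse (Ph x) *\<^sub>R grad Ph x) ==>
   (ALL x. norm (grad Ph x) <= 0 * Ph x) ==>
   evolution T0 v v' ==> open Om ==> open Om' ==> Om \<inter> Om' = {} ==>
   (ALL t x. T0 < t --> 0 < v t x --> (t, x) \<in> Om \<union> Om') ==> growth T0 Om (%t x. v t x / Ph x) ==> dominated T0 Om v (%x. Ph x * j x) ==>
   integrable lborel j ==> (ALL x. 0 <= j x) ==>
   (ALL t x. T0 < t --> (t, x) \<in> Om --> 0 < v t x -->
   v' t x <= D (v t) x + a t x * v t x & D Ph x + a t x * Ph x <= si * Ph x) ==> T0 < t ==>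
   (ALL x. (t, x) \<in> Om --> v t x <= Kw * (t - T0) powr (- real CARD('n) / 2) * exp (si * (t - T0)) * Ph x * (LINT x|lborel. j x)) \<and>
   (\<integral>\<^sup>+x. ennreal (indicator {x. (t, x) \<in> Om} x * max 0 (v t x / Ph x)) \<partial>lborel)
   <= ennreal (exp (si * (t - T0))) * ennreal (Kw * (LINT x|lborel. j x))"
 have gr: "growth T0 Om (%t x. v t x / 1)"
 proof (rule growth_bounded[of 1])
  fix t x assume "T0 < t"
  then have "v t x / 1 <= \<bar>M\<bar> * 1" using bd[of t x] by simp
  also have "... <= \<bar>M\<bar> * exp (1 * norm x)" by (intro mult_left_mono) auto
  finally show "v t x / 1 <= \<bar>M\<bar> * exp (1 * norm x)" .
 qed simp
 have dom: "dominated T0 Om v (%x. 1 * 0)"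
  by (rule dominatedI) (rule AE_mp[OF init], auto intro!: AE_I2)
 have "(ALL x. (t, x) \<in> Om --> v t x <= Kw * (t - T0) powr (- real CARD('n) / 2) * exp (K * (t - T0)) * 1 * (LINT x|(lborel :: (real ^ 'n) measure). 0))"
  by (rule conjunct1[OF E[of "%_. 1" T0 v v' Om "{}" "%_. 0" "%_ _. K" K t]])
   (use v Om sep sub t gr dom in "simp_all add: periodic_def")
 then have "(t, x) \<in> Om --> v t x <= 0" by simp
 then show ?thesis using sep[OF t, of x] by fastforce
qed

lemma coordinate_bounded: "periodic L (D (%y. y $ i))" "EX K. ALL x. \<bar>D (%y. y $ i) x\<bar> <= K"
proof -
 have "periodic L (%y. (A y *v axis i 1) $ j)" for j using A_per by (simp add: periodic_def)
 then have "periodic L (pd j (%y. (A y *v axis i 1) $ j))" for j by (rule periodic_pd)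
 then show p: "periodic L (D (%y. y $ i))"
  by (simp add: D_def[abs_def] grad_component div_field_def[abs_def] periodic_def)
 obtain K where "!!x. norm (D (%y. y $ i) x) <= K" using periodic_bounded[OF L_pos p D_continuous[OF C2_nth]] by metis
 then show "EX K. ALL x. \<bar>D (%y. y $ i) x\<bar> <= K" by auto
qed

text \<open>Mollification spoils the eigenvalue equation by an amount that, \<open>ps\<close> being
  bounded below, is a shift \<open>ep\<close> of the eigenvalue. The bounds \<open>l\<close> and
  \<open>B\<close> are fixed before \<open>ep\<close>, so \<open>ep\<close> can tend to 0 with
  uniform constants.\<close>

lemma approximate_eigenfunction:
 assumes ev: "principal_eigenvalue L A N m"
  and per: "!!ph. C1 ph ==> periodic L ph ==> periodic L (N ph)"
  and lip: "!!ph ps x. C1 ph ==> C1 ps ==> \<bar>N ps x - N ph x\<bar> <= C * (\<bar>ps x - ph x\<bar> + norm (grad ps x - grad ph x))"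
 shows "EX l B. l > 0 & B > 0 & (\<forall>ep>0. EX ps. C2 ps & periodic L ps & (ALL x. l <= ps x & ps x <= B & norm (grad ps x) <= B \<and>
  D ps x + N ps x <= (m + ep) * ps x))"
proof -
 obtain ph where ph: "C1 ph" "periodic L ph" "!!x. 0 < ph x" and w: "has_weak_divergence (%x. A x *v grad ph x) (%x. m * ph x - N ph x)"
  using ev unfolding principal_eigenvalue_def by blast
 obtain x0 where "!!x. ph x0 <= ph x" using periodic_attains_min[OF L_pos ph(2) C1_cont[OF ph(1)]] by blast
 then obtain l0 where l0: "l0 > 0" "!!x. l0 <= ph x" using ph(3) by metis
 obtain B1 where B1: "!!x. norm (ph x) <= B1" using periodic_bounded[OF L_pos ph(2) C1_cont[OF ph(1)]] by metis
 obtain B2 where B2: "!!x. norm (grad ph x) <= B2" using periodic_bounded[OF L_pos periodic_grad[OF ph(2)] C1_grad_cont[OF ph(1)]] by metis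
 define l where "l = l0 / 2"
 define B where "B = \<bar>B1\<bar> + \<bar>B2\<bar> + l0"
 have l: "l > 0" "B > 0" using l0 by (auto simp: l_def B_def add_nonneg_pos)
 have "EX ps. C2 ps & periodic L ps & (ALL x. l <= ps x & ps x <= B & norm (grad ps x) <= B & D ps x + N ps x <= (m + ep) * ps x)"
  if ep: "ep > 0" for ep
 proof -
  \<comment> \<open>The total weight of the mollification error: 1 for the equation,
    \<open>2 * \<bar>C\<bar>\<close> for value and gradient in \<open>N\<close>, and
    \<open>\<bar>m\<bar>\<close> for the eigenvalue term.\<close>
  define q where "q = 1 + 2 * \<bar>C\<bar> + \<bar>m\<bar>"
  have q: "q > 0" by (simp add: q_def)
  define dt where "dt = min l (ep * l / q)"
  have dt: "dt > 0" "dt <= l" "q * dt <= ep * l" using ep l q by (auto simp: dt_def min_def field_simps)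
  have Gp: "periodic L (%x. m * ph x - N ph x)" using ph(2) per[OF ph(1,2)] by (simp add: periodic_def)
  obtain ps where ps: "C2 ps" "periodic L ps" "!!x. \<bar>ps x - ph x\<bar> <= dt" "!!x. norm (grad ps x - grad ph x) <= dt"
   and Dps: "!!x. \<bar>D ps x - (m * ph x - N ph x)\<bar> <= dt"
   by (rule weak_approximation[OF ph(1,2) w Gp dt(1)]) blast
  have "l <= ps x & ps x <= B & norm (grad ps x) <= B & D ps x + N ps x <= (m + ep) * ps x" for x
  proof -
   have 1: "l <= ps x" using ps(3)[of x] l0(2)[of x] dt by (simp add: l_def abs_le_iff)
   have 2: "ps x <= B"
   proof -
   have "ph x <= \<bar>B1\<bar>" using B1[of x] abs_ge_self[of B1] abs_ge_self[of "ph x"] by simp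
   moreover have "ps x <= ph x + dt" using ps(3)[of x] by linarith
   ultimately show ?thesis using dt l0 abs_ge_zero[of B2] unfolding B_def l_def by linarith
   qed
   have 3: "norm (grad ps x) <= B" using ps(4)[of x] B2[of x] norm_triangle_ineq2[of "grad ps x" "grad ph x"] dt l0 by (simp add: l_def B_def)
   have "\<bar>N ps x - N ph x\<bar> <= C * (\<bar>ps x - ph x\<bar> + norm (grad ps x - grad ph x))" by (rule lip[OF ph(1) C2_C1[OF ps(1)]])
   also have "... <= \<bar>C\<bar> * (dt + dt)" using ps(3)[of x] ps(4)[of x] by (intro mult_mono add_mono) auto
   finally have "N ps x - N ph x <= 2 * \<bar>C\<bar> * dt" by simp
   moreover have "m * ph x - m * ps x <= \<bar>m\<bar> * dt"
   proof -
   have "m * (ph x - ps x) <= \<bar>m\<bar> * \<bar>ph x - ps x\<bar>" by (metis abs_ge_self abs_mult)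
   also have "... <= \<bar>m\<bar> * dt" using ps(3)[of x] by (intro mult_left_mono) auto
   finally show ?thesis by (simp add: algebra_simps)
   qed
   ultimately have "D ps x + N ps x <= m * ps x + q * dt" using Dps[of x] by (simp add: q_def algebra_simps abs_le_iff)
   also have "q * dt <= ep * ps x" using dt(3) mult_left_mono[OF 1, of ep] ep by linarith
   finally show ?thesis using 1 2 3 by (simp add: algebra_simps)
  qed
  then show ?thesis using ps(1,2) by blast
 qed
 then show ?thesis using l by blast
qed

end

subsection \<open>Reaction terms of KPP type\<close>

lemma reaction_derivative:
 assumes "admissible_reaction L \<alpha> f"
 shows "(f x has_real_derivative f_u f x s) (at s)"
 using assms unfolding admissible_reaction_def f_u_def by (simp add: field_differentiable_derivI)

lemma f_u_periodic:
 assumes "admissible_reaction L \<alpha> f"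
 shows "f (x + (L $ i) *\<^sub>R axis i 1) = f x" "f_u f (x + (L $ i) *\<^sub>R axis i 1) s = f_u f x s"
proof -
 show "f (x + (L $ i) *\<^sub>R axis i 1) = f x" using assms by (intro ext) (simp add: admissible_reaction_def periodic_def)
 then show "f_u f (x + (L $ i) *\<^sub>R axis i 1) s = f_u f x s" by (simp add: f_u_def)
qed

text \<open>Continuity at each \<open>s\<close>, uniform in \<open>x\<close>, becomes uniform over a
  bounded range of \<open>s\<close> by a Lebesgue number.\<close>

lemma f_u_uniform:
 assumes f: "admissible_reaction L \<alpha> f" and e: "e > 0"
 obtains d where "d > 0" "!!s r x. \<bar>s\<bar> <= B ==> \<bar>r - s\<bar> < d ==> \<bar>f_u f x r - f_u f x s\<bar> < e"
proof -
 have "ALL s. \<exists>d>0. ALL r. \<bar>r - s\<bar> < d --> (ALL x. \<bar>f_u f x r - f_u f x s\<bar> < e / 2)"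
  using f e unfolding admissible_reaction_def by (metis half_gt_zero)
 then obtain d where d: "!!s. d s > 0" "!!s r x. \<bar>r - s\<bar> < d s ==> \<bar>f_u f x r - f_u f x s\<bar> < e / 2" by metis
 have cov: "{- B..B} \<subseteq> \<Union> (range (%s. ball s (d s)))" using d(1) by (auto intro!: centre_in_ball[THEN iffD2])
 have "\<exists>dt>0. \<forall>s\<in>{- B..B}. \<exists>T\<in>range (%s. ball s (d s)). ball s dt \<subseteq> T"
 proof (rule Heine_Borel_lemma[OF compact_Icc cov])
  show "open G" if "G \<in> range (%s. ball s (d s))" for G using that by auto
 qed blast
 then obtain dt where dt: "dt > 0" "!!s. s \<in> {- B..B} ==> \<exists>T\<in>range (%s. ball s (d s)). ball s dt \<subseteq> T" by blast
 show ?thesis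
 proof (rule that[OF dt(1)])
  fix s r x assume s: "\<bar>s\<bar> <= B" "\<bar>r - s\<bar> < dt"
  then obtain z where z: "ball s dt \<subseteq> ball z (d z)" using dt(2)[of s] by (auto simp: abs_le_iff)
  have "s \<in> ball z (d z)" by (rule subsetD[OF z]) (use dt(1) in simp)
  moreover have "r \<in> ball z (d z)" by (rule subsetD[OF z]) (use s in "simp add: dist_real_def abs_minus_commute")
  ultimately have h: "\<bar>s - z\<bar> < d z" "\<bar>r - z\<bar> < d z" by (auto simp: dist_real_def abs_minus_commute)
  from d(2)[OF h(1), of x] d(2)[OF h(2), of x] show "\<bar>f_u f x r - f_u f x s\<bar> < e" by linarith
 qed
qed

lemma reaction_mvt:
 assumes "admissible_reaction L \<alpha> f"
 shows "EX z. min a b <= z & z <= max a b & f x b - f x a = (b - a) * f_u f x z"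
proof (cases a b rule: linorder_cases)
 case less
 from MVT2[OF this, of "f x" "f_u f x"] reaction_derivative[OF assms] obtain z where "a < z" "z < b" "f x b - f x a = (b - a) * f_u f x z" by blast
 then show ?thesis by (intro exI[of _ z]) auto
next
 case greater
 from MVT2[OF this, of "f x" "f_u f x"] reaction_derivative[OF assms] obtain z where "b < z" "z < a" "f x a - f x b = (a - b) * f_u f x z" by blast
 then show ?thesis by (intro exI[of _ z]) (auto simp: algebra_simps)
qed (auto intro!: exI[of _ a])

text \<open>Boundedness of \<open>f_u\<close> at one \<open>s\<close> is read off from a difference
  quotient of the bounded \<open>f\<close> over a step \<open>d / 2\<close>, on which
  \<open>f_u\<close> varies by less than 1; finitely many \<open>s\<close> then cover the
  range.\<close>

lemma reaction_lipschitz: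
 assumes f: "admissible_reaction L \<alpha> f" and L: "!!i. 0 < L $ i"
 obtains K where "K > 0" "!!x s. \<bar>s\<bar> <= B ==> \<bar>f_u f x s\<bar> <= K"
  "!!x s r. \<bar>s\<bar> <= B ==> \<bar>r\<bar> <= B ==> \<bar>f x s - f x r\<bar> <= K * \<bar>s - r\<bar>"
proof -
 obtain d where d: "d > 0" "!!s r x. \<bar>s\<bar> <= B ==> \<bar>r - s\<bar> < d ==> \<bar>f_u f x r - f_u f x s\<bar> < 1"
  using f_u_uniform[OF f zero_less_one] by metis
 note mvt = reaction_mvt[OF f]
 have fb: "EX M. ALL x. \<bar>f x s\<bar> <= M" for s
 proof -
  have "continuous_on UNIV (%(x, s). f x s)" using f by (simp add: admissible_reaction_def)
  then have "continuous_on UNIV (%x. (%(x, s). f x s) (x, s))" by (rule continuous_on_compose2) (auto intro!: continuous_intros)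
  then have "continuous_on UNIV (%x. f x s)" by simp
  moreover have "periodic L (%x. f x s)" using f by (simp add: admissible_reaction_def)
  ultimately obtain M where "!!x. norm (f x s) <= M" using periodic_bounded[OF L] by metis
  then show ?thesis by auto
 qed
 have "EX M. ALL x. \<bar>f_u f x s\<bar> <= M" if s: "\<bar>s\<bar> <= B" for s
 proof -
  obtain M1 M2 where M: "!!x. \<bar>f x s\<bar> <= M1" "!!x. \<bar>f x (s + d / 2)\<bar> <= M2" using fb by metis
  have "\<bar>f_u f x s\<bar> <= (M1 + M2) / (d / 2) + 1" for x
  proof -
   obtain z where z: "s <= z" "z <= s + d / 2" "f x (s + d / 2) - f x s = (s + d / 2 - s) * f_u f x z"
   using mvt[of s "s + d / 2" x] d(1) by auto
   have "\<bar>f_u f x z\<bar> * (d / 2) = \<bar>f x (s + d / 2) - f x s\<bar>"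
   unfolding z(3) add_diff_cancel_left' abs_mult using d(1) by simp
   also have "... <= M1 + M2" using M[of x] by linarith
   finally have "\<bar>f_u f x z\<bar> <= (M1 + M2) / (d / 2)" using d(1) by (simp add: field_simps)
   moreover have "\<bar>f_u f x z - f_u f x s\<bar> < 1" by (rule d(2)[OF s]) (use z d(1) in auto)
   ultimately show ?thesis by linarith
  qed
  then show ?thesis by blast
 qed
 then obtain m where m: "!!s x. \<bar>s\<bar> <= B ==> \<bar>f_u f x s\<bar> <= m s" by metis
 have cov: "{- B..B} \<subseteq> (\<Union>s\<in>{- B..B}. ball s d)" using d(1) by force
 obtain T where T: "T \<subseteq> {- B..B}" "finite T" "{- B..B} \<subseteq> (\<Union>s\<in>T. ball s d)"
  by (rule compactE_image[OF compact_Icc _ cov]) auto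
 define K where "K = (\<Sum>s\<in>T. \<bar>m s\<bar>) + 1"
 have Kb: "\<bar>f_u f x s\<bar> <= K" if s: "\<bar>s\<bar> <= B" for x s
 proof -
  have "s \<in> {- B..B}" using s by auto
  then obtain z where z: "z \<in> T" "s \<in> ball z d" using T(3) by blast
  have "- B <= z" "z <= B" using subsetD[OF T(1) z(1)] by auto
  then have zB: "\<bar>z\<bar> <= B" by linarith
  have "\<bar>f_u f x s - f_u f x z\<bar> < 1" by (rule d(2)[OF zB]) (use z in "auto simp: dist_real_def abs_minus_commute")
  moreover have "\<bar>f_u f x z\<bar> <= \<bar>m z\<bar>" using m[OF zB, of x] by linarith
  moreover have "\<bar>m z\<bar> <= (\<Sum>s\<in>T. \<bar>m s\<bar>)" by (rule member_le_sum) (use z T in auto)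
  ultimately show ?thesis unfolding K_def by linarith
 qed
 show ?thesis
 proof (rule that[of K])
  show "K > 0" unfolding K_def by (intro add_nonneg_pos sum_nonneg) auto
  show "\<bar>f_u f x s\<bar> <= K" if "\<bar>s\<bar> <= B" for x s by (rule Kb[OF that])
  show "\<bar>f x s - f x r\<bar> <= K * \<bar>s - r\<bar>" if "\<bar>s\<bar> <= B" "\<bar>r\<bar> <= B" for x s r
  proof -
   obtain z where z: "min r s <= z" "z <= max r s" "f x s - f x r = (s - r) * f_u f x z" using mvt[of r s x] by blast
   have "\<bar>z\<bar> <= B" using z that by (auto simp: abs_le_iff min_def max_def split: if_splits)
   then have "\<bar>s - r\<bar> * \<bar>f_u f x z\<bar> <= \<bar>s - r\<bar> * K" by (intro mult_left_mono Kb) auto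
   then show ?thesis unfolding z(3) by (simp add: abs_mult mult.commute)
  qed
 qed
qed

section \<open>Inequalities for the reaction term and bounds for the wavefront\<close>

locale kpp_front = periodic_diffusion A L \<alpha>0
 for A :: "real ^ 'n::finite => real ^ 'n ^ 'n" and L :: "real ^ 'n" and \<alpha>0 :: real +
 fixes f :: "real ^ 'n => real => real" and p :: "real ^ 'n => real" and w :: "real ^ 'n => real => real"
  and k :: 'n and \<alpha> c :: real
 assumes reaction: "admissible_reaction L \<alpha> f"
  and decreasing: "!!x s r. 0 < s ==> s < r ==> f x r / r < f x s / s"
  and p_C2: "C2 p" and p_per: "periodic L p" and p_pos: "!!x. 0 < p x" and p_steady: "!!x. D p x + f x (p x) = 0"
  and front: "wavefront L k A f p c w"
begin

lemma f_zero: "f x 0 = 0" using reaction by (simp add: admissible_reaction_def)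

lemma f_quotient_le:
 assumes "0 < a" shows "f x a / a <= f_u f x 0"
proof -
 have "((%s. f x s / s) \<longlongrightarrow> f_u f x 0) (at 0)"
  using reaction_derivative[OF reaction, of x 0] by (simp add: DERIV_def f_zero)
 then have "((%s. f x s / s) \<longlongrightarrow> f_u f x 0) (at_right 0)" by (simp add: filterlim_at_split)
 moreover have "\<forall>\<^sub>F s in at_right 0. f x a / a <= f x s / s"
  unfolding eventually_at_right_field using assms decreasing by (intro exI[of _ a]) (auto intro: less_imp_le)
 ultimately show ?thesis by (rule tendsto_lowerbound) simp
qed

text \<open>Because \<open>f x s / s\<close> decreases, \<open>f x b <= b * (f x a / a)\<close>, and
  the quotient is at most its limit at 0. So the linearization at 0 dominates every difference of
  ordered nonnegative states, not only small ones.\<close>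

lemma f_diff_le:
 assumes "0 <= a" "a <= b" shows "f x b - f x a <= f_u f x 0 * (b - a)"
proof (cases "a = 0")
 case True
 show ?thesis
 proof (cases "b = 0")
  case False
  then have b: "b > 0" using assms by simp
  from f_quotient_le[OF this, of x] show ?thesis using True b by (simp add: f_zero field_simps)
 qed (use True in simp)
next
 case False
 then have a: "a > 0" using assms by simp
 have "f x b / b <= f x a / a" using decreasing[OF a, of b x] assms by (cases "a = b") auto
 then have "f x b <= b * (f x a / a)" using a assms by (simp add: field_simps)
 then have "f x b - f x a <= (f x a / a) * (b - a)" using a by (simp add: field_simps)
 also have "... <= f_u f x 0 * (b - a)" using f_quotient_le[OF a] assms by (intro mult_right_mono) auto
 finally show ?thesis .
qed

text \<open>With the potential \<open>f x (p x) / p x\<close> the steady state solves a linear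
  equation exactly, and every solution between 0 and \<open>p\<close> is a supersolution of that
  equation.\<close>

lemma f_below_p:
 assumes "0 <= s" "s <= p x" shows "f x (p x) / p x * s <= f x s"
proof (cases "s = 0 | s = p x")
 case True
 then show ?thesis using p_pos[of x] by (auto simp: f_zero)
next
 case False
 then have "f x (p x) / p x < f x s / s" using assms by (intro decreasing) auto
 then show ?thesis using False assms by (simp add: field_simps)
qed

definition W :: "real => real ^ 'n => real" where "W t x = w x (x $ k + c * t)"

lemma classical_evolution:
 assumes "classical_solution A f T u" "{T0<..} \<subseteq> T"
 shows "evolution T0 u (%t x. deriv (%s. u s x) t)" "!!t x. T0 < t ==> deriv (%s. u s x) t = D (u t) x + f x (u t x)"
proof -
 have sub: "{T0<..} \<times> UNIV \<subseteq> T \<times> (UNIV :: (real ^ 'n) set)" using assms(2) by auto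
 show "evolution T0 u (%t x. deriv (%s. u s x) t)"
  unfolding evolution_def
 proof (intro conjI allI impI)
  fix t x assume "T0 < t"
  then have "t \<in> T" using assms(2) by auto
  then show "C2 (u t)" "((%t. u t x) has_real_derivative deriv (%s. u s x) t) (at t)"
   using assms(1) by (auto simp: classical_solution_def field_differentiable_derivI)
 next
  show "continuous_on ({T0<..} \<times> UNIV) (%(t, x). u t x)" "continuous_on ({T0<..} \<times> UNIV) (%(t, x). deriv (%s. u s x) t)"
   using assms(1) by (auto simp: classical_solution_def intro: continuous_on_subset[OF _ sub])
 qed
 fix t x assume "T0 < t"
 then have "t \<in> T" using assms(2) by auto
 then have "deriv (%s. u s x) t - div_field (%y. A y *v grad (u t) y) x = f x (u t x)"
  using assms(1) by (simp add: classical_solution_def)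
 then show "deriv (%s. u s x) t = D (u t) x + f x (u t x)" by (simp add: D_def)
qed

abbreviation "W' \<equiv> %t x. deriv (%s. W s x) t"

lemma W_evolution: "evolution T0 W W'" "deriv (%s. W s x) t = D (W t) x + f x (W t x)"
proof -
 have c: "classical_solution A f UNIV W" using front by (simp add: wavefront_def W_def[abs_def])
 show "evolution T0 W W'" by (rule classical_evolution(1)[OF c]) simp
 show "deriv (%s. W s x) t = D (W t) x + f x (W t x)" by (rule classical_evolution(2)[OF c, of "t - 1"]) auto
qed

lemma W_nonneg: "0 <= W t x" using front by (simp add: wavefront_def W_def)

lemma w_right: "e > 0 ==> EX \<xi>1. \<forall>\<xi>\<ge>\<xi>1. ALL x. \<bar>w x \<xi> - p x\<bar> < e"
 using front unfolding wavefront_def uniform_limit_iff eventually_at_top_linorder by (auto simp: dist_real_def)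

lemma w_left: "e > 0 ==> EX \<xi>1. \<forall>\<xi>\<le>\<xi>1. ALL x. \<bar>w x \<xi>\<bar> < e"
 using front unfolding wavefront_def uniform_limit_iff eventually_at_bot_linorder by (auto simp: dist_real_def)

lemma p_bounds: "EX l B. l > 0 & (ALL x. l <= p x & p x <= B)"
proof -
 obtain x0 where "!!x. p x0 <= p x" using periodic_attains_min[OF L_pos p_per C2_cont[OF p_C2]] by blast
 moreover obtain B where "!!x. norm (p x) <= B" using periodic_bounded[OF L_pos p_per C2_cont[OF p_C2]] by metis
 ultimately show ?thesis using p_pos by (intro exI[of _ "p x0"] exI[of _ B]) (auto simp: abs_le_iff)
qed

text \<open>The limits control \<open>\<xi>\<close> of large modulus. In the strip between,
  \<open>W\<close> depends on \<open>x\<close> modulo the periods and on \<open>\<xi>\<close> alone,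
  so every point can be moved to a compact set of times and places without changing the
  value.\<close>

lemma W_bounded: "EX M. ALL t x. \<bar>W t x\<bar> <= M"
proof -
 obtain \<xi>1 where x1: "!!\<xi> x. \<xi> >= \<xi>1 ==> \<bar>w x \<xi> - p x\<bar> < 1" using w_right[of 1] by auto
 obtain \<xi>2 where x2: "!!\<xi> x. \<xi> <= \<xi>2 ==> \<bar>w x \<xi>\<bar> < 1" using w_left[of 1] by auto
 obtain B where B: "!!x. p x <= B" using p_bounds by blast
 define X where "X = \<bar>\<xi>1\<bar> + \<bar>\<xi>2\<bar>"
 define R where "R = X + norm L"
 define T where "T = (if c = 0 then 0 else R / \<bar>c\<bar>)"
 have R0: "0 <= X" "0 <= R" by (auto simp: X_def R_def)
 let ?K = "{- T..T} \<times> cbox (- (\<chi> i. R)) (\<chi> i. R) :: (real \<times> (real ^ 'n)) set"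
 have wper: "w (x + lat L z) \<xi> = w x \<xi>" for x z \<xi>
  by (rule periodic_lat[where h="%x. w x \<xi>"]) (use front in "simp add: wavefront_def")
 have "compact ?K" by (intro compact_Times) auto
 moreover have "continuous_on ?K (%q. W (fst q) (snd q))"
  by (rule continuous_on_subset[OF evolutionD(3)[OF W_evolution(1)[of "- T - 1"]]]) auto
 ultimately have "bounded ((%q. W (fst q) (snd q)) ` ?K)" by (intro compact_imp_bounded compact_continuous_image)
 then obtain M where M: "!!t x. (t, x) \<in> ?K ==> \<bar>W t x\<bar> <= M" unfolding bounded_iff by force
 have "\<bar>W t x\<bar> <= \<bar>M\<bar> + \<bar>B\<bar> + 1" for t x
 proof -
  define \<xi> where "\<xi> = x $ k + c * t"
  consider "\<xi> >= \<xi>1" | "\<xi> <= \<xi>2" | "\<bar>\<xi>\<bar> <= X" unfolding X_def by arith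
  then show ?thesis
  proof cases
   case 1
   then show ?thesis using x1[OF 1, of x] B[of x] p_pos[of x] by (simp add: W_def \<xi>_def)
  next
   case 2
   then show ?thesis using x2[OF 2, of x] by (simp add: W_def \<xi>_def)
  next
   case 3
   \<comment> \<open>For \<open>c = 0\<close> time cannot compensate a shift of the coordinate
     \<open>k\<close>, which is then left alone; it equals \<open>\<xi>\<close> and is bounded in
     the strip.\<close>
   define z where "z i = (if c = 0 & i = k then 0 else - \<lfloor>x $ i / L $ i\<rfloor>)" for i
   define y where "y = x + lat L z"
   have cell: "0 <= y $ i & y $ i <= L $ i" if "\<not> (c = 0 & i = k)" for i
   proof -
   have "of_int \<lfloor>x $ i / L $ i\<rfloor> * L $ i <= x $ i / L $ i * L $ i"
   by (rule mult_right_mono[OF of_int_floor_le less_imp_le[OF L_pos]])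
   moreover have "x $ i / L $ i * L $ i <= (of_int \<lfloor>x $ i / L $ i\<rfloor> + 1) * L $ i"
   by (rule mult_right_mono[OF real_of_int_floor_add_one_ge less_imp_le[OF L_pos]])
   moreover have "x $ i / L $ i * L $ i = x $ i" using L_pos[of i] by simp
   ultimately have "of_int \<lfloor>x $ i / L $ i\<rfloor> * L $ i <= x $ i" "x $ i <= (of_int \<lfloor>x $ i / L $ i\<rfloor> + 1) * L $ i" by (simp_all only:)
   then show ?thesis using that by (auto simp: y_def z_def algebra_simps)
   qed
   have yR: "\<bar>y $ i\<bar> <= R" for i
   proof (cases "c = 0 & i = k")
   case True
   then have "y $ i = \<xi>" by (simp add: y_def z_def \<xi>_def)
   then show ?thesis using 3 norm_ge_zero[of L] unfolding R_def by linarith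
   next
   case False
   then show ?thesis using cell[OF False] component_le_norm_cart[of L i] R0 by (simp add: R_def)
   qed
   \<comment> \<open>The time at which the shifted point has the same \<open>\<xi>\<close> as
     before.\<close>
   define s where "s = (if c = 0 then 0 else (\<xi> - y $ k) / c)"
   have sT: "\<bar>s\<bar> <= T"
   proof (cases "c = 0")
   case False
   have "\<bar>\<xi> - y $ k\<bar> <= R" using 3 cell[of k] False component_le_norm_cart[of L k] by (simp add: R_def abs_le_iff)
   then show ?thesis using False by (simp add: s_def T_def divide_right_mono)
   qed (simp add: s_def T_def)
   have e: "y $ k + c * s = \<xi>" by (auto simp: s_def y_def z_def \<xi>_def)
   have "W t x = w y \<xi>" unfolding y_def wper W_def \<xi>_def ..
   also have "... = W s y" by (simp add: W_def e)
   finally have "W t x = W s y" .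
   moreover have "(s, y) \<in> ?K" using sT yR by (auto simp: mem_box_cart abs_le_iff minus_le_iff)
   ultimately show ?thesis using M[of s y] by simp
  qed
 qed
 then show ?thesis by blast
qed

end

subsection \<open>Convergence to the wavefront\<close>

lemma evolution_static:
 assumes "C2 ph" shows "evolution T0 (%t x. ph x) (%t x. 0)"
 by (rule evolutionI) (auto intro!: assms continuous_on_compose2[OF C2_cont[OF assms, of UNIV]] continuous_intros)

lemma powr_decay:
 fixes n a :: real assumes "n > 0" "e > 0"
 shows "\<exists>T>a. \<forall>t\<ge>T. K * (t - a) powr (- n / 2) <= e"
proof -
 have "filterlim (%t. t - a) at_top at_top"
  using filterlim_tendsto_add_at_top[OF tendsto_const[of "- a"] filterlim_ident] by (simp add: add.commute)
 then have "((%t. (t - a) powr (- n / 2)) \<longlongrightarrow> 0) at_top"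
  by (rule tendsto_neg_powr[rotated]) (use assms in simp)
 then have "((%t. K * (t - a) powr (- n / 2)) \<longlongrightarrow> K * 0) at_top" by (intro tendsto_intros)
 then have "\<forall>\<^sub>F t in at_top. K * (t - a) powr (- n / 2) < e"
  by (rule order_tendstoD(2)) (use assms in simp)
 then obtain T where "\<forall>t\<ge>T. K * (t - a) powr (- n / 2) < e" unfolding eventually_at_top_linorder by blast
 then show ?thesis by (intro exI[of _ "max T (a + 1)"]) (auto intro: less_imp_le)
qed

text \<open>The lower-order part is linear in the function and its gradient with bounded periodic
  coefficients, as the approximation of eigenfunctions requires; the sign of \<open>\<mu>\<close>
  flips because \<open>mu_speed\<close> is an eigenvalue of the negative operator.\<close>

lemma (in kpp_front) left_supersolution:
 assumes mu: "mu_speed L k A f c lam \<mu>"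
 shows "EX l B. l > 0 & B > 0 & (\<forall>ep>0. EX ps. C2 ps & periodic L ps & (ALL x. l <= ps x & ps x <= B & norm (grad ps x) <= B \<and>
  D ps x + speed_lower_order k A f c lam ps x <= (- \<mu> + ep) * ps x))"
proof -
 define e :: "real ^ 'n" where "e = axis k 1"
 have e1: "norm e = 1" by (simp add: e_def)
 have Dk: "div_field (%y. A y *v axis k 1) x = D (%y. y $ k) x" for x by (simp add: D_def grad_component)
 obtain Kd where Kd: "!!x. \<bar>D (%y. y $ k) x\<bar> <= Kd" using coordinate_bounded(2) by blast
 obtain Kl where Kl: "Kl > 0" "!!i j x. \<bar>A x $ i $ j\<bar> <= Kl" using entry_lipschitz by metis
 define Ka where "Ka = (real CARD('n))\<^sup>2 * Kl"
 have Ka: "norm (A x *v v) <= Ka * norm v" for x v unfolding Ka_def by (rule matrix_bound) (rule Kl)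
 have eA: "\<bar>inner e (A x *v v)\<bar> <= Ka * norm v" for x v
  using Cauchy_Schwarz_ineq2[of e "A x *v v"] Ka[of x v] e1 by simp
 obtain Kq where Kq: "!!x. \<bar>f_u f x 0\<bar> <= Kq" using reaction_lipschitz[OF reaction L_pos, of 0] by (metis abs_zero order_refl)
 define co where "co x = lam * D (%y. y $ k) x + lam\<^sup>2 * inner e (A x *v e) - lam * c + f_u f x 0" for x
 define Kc where "Kc = \<bar>lam\<bar> * Kd + lam\<^sup>2 * Ka + \<bar>lam * c\<bar> + Kq"
 have Kc: "\<bar>co x\<bar> <= Kc" for x
 proof -
  have "\<bar>lam * D (%y. y $ k) x\<bar> <= \<bar>lam\<bar> * Kd" unfolding abs_mult by (intro mult_left_mono Kd) simp
  moreover have "\<bar>lam\<^sup>2 * inner e (A x *v e)\<bar> <= lam\<^sup>2 * Ka" unfolding abs_mult using eA[of x e] e1 by (simp add: mult_left_mono)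
  ultimately show ?thesis unfolding co_def Kc_def using Kq[of x] by linarith
 qed
 have N: "speed_lower_order k A f c lam ps x = 2 * lam * inner e (A x *v grad ps x) + co x * ps x" for ps x
  unfolding speed_lower_order_def co_def Dk e_def ..
 have Kc0: "Kc >= 0" "Ka >= 0" using Kc[of 0] Kl(1) by (auto simp: Ka_def)
 show ?thesis
 proof (rule approximate_eigenfunction[OF mu[unfolded mu_speed_def]])
  fix ph :: "real ^ 'n => real" assume ph: "C1 ph" "periodic L ph"
  have "D (%y. y $ k) (x + (L $ i) *\<^sub>R axis i 1) = D (%y. y $ k) x" for x i
   using coordinate_bounded(1) by (simp add: periodic_def)
  moreover have "A (x + (L $ i) *\<^sub>R axis i 1) = A x" for x i using A_per by (simp add: periodic_def)
  moreover have "grad ph (x + (L $ i) *\<^sub>R axis i 1) = grad ph x" for x i using periodic_grad[OF ph(2)] by (simp add: periodic_def)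
  ultimately show "periodic L (speed_lower_order k A f c lam ph)"
   unfolding periodic_def N co_def using ph(2) f_u_periodic(2)[OF reaction] by (simp add: periodic_def)
 next
  fix ph ps :: "real ^ 'n => real" and x
  define g where "g = grad ps x - grad ph x"
  have "speed_lower_order k A f c lam ps x - speed_lower_order k A f c lam ph x = 2 * lam * inner e (A x *v g) + co x * (ps x - ph x)"
   unfolding N g_def by (simp add: algebra_simps matrix_vector_mult_diff_distrib inner_diff_right)
  also have "\<bar>...\<bar> <= \<bar>2 * lam * inner e (A x *v g)\<bar> + \<bar>co x * (ps x - ph x)\<bar>" by (rule abs_triangle_ineq)
  also have "... <= (2 * \<bar>lam\<bar>) * (Ka * norm g) + Kc * \<bar>ps x - ph x\<bar>"
   unfolding abs_mult using eA[of x g] Kc[of x] by (intro add_mono mult_mono) auto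
  also have "... <= (2 * \<bar>lam\<bar> * Ka + Kc) * (\<bar>ps x - ph x\<bar> + norm g)"
  proof -
   have "0 <= 2 * \<bar>lam\<bar> * Ka * \<bar>ps x - ph x\<bar>" "0 <= Kc * norm g" using Kc0 by auto
   then show ?thesis by (simp add: algebra_simps)
  qed
  finally show "\<bar>speed_lower_order k A f c lam ps x - speed_lower_order k A f c lam ph x\<bar>
   <= (2 * \<bar>lam\<bar> * Ka + Kc) * (\<bar>ps x - ph x\<bar> + norm (grad ps x - grad ph x))" unfolding g_def .
 qed
qed

section \<open>The solution of the initial value problem compared with the wavefront\<close>

locale kpp_solution = kpp_front A L \<alpha>0 f p w k \<alpha> c
 for A :: "real ^ 'n::finite => real ^ 'n ^ 'n" and L \<alpha>0 f p w k \<alpha> c +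
 fixes u0 :: "real ^ 'n => real" and u :: "real => real ^ 'n => real"
 assumes u0_disc: "finite {x. \<not> isCont u0 x}" and u0_bounds: "0 <= u0 x" "u0 x <= p x"
  and sol: "solves_ivp A f u0 u"
begin

abbreviation "u' \<equiv> %t x. deriv (%s. u s x) t"

lemma u_evolution: "evolution 0 u u'" "0 < t ==> deriv (%s. u s x) t = D (u t) x + f x (u t x)"
proof -
 have c: "classical_solution A f {0<..} u" using sol by (simp add: solves_ivp_def)
 show "evolution 0 u u'" by (rule classical_evolution(1)[OF c order_refl])
 show "0 < t ==> deriv (%s. u s x) t = D (u t) x + f x (u t x)" by (rule classical_evolution(2)[OF c order_refl])
qed

lemma u_zero: "u 0 x = u0 x" using sol by (simp add: solves_ivp_def)

text \<open>Finitely many discontinuities form a null set; at all other points the initial value is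
  attained continuously.\<close>

lemma u_limit: "AE x in lborel. ((%t. u t x) \<longlongrightarrow> u0 x) (at_right 0)"
proof -
 have "AE x in lborel. x \<notin> {x. \<not> isCont u0 x}" by (rule AE_not_in[OF finite_imp_null_set_lborel[OF u0_disc]])
 then show ?thesis
 proof (rule AE_mp, intro AE_I2 impI)
  fix x assume "x \<notin> {x. \<not> isCont u0 x}"
  then have "continuous (at (0, x) within {0..} \<times> UNIV) (%(t, y). u t y)" using sol by (simp add: solves_ivp_def)
  then have "((%(t, y). u t y) \<longlongrightarrow> u 0 x) (at (0, x) within {0..} \<times> UNIV)" by (simp add: continuous_within)
  moreover have "filterlim (%t. (t, x)) (at (0, x) within {0..} \<times> UNIV) (at_right (0::real))"
   unfolding filterlim_at
  proof
   show "\<forall>\<^sub>F t in at_right (0::real). (t, x) \<in> {0..} \<times> UNIV & (t, x) \<noteq> (0, x)"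
   by (auto simp: eventually_at_right_field intro!: exI[of _ 1])
   show "((%t. (t, x)) \<longlongrightarrow> (0, x)) (at_right 0)" by (intro tendsto_Pair tendsto_const tendsto_ident_at)
  qed
  ultimately have "((%t. (%(t, y). u t y) (t, x)) \<longlongrightarrow> u 0 x) (at_right 0)" by (rule filterlim_compose)
  then show "((%t. u t x) \<longlongrightarrow> u0 x) (at_right 0)" by (simp add: u_zero)
 qed
qed

lemma u_bounded: "EX B. \<forall>t\<ge>0. ALL x. \<bar>u t x\<bar> <= B"
 using sol by (simp add: solves_ivp_def)

lemma u_lower: assumes t: "0 < t" shows "0 <= u t x"
proof -
 obtain B where B: "!!t x. 0 <= t ==> \<bar>u t x\<bar> <= B" using u_bounded by blast
 have B0: "0 <= B" using B[of 0 0] by simp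
 obtain K where K: "K > 0" "!!x s r. \<bar>s\<bar> <= B ==> \<bar>r\<bar> <= B ==> \<bar>f x s - f x r\<bar> <= K * \<bar>s - r\<bar>"
  using reaction_lipschitz[OF reaction L_pos, of B] by metis
 have "(- 1) * u t x <= 0"
 proof (rule comparison[OF evolution_cmult[OF u_evolution(1), of "- 1"] open_UNIV _ _ _ _ t, where M=B and K=K])
  show "(t, x) \<in> UNIV" for t :: real and x :: "real ^ 'n" by simp
  show "(- 1) * u t x <= B" if "0 < t" for t x using B[of t x] that by (simp add: abs_le_iff)
  show "AE x in lborel. \<exists>V\<le>0. ((%t. (- 1) * u t x) \<longlongrightarrow> V) (at_right 0)"
   using u_limit
  proof (rule AE_mp, intro AE_I2 impI)
   fix x assume "((%t. u t x) \<longlongrightarrow> u0 x) (at_right 0)"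
   then have "((%t. (- 1) * u t x) \<longlongrightarrow> (- 1) * u0 x) (at_right 0)" by (rule tendsto_mult[OF tendsto_const])
   then show "\<exists>V\<le>0. ((%t. (- 1) * u t x) \<longlongrightarrow> V) (at_right 0)" using u0_bounds(1)[of x] by (intro exI[of _ "(- 1) * u0 x"]) simp
  qed
  fix t x assume t: "0 < t" and pos: "0 < (- 1) * u t x"
  have "\<bar>f x (u t x) - f x 0\<bar> <= K * \<bar>u t x - 0\<bar>" by (rule K(2)) (use B[of t x] t B0 in auto)
  then have "- f x (u t x) <= K * ((- 1) * u t x)" using pos by (simp add: f_zero abs_le_iff)
  then show "(- 1) * deriv (%s. u s x) t <= D (%x. (- 1) * u t x) x + K * ((- 1) * u t x)"
   unfolding D_cmult[OF evolutionD(1)[OF u_evolution(1) t]] u_evolution(2)[OF t] by simp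
 qed
 then show ?thesis by simp
qed

lemma u_upper: assumes t: "0 < t" shows "u t x <= p x"
proof -
 obtain B where B: "!!t x. 0 <= t ==> \<bar>u t x\<bar> <= B" using u_bounded by blast
 obtain Bp where Bp: "!!x. p x <= Bp" using p_bounds by blast
 obtain K where K: "K > 0" "!!x s r. \<bar>s\<bar> <= max B Bp ==> \<bar>r\<bar> <= max B Bp ==> \<bar>f x s - f x r\<bar> <= K * \<bar>s - r\<bar>"
  using reaction_lipschitz[OF reaction L_pos, of "max B Bp"] by metis
 have "u t x - p x <= 0"
 proof (rule comparison[OF evolution_diff[OF u_evolution(1) evolution_static[OF p_C2]] open_UNIV _ _ _ _ t, where M=B and K=K])
  show "(t, x) \<in> UNIV" for t :: real and x :: "real ^ 'n" by simp
  show "u t x - p x <= B" if "0 < t" for t x using B[of t x] p_pos[of x] that by (simp add: abs_le_iff)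
  show "AE x in lborel. \<exists>V\<le>0. ((%t. u t x - p x) \<longlongrightarrow> V) (at_right 0)"
   using u_limit
  proof (rule AE_mp, intro AE_I2 impI)
   fix x assume "((%t. u t x) \<longlongrightarrow> u0 x) (at_right 0)"
   then have "((%t. u t x - p x) \<longlongrightarrow> u0 x - p x) (at_right 0)" by (rule tendsto_diff[OF _ tendsto_const])
   then show "\<exists>V\<le>0. ((%t. u t x - p x) \<longlongrightarrow> V) (at_right 0)" using u0_bounds(2)[of x] by (intro exI[of _ "u0 x - p x"]) simp
  qed
  fix t x assume t: "0 < t" and pos: "0 < u t x - p x"
  have "\<bar>f x (u t x) - f x (p x)\<bar> <= K * \<bar>u t x - p x\<bar>"
   by (rule K(2)) (use B[of t x] t Bp[of x] p_pos[of x] in auto)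
  then have "f x (u t x) - f x (p x) <= K * (u t x - p x)" using pos by (simp add: abs_le_iff)
  then show "deriv (%s. u s x) t - 0 <= D (%x. u t x - p x) x + K * (u t x - p x)"
   unfolding D_diff[OF evolutionD(1)[OF u_evolution(1) t] p_C2] u_evolution(2)[OF t] using p_steady[of x] by linarith
 qed
 then show ?thesis by simp
qed

lemma diff_evolution: "evolution 0 (%t x. sg * (u t x - W t x)) (%t x. sg * (u' t x - W' t x))"
 by (rule evolution_cmult[OF evolution_diff[OF u_evolution(1) W_evolution(1)]])

lemma diff_D:
 assumes "0 < t"
 shows "D (%x. sg * (u t x - W t x)) x = sg * (D (u t) x - D (W t) x)"
 using assms evolutionD(1)[OF u_evolution(1)] evolutionD(1)[OF W_evolution(1), of "t - 1" t]
 by (simp add: D_cmult D_diff C2_diff)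

text \<open>The factor \<open>sg\<close>, equal to 1 or -1, treats \<open>u - W\<close> and
  \<open>W - u\<close> together; where the signed difference is positive, \<open>f_diff_le\<close>
  applies with the smaller function in the role of \<open>a\<close>.\<close>

lemma diff_sub:
 assumes sg: "\<bar>sg\<bar> = 1" and t: "0 < t" and pos: "0 < sg * (u t x - W t x)"
 shows "sg * (u' t x - W' t x) <= D (%x. sg * (u t x - W t x)) x + f_u f x 0 * (sg * (u t x - W t x))"
proof -
 have "sg * (f x (u t x) - f x (W t x)) <= f_u f x 0 * (sg * (u t x - W t x))"
 proof (cases "sg = 1")
  case True
  then show ?thesis using f_diff_le[OF W_nonneg, of t x "u t x" x] pos by simp
 next
  case False
  then have "sg = - 1" using sg by (auto simp: abs_if split: if_splits)
  then show ?thesis using f_diff_le[OF u_lower[OF t], of x "W t x" x] pos by (simp add: algebra_simps)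
 qed
 then show ?thesis unfolding diff_D[OF t] u_evolution(2)[OF t] W_evolution(2) by (simp add: algebra_simps)
qed

lemma diff_bounded: "\<exists>M>0. \<forall>t\<ge>0. ALL x. \<bar>u t x - W t x\<bar> <= M"
proof -
 obtain B M where B: "!!t x. 0 <= t ==> \<bar>u t x\<bar> <= B" and M: "!!t x. \<bar>W t x\<bar> <= M" using u_bounded W_bounded by blast
 have "\<bar>u t x - W t x\<bar> <= \<bar>B\<bar> + \<bar>M\<bar> + 1" if "0 <= t" for t x using B[OF that, of x] M[of t x] by linarith
 then show ?thesis by (intro exI[of _ "\<bar>B\<bar> + \<bar>M\<bar> + 1"]) auto
qed

text \<open>Fixes the constant \<open>K\<close> before the weight, the rate and the sign are chosen,
  so that it is kept while approximate eigenfunctions vary.\<close>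

definition weighted_estimate :: "real => real => bool" where
 "weighted_estimate Bd K \<longleftrightarrow> (ALL Ph si sg l B. \<bar>sg\<bar> = 1 --> C2 Ph --> (ALL x. 0 < Ph x) --> periodic L (%x. inverse (Ph x) *\<^sub>R grad Ph x) -->
  (ALL x. norm (grad Ph x) <= Bd * Ph x) --> 0 < l --> 0 < B --> (ALL x. l * exp (- B * norm x) <= Ph x) -->
  (ALL x. D Ph x + f_u f x 0 * Ph x <= si * Ph x) --> integrable lborel (%x. (u0 x - W 0 x) / Ph x) -->
  (\<forall>t>0. (ALL x. sg * (u t x - W t x) <= K * t powr (- real CARD('n) / 2) * exp (si * t) * Ph x * (LINT x|lborel. \<bar>(u0 x - W 0 x) / Ph x\<bar>)) \<and>
   (\<integral>\<^sup>+x. ennreal (max 0 (sg * (u t x - W t x) / Ph x)) \<partial>lborel) < \<infinity>))"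

lemma weighted_estimateD:
 assumes "weighted_estimate Bd K" "\<bar>sg\<bar> = 1" "C2 Ph" "!!x. 0 < Ph x" "periodic L (%x. inverse (Ph x) *\<^sub>R grad Ph x)"
  "!!x. norm (grad Ph x) <= Bd * Ph x" "0 < l" "0 < B" "!!x. l * exp (- B * norm x) <= Ph x"
  "!!x. D Ph x + f_u f x 0 * Ph x <= si * Ph x" "integrable lborel (%x. (u0 x - W 0 x) / Ph x)" "0 < t"
 shows "(ALL x. sg * (u t x - W t x) <= K * t powr (- real CARD('n) / 2) * exp (si * t) * Ph x * (LINT x|lborel. \<bar>(u0 x - W 0 x) / Ph x\<bar>)) \<and>
   (\<integral>\<^sup>+x. ennreal (max 0 (sg * (u t x - W t x) / Ph x)) \<partial>lborel) < \<infinity>"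
 by (rule assms(1)[unfolded weighted_estimate_def, rule_format, of sg Ph l B si t, OF assms(2-)])

lemma diff_weighted:
 assumes Bd: "Bd >= 0"
 shows "\<exists>K>0. weighted_estimate Bd K"
proof (rule weighted_bound[OF Bd])
 fix Kw :: real
 assume Kw: "Kw > 0"
 assume E: "!!Ph si a v v' T0 Om Om' j t. C2 Ph ==> (ALL x. 0 < Ph x) ==> periodic L (%x. inverse (Ph x) *\<^sub>R grad Ph x) ==>
   (ALL x. norm (grad Ph x) <= Bd * Ph x) ==>
   evolution T0 v v' ==> open Om ==> open Om' ==> Om \<inter> Om' = {} ==>
   (ALL t x. T0 < t --> 0 < v t x --> (t, x) \<in> Om \<union> Om') ==> growth T0 Om (%t x. v t x / Ph x) ==> dominated T0 Om v (%x. Ph x * j x) ==>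
   integrable lborel j ==> (ALL x. 0 <= j x) ==>
   (ALL t x. T0 < t --> (t, x) \<in> Om --> 0 < v t x -->
   v' t x <= D (v t) x + a t x * v t x & D Ph x + a t x * Ph x <= si * Ph x) ==> T0 < t ==>
   (ALL x. (t, x) \<in> Om --> v t x <= Kw * (t - T0) powr (- real CARD('n) / 2) * exp (si * (t - T0)) * Ph x * (LINT x|lborel. j x)) \<and>
   (\<integral>\<^sup>+x. ennreal (indicator {x. (t, x) \<in> Om} x * max 0 (v t x / Ph x)) \<partial>lborel)
   <= ennreal (exp (si * (t - T0))) * ennreal (Kw * (LINT x|lborel. j x))"
 show ?thesis unfolding weighted_estimate_def
 proof (intro exI[of _ Kw] conjI Kw allI impI)
  fix Ph :: "real ^ 'n => real" and si sg l B t :: real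
  assume sg: "\<bar>sg\<bar> = 1" and Ph: "C2 Ph" "ALL x. 0 < Ph x" "periodic L (%x. inverse (Ph x) *\<^sub>R grad Ph x)" "ALL x. norm (grad Ph x) <= Bd * Ph x"
   and l: "0 < l" "0 < B" "ALL x. l * exp (- B * norm x) <= Ph x" and si: "ALL x. D Ph x + f_u f x 0 * Ph x <= si * Ph x"
   and int: "integrable lborel (%x. (u0 x - W 0 x) / Ph x)" and t: "0 < t"
  obtain M where M: "M > 0" "!!t x. 0 <= t ==> \<bar>u t x - W t x\<bar> <= M" using diff_bounded by blast
  have gr: "growth 0 UNIV (%t x. sg * (u t x - W t x) / Ph x)"
  proof (rule growth_bounded[OF l(2)])
   fix t x assume "0 < (t::real)"
   then have "sg * (u t x - W t x) <= M" using M(2)[of t x] sg by (metis abs_ge_self abs_mult less_imp_le mult_1 order_trans)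
   then have "sg * (u t x - W t x) / Ph x <= M / Ph x" using Ph(2) by (intro divide_right_mono) (auto intro: less_imp_le)
   also have "... <= M / (l * exp (- B * norm x))" using Ph(2) l M by (intro divide_left_mono) auto
   also have "... = M / l * exp (B * norm x)" by (simp add: exp_minus field_simps)
   finally show "sg * (u t x - W t x) / Ph x <= M / l * exp (B * norm x)" .
  qed
  have dom: "dominated 0 UNIV (%t x. sg * (u t x - W t x)) (%x. Ph x * \<bar>(u0 x - W 0 x) / Ph x\<bar>)"
  proof (rule dominatedI, rule AE_mp[OF u_limit], intro AE_I2 impI)
   fix x assume lim: "((%t. u t x) \<longlongrightarrow> u0 x) (at_right 0)"
   have "((%t. sg * (u t x - W t x)) \<longlongrightarrow> sg * (u0 x - W 0 x)) (at_right 0)"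
   by (intro tendsto_mult tendsto_const tendsto_diff lim evolution_right_limit[OF W_evolution(1)[of "- 1"]]) simp
   moreover have "Ph x * \<bar>(u0 x - W 0 x) / Ph x\<bar> = \<bar>u0 x - W 0 x\<bar>" using Ph(2)[rule_format, of x] by (simp add: abs_divide)
   moreover have "sg * (u0 x - W 0 x) <= \<bar>u0 x - W 0 x\<bar>" using sg by (metis abs_ge_self abs_mult mult_1)
   ultimately show "EX V. ((%t. sg * (u t x - W t x)) \<longlongrightarrow> V) (at_right 0) \<and>
   ((\<exists>\<^sub>F t in at_right 0. (t, x) \<in> UNIV) --> V <= Ph x * \<bar>(u0 x - W 0 x) / Ph x\<bar>)" by metis
  qed
  have e: "(ALL x. (t, x) \<in> UNIV --> sg * (u t x - W t x) <= Kw * (t - 0) powr (- real CARD('n) / 2) * exp (si * (t - 0)) * Ph x * (LINT x|lborel. \<bar>(u0 x - W 0 x) / Ph x\<bar>)) \<and>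
   (\<integral>\<^sup>+x. ennreal (indicator {x. (t, x) \<in> UNIV} x * max 0 (sg * (u t x - W t x) / Ph x)) \<partial>lborel)
   <= ennreal (exp (si * (t - 0))) * ennreal (Kw * (LINT x|lborel. \<bar>(u0 x - W 0 x) / Ph x\<bar>))"
  proof (rule E[of Ph 0 "%t x. sg * (u t x - W t x)" "%t x. sg * (u' t x - W' t x)" UNIV "{}" "%x. \<bar>(u0 x - W 0 x) / Ph x\<bar>" "%t x. f_u f x 0" si t,
   OF Ph diff_evolution open_UNIV open_empty _ _ gr dom integrable_abs[OF int] _ _ t])
   show "ALL t x. 0 < t --> (t, x) \<in> UNIV --> 0 < sg * (u t x - W t x) -->
   sg * (u' t x - W' t x) <= D (%x. sg * (u t x - W t x)) x + f_u f x 0 * (sg * (u t x - W t x)) & D Ph x + f_u f x 0 * Ph x <= si * Ph x"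
   using diff_sub[OF sg] si by blast
  qed simp_all
  show "!!x. sg * (u t x - W t x) <= Kw * t powr (- real CARD('n) / 2) * exp (si * t) * Ph x * (LINT x|lborel. \<bar>(u0 x - W 0 x) / Ph x\<bar>)"
   using e by simp
  have "(\<integral>\<^sup>+x. ennreal (max 0 (sg * (u t x - W t x) / Ph x)) \<partial>lborel)
   <= ennreal (exp (si * t)) * ennreal (Kw * (LINT x|lborel. \<bar>(u0 x - W 0 x) / Ph x\<bar>))" using conjunct2[OF e] by simp
  also have "... < \<infinity>" by (simp add: ennreal_mult_less_top)
  finally show "(\<integral>\<^sup>+x. ennreal (max 0 (sg * (u t x - W t x) / Ph x)) \<partial>lborel) < \<infinity>" .
 qed
qed

lemma diff_measurable: "0 < t ==> (%x. u t x - W t x) \<in> borel_measurable borel"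
 using evolutionD(1)[OF u_evolution(1), of t] evolutionD(1)[OF W_evolution(1), of "t - 1" t]
 by (intro borel_measurable_continuous_onI continuous_on_diff C2_cont) auto

text \<open>The weighted estimate with weight 1. Its growth rate does no harm, as only finiteness at
  a given time is wanted, to restart from that time in \<open>right_region\<close>.\<close>

lemma diff_integrable:
 assumes int: "integrable lborel (%x. u0 x - W 0 x)" and t: "0 < t"
 shows "integrable lborel (%x. u t x - W t x)"
proof -
 obtain Kq where Kq: "!!x. \<bar>f_u f x 0\<bar> <= Kq" using reaction_lipschitz[OF reaction L_pos, of 0] by (metis abs_zero order_refl)
 obtain K where K: "weighted_estimate 0 K" using diff_weighted[OF order_refl] by blast
 have fin: "(\<integral>\<^sup>+x. ennreal (max 0 (sg * (u t x - W t x))) \<partial>lborel) < \<infinity>" if sg: "\<bar>sg\<bar> = 1" for sg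
 proof -
  have "f_u f x 0 <= Kq" for x using Kq[of x] by simp
  moreover have "exp (- norm x) <= 1" for x :: "real ^ 'n" by simp
  ultimately have "(\<integral>\<^sup>+x. ennreal (max 0 (sg * (u t x - W t x) / 1)) \<partial>lborel) < \<infinity>"
   by (intro conjunct2[OF weighted_estimateD[OF K sg, of "%_. 1" 1 1 Kq t]]) (use int t in "simp_all add: periodic_def")
  then show ?thesis by simp
 qed
 show ?thesis
 proof (rule integrableI_bounded)
  show "(%x. u t x - W t x) \<in> borel_measurable lborel" using diff_measurable[OF t] by simp
  have m: "(%x. ennreal (max 0 (sg * (u t x - W t x)))) \<in> borel_measurable lborel" for sg
   unfolding measurable_lborel2
   by (intro measurable_compose[OF _ measurable_ennreal] borel_measurable_max borel_measurable_const borel_measurable_times diff_measurable t)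
  have "ennreal (norm (u t x - W t x)) = ennreal (max 0 (1 * (u t x - W t x))) + ennreal (max 0 (- 1 * (u t x - W t x)))" for x
   by (subst ennreal_plus[symmetric]) (auto simp: max_def abs_if)
  then have "(\<integral>\<^sup>+x. ennreal (norm (u t x - W t x)) \<partial>lborel)
   = (\<integral>\<^sup>+x. ennreal (max 0 (1 * (u t x - W t x))) \<partial>lborel) + (\<integral>\<^sup>+x. ennreal (max 0 (- 1 * (u t x - W t x))) \<partial>lborel)"
   by (simp only: nn_integral_add[OF m m])
  then show "(\<integral>\<^sup>+x. ennreal (norm (u t x - W t x)) \<partial>lborel) < \<infinity>" using fin[of 1] fin[of "- 1"] by simp
 qed
qed

end

lemma integrable_change_weight:
 fixes g g2 h :: "real ^ 'n::finite => real"
 assumes int: "integrable lborel (%x. g x * h x)" and c: "continuous_on UNIV g" "continuous_on UNIV g2"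
  and g: "!!x. 0 < g x" "!!x. \<bar>g2 x\<bar> <= C * g x"
 shows "integrable lborel (%x. g2 x * h x)" "(LINT x|lborel. \<bar>g2 x * h x\<bar>) <= C * (LINT x|lborel. \<bar>g x * h x\<bar>)"
proof -
 have e: "g2 x * h x = g2 x / g x * (g x * h x)" for x using g(1)[of x] by simp
 have b: "\<bar>g2 x * h x\<bar> <= C * \<bar>g x * h x\<bar>" for x
  using mult_right_mono[OF g(2)[of x], of "\<bar>h x\<bar>"] g(1)[of x] by (simp add: abs_mult)
 have iC: "integrable lborel (%x. C * \<bar>g x * h x\<bar>)" by (intro integrable_mult_right integrable_abs int)
 show i: "integrable lborel (%x. g2 x * h x)"
 proof (rule Bochner_Integration.integrable_bound[OF iC])
  have m: "(%x. g2 x / g x) \<in> borel_measurable borel"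
   by (intro borel_measurable_continuous_onI continuous_intros c) (use g(1) in "auto simp: less_imp_neq[symmetric]")
  show "(%x. g2 x * h x) \<in> borel_measurable lborel"
   unfolding e by (rule borel_measurable_times[OF _ borel_measurable_integrable[OF int]]) (use m in simp)
  show "AE x in lborel. norm (g2 x * h x) <= norm (C * \<bar>g x * h x\<bar>)"
   by (intro AE_I2) (use b in "auto intro: order_trans[OF _ abs_ge_self]")
 qed
 have "(LINT x|lborel. \<bar>g2 x * h x\<bar>) <= (LINT x|lborel. C * \<bar>g x * h x\<bar>)"
  by (intro integral_mono integrable_abs i iC b)
 then show "(LINT x|lborel. \<bar>g2 x * h x\<bar>) <= C * (LINT x|lborel. \<bar>g x * h x\<bar>)" by simp
qed

context kpp_solution
begin

text \<open>Conjugation by \<open>E x = exp (lam * x $ k)\<close> turns the linearization at 0 into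
  the operator of \<open>mu_speed\<close> plus \<open>lam * c\<close>. The growth
  \<open>exp (lam * c * t)\<close> joins \<open>E\<close> to form the exponential of the moving
  coordinate, and \<open>exp (- \<mu> * t)\<close> remains. The loss \<open>ep\<close> goes to 0
  because the constants do not depend on it.\<close>

lemma left_decay:
 assumes mu: "mu_speed L k A f c lam \<mu>" and lam: "lam > 0"
  and int: "integrable lborel (%x. exp (- lam * x $ k) * (u0 x - W 0 x))"
 shows "\<exists>K>0. \<forall>t>0. ALL x. \<bar>u t x - W t x\<bar> <= K * t powr (- real CARD('n) / 2) * exp (- \<mu> * t) * exp (lam * (x $ k + c * t))"
proof -
 obtain l B where lB: "l > 0" "B > 0" and psex: "\<forall>ep>0. EX ps. C2 ps & periodic L ps & (ALL x. l <= ps x & ps x <= B & norm (grad ps x) <= B \<and>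
  D ps x + speed_lower_order k A f c lam ps x <= (- \<mu> + ep) * ps x)" using left_supersolution[OF mu] by (elim exE conjE)
 define e :: "real ^ 'n" where "e = axis k 1"
 define E where "E x = exp (lam * x $ k)" for x :: "real ^ 'n"
 have d1: "((%s. exp (lam * s)) has_real_derivative lam * exp (lam * s)) (at s)" for s by (auto intro!: derivative_eq_intros)
 have d2: "((%s. lam * exp (lam * s)) has_real_derivative lam\<^sup>2 * exp (lam * s)) (at s)" for s
  by (auto intro!: derivative_eq_intros simp: power2_eq_square)
 have cE: "continuous_on UNIV (%x :: real ^ 'n. lam\<^sup>2 * exp (lam * x $ k))" by (intro continuous_intros)
 note FE = C2_compose[where F="%s. exp (lam * s)" and F'="%s. lam * exp (lam * s)" and F''="%s. lam\<^sup>2 * exp (lam * s)", OF C2_nth d1 d2 cE]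
 note DEc = D_compose[where F="%s. exp (lam * s)" and F'="%s. lam * exp (lam * s)" and F''="%s. lam\<^sup>2 * exp (lam * s)", OF C2_nth d1 d2 cE]
 have EC2: "C2 E" unfolding E_def[abs_def] by (rule FE)
 have Ep: "E x > 0" for x by (simp add: E_def)
 have gE: "grad E x = (lam * E x) *\<^sub>R e" for x
  unfolding E_def[abs_def] e_def
  using grad_compose[where F="%s. exp (lam * s)" and F'="%s. lam * exp (lam * s)", OF C1_nth d1, of k x] by (simp add: grad_component)
 have DE: "D E x = lam * E x * D (%y. y $ k) x + lam\<^sup>2 * E x * inner e (A x *v e)" for x
  unfolding E_def[abs_def] e_def using DEc[of x] by (simp add: grad_component)
 \<comment> \<open>A bound for the gradient of the weight relative to the weight, in which
   \<open>E\<close> cancels.\<close>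
 define Bd where "Bd = (B + lam * B) / l"
 have Bd0: "Bd >= 0" using lB lam by (simp add: Bd_def)
 obtain K where K0: "K > 0" and K: "weighted_estimate Bd K" using diff_weighted[OF Bd0] by blast
 define J where "J = (LINT x|lborel. \<bar>exp (- lam * x $ k) * (u0 x - W 0 x)\<bar>)"
 have J: "J >= 0" unfolding J_def by (intro Bochner_Integration.integral_nonneg) simp
 define Q where "Q = K * (B * (J / l))"
 have Q: "Q >= 0" using K0 lB J by (simp add: Q_def)
 have main: "sg * (u t x - W t x) <= Q * t powr (- real CARD('n) / 2) * exp (- \<mu> * t) * exp (lam * (x $ k + c * t)) * exp (ep * t)"
  if sg: "\<bar>sg\<bar> = 1" and ep: "ep > 0" and t: "t > 0" for sg ep t x
 proof -
  obtain ps where ps: "C2 ps" "periodic L ps" and ps': "ALL x. l <= ps x & ps x <= B & norm (grad ps x) <= B \<and>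
   D ps x + speed_lower_order k A f c lam ps x <= (- \<mu> + ep) * ps x" using psex ep by blast
  have psb: "l <= ps x" "ps x <= B" "norm (grad ps x) <= B" "D ps x + speed_lower_order k A f c lam ps x <= (- \<mu> + ep) * ps x" for x
   using ps' by blast+
  have psp: "ps x > 0" for x using psb(1)[of x] lB by simp
  define Ph where "Ph x = E x * ps x" for x
  have PhC2: "C2 Ph" unfolding Ph_def[abs_def] by (rule C2_mult[OF EC2 ps(1)])
  have Php: "0 < Ph x" for x using Ep[of x] psp[of x] by (simp add: Ph_def)
  have gPh: "grad Ph x = E x *\<^sub>R grad ps x + (ps x * (lam * E x)) *\<^sub>R e" for x
   unfolding Ph_def[abs_def] grad_mult[OF C2_C1[OF EC2] C2_C1[OF ps(1)]] gE scaleR_scaleR ..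
  have q: "inverse (Ph x) *\<^sub>R grad Ph x = inverse (ps x) *\<^sub>R grad ps x + lam *\<^sub>R e" for x
  proof -
   have "inverse (Ph x) * E x = inverse (ps x)" "inverse (Ph x) * (ps x * (lam * E x)) = lam"
   using Ep[of x] psp[of x] by (simp_all add: Ph_def field_simps)
   then show ?thesis by (simp only: gPh scaleR_add_right scaleR_scaleR)
  qed
  have per: "periodic L (%x. inverse (Ph x) *\<^sub>R grad Ph x)"
   unfolding q using ps(2) periodic_grad[OF ps(2)] by (simp add: periodic_def)
  have gb: "norm (grad Ph x) <= Bd * Ph x" for x
  proof -
   have "norm (grad Ph x) <= E x * norm (grad ps x) + ps x * (lam * E x)"
   unfolding gPh using Ep[of x] psp[of x] lam by (intro order_trans[OF norm_triangle_ineq]) (simp add: e_def)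
   also have "... <= E x * B + B * (lam * E x)"
   using psb[of x] Ep[of x] lam by (intro add_mono mult_left_mono mult_right_mono) auto
   also have "... = Bd * (E x * l)" using lB by (simp add: Bd_def field_simps)
   also have "... <= Bd * Ph x" unfolding Ph_def using psb(1)[of x] Ep[of x] Bd0 by (intro mult_left_mono) auto
   finally show ?thesis .
  qed
  have low: "l * exp (- lam * norm x) <= Ph x" for x
  proof -
   have "- norm x <= x $ k" using component_le_norm_cart[of x k] by (simp add: abs_le_iff)
   then have "- lam * norm x <= lam * x $ k" using mult_left_mono[of "- norm x" "x $ k" lam] lam by simp
   then have "exp (- lam * norm x) <= E x" by (simp add: E_def)
   then have "exp (- lam * norm x) * l <= E x * ps x" using psb(1)[of x] lB Ep[of x] by (intro mult_mono) auto
   then show ?thesis by (simp add: Ph_def mult.commute)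
  qed
  have DPh: "D Ph x + f_u f x 0 * Ph x <= (- \<mu> + ep + lam * c) * Ph x" for x
  proof -
   have Dk: "div_field (%y. A y *v axis k 1) x = D (%y. y $ k) x" by (simp add: D_def grad_component)
   have "D Ph x + f_u f x 0 * Ph x - lam * c * Ph x = E x * (D ps x + speed_lower_order k A f c lam ps x)"
   unfolding Ph_def[abs_def] D_mult[OF EC2 ps(1)] DE gE speed_lower_order_def Dk e_def by (simp add: algebra_simps)
   also have "... <= E x * ((- \<mu> + ep) * ps x)" using psb(4)[of x] Ep[of x] by (intro mult_left_mono) auto
   finally show ?thesis by (simp add: Ph_def algebra_simps)
  qed
  have ib: "\<bar>inverse (Ph x)\<bar> <= 1 / l * exp (- lam * x $ k)" for x
  proof -
   have "inverse (Ph x) <= inverse (E x * l)" unfolding Ph_def using psb(1)[of x] lB Ep[of x] by (intro le_imp_inverse_le mult_left_mono mult_pos_pos) auto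
   then show ?thesis using Php[of x] by (simp add: E_def exp_minus inverse_eq_divide mult.commute)
  qed
  have c1: "continuous_on UNIV (%x :: real ^ 'n. exp (- lam * x $ k))" by (intro continuous_intros)
  note cw = integrable_change_weight[OF int c1 C2_cont[OF C2_inverse[OF PhC2 Php]] exp_gt_zero ib]
  have iPh: "integrable lborel (%x. (u0 x - W 0 x) / Ph x)" using cw(1) by (simp add: divide_inverse mult.commute)
  have JPh: "(LINT x|lborel. \<bar>(u0 x - W 0 x) / Ph x\<bar>) <= J / l" using cw(2) by (simp add: J_def divide_inverse mult.commute)
  define P where "P = K * t powr (- real CARD('n) / 2) * exp ((- \<mu> + ep + lam * c) * t)"
  have P: "P >= 0" using K0 by (simp add: P_def)
  have "sg * (u t x - W t x) <= P * Ph x * (LINT x|lborel. \<bar>(u0 x - W 0 x) / Ph x\<bar>)"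
   unfolding P_def by (rule conjunct1[OF weighted_estimateD[OF K sg PhC2 Php per gb lB(1) lam low DPh iPh t], THEN spec])
  also have "... <= P * (E x * B) * (J / l)"
   using P JPh psb(2)[of x] Ep[of x] psp[of x] lB J
   by (intro mult_mono mult_left_mono) (auto simp: Ph_def intro!: mult_nonneg_nonneg Bochner_Integration.integral_nonneg)
  also have "... = Q * t powr (- real CARD('n) / 2) * (exp ((- \<mu> + ep + lam * c) * t) * E x)" by (simp add: P_def Q_def)
  also have "exp ((- \<mu> + ep + lam * c) * t) * E x = exp (- \<mu> * t) * exp (lam * (x $ k + c * t)) * exp (ep * t)"
   by (simp add: E_def exp_add[symmetric] algebra_simps)
  finally show ?thesis by (simp add: mult.assoc)
 qed
 have lim: "sg * (u t x - W t x) <= Q * t powr (- real CARD('n) / 2) * exp (- \<mu> * t) * exp (lam * (x $ k + c * t))"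
  if sg: "\<bar>sg\<bar> = 1" and t: "t > 0" for sg t x
 proof -
  define R where "R = Q * t powr (- real CARD('n) / 2) * exp (- \<mu> * t) * exp (lam * (x $ k + c * t))"
  have "((%ep. R * exp (ep * t)) \<longlongrightarrow> R * exp (0 * t)) (at_right 0)" by (intro tendsto_intros)
  moreover have "\<forall>\<^sub>F ep in at_right 0. sg * (u t x - W t x) <= R * exp (ep * t)"
   unfolding eventually_at_right_field R_def using main[OF sg _ t] by (intro exI[of _ 1]) auto
  ultimately have "sg * (u t x - W t x) <= R * exp (0 * t)" by (rule tendsto_lowerbound) simp
  then show ?thesis by (simp add: R_def)
 qed
 have "\<bar>u t x - W t x\<bar> <= (Q + 1) * t powr (- real CARD('n) / 2) * exp (- \<mu> * t) * exp (lam * (x $ k + c * t))" if t: "t > 0" for t x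
 proof -
  define R where "R = t powr (- real CARD('n) / 2) * exp (- \<mu> * t) * exp (lam * (x $ k + c * t))"
  have "R >= 0" by (simp add: R_def)
  then have "Q * R <= (Q + 1) * R" by (simp add: distrib_right)
  moreover have "\<bar>u t x - W t x\<bar> <= Q * R" using lim[of 1 t x] lim[of "- 1" t x] t by (simp add: R_def abs_le_iff mult.assoc)
  ultimately have "\<bar>u t x - W t x\<bar> <= (Q + 1) * R" by linarith
  then show ?thesis by (simp add: R_def mult.assoc)
 qed
 then show ?thesis using Q by (intro exI[of _ "Q + 1"]) auto
qed

text \<open>The function \<open>(1 - 2 * e1) * p - u\<close> is a subsolution for the potential
  \<open>f x (p x) / p x\<close>, for which \<open>p\<close> is a weight of rate 0, so its positive
  part decays like a power of time. On the interface \<open>\<xi> = \<xi>s\<close> it is nonpositive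
  from \<open>T0\<close> on by the left estimate, which permits cutting it off there.\<close>

lemma right_region:
 assumes int: "integrable lborel (%x. u0 x - W 0 x)" and e: "0 < e" "e < 1" and \<mu>: "\<mu> >= 0"
  and left: "\<forall>t>0. ALL x. \<bar>u t x - W t x\<bar> <= K * t powr (- real CARD('n) / 2) * exp (- \<mu> * t) * exp (lam * (x $ k + c * t))"
 shows "EX \<xi>s T. T > 0 & (\<forall>t\<ge>T. ALL x. x $ k + c * t > \<xi>s --> (1 - e) * p x <= u t x & \<bar>W t x - p x\<bar> <= e * p x)"
proof -
 \<comment> \<open>One third for the distance of \<open>W\<close> to \<open>p\<close>, one for that
   of \<open>u\<close> to \<open>W\<close> on the interface, one for what remains of
   \<open>v\<close> at late times.\<close>
 define e1 where "e1 = e / 3"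
 have e1: "0 < e1" "e1 <= e" "3 * e1 = e" using e by (auto simp: e1_def)
 obtain l B where l: "l > 0" "!!x. l <= p x" "!!x. p x <= B" using p_bounds by blast
 obtain \<xi>s where xs: "!!\<xi> x. \<xi> >= \<xi>s ==> \<bar>w x \<xi> - p x\<bar> < e1 * l"
  using w_right[OF mult_pos_pos[OF e1(1) l(1)]] by blast
 have Wp: "\<bar>W t x - p x\<bar> <= e1 * p x" if "x $ k + c * t >= \<xi>s" for t x
 proof -
  have "e1 * l <= e1 * p x" by (rule mult_left_mono[OF l(2)]) (use e1 in simp)
  then show ?thesis using xs[OF that, of x] unfolding W_def by linarith
 qed
 have n0: "real CARD('n) > 0" by simp
 obtain T0 where T0: "T0 > 0" "\<forall>t\<ge>T0. (\<bar>K\<bar> * exp (lam * \<xi>s)) * (t - 0) powr (- real CARD('n) / 2) <= e1 * l"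
  using powr_decay[OF n0, of "e1 * l" 0] e1 l by (metis mult_pos_pos)
 have bdry: "\<bar>u t x - W t x\<bar> <= e1 * p x" if t: "t >= T0" and x: "x $ k + c * t = \<xi>s" for t x
 proof -
  have t0: "t > 0" using t T0 by simp
  have "\<bar>u t x - W t x\<bar> <= K * t powr (- real CARD('n) / 2) * exp (- \<mu> * t) * exp (lam * \<xi>s)" using left t0 x by metis
  also have "... <= \<bar>K\<bar> * t powr (- real CARD('n) / 2) * 1 * exp (lam * \<xi>s)"
   using \<mu> t0 by (intro mult_mono mult_right_mono mult_nonneg_nonneg) auto
  also have "... <= e1 * l" using T0(2) t by (simp add: mult_ac)
  also have "... <= e1 * p x" using l(2)[of x] e1 by (intro mult_left_mono) auto
  finally show ?thesis .
 qed
 obtain Bg where Bg: "Bg > 0" "!!x. norm (grad p x) <= Bg" using periodic_bounded[OF L_pos periodic_grad[OF p_per] C1_grad_cont[OF C2_C1[OF p_C2]]] by metis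
 define Bd where "Bd = Bg / l"
 have Bd0: "Bd >= 0" using Bg l by (simp add: Bd_def)
 define v where "v t x = (1 - 2 * e1) * p x - u t x" for t x
 define v' where "v' t x = 0 - u' t x" for t x
 have v: "evolution 0 v v'" unfolding v_def[abs_def] v'_def[abs_def]
  by (intro evolution_diff evolution_static C2_cmult p_C2 u_evolution)
 define Om where "Om = {q :: real \<times> (real ^ 'n). \<xi>s < snd q $ k + c * fst q}"
 define Om' where "Om' = {q :: real \<times> (real ^ 'n). snd q $ k + c * fst q < \<xi>s}"
 have Om: "open Om" "open Om'" "Om \<inter> Om' = {}"
  unfolding Om_def Om'_def by (intro open_Collect_less continuous_intros, intro open_Collect_less continuous_intros) auto
 \<comment> \<open>Right of the interface the positive part of \<open>v\<close> at time
   \<open>T0\<close> lies below the modulus of \<open>u - W\<close>, because \<open>W\<close> is at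
   least \<open>(1 - e1) * p\<close> there; \<open>diff_integrable\<close> makes this an admissible
   initial bound.\<close>
 define j where "j x = \<bar>inverse (p x) * (u T0 x - W T0 x)\<bar>" for x
 have ib: "\<bar>inverse (p x)\<bar> <= 1 / l * 1" for x using l(1) l(2)[of x] by (simp add: field_simps)
 have "integrable lborel (%x. 1 * (u T0 x - W T0 x))" using diff_integrable[OF int T0(1)] by simp
 from integrable_change_weight(1)[OF this continuous_on_const C2_cont[OF C2_inverse[OF p_C2 p_pos]] zero_less_one ib]
 have ij: "integrable lborel j" unfolding j_def[abs_def] by (rule integrable_abs)
 have pj: "p x * j x = \<bar>u T0 x - W T0 x\<bar>" for x using p_pos[of x] by (simp add: j_def abs_mult)
 have vt: "v' t x <= D (v t) x + f x (p x) / p x * v t x" if t: "0 < t" and pos: "0 < v t x" for t x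
 proof -
  have Dv: "D (v t) x = (1 - 2 * e1) * D p x - D (u t) x"
   unfolding v_def[abs_def] using D_diff[OF C2_cmult[OF p_C2] evolutionD(1)[OF u_evolution(1) t]] by (simp add: D_cmult p_C2)
  have "u t x <= p x" by (rule u_upper[OF t])
  then have "f x (p x) / p x * u t x <= f x (u t x)" using f_below_p u_lower[OF t] by blast
  moreover have "f x (p x) / p x * v t x = (1 - 2 * e1) * f x (p x) - f x (p x) / p x * u t x"
   using p_pos[of x] by (simp add: v_def field_simps)
  moreover have "(1 - 2 * e1) * D p x = - ((1 - 2 * e1) * f x (p x))" using p_steady[of x] by (metis add_eq_0_iff2 mult_minus_right)
  ultimately show ?thesis unfolding Dv v'_def u_evolution(2)[OF t] by linarith
 qed
 have "EX J. \<forall>t>T0. ALL x. (t, x) \<in> Om --> v t x <= J * (t - T0) powr (- real CARD('n) / 2)"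
 proof (rule weighted_bound[OF Bd0])
  fix Kw :: real
  assume Kw: "Kw > 0"
  assume E: "!!Ph si a v v' T0 Om Om' j t. C2 Ph ==> (ALL x. 0 < Ph x) ==> periodic L (%x. inverse (Ph x) *\<^sub>R grad Ph x) ==>
   (ALL x. norm (grad Ph x) <= Bd * Ph x) ==>
   evolution T0 v v' ==> open Om ==> open Om' ==> Om \<inter> Om' = {} ==>
   (ALL t x. T0 < t --> 0 < v t x --> (t, x) \<in> Om \<union> Om') ==> growth T0 Om (%t x. v t x / Ph x) ==> dominated T0 Om v (%x. Ph x * j x) ==>
   integrable lborel j ==> (ALL x. 0 <= j x) ==>
   (ALL t x. T0 < t --> (t, x) \<in> Om --> 0 < v t x -->
   v' t x <= D (v t) x + a t x * v t x & D Ph x + a t x * Ph x <= si * Ph x) ==> T0 < t ==>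
   (ALL x. (t, x) \<in> Om --> v t x <= Kw * (t - T0) powr (- real CARD('n) / 2) * exp (si * (t - T0)) * Ph x * (LINT x|lborel. j x)) \<and>
   (\<integral>\<^sup>+x. ennreal (indicator {x. (t, x) \<in> Om} x * max 0 (v t x / Ph x)) \<partial>lborel)
   <= ennreal (exp (si * (t - T0))) * ennreal (Kw * (LINT x|lborel. j x))"
  have per: "periodic L (%x. inverse (p x) *\<^sub>R grad p x)" using p_per periodic_grad[OF p_per] by (simp add: periodic_def)
  have gb: "ALL x. norm (grad p x) <= Bd * p x"
  proof
   fix x
   have "Bg * 1 <= Bg * (p x / l)" using l(1) l(2)[of x] Bg by (intro mult_left_mono) (auto simp: field_simps)
   then show "norm (grad p x) <= Bd * p x" using Bg(2)[of x] by (simp add: Bd_def)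
  qed
  have sep: "ALL t x. T0 < t --> 0 < v t x --> (t, x) \<in> Om \<union> Om'"
  proof (intro allI impI, rule ccontr)
   fix t x assume t: "T0 < t" and pos: "0 < v t x" and "(t, x) \<notin> Om \<union> Om'"
   then have x: "x $ k + c * t = \<xi>s" by (auto simp: Om_def Om'_def)
   show False using bdry[of t x] Wp[of x t] x t pos by (simp add: v_def algebra_simps abs_le_iff)
  qed
  have gr: "growth T0 Om (%t x. v t x / p x)"
  proof (rule growth_bounded[of 1])
   fix t x assume "T0 < t"
   then have "v t x <= 1 * p x" using u_lower[of t x] T0 e1 p_pos[of x] by (simp add: v_def algebra_simps)
   then have "v t x / p x <= 1" using p_pos[of x] by (simp add: divide_le_eq)
   also have "... <= 1 * exp (1 * norm x)" by simp
   finally show "v t x / p x <= 1 * exp (1 * norm x)" .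
  qed simp
  have dom: "dominated T0 Om v (%x. p x * j x)"
  proof (rule dominatedI, rule AE_I2)
   fix x
   have "V <= p x * j x" if f: "\<exists>\<^sub>F t in at_right T0. (t, x) \<in> Om" and V: "V = v T0 x" for V
   proof -
   have "x $ k + c * T0 >= \<xi>s"
   proof (rule ccontr)
   assume "\<not> ?thesis"
   moreover have "((%t. x $ k + c * t) \<longlongrightarrow> x $ k + c * T0) (at_right T0)" by (intro tendsto_intros)
   ultimately have "\<forall>\<^sub>F t in at_right T0. x $ k + c * t < \<xi>s" by (intro order_tendstoD(2)) auto
   then have "\<forall>\<^sub>F t in at_right T0. (t, x) \<notin> Om" by (rule eventually_mono) (simp add: Om_def)
   then show False using f by (simp add: frequently_def)
   qed
   from Wp[OF this] have "(1 - e1) * p x <= W T0 x" by (simp add: algebra_simps abs_le_iff)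
   moreover have "(1 - 2 * e1) * p x <= (1 - e1) * p x" using e1 p_pos[of x] by (intro mult_right_mono) auto
   ultimately show ?thesis unfolding pj V v_def using abs_ge_minus_self[of "u T0 x - W T0 x"] by linarith
   qed
   then show "EX V. ((%t. v t x) \<longlongrightarrow> V) (at_right T0) & ((\<exists>\<^sub>F t in at_right T0. (t, x) \<in> Om) --> V <= p x * j x)"
   using evolution_right_limit[OF v T0(1), of x] by blast
  qed
  have sb: "ALL t x. T0 < t --> (t, x) \<in> Om --> 0 < v t x -->
   v' t x <= D (v t) x + f x (p x) / p x * v t x & D p x + f x (p x) / p x * p x <= 0 * p x"
   using vt T0(1) p_steady p_pos by (simp add: less_imp_neq[symmetric])
  have "v t x <= (Kw * B * (LINT x|lborel. j x)) * (t - T0) powr (- real CARD('n) / 2)" if t: "T0 < t" and x: "(t, x) \<in> Om" for t x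
  proof -
   have J0: "0 <= (LINT x|lborel. j x)" by (intro Bochner_Integration.integral_nonneg) (simp add: j_def)
   have "v t x <= Kw * (t - T0) powr (- real CARD('n) / 2) * exp (0 * (t - T0)) * p x * (LINT x|lborel. j x)"
   by (rule conjunct1[OF E[of p T0 v v' Om Om' j "%t x. f x (p x) / p x" 0 t, OF p_C2 _ per gb evolution_mono[OF v less_imp_le[OF T0(1)]] Om sep gr dom ij _ sb t], THEN spec, THEN mp, OF _ _ x])
   (simp_all add: p_pos j_def)
   also have "... <= Kw * (t - T0) powr (- real CARD('n) / 2) * exp (0 * (t - T0)) * B * (LINT x|lborel. j x)"
   using l(3)[of x] Kw J0 by (intro mult_right_mono mult_left_mono) auto
   finally show ?thesis by (simp add: mult_ac)
  qed
  then show ?thesis by blast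
 qed
 then obtain J where J: "\<forall>t>T0. ALL x. (t, x) \<in> Om --> v t x <= J * (t - T0) powr (- real CARD('n) / 2)" by blast
 obtain T where T: "T > T0" "\<forall>t\<ge>T. J * (t - T0) powr (- real CARD('n) / 2) <= e1 * l"
  using powr_decay[OF n0, of "e1 * l" T0 J] e1 l by (metis mult_pos_pos)
 show ?thesis
 proof (intro exI conjI allI impI)
  show "T > 0" using T T0 by simp
  fix t x assume t: "T <= t" and x: "\<xi>s < x $ k + c * t"
  have "v t x <= J * (t - T0) powr (- real CARD('n) / 2)" using J t T x by (simp add: Om_def)
  also have "... <= e1 * l" using T t by blast
  also have "... <= e1 * p x" using l(2)[of x] e1 by (intro mult_left_mono) auto
  finally have "(1 - 3 * e1) * p x <= u t x" by (simp add: v_def algebra_simps)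
  then show "(1 - e) * p x <= u t x" by (simp add: e1)
  show "\<bar>W t x - p x\<bar> <= e * p x" by (rule order_trans[OF Wp[OF less_imp_le[OF x]] mult_right_mono[OF e1(2) less_imp_le[OF p_pos]]])
 qed
qed

text \<open>Once \<open>u\<close> and \<open>W\<close> are close to \<open>p\<close>,
  \<open>ka * s t * ps x\<close> is a barrier to the right of a fixed level: \<open>ps\<close>
  supplies the rate \<open>- m / 2\<close>, one half of which pays for the variation of
  \<open>f_u\<close> near \<open>p\<close> and the other for the decay of \<open>s\<close>. The
  profile \<open>s\<close> stays general so that exponential and algebraic decay share the
  argument.\<close>

lemma barrier:
 assumes ev: "principal_eigenvalue L A (%ph x. f_u f x (p x) * ph x) m" and m: "m < 0"
  and s: "!!t. 0 <= t ==> 0 < s t" "!!t. 0 <= t ==> (s has_real_derivative s' t) (at t)" "continuous_on {0<..} s'"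
  and slow: "!!t. T3 <= t ==> - s' t <= - m / 4 * s t"
  and left: "!!\<xi>. EX K. \<forall>t\<ge>1. ALL x. x $ k + c * t <= \<xi> --> \<bar>u t x - W t x\<bar> <= K * s t"
  and right: "!!e. 0 < e ==> e < 1 ==> EX \<xi>s T. T > 0 & (\<forall>t\<ge>T. ALL x. x $ k + c * t > \<xi>s --> (1 - e) * p x <= u t x & \<bar>W t x - p x\<bar> <= e * p x)"
 shows "\<exists>C>0. \<forall>t\<ge>0. ALL x. \<bar>u t x - W t x\<bar> <= C * s t"
proof -
 define \<nu> where "\<nu> = - m / 4"
 have \<nu>: "\<nu> > 0" using m by (simp add: \<nu>_def)
 obtain l B where l: "l > 0" "!!x. l <= p x" "!!x. p x <= B" using p_bounds by blast
 have B: "B > 0" using l(1) l(2)[of 0] l(3)[of 0] by linarith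
 obtain d where d: "d > 0" "!!s r x. \<bar>s\<bar> <= B ==> \<bar>r - s\<bar> < d ==> \<bar>f_u f x r - f_u f x s\<bar> < \<nu>"
  using f_u_uniform[OF reaction \<nu>] by metis
 obtain Kf where Kf: "!!x s. \<bar>s\<bar> <= B ==> \<bar>f_u f x s\<bar> <= Kf" using reaction_lipschitz[OF reaction L_pos, of B] by metis
 define r where "r x = f_u f x (p x)" for x
 have pB: "\<bar>p x\<bar> <= B" for x using l(3)[of x] p_pos[of x] by simp
 have r: "\<bar>r x\<bar> <= Kf" for x unfolding r_def by (rule Kf[OF pB])
 \<comment> \<open>Relative distance \<open>e\<close> to \<open>p\<close> keeps every value between
   \<open>u\<close> and \<open>W\<close> within \<open>d\<close> of \<open>p\<close>, and thus
   \<open>f_u\<close> within \<open>\<nu>\<close> of its value at \<open>p\<close>.\<close>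
 define e where "e = min (1 / 2) (d / (2 * B))"
 have e: "0 < e" "e < 1" using d(1) B by (auto simp: e_def)
 have eB: "e * p x < d" for x
 proof -
  have "e * p x <= d / (2 * B) * B" using l(3)[of x] p_pos[of x] B d(1) by (intro mult_mono) (auto simp: e_def less_imp_le)
  also have "... < d" using B d(1) by simp
  finally show ?thesis .
 qed
 obtain \<xi>s T where T: "T > 0" "!!t x. T <= t ==> x $ k + c * t > \<xi>s ==> (1 - e) * p x <= u t x & \<bar>W t x - p x\<bar> <= e * p x"
  using right[OF e] by blast
 obtain Kl where Kl: "!!t x. 1 <= t ==> x $ k + c * t <= \<xi>s ==> \<bar>u t x - W t x\<bar> <= Kl * s t" using left[of \<xi>s] by blast
 have "EX l B. l > 0 & B > 0 & (\<forall>ep>0. EX ps. C2 ps & periodic L ps & (ALL x. l <= ps x & ps x <= B & norm (grad ps x) <= B \<and>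
  D ps x + f_u f x (p x) * ps x <= (m + ep) * ps x))"
 proof (rule approximate_eigenfunction[OF ev, where C=Kf])
  show "periodic L (%x. f_u f x (p x) * ph x)" if "periodic L ph" for ph
   using that p_per f_u_periodic(2)[OF reaction] by (simp add: periodic_def)
  show "\<bar>f_u f x (p x) * ps x - f_u f x (p x) * ph x\<bar> <= Kf * (\<bar>ps x - ph x\<bar> + norm (grad ps x - grad ph x))" for ph ps :: "real ^ 'n => real" and x
  proof -
   have "\<bar>f_u f x (p x) * (ps x - ph x)\<bar> <= Kf * \<bar>ps x - ph x\<bar>" unfolding abs_mult using r[of x] by (intro mult_right_mono) (auto simp: r_def)
   also have "... <= Kf * (\<bar>ps x - ph x\<bar> + norm (grad ps x - grad ph x))" using r[of x] by (intro mult_left_mono) auto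
   finally show ?thesis by (simp add: right_diff_distrib)
  qed
 qed
 then obtain l2 B2 where lB: "l2 > 0" "B2 > 0" and ex: "\<forall>ep>0. EX ps. C2 ps & periodic L ps & (ALL x. l2 <= ps x & ps x <= B2 & norm (grad ps x) <= B2 \<and>
  D ps x + f_u f x (p x) * ps x <= (m + ep) * ps x)" by (elim exE conjE)
 have "- m / 2 > 0" using m by simp
 with ex obtain ps where ps: "C2 ps" and ps': "ALL x. l2 <= ps x & ps x <= B2 & norm (grad ps x) <= B2 \<and>
  D ps x + f_u f x (p x) * ps x <= (m + - m / 2) * ps x" by blast
 have psb: "l2 <= ps x" "ps x <= B2" "D ps x + r x * ps x <= - 2 * \<nu> * ps x" for x
  using ps'[rule_format, of x] by (auto simp: r_def \<nu>_def)
 have psp: "ps x > 0" for x using psb(1)[of x] lB by simp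
 obtain M where M: "M > 0" "!!t x. 0 <= t ==> \<bar>u t x - W t x\<bar> <= M" using diff_bounded by blast
 define T2 where "T2 = max T T3 + 1 + \<bar>T3\<bar>"
 have T2: "T2 > 0" "T2 >= 1" "T2 >= T" "T2 >= T3" using T(1) by (auto simp: T2_def)
 have sT2: "s T2 > 0" by (rule s(1)) (use T2 in simp)
 \<comment> \<open>One summand dominates the left bound, the other the difference at the starting
   time \<open>T2\<close>; \<open>l2\<close> compensates the size of \<open>ps\<close>.\<close>
 define ka where "ka = (\<bar>Kl\<bar> + M / s T2) / l2"
 have kap: "ka > 0" using M(1) sT2 lB by (simp add: ka_def add_nonneg_pos)
 have ka1: "\<bar>Kl\<bar> * s t <= ka * s t * ps x" if "0 <= t" for t x
 proof -
  have "\<bar>Kl\<bar> <= ka * l2" using M(1) sT2 lB by (simp add: ka_def)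
  also have "... <= ka * ps x" using psb(1) kap by (intro mult_left_mono) auto
  finally have "\<bar>Kl\<bar> * s t <= ka * ps x * s t" using s(1)[OF that] by (intro mult_right_mono) auto
  then show ?thesis by (simp add: mult_ac)
 qed
 have ka2: "M <= ka * s T2 * ps x" for x
 proof -
  have "M / s T2 <= ka * l2" using lB by (simp add: ka_def)
  also have "... <= ka * ps x" using psb(1) kap by (intro mult_left_mono) auto
  finally show ?thesis using sT2 by (simp add: divide_le_eq mult_ac)
 qed
 have up: "sg * (u t x - W t x) <= ka * s t * ps x" if sg: "\<bar>sg\<bar> = 1" and t: "T2 < t" for sg t x
 proof -
  define z where "z t x = sg * (u t x - W t x) - (ka * s t) * ps x * 1" for t x
  define z' where "z' t x = sg * (u' t x - W' t x) - ps x * ((ka * s' t) * 1 + (ka * s t) * 0)" for t x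
  have ze: "evolution 0 z z'" unfolding z_def[abs_def] z'_def[abs_def]
  proof (intro evolution_diff diff_evolution evolution_scale evolution_const ps)
   show "((%t. ka * s t) has_real_derivative ka * s' t) (at t)" if "0 < t" for t using s(2)[of t] that by (intro DERIV_cmult) auto
   show "continuous_on {0<..} (%t. ka * s' t)" by (intro continuous_intros s(3))
  qed
  have sgd: "sg * (u t x - W t x) <= \<bar>u t x - W t x\<bar>" for t x using sg by (metis abs_ge_self abs_mult mult_1)
  have S0: "0 < ka * s t * ps x" if "0 <= t" for t x using s(1)[OF that] kap psp[of x] by simp
  \<comment> \<open>Outside \<open>Om\<close> the barrier need not be a supersolution, but there the
    left bound already keeps \<open>z\<close> nonpositive.\<close>
  define Om where "Om = {q :: real \<times> (real ^ 'n). \<xi>s < snd q $ k + c * fst q}"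
  have "z t x <= 0"
  proof (rule comparison[OF evolution_mono[OF ze less_imp_le[OF T2(1)]] _ _ _ _ _ t, where Om=Om and M=M and K="Kf + \<nu>"])
   show "open Om" unfolding Om_def by (intro open_Collect_less continuous_intros)
   show "(t, x) \<in> Om" if t: "T2 < t" and pos: "0 < z t x" for t x
   proof (rule ccontr)
   assume "(t, x) \<notin> Om"
   then have "\<bar>u t x - W t x\<bar> <= Kl * s t" using t T2 by (intro Kl) (auto simp: Om_def)
   also have "... <= \<bar>Kl\<bar> * s t" using s(1)[of t] t T2 by (intro mult_right_mono) auto
   also have "... <= ka * s t * ps x" by (rule ka1) (use t T2 in simp)
   finally show False using pos sgd[of t x] by (simp add: z_def)
   qed
   show "z t x <= M" if t: "T2 < t" for t x
   using sgd[of t x] M(2)[of t x] S0[of t x] t T2 by (simp add: z_def)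
   show "AE x in lborel. \<exists>V\<le>0. ((%t. z t x) \<longlongrightarrow> V) (at_right T2)"
   proof (rule AE_I2)
   fix x
   have "z T2 x <= 0" using sgd[of T2 x] M(2)[of T2 x] ka2[of x] T2 by (simp add: z_def)
   then show "\<exists>V\<le>0. ((%t. z t x) \<longlongrightarrow> V) (at_right T2)" using evolution_right_limit[OF ze T2(1)] by blast
   qed
   fix t x assume t: "T2 < t" and "(t, x) \<in> Om" and pos: "0 < z t x"
   then have x: "x $ k + c * t > \<xi>s" by (simp add: Om_def)
   have t0: "0 < t" using t T2 by simp
   have near: "(1 - e) * p x <= u t x" "\<bar>W t x - p x\<bar> <= e * p x" using T(2)[OF _ x] t T2 by auto
   have un: "\<bar>u t x - p x\<bar> <= e * p x" using near(1) u_upper[OF t0, of x] by (simp add: algebra_simps)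
   define dt where "dt = sg * (u t x - W t x)"
   have dt: "dt = z t x + ka * s t * ps x" by (simp add: dt_def z_def)
   have dtp: "dt > 0" using pos S0[of t x] t0 by (simp add: dt)
   obtain y where y: "min (W t x) (u t x) <= y" "y <= max (W t x) (u t x)" "f x (u t x) - f x (W t x) = (u t x - W t x) * f_u f x y"
   using reaction_mvt[OF reaction] by blast
   have "\<bar>y - p x\<bar> <= e * p x" using y(1,2) near(2) un by (auto simp: min_def max_def abs_le_iff split: if_splits)
   then have "\<bar>y - p x\<bar> < d" using eB[of x] by simp
   then have "f_u f x y <= r x + \<nu>" using d(2)[OF pB, of y x x] by (simp add: r_def)
   then have "dt * f_u f x y <= dt * (r x + \<nu>)" using dtp by (intro mult_left_mono) auto
   then have reac: "sg * (f x (u t x) - f x (W t x)) <= (r x + \<nu>) * (z t x + ka * s t * ps x)"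
   unfolding y(3) dt[symmetric] by (simp add: dt_def mult_ac)
   have rz: "(r x + \<nu>) * z t x <= (Kf + \<nu>) * z t x" using r[of x] pos by (intro mult_right_mono) auto
   have bar: "ka * s t * D ps x + (r x + \<nu>) * (ka * s t * ps x) - ps x * (ka * s' t) <= 0"
   proof -
   have st: "s t > 0" by (rule s(1)) (use t0 in simp)
   have "s t * (D ps x + r x * ps x) <= s t * (- 2 * \<nu> * ps x)" using psb(3)[of x] st by (intro mult_left_mono) auto
   moreover have "ps x * (- s' t) <= ps x * (\<nu> * s t)" using slow[of t] t T2 psp[of x] by (intro mult_left_mono) (auto simp: \<nu>_def)
   moreover have "0 <= ps x * (\<nu> * s t)" using psp[of x] st \<nu> by simp
   ultimately have "s t * (D ps x + r x * ps x) + ps x * (\<nu> * s t) + ps x * (- s' t) <= 0" by (simp add: algebra_simps)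
   then have "ka * (s t * (D ps x + r x * ps x) + ps x * (\<nu> * s t) + ps x * (- s' t)) <= 0" using kap by (intro mult_nonneg_nonpos) auto
   then show ?thesis by (simp add: algebra_simps)
   qed
   have Dz: "D (z t) x = sg * (D (u t) x - D (W t) x) - ka * s t * D ps x"
   proof -
   have c2: "C2 (%x. sg * (u t x - W t x))" by (rule evolutionD(1)[OF diff_evolution t0])
   have "z t = (%x. sg * (u t x - W t x) - ka * s t * ps x)" by (simp add: z_def[abs_def])
   then show ?thesis using D_diff[OF c2 C2_cmult[OF ps]] by (simp add: diff_D[OF t0] D_cmult[OF ps])
   qed
   have "z' t x = sg * (D (u t) x - D (W t) x) + sg * (f x (u t x) - f x (W t x)) - ps x * (ka * s' t)"
   unfolding z'_def u_evolution(2)[OF t0] W_evolution(2) by (simp add: algebra_simps)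
   then show "z' t x <= D (z t) x + (Kf + \<nu>) * z t x"
   using reac rz bar unfolding Dz by (simp add: distrib_left)
  qed
  then show ?thesis by (simp add: z_def)
 qed
 \<comment> \<open>On the initial compact time interval the uniform bound \<open>M\<close> becomes a
   multiple of \<open>s\<close> through the positive minimum of \<open>s\<close>.\<close>
 have "continuous_on {0..T2} s" by (rule DERIV_continuous_on) (use s(2) in "auto intro: has_field_derivative_at_within")
 then obtain t0 where t0: "t0 \<in> {0..T2}" "!!t. t \<in> {0..T2} ==> s t0 <= s t"
  using continuous_attains_inf[of "{0..T2}" s] T2 by auto
 have st0: "s t0 > 0" by (rule s(1)) (use t0 in simp)
 define C where "C = ka * B2 + M / s t0"
 have C: "C > 0" "ka * B2 <= C" "M / s t0 <= C" using kap lB M(1) st0 by (auto simp: C_def add_pos_pos)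
 have "\<bar>u t x - W t x\<bar> <= C * s t" if t: "0 <= t" for t x
 proof (cases "t <= T2")
  case True
  have "M <= C * s t0" using C(3) st0 by (simp add: divide_le_eq)
  also have "... <= C * s t" using t0(2)[of t] t True C(1) by (intro mult_left_mono) auto
  finally show ?thesis using M(2)[OF t, of x] by linarith
 next
  case False
  then have "\<bar>u t x - W t x\<bar> <= ka * s t * ps x" using up[of 1 t x] up[of "- 1" t x] by (simp add: abs_le_iff)
  also have "... <= ka * s t * B2" using psb(2)[of x] kap s(1)[OF t] by (intro mult_left_mono) auto
  also have "... = ka * B2 * s t" by simp
  also have "... <= C * s t" using C(2) s(1)[OF t] by (intro mult_right_mono) auto
  finally show ?thesis .
 qed
 then show ?thesis using C(1) by blast
qed

text \<open>The weight is \<open>exp (lam * max 0 (\<xi>0 - \<xi>))\<close>: at least 1, and above a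
  multiple of the pure exponential. So one integrability hypothesis serves both the right region and
  the left estimate.\<close>

lemma weighted_initial:
 assumes lam: "lam > 0" and int: "integrable lborel (%x. weight lam \<xi>0 (x $ k) * (u0 x - w x (x $ k)))"
 shows "integrable lborel (%x. u0 x - W 0 x)" "integrable lborel (%x. exp (- lam * x $ k) * (u0 x - W 0 x))"
proof -
 have wt: "weight lam \<xi>0 \<xi> = exp (lam * max 0 (\<xi>0 - \<xi>))" for \<xi>
  by (simp add: weight_def max_def) (simp add: algebra_simps)
 have int': "integrable lborel (%x. exp (lam * max 0 (\<xi>0 - x $ k)) * (u0 x - W 0 x))" using int by (simp add: wt W_def)
 have c: "continuous_on UNIV (%x :: real ^ 'n. exp (lam * max 0 (\<xi>0 - x $ k)))" "continuous_on UNIV (%x :: real ^ 'n. exp (- lam * x $ k))"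
  by (intro continuous_intros)+
 have "integrable lborel (%x. 1 * (u0 x - W 0 x))"
  by (rule integrable_change_weight(1)[OF int' c(1) continuous_on_const exp_gt_zero, of _ 1]) (use lam in simp)
 then show "integrable lborel (%x. u0 x - W 0 x)" by simp
 show "integrable lborel (%x. exp (- lam * x $ k) * (u0 x - W 0 x))"
 proof (rule integrable_change_weight(1)[OF int' c exp_gt_zero, of "exp (- lam * \<xi>0)"])
  fix x :: "real ^ 'n"
  have "lam * (\<xi>0 - x $ k) <= lam * max 0 (\<xi>0 - x $ k)" using lam by (intro mult_left_mono) auto
  then show "\<bar>exp (- lam * x $ k)\<bar> <= exp (- lam * \<xi>0) * exp (lam * max 0 (\<xi>0 - x $ k))"
   by (simp add: exp_add[symmetric] algebra_simps)
 qed
qed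

text \<open>Both conclusions rest on the same left estimate, a power of time multiplied by
  \<open>exp (- \<mu> * t)\<close>: for \<open>\<mu> > 0\<close> the exponential prevails, for
  \<open>\<mu> = 0\<close> the power is what remains. To the right \<open>barrier\<close> carries
  over the respective profile.\<close>

lemma stability:
 assumes lam: "lam > 0" and int: "integrable lborel (%x. weight lam \<xi>0 (x $ k) * (u0 x - w x (x $ k)))"
  and ev: "principal_eigenvalue L A (%ph x. f_u f x (p x) * ph x) m" and m: "m < 0"
  and mu: "mu_speed L k A f c lam \<mu>"
 shows "\<mu> > 0 ==> \<exists>C>0. \<exists>\<mu>3>0. \<forall>t\<ge>0. ALL x. \<bar>u t x - w x (x $ k + c * t)\<bar> <= C * exp (- \<mu>3 * t)"
  "\<mu> = 0 ==> \<exists>C>0. \<forall>t\<ge>0. ALL x. \<bar>u t x - w x (x $ k + c * t)\<bar> <= C * (1 + t) powr (- real CARD('n) / 2)"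
proof -
 let ?a = "- real CARD('n) / 2"
 note ints = weighted_initial[OF lam int]
 obtain K where K: "K > 0" and left: "\<forall>t>0. ALL x. \<bar>u t x - W t x\<bar> <= K * t powr ?a * exp (- \<mu> * t) * exp (lam * (x $ k + c * t))"
  using left_decay[OF mu lam ints(2)] by blast
 have lf: "\<bar>u t x - W t x\<bar> <= (K * exp (lam * \<xi>)) * (t powr ?a * exp (- \<mu> * t))" if "t > 0" "x $ k + c * t <= \<xi>" for t x \<xi>
 proof -
  have "\<bar>u t x - W t x\<bar> <= K * t powr ?a * exp (- \<mu> * t) * exp (lam * (x $ k + c * t))" using left that by blast
  also have "... <= K * t powr ?a * exp (- \<mu> * t) * exp (lam * \<xi>)" using that lam K by (intro mult_left_mono) auto
  finally show ?thesis by (simp add: mult_ac)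
 qed
 {
  assume \<mu>: "\<mu> > 0"
  \<comment> \<open>The rate is limited by the left estimate and by what the barrier at
    \<open>p\<close> allows.\<close>
  define q where "q = min \<mu> (- m / 4)"
  have q: "q > 0" "q <= \<mu>" "q <= - m / 4" using \<mu> m by (auto simp: q_def)
  have "\<exists>C>0. \<forall>t\<ge>0. ALL x. \<bar>u t x - W t x\<bar> <= C * exp (- q * t)"
  proof (rule barrier[OF ev m, where s'="%t. - q * exp (- q * t)" and ?T3.0=0])
   show "((%t. exp (- q * t)) has_real_derivative - q * exp (- q * t)) (at t)" for t by (auto intro!: derivative_eq_intros)
   show "continuous_on {0<..} (%t. - q * exp (- q * t))" by (intro continuous_intros)
   show "- (- q * exp (- q * t)) <= - m / 4 * exp (- q * t)" for t using mult_right_mono[OF q(3), of "exp (- q * t)"] by simp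
   show "EX K. \<forall>t\<ge>1. ALL x. x $ k + c * t <= \<xi> --> \<bar>u t x - W t x\<bar> <= K * exp (- q * t)" for \<xi>
   proof (intro exI[of _ "K * exp (lam * \<xi>)"] allI impI)
   fix t :: real and x :: "real ^ 'n" assume t: "1 <= t" and x: "x $ k + c * t <= \<xi>"
   have "t powr ?a <= t powr 0" using t by (intro powr_mono) auto
   then have "t powr ?a * exp (- \<mu> * t) <= 1 * exp (- q * t)" using t q by (intro mult_mono) auto
   then have "(K * exp (lam * \<xi>)) * (t powr ?a * exp (- \<mu> * t)) <= (K * exp (lam * \<xi>)) * (1 * exp (- q * t))" using K by (intro mult_left_mono) auto
   then show "\<bar>u t x - W t x\<bar> <= K * exp (lam * \<xi>) * exp (- q * t)" using lf[of t x \<xi>] t x by simp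
   qed
   show "EX \<xi>s T. T > 0 & (\<forall>t\<ge>T. ALL x. x $ k + c * t > \<xi>s --> (1 - e) * p x <= u t x & \<bar>W t x - p x\<bar> <= e * p x)" if "0 < e" "e < 1" for e
   by (rule right_region[OF ints(1) that less_imp_le[OF \<mu>] left])
  qed simp
  then show "\<exists>C>0. \<exists>\<mu>3>0. \<forall>t\<ge>0. ALL x. \<bar>u t x - w x (x $ k + c * t)\<bar> <= C * exp (- \<mu>3 * t)"
   using q(1) unfolding W_def by blast
 next
  assume \<mu>: "\<mu> = 0"
  \<comment> \<open>From this time on \<open>(n / 2) / (1 + t)\<close>, the relative decay rate of
    the profile, is at most \<open>- m / 4\<close>, where \<open>n\<close> is the dimension.\<close>
  define T3 where "T3 = max 0 (real CARD('n) / 2 / (- m / 4))"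
  have "\<exists>C>0. \<forall>t\<ge>0. ALL x. \<bar>u t x - W t x\<bar> <= C * (1 + t) powr ?a"
  proof (rule barrier[OF ev m, where s'="%t. ?a * (1 + t) powr (?a - 1)" and ?T3.0=T3])
   show "0 < (1 + t) powr ?a" if "0 <= t" for t using that by simp
   show "((%t. (1 + t) powr ?a) has_real_derivative ?a * (1 + t) powr (?a - 1)) (at t)" if "0 <= t" for t
   proof -
   have "((%t. 1 + t) has_real_derivative 1) (at t)" by (auto intro!: derivative_eq_intros)
   from DERIV_chain2[OF has_real_derivative_powr this, of ?a] that show ?thesis by simp
   qed
   show "continuous_on {0<..} (%t. ?a * (1 + t) powr (?a - 1))" by (intro continuous_intros) auto
   show "- (?a * (1 + t) powr (?a - 1)) <= - m / 4 * (1 + t) powr ?a" if t: "T3 <= t" for t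
   proof -
   have t0: "1 + t > 0" using t by (simp add: T3_def)
   have "real CARD('n) / 2 / (- m / 4) <= 1 + t" using t by (simp add: T3_def)
   then have "real CARD('n) / 2 <= (1 + t) * (- m / 4)" using m by (subst (asm) pos_divide_le_eq) auto
   then have "real CARD('n) / 2 * (1 + t) powr (?a - 1) <= (1 + t) * (- m / 4) * (1 + t) powr (?a - 1)" by (intro mult_right_mono) auto
   also have "... = - m / 4 * ((1 + t) powr 1 * (1 + t) powr (?a - 1))" using t0 by simp
   also have "(1 + t) powr 1 * (1 + t) powr (?a - 1) = (1 + t) powr ?a" by (subst powr_add[symmetric]) simp
   finally show ?thesis by simp
   qed
   show "EX K. \<forall>t\<ge>1. ALL x. x $ k + c * t <= \<xi> --> \<bar>u t x - W t x\<bar> <= K * (1 + t) powr ?a" for \<xi>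
   proof (intro exI[of _ "K * exp (lam * \<xi>) * (1 / 2) powr ?a"] allI impI)
   fix t :: real and x :: "real ^ 'n" assume t: "1 <= t" and x: "x $ k + c * t <= \<xi>"
   \<comment> \<open>For \<open>t >= 1\<close> one has \<open>t >= (1 + t) / 2\<close>. The power
     \<open>t powr ?a\<close> blows up at 0, which is why the left bound is passed to
     \<open>barrier\<close> from time 1 on.\<close>
   have "t powr ?a <= ((1 / 2) * (1 + t)) powr ?a" using t by (intro powr_mono2') auto
   also have "... = (1 / 2) powr ?a * (1 + t) powr ?a" by (rule powr_mult)
   finally have "(K * exp (lam * \<xi>)) * (t powr ?a * exp (- \<mu> * t)) <= (K * exp (lam * \<xi>)) * ((1 / 2) powr ?a * (1 + t) powr ?a)"
   using K \<mu> by (intro mult_left_mono) auto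
   then show "\<bar>u t x - W t x\<bar> <= K * exp (lam * \<xi>) * (1 / 2) powr ?a * (1 + t) powr ?a" using lf[of t x \<xi>] t x by (simp add: mult.assoc)
   qed
   show "EX \<xi>s T. T > 0 & (\<forall>t\<ge>T. ALL x. x $ k + c * t > \<xi>s --> (1 - e) * p x <= u t x & \<bar>W t x - p x\<bar> <= e * p x)" if "0 < e" "e < 1" for e
   by (rule right_region[OF ints(1) that _ left]) (simp add: \<mu>)
  qed
  then show "\<exists>C>0. \<forall>t\<ge>0. ALL x. \<bar>u t x - w x (x $ k + c * t)\<bar> <= C * (1 + t) powr ?a" unfolding W_def by blast
 }
qed

end

theorem theorem2p2:
  fixes L :: "real ^ 'n::finite" and k :: 'n
    and A :: "real ^ 'n \<Rightarrow> real ^ 'n ^ 'n"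
    and f :: "real ^ 'n \<Rightarrow> real \<Rightarrow> real"
    and p :: "real ^ 'n \<Rightarrow> real"
    and w :: "real ^ 'n \<Rightarrow> real \<Rightarrow> real"
    and \<alpha> \<mu>1 \<mu>bar1 cs c l1 l2 lam :: real
  assumes "\<And>i. 0 < L $ i"
    and "0 < \<alpha>" and "\<alpha> < 1"
    and "admissible_diffusion L \<alpha> A"
    and "admissible_reaction L \<alpha> f"
    and "\<And>x s r. 0 < s \<Longrightarrow> s < r \<Longrightarrow> f x r / r < f x s / s"
    and "\<exists>M>0. \<forall>x. \<forall>s\<ge>M. f x s \<le> 0"
    and "principal_eigenvalue L A (\<lambda>\<phi> x. f_u f x 0 * \<phi> x) \<mu>1" and "\<mu>1 > 0"
    and "steady_state A f p" and "periodic L p" and "\<And>x. 0 < p x" and "C2_holder \<alpha> p"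
    and "principal_eigenvalue L A (\<lambda>\<phi> x. f_u f x (p x) * \<phi> x) \<mu>bar1" and "\<mu>bar1 < 0"
    and "minimal_speed L k A f cs" and "c \<ge> cs"
    and "wavefront L k A f p c w"
    and "decay_rates L k A f cs c l1 l2" and "lam \<in> {l1..l2}"
  shows "\<exists>\<epsilon>0>0. \<forall>\<epsilon>\<in>{0<..<\<epsilon>0}. \<forall>\<xi>0. (\<forall>\<xi>\<ge>\<xi>0. \<forall>x. \<bar>w x \<xi> - p x\<bar> < \<epsilon>) \<longrightarrow>
    (\<forall>u0 u.
       finite {x. \<not> isCont u0 x} \<and>
       (\<forall>x. 0 \<le> u0 x \<and> u0 x \<le> p x) \<and>
       integrable lborel (\<lambda>x. weight lam \<xi>0 (x $ k) * (u0 x - w x (x $ k))) \<and>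
       solves_ivp A f u0 u \<longrightarrow>
         (c > cs \<and> lam \<in> {l1<..<l2} \<longrightarrow>
            (\<exists>C>0. \<exists>\<mu>3>0. \<forall>t\<ge>0. \<forall>x.
               \<bar>u t x - w x (x $ k + c * t)\<bar> \<le> C * exp (- \<mu>3 * t))) \<and>
         (c = cs \<or> (c > cs \<and> lam = l1) \<longrightarrow>
            (\<exists>C>0. \<forall>t\<ge>0. \<forall>x.
               \<bar>u t x - w x (x $ k + c * t)\<bar> \<le> C * (1 + t) powr (- real CARD('n) / 2))))"
proof -
 obtain \<alpha>0 where \<alpha>0: "\<alpha>0 > 0" "!!x \<xi>. \<alpha>0 * (norm \<xi>)\<^sup>2 <= \<xi> \<bullet> (A x *v \<xi>)"
  using assms(4) unfolding admissible_diffusion_def by blast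
 interpret periodic_diffusion A L \<alpha>0
  using assms(4) \<alpha>0 assms(1) by unfold_locales (auto simp: admissible_diffusion_def C1_holder_def)
 have pC2: "C2 p" and pst: "D p x + f x (p x) = 0" for x using assms(10) by (auto simp: steady_state_def D_def)
 interpret kpp_front A L \<alpha>0 f p w k \<alpha> c
  by unfold_locales (use assms(5,6,11,12,18) pC2 pst in auto)
 have l1: "0 < l1" and mu1: "mu_speed L k A f c l1 0" and dec: "c > cs ==> lam \<in> {l1<..<l2} ==> \<exists>m>0. mu_speed L k A f c lam m" "c = cs ==> l1 = l2"
  using assms(19) by (auto simp: decay_rates_def)
 have lam: "lam > 0" using l1 assms(20) by simp
 show ?thesis
 proof (rule exI[of _ 1], intro conjI ballI allI impI zero_less_one)
  fix \<xi>0 :: real and u0 :: "real ^ 'n \<Rightarrow> real" and u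
  assume h: "finite {x. \<not> isCont u0 x} & (ALL x. 0 <= u0 x & u0 x <= p x) \<and>
   integrable lborel (%x. weight lam \<xi>0 (x $ k) * (u0 x - w x (x $ k))) & solves_ivp A f u0 u"
  interpret kpp_solution A L \<alpha>0 f p w k \<alpha> c u0 u
   by unfold_locales (use h in auto)
  note st = stability[OF lam conjunct1[OF conjunct2[OF conjunct2[OF h]]] assms(14,15)]
  show "\<exists>C>0. \<exists>\<mu>3>0. \<forall>t\<ge>0. ALL x. \<bar>u t x - w x (x $ k + c * t)\<bar> <= C * exp (- \<mu>3 * t)" if "c > cs & lam \<in> {l1<..<l2}"
   using dec(1) that st(1) by blast
  \<comment> \<open>At \<open>c = cs\<close> the interval of admissible \<open>lam\<close> shrinks
    to the point \<open>l1\<close>, where the eigenvalue is 0, so both algebraic cases reduce to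
    \<open>lam = l1\<close>.\<close>
  have "lam = l1" if "c = cs | (c > cs & lam = l1)" using that dec(2) assms(20) by auto
  then show "\<exists>C>0. \<forall>t\<ge>0. ALL x. \<bar>u t x - w x (x $ k + c * t)\<bar> <= C * (1 + t) powr (- real CARD('n) / 2)" if "c = cs | (c > cs & lam = l1)"
   using st(2)[of 0] mu1 that by simp
 qed
qed

end
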